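(* Let $n$ and $k$ be integers with $k$ odd and $2<k<n-3$. There exists a deterministic distributed protocol for $k$ anonymous, oblivious, disoriented robots with local weak multiplicity detection on an anonymous unoriented ring of $n$ nodes, executed under the asynchronous non-atomic CORDA model with a fair scheduler, such that from every initial configuration in which each node hosts at most one robot (no tower) and which is not periodic, the robots achieve gathering within $O(n^2)$ asynchronous rounds.
   Context: Ring and robots: the network is an anonymous, unoriented, undirected ring of $n$ nodes $u_0,\dots,u_{n-1}$, $u_i$ adjacent to $u_{i-1}$ and $u_{i+1}$ (indices mod $n$); nodes and edges carry no labels. $k$ robots occupy nodes. Robots are identical (run the same program, no identifiers), oblivious (no memory between cycles), have no common sense of direction, and cannot communicate. Each robot repeatedly executes cycles of Look (take a snapshot of robot positions), Compute (decide, based only on the snapshot, either to stay or to move to one of its two neighboring nodes), and Move (move to that neighbor; moves are instantaneous, so snapshots always show robots on nodes). CORDA model with fair asynchronous scheduling: an adversarial scheduler activates robots, each robot is activated infinitely often, and phases of different robots may be arbitrarily interleaved, so a robot may move based on an outdated snapshot. A node hosting more than one robot is a tower. View: if the occupied nodes, read around the ring starting at the robot's node $u_1$ in one direction, define consecutive segments of lengths (numbers of edges) $D_1,\dots,D_w$ between successive occupied nodes, the robot's snapshot is $(\max\{(D_1,\dots,D_w),(D_w,\dots,D_1)\}, m)$ with the maximum in lexicographic order, where $m$ is true iff the robot's own node is a tower (local weak multiplicity detection: a robot cannot tell whether other occupied nodes host one or several robots). If the two sequences are equal (symmetric view), the robot cannot distinguish its two incident edges, and if it decides to move the scheduler chooses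 the direction. A tower-free configuration is periodic if its cyclic sequence of segment lengths is a concatenation of at least two copies of a shorter sequence (i.e., invariant under a nontrivial rotation of the ring). Gathering: all $k$ robots reach a single node (not fixed in advance) and remain there forever afterwards. An asynchronous round is a shortest fragment of an execution in which every robot performs a Move phase at least once. *)

theory Defs
  imports Main "HOL-Library.List_Lexorder"
begin

(* Ring nodes are 0..n-1; node x is adjacent to (x+1) mod n and (x+n-1) mod n.
   Robots are indexed 0..k-1; a configuration is a map pos :: nat => nat (robot -> node). *)

(* distances (in one fixed physical direction, "clockwise" = +1) from u to the occupied nodes S,
   sorted; the first entry is 0 since u is occupied *)
definition cw_dists :: "nat \<Rightarrow> nat set \<Rightarrow> nat \<Rightarrow> nat list" where
  "cw_dists n S u = sorted_list_of_set ((\<lambda>x. (x + n - u) mod n) ` S)"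

definition segs :: "nat \<Rightarrow> nat set \<Rightarrow> nat \<Rightarrow> nat list" where
  "segs n S u = (let a = cw_dists n S u in map2 (\<lambda>x y. x - y) (tl a @ [n]) a)"

definition periodic_seq :: "nat list \<Rightarrow> bool" where
  "periodic_seq L \<longleftrightarrow> (\<exists>q m. 2 \<le> m \<and> L = concat (replicate m q))"

definition occupied :: "nat \<Rightarrow> (nat \<Rightarrow> nat) \<Rightarrow> nat set" where
  "occupied k p = p ` {..<k}"

definition snapshot :: "nat \<Rightarrow> nat \<Rightarrow> (nat \<Rightarrow> nat) \<Rightarrow> nat \<Rightarrow> nat list \<times> bool" where
  "snapshot n k p r =
     (let c = segs n (occupied k p) (p r)
      in (max c (rev c), (\<exists>r'<k. r' \<noteq> r \<and> p r' = p r)))"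

(* decision of the Compute phase: stay, or move; Move True = move towards the neighbour
   along which the (lexicographically maximal) view is read, Move False = the other neighbour *)
datatype decision = Stay | Move bool

type_synonym protocol = "nat list \<times> bool \<Rightarrow> decision"

(* possible target nodes of robot r after Look/Compute; if the view is symmetric and the
   robot decides to move, the scheduler chooses the direction *)
definition targets :: "protocol \<Rightarrow> nat \<Rightarrow> nat \<Rightarrow> (nat \<Rightarrow> nat) \<Rightarrow> nat \<Rightarrow> nat set" where
  "targets P n k p r =
     (let u = p r; c = segs n (occupied k p) u; cw = (u + 1) mod n; ccw = (u + n - 1) mod n
      in case P (snapshot n k p r) of
           Stay \<Rightarrow> {u}
         | Move b \<Rightarrow> (if c = rev c then {cw, ccw}
                      else if (rev c < c) = b then {cw} else {ccw}))"

(* global state: positions and pending (already computed, not yet executed) moves *)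
type_synonym state = "(nat \<Rightarrow> nat) \<times> (nat \<Rightarrow> nat option)"

(* one atomic event of robot r: either Look(+Compute) when idle, or Move when pending *)
definition cstep :: "protocol \<Rightarrow> nat \<Rightarrow> nat \<Rightarrow> nat \<Rightarrow> state \<Rightarrow> state \<Rightarrow> bool" where
  "cstep P n k r s s' \<longleftrightarrow> r < k \<and>
     ((snd s r = None \<and> fst s' = fst s \<and>
        (\<exists>x \<in> targets P n k (fst s) r. snd s' = (snd s)(r := Some x)))
      \<or> (\<exists>x. snd s r = Some x \<and> fst s' = (fst s)(r := x) \<and> snd s' = (snd s)(r := None)))"

definition move_at :: "(nat \<Rightarrow> state) \<Rightarrow> (nat \<Rightarrow> nat) \<Rightarrow> nat \<Rightarrow> nat \<Rightarrow> bool" where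
  "move_at s sched t r \<longleftrightarrow> sched t = r \<and> snd (s t) r \<noteq> None"

definition fair_exec :: "protocol \<Rightarrow> nat \<Rightarrow> nat \<Rightarrow> (nat \<Rightarrow> nat) \<Rightarrow> (nat \<Rightarrow> nat) \<Rightarrow> (nat \<Rightarrow> state) \<Rightarrow> bool" where
  "fair_exec P n k p0 sched s \<longleftrightarrow>
     s 0 = (p0, \<lambda>_. None) \<and>
     (\<forall>t. cstep P n k (sched t) (s t) (s (Suc t))) \<and>
     (\<forall>r<k. \<forall>t. \<exists>t'\<ge>t. move_at s sched t' r)"

(* end (exclusive step index) of the j-th asynchronous round; rounds are consecutive
   shortest fragments in which every robot performs at least one Move *)
primrec round_end :: "nat \<Rightarrow> (nat \<Rightarrow> state) \<Rightarrow> (nat \<Rightarrow> nat) \<Rightarrow> nat \<Rightarrow> nat" where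
  "round_end k s sched 0 = 0"
| "round_end k s sched (Suc j) =
     (LEAST t. \<forall>r<k. \<exists>t'. round_end k s sched j \<le> t' \<and> t' < t \<and> move_at s sched t' r)"

definition gathered_within :: "nat \<Rightarrow> (nat \<Rightarrow> state) \<Rightarrow> (nat \<Rightarrow> nat) \<Rightarrow> nat \<Rightarrow> bool" where
  "gathered_within k s sched R \<longleftrightarrow>
     (\<exists>g. \<forall>t \<ge> round_end k s sched R. \<forall>r<k. fst (s t) r = g)"

end

theory Submission
  imports Defs
begin

text \<open>Without towers, the robots first build a single block of \<open>k\<close> consecutive occupied nodes. A run of adjacent
  robots that is strictly longer than all others is a champion: its neighbours can be told to join it one after the
  other, and outdated moves elsewhere only create shorter runs. To obtain a champion from a nonperiodic
  configuration, at most two robots are allowed to approach a longest run, since a view is shared by at most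
  two robots, which are then mirror images of each other. If an outdated move creates a second run of the same length,
  the two runs absorb all other robots, and as \<open>k\<close> is odd they end up with different lengths. In a block
  of odd length the robots then move symmetrically into the centre, which stays recognisable from the order of the
  occupied nodes, so that towers occur only there.
  In every phase an integer of size \<open>O(n\<^sup>2)\<close> decreases with every move, and during any two consecutive rounds some robot moves.\<close>

text \<open>The difficulty is that a state is more than a configuration: a robot may execute a
  decision taken on a snapshot that has since changed. The proof therefore works with pairs of gaps
  \<open>g\<close> and pending moves \<open>q\<close>, and with classes of such pairs
  (\<open>Init\<close>, the race given by \<open>PA0\<close> and \<open>PA1\<close>,
  \<open>pair_zone\<close>, \<open>champ_zone\<close>) that a Look never leaves and that a Move
  leaves only towards a class already under control. Each class bounds a different kind of outdated
  decision. The only return, from a champion to two equal runs and back to a champion, happens at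
  most once, because it consumes the single rogue robot \<open>x\<close>. The coefficients of
  \<open>N * N\<close> (10, 40, 60, 80) are spaced so that a change of class also lowers the
  potential; within a class the potential pays a multiple of \<open>N\<close> for each of the at
  most \<open>k\<close> joins, or measures how far the sum of squared gaps is from its bound.
  Reflection halves the work, so that only left moves are analysed. In the final phase outdated
  decisions disappear altogether: an enabled robot remains enabled until it moves.\<close>

locale robot_ring =
  fixes k n :: nat
  assumes k3: "3 \<le> k" and kodd: "odd k" and nk: "k + 4 \<le> n"
begin

abbreviation "K \<equiv> int k"

section \<open>Robot indices modulo \<open>k\<close>\<close>

definition cg :: "int \<Rightarrow> int \<Rightarrow> bool" where "cg i j \<longleftrightarrow> K dvd (i - j)"

lemma cg_refl[simp]: "cg i i" by (simp add: cg_def)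
lemma cg_sym: "cg i j \<Longrightarrow> cg j i" by (simp add: cg_def dvd_diff_commute)
lemma cg_commute: "cg i j \<longleftrightarrow> cg j i" by (metis cg_sym)
lemma cg_trans: "cg i j \<Longrightarrow> cg j l \<Longrightarrow> cg i l"
  unfolding cg_def by (metis diff_add_cancel diff_diff_eq2 dvd_add add_diff_eq)
lemma cg_add[simp]: "cg (i + t) (j + t) = cg i j" by (simp add: cg_def)
lemma cg_diff[simp]: "cg (i - t) (j - t) = cg i j" by (simp add: cg_def)
lemma cg_neg[simp]: "cg (- i) (- j) = cg i j"
proof -
  have "- i - (- j) = - (i - j)" by simp
  thus ?thesis unfolding cg_def by (simp only: dvd_minus_iff)
qed
lemma cg_move: "cg (i + t) j = cg i (j - t)" by (simp add: cg_def algebra_simps)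
lemma cg_K[simp]: "cg (i + K) j = cg i j" "cg i (j + K) = cg i j" "cg (i - K) j = cg i j" "cg i (j - K) = cg i j"
proof -
  have e: "i + K - j = (i - j) + K" "i - (j + K) = (i - j) - K" "i - K - j = (i - j) - K" "i - (j - K) = (i - j) + K" by auto
  have m: "K dvd x + K \<longleftrightarrow> K dvd x" "K dvd x - K \<longleftrightarrow> K dvd x" for x
    by (simp, metis diff_add_cancel dvd_add_triv_right_iff)
  show "cg (i + K) j = cg i j" "cg i (j + K) = cg i j" "cg (i - K) j = cg i j" "cg i (j - K) = cg i j"
    unfolding cg_def e m by simp_all
qed
lemma cg_win: assumes "cg i j" "\<bar>i - j\<bar> < K" shows "i = j"
proof (rule ccontr)
  assume "i \<noteq> j"
  hence "K \<le> \<bar>i - j\<bar>" using assms(1) zdvd_imp_le[of K "\<bar>i-j\<bar>"] by (simp add: cg_def)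
  thus False using assms(2) by simp
qed
lemma cg_win_iff: "\<bar>i - j\<bar> < K \<Longrightarrow> cg i j \<longleftrightarrow> i = j" using cg_win by auto
lemma cg_mod: "cg (i mod K) i" by (simp add: cg_def mod_eq_dvd_iff[symmetric])
lemma cg_rep: "\<exists>j. l \<le> j \<and> j < l + K \<and> cg j i"
proof -
  have "cg (l + (i - l) mod K) (l + (i - l))"
    using cg_mod[of "i-l"] cg_add[of "(i-l) mod K" l "i - l"] by (simp add: add.commute)
  moreover have "0 \<le> (i-l) mod K" "(i-l) mod K < K" using k3 by simp_all
  ultimately show ?thesis by (intro exI[of _ "l + (i-l) mod K"]) auto
qed
text \<open>As \<open>k\<close> is odd, 2 is invertible modulo \<open>k\<close>. This excludes a
  rotation that exchanges two equal runs.\<close>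

lemma cg_double: assumes "cg (2 * i) (2 * j)" shows "cg i j"
proof -
  have "K dvd 2 * (i - j)" using assms by (simp add: cg_def algebra_simps)
  moreover have "coprime K 2" using kodd by simp
  ultimately show ?thesis unfolding cg_def using coprime_dvd_mult_right_iff by blast
qed

section \<open>Periodic functions, gap sequences and moves\<close>

definition per :: "(int \<Rightarrow> int) \<Rightarrow> bool" where "per f \<longleftrightarrow> (\<forall>j. f (j + K) = f j)"

lemma per_mult: assumes "per f" shows "f (j + K * int m) = f j"
proof (induction m)
  case (Suc m)
  have "f (j + K * int (Suc m)) = f ((j + K * int m) + K)" by (simp add: algebra_simps)
  thus ?case using Suc assms by (simp add: per_def)
qed simp
lemma per_cg: assumes "per f" "cg i j" shows "f i = f j"
proof -
  obtain c where c: "i - j = K * c" using assms(2) by (auto simp: cg_def)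
  show ?thesis
  proof (cases "c \<ge> 0")
    case True
    thus ?thesis using per_mult[OF assms(1), of j "nat c"] c by (simp add: algebra_simps)
  next
    case False
    hence "j = i + K * int (nat (-c))" using c by (simp add: algebra_simps)
    thus ?thesis using per_mult[OF assms(1), of i "nat (-c)"] by simp
  qed
qed
lemma per_shift: "per f \<Longrightarrow> f (j - K) = f j" by (metis per_def diff_add_cancel)

definition valid :: "(int \<Rightarrow> int) \<Rightarrow> bool" where
  "valid g \<longleftrightarrow> per g \<and> (\<forall>j. 1 \<le> g j) \<and> (\<Sum>j\<in>{0..<K}. g j) = int n"

lemma validD: "valid g \<Longrightarrow> per g" "valid g \<Longrightarrow> 1 \<le> g j" by (auto simp: valid_def)

text \<open>\<open>g i\<close> is the distance from robot \<open>i\<close> to robot \<open>i + 1\<close>, where the \<open>k\<close> robots are indexed in cyclic order by the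
  integers modulo \<open>k\<close>; \<open>q i \<in> {-1, 0, 1}\<close> is the pending move of robot \<open>i\<close>. \<open>upd g i d\<close> is the effect of moving robot \<open>i\<close>
  by \<open>d\<close>. Under reflection of the ring robot \<open>i\<close> becomes robot \<open>-i\<close> and gap \<open>j\<close> becomes gap \<open>-1-j\<close>.\<close>

definition upd :: "(int \<Rightarrow> int) \<Rightarrow> int \<Rightarrow> int \<Rightarrow> int \<Rightarrow> int" where
  "upd g i d = (\<lambda>j. g j + (if cg j (i - 1) then d else 0) - (if cg j i then d else 0))"
definition setq :: "(int \<Rightarrow> int) \<Rightarrow> int \<Rightarrow> int \<Rightarrow> int \<Rightarrow> int" where
  "setq q i v = (\<lambda>j. if cg j i then v else q j)"
definition rf :: "(int \<Rightarrow> int) \<Rightarrow> int \<Rightarrow> int" where "rf g = (\<lambda>j. g (-1 - j))"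
definition rq :: "(int \<Rightarrow> int) \<Rightarrow> int \<Rightarrow> int" where "rq q = (\<lambda>j. - q (- j))"

lemma rf_rf[simp]: "rf (rf g) = g" by (simp add: rf_def)
lemma rq_rq[simp]: "rq (rq g) = g" by (simp add: rq_def)

lemma not_cg_pred: "\<not> cg (i - 1) i" "\<not> cg i (i - 1)"
proof -
  have "\<not> cg i (i-1)" using cg_win[of i "i-1"] k3 by auto
  thus "\<not> cg i (i - 1)" "\<not> cg (i - 1) i" by (auto simp: cg_commute)
qed

lemma rf_upd: "rf (upd g i d) = upd (rf g) (- i) (- d)"
proof
  fix j
  have 1: "cg (-1 - j) (i - 1) = cg j (- i)" "cg (-1 - j) i = cg j (- i - 1)"
    using cg_neg[of "-1-j" "i-1"] cg_add[of j 1 "-i"] cg_neg[of "-1-j" "i"] cg_diff[of "j+1" 1 "-i"] by simp_all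
  show "rf (upd g i d) j = upd (rf g) (- i) (- d) j" by (simp add: rf_def upd_def 1)
qed
lemma rq_setq: "rq (setq q i v) = setq (rq q) (- i) (- v)"
proof
  fix j show "rq (setq q i v) j = setq (rq q) (- i) (- v) j"
    using cg_neg[of "-j" i] by (simp add: rq_def setq_def)
qed

lemma cg_iff: "cg i i' \<Longrightarrow> cg j i \<longleftrightarrow> cg j i'" using cg_trans cg_sym by blast
lemma upd_cong: assumes "cg i i'" shows "upd g i d = upd g i' d"
proof -
  have "cg (i-1) (i'-1)" using assms by simp
  thus ?thesis unfolding upd_def using cg_iff[OF assms] cg_iff[of "i-1" "i'-1"] by auto
qed
lemma setq_cong: "cg i i' \<Longrightarrow> setq q i d = setq q i' d"
  unfolding setq_def using cg_iff by auto

lemma per_upd: "per g \<Longrightarrow> per (upd g i d)" by (simp add: per_def upd_def)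
lemma per_setq: "per g \<Longrightarrow> per (setq g i d)" by (simp add: per_def setq_def)
lemma per_rf: assumes "per g" shows "per (rf g)"
  unfolding per_def
proof
  fix j show "rf g (j + K) = rf g j"
    using per_shift[OF assms, of "-1-j"] by (simp add: rf_def algebra_simps)
qed
lemma per_rq: assumes "per g" shows "per (rq g)"
  unfolding per_def
proof
  fix j show "rq g (j + K) = rq g j"
    using per_shift[OF assms, of "-j"] by (simp add: rq_def algebra_simps)
qed

lemma sum_ind: "(\<Sum>j\<in>{0..<K}. if cg j i then d else 0) = (d::int)"
proof -
  obtain r where r: "0 \<le> r" "r < K" "cg r i" using cg_rep[of 0 i] by auto
  have "(\<Sum>j\<in>{0..<K}. if cg j i then d else 0) = (\<Sum>j\<in>{0..<K}. if j = r then d else 0)"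
  proof (rule sum.cong)
    fix j assume j: "j \<in> {0..<K}"
    have "cg j i \<longleftrightarrow> cg j r" using r(3) cg_trans cg_sym by blast
    also have "\<dots> \<longleftrightarrow> j = r" using j r by (intro cg_win_iff) auto
    finally show "(if cg j i then d else 0) = (if j = r then d else 0)" by simp
  qed simp
  thus ?thesis using r by simp
qed

lemma upd_vals: assumes "per g" shows "upd g i d (i - 1) = g (i - 1) + d" "upd g i d i = g i - d"
  using not_cg_pred by (auto simp: upd_def)
lemma upd_at: assumes "per g" "cg j (i-1)" shows "upd g i d j = g j + d"
  using assms upd_vals(1)[OF assms(1), of i d] per_cg[OF per_upd[OF assms(1)] assms(2)] per_cg[OF assms] by metis
lemma upd_at2: assumes "per g" "cg j i" shows "upd g i d j = g j - d"
  using assms upd_vals(2)[OF assms(1), of i d] per_cg[OF per_upd[OF assms(1)] assms(2)] per_cg[OF assms] by metis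
lemma upd_other: "\<not> cg j (i-1) \<Longrightarrow> \<not> cg j i \<Longrightarrow> upd g i d j = g j" by (simp add: upd_def)

lemma valid_upd: assumes "valid g" "d = -1" "2 \<le> g (i - 1)" shows "valid (upd g i d)"
proof -
  have p: "per g" using assms validD by auto
  have ge: "1 \<le> upd g i d j" for j
  proof (cases "cg j (i-1)")
    case True
    thus ?thesis using upd_at[OF p True] assms per_cg[OF p True] by simp
  next
    case False
    thus ?thesis using validD(2)[OF assms(1), of j] assms(2) by (auto simp: upd_def)
  qed
  have "(\<Sum>j\<in>{0..<K}. upd g i d j) = (\<Sum>j\<in>{0..<K}. g j)"
    unfolding upd_def by (simp only: sum.distrib sum_subtractf sum_ind)
  thus ?thesis using ge p assms(1) per_upd by (auto simp: valid_def)
qed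

lemma sum_rf: "(\<Sum>j\<in>{0..<K}. f (rf g j)) = (\<Sum>j\<in>{0..<K}. f (g j))" if "per g" for f :: "int \<Rightarrow> int"
proof -
  have "(\<Sum>j\<in>{0..<K}. f (rf g j)) = (\<Sum>j\<in>{0..<K}. f (g (K - 1 - j)))"
  proof (rule sum.cong)
    fix j show "f (rf g j) = f (g (K - 1 - j))"
      using that[unfolded per_def, rule_format, of "-1-j"] by (simp add: rf_def algebra_simps)
  qed simp
  also have "\<dots> = (\<Sum>j\<in>{0..<K}. f (g j))"
    by (rule sum.reindex_bij_witness[of _ "\<lambda>j. K - 1 - j" "\<lambda>j. K - 1 - j"]) auto
  finally show ?thesis .
qed

lemma valid_rf: "valid g \<Longrightarrow> valid (rf g)"
  using sum_rf[of g "\<lambda>x. x"] per_rf by (auto simp: valid_def rf_def)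

lemma g_le: assumes "valid g" shows "g j \<le> int n"
proof -
  have "g j = g (j mod K)" using per_cg[OF validD(1)[OF assms] cg_mod] by simp
  also have "\<dots> \<le> (\<Sum>j\<in>{0..<K}. g j)"
    using k3 assms by (intro member_le_sum) (auto simp: valid_def intro: order_trans[OF zero_le_one])
  finally show ?thesis using assms by (simp add: valid_def)
qed

text \<open>\<open>s\<close> robots on consecutive nodes, starting with robot \<open>j\<close>.\<close>

definition run :: "(int \<Rightarrow> int) \<Rightarrow> int \<Rightarrow> int \<Rightarrow> bool" where
  "run g s j \<longleftrightarrow> (\<forall>t. j \<le> t \<longrightarrow> t < j + s - 1 \<longrightarrow> g t = 1)"
definition in_run :: "(int \<Rightarrow> int) \<Rightarrow> int \<Rightarrow> int \<Rightarrow> bool" where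
  "in_run g s i \<longleftrightarrow> (\<exists>j. j \<le> i \<and> i < j + s \<and> run g s j)"

lemma run1[simp]: "s \<le> 1 \<Longrightarrow> run g s j" by (simp add: run_def)
lemma inr1[simp]: "in_run g 1 i" by (auto simp: in_run_def intro!: exI[of _ i])
lemma run_mono: "run g s j \<Longrightarrow> j \<le> j' \<Longrightarrow> j' + s' \<le> j + s \<Longrightarrow> run g s' j'" by (auto simp: run_def)
lemma run_rf: "run (rf g) s j \<longleftrightarrow> run g s (- (j + s - 1))"
proof -
  have "run (rf g) s j \<Longrightarrow> run g s (- (j + s - 1))" for g j
    unfolding run_def rf_def
  proof (intro allI impI)
    fix t assume a: "\<forall>t\<ge>j. t < j + s - 1 \<longrightarrow> g (- 1 - t) = 1" "- (j + s - 1) \<le> t" "t < - (j + s - 1) + s - 1"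
    show "g t = 1" using a(1)[rule_format, of "-1 - t"] a(2,3) by simp
  qed
  from this[of g j] this[of "rf g" "- (j + s - 1)"] show ?thesis by (auto simp: algebra_simps)
qed
lemma in_run_rf: "in_run (rf g) s i \<longleftrightarrow> in_run g s (- i)"
proof -
  have "in_run (rf g) s i \<Longrightarrow> in_run g s (- i)" for g i
    unfolding in_run_def run_rf by (elim exE, rule_tac x="- (j + s - 1)" in exI) auto
  from this[of g i] this[of "rf g" "-i"] show ?thesis by auto
qed
lemma run_cg: assumes "per g" "cg i j" shows "run g s i \<longleftrightarrow> run g s j"
proof -
  have "run g s i \<Longrightarrow> run g s j" if "cg i j" for i j
    unfolding run_def
  proof (intro allI impI)
    fix t assume a: "\<forall>t\<ge>i. t < i + s - 1 \<longrightarrow> g t = 1" "j \<le> t" "t < j + s - 1"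
    have "cg (t + (i - j)) t" using that by (simp add: cg_def)
    thus "g t = 1" using a(1)[rule_format, of "t + (i - j)"] a(2,3) per_cg[OF assms(1)] by force
  qed
  thus ?thesis using assms(2) cg_sym by blast
qed
lemma in_run_cg: assumes "per g" "cg i j" shows "in_run g s i \<longleftrightarrow> in_run g s j"
proof -
  have "in_run g s i \<Longrightarrow> in_run g s j" if "cg i j" for i j
  proof -
    assume "in_run g s i"
    then obtain a where a: "a \<le> i" "i < a + s" "run g s a" by (auto simp: in_run_def)
    have "cg (a + (j - i)) a" using that cg_sym by (simp add: cg_def dvd_diff_commute)
    hence "run g s (a + (j - i))" using a(3) run_cg[OF assms(1)] by blast
    thus "in_run g s j" using a unfolding in_run_def by (intro exI[of _ "a + (j-i)"]) auto
  qed
  thus ?thesis using assms(2) cg_sym by blast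
qed
lemma in_run_mono: assumes "in_run g s i" "s' \<le> s" "1 \<le> s'" shows "in_run g s' i"
proof -
  obtain j where j: "j \<le> i" "i < j + s" "run g s j" using assms by (auto simp: in_run_def)
  show ?thesis
  proof (cases "i < j + s'")
    case True thus ?thesis using j assms run_mono[OF j(3), of j s'] by (auto simp: in_run_def)
  next
    case False
    have "run g s' (i - s' + 1)" using run_mono[OF j(3), of "i-s'+1" s'] j False by auto
    thus ?thesis using assms unfolding in_run_def by (intro exI[of _ "i - s' + 1"]) auto
  qed
qed

text \<open>Such a run meets every gap modulo \<open>k\<close>, so all gaps would be 1 and sum to
  \<open>k\<close>, which is less than \<open>n\<close>. The complete block is therefore expressed
  by \<open>max_run g K\<close>.\<close>

lemma no_run_all: assumes "valid g" shows "\<not> run g (K + 1) j"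
proof
  assume r: "run g (K + 1) j"
  have p: "per g" using assms validD by auto
  have "g i = 1" for i
  proof -
    obtain t where "j \<le> t" "t < j + K" "cg t i" using cg_rep by blast
    thus ?thesis using r per_cg[OF p] unfolding run_def by (metis add_diff_cancel_right' add.assoc)
  qed
  hence "(\<Sum>j\<in>{0..<K}. g j) = K" by simp
  thus False using assms nk by (simp add: valid_def)
qed

definition max_run :: "(int \<Rightarrow> int) \<Rightarrow> int \<Rightarrow> bool" where
  "max_run g b \<longleftrightarrow> 1 \<le> b \<and> (\<exists>j. run g b j) \<and> (\<forall>j. \<not> run g (b + 1) j)"

lemma max_run_ex: assumes "valid g" shows "\<exists>b. max_run g b \<and> b \<le> K"
proof -
  let ?P = "\<lambda>m::nat. m \<ge> 1 \<and> (\<exists>j. run g (int m) j)"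
  have b: "?P m \<Longrightarrow> m \<le> k" for m
  proof (rule ccontr)
    assume "?P m" "\<not> m \<le> k"
    then obtain j where "run g (int m) j" by auto
    hence "run g (K + 1) j" using \<open>\<not> m \<le> k\<close> run_mono[of g "int m" j j "K+1"] by auto
    thus False using no_run_all[OF assms] by blast
  qed
  have ex: "?P 1" by simp
  define m where "m = (GREATEST m. ?P m)"
  have m: "?P m" unfolding m_def by (rule GreatestI_nat[of ?P, OF ex]) (use b in auto)
  have mm: "?P m' \<Longrightarrow> m' \<le> m" for m' unfolding m_def by (rule Greatest_le_nat[of ?P]) (use b in auto)
  have "max_run g (int m)" unfolding max_run_def
  proof (intro conjI allI notI)
    fix j assume "run g (int m + 1) j"
    hence "?P (Suc m)" by (auto simp: add.commute)
    thus False using mm[of "Suc m"] by simp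
  qed (use m in auto)
  thus ?thesis using b[OF m] by auto
qed
lemma max_run_unique: assumes "max_run g b" "max_run g b'" shows "b = b'"
proof -
  have A: "\<not> c < c'" if h: "max_run g c" "max_run g c'" for c c'
  proof
    assume "c < c'"
    obtain j where "run g c' j" using h(2) unfolding max_run_def by blast
    hence "run g (c + 1) j" using \<open>c < c'\<close> run_mono[of g c' j j] by auto
    thus False using h(1) by (auto simp: max_run_def)
  qed
  from A[OF assms] A[OF assms(2,1)] show ?thesis by simp
qed
lemma max_run_rf: "max_run (rf g) b \<longleftrightarrow> max_run g b"
proof -
  have "max_run g b" if h: "max_run (rf g) b" for g
  proof -
    have "\<not> run g (b + 1) j" for j
    proof -
      have "\<not> run (rf g) (b + 1) (- (j + (b + 1) - 1))" using h by (simp add: max_run_def)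
      thus ?thesis unfolding run_rf by (simp add: algebra_simps)
    qed
    thus ?thesis using h unfolding max_run_def run_rf by blast
  qed
  from this[of g] this[of "rf g"] show ?thesis by auto
qed

text \<open>Only moves to the left are described; the others come from the reflected configuration. A heavy robot
  lies in a run of maximal length \<open>b\<close>.
  If the longest run is unique (\<open>r1\<close>), the neighbour lying in the smaller run approaches it.
  Otherwise (\<open>r3\<close>) a robot next to a heavy run approaches it, provided that the robot behind it is not heavy
  (\<open>sideA\<close>) or else that the robot beyond the target run is not (\<open>sideB\<close>); the smallest gap, then the largest
  view, decides. If there is no such robot, an isolated robot approaches its nearer neighbour (\<open>pS\<close>), and if that
  is not possible without risking a periodic configuration, the two ends of a run between two heavy runs leave it (\<open>topm\<close>).\<close>

definition one_head :: "(int \<Rightarrow> int) \<Rightarrow> int \<Rightarrow> bool" where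
  "one_head g b \<longleftrightarrow> (\<forall>i j. run g b i \<longrightarrow> run g b j \<longrightarrow> cg i j)"
text \<open>The maximum over both reading directions makes views comparable without a common
  orientation, exactly as in a snapshot.\<close>

definition view :: "(int \<Rightarrow> int) \<Rightarrow> int \<Rightarrow> int list" where
  "view g r = max (map (\<lambda>j. g (r + int j)) [0..<k]) (map (\<lambda>j. g (r - 1 - int j)) [0..<k])"
definition r1 :: "(int \<Rightarrow> int) \<Rightarrow> int \<Rightarrow> int \<Rightarrow> bool" where
  "r1 g b r \<longleftrightarrow> run g b (r - b) \<and> (\<forall>s. in_run g s r \<longrightarrow> in_run g s (r - b - 1)) \<and> (b = K - 1 \<longrightarrow> g (r - 1) \<le> g r)"
definition sideA :: "(int \<Rightarrow> int) \<Rightarrow> int \<Rightarrow> int \<Rightarrow> bool" where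
  "sideA g b r \<longleftrightarrow> in_run g b (r - 1) \<and> \<not> in_run g b r \<and> \<not> in_run g b (r + 1)"
definition sideB :: "(int \<Rightarrow> int) \<Rightarrow> int \<Rightarrow> int \<Rightarrow> bool" where
  "sideB g b r \<longleftrightarrow> in_run g b (r - 1) \<and> \<not> in_run g b r \<and> \<not> in_run g b (r - b - 1)"
definition exA :: "(int \<Rightarrow> int) \<Rightarrow> int \<Rightarrow> bool" where
  "exA g b \<longleftrightarrow> (\<exists>r. sideA g b r) \<or> (\<exists>r. sideA (rf g) b r)"
definition good :: "(int \<Rightarrow> int) \<Rightarrow> int \<Rightarrow> int \<Rightarrow> bool" where
  "good g b r \<longleftrightarrow> (if exA g b then sideA g b r else sideB g b r)"
definition exG :: "(int \<Rightarrow> int) \<Rightarrow> int \<Rightarrow> bool" where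
  "exG g b \<longleftrightarrow> (\<exists>r. good g b r) \<or> (\<exists>r. good (rf g) b r)"
definition best :: "(int \<Rightarrow> int) \<Rightarrow> int \<Rightarrow> int \<Rightarrow> bool" where
  "best g b r \<longleftrightarrow> good g b r \<and> (\<forall>r'. good g b r' \<longrightarrow> g (r - 1) \<le> g (r' - 1))
     \<and> (\<forall>r'. good (rf g) b r' \<longrightarrow> g (r - 1) \<le> rf g (r' - 1))"
definition sel :: "(int \<Rightarrow> int) \<Rightarrow> int \<Rightarrow> int \<Rightarrow> bool" where
  "sel g b r \<longleftrightarrow> best g b r \<and> (\<forall>r'. best g b r' \<longrightarrow> view g r' \<le> view g r)
     \<and> (\<forall>r'. best (rf g) b r' \<longrightarrow> view (rf g) r' \<le> view g r)"
text \<open>In a nonperiodic configuration with a reflection these are exactly the robots on the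
  axis, by \<open>uniq_refl\<close> and \<open>refl_uniq\<close>.\<close>

definition uniq :: "(int \<Rightarrow> int) \<Rightarrow> int \<Rightarrow> bool" where
  "uniq g r \<longleftrightarrow> (\<forall>r'. view g r' = view g r \<longrightarrow> cg r' r)"
definition iso :: "(int \<Rightarrow> int) \<Rightarrow> int \<Rightarrow> bool" where "iso g r \<longleftrightarrow> 2 \<le> g r \<and> 2 \<le> g (r - 1)"
definition z1 :: "(int \<Rightarrow> int) \<Rightarrow> int \<Rightarrow> int" where "z1 g r = min (g r) (g (r - 1))"
definition cand :: "(int \<Rightarrow> int) \<Rightarrow> int \<Rightarrow> bool" where
  "cand g r \<longleftrightarrow> iso g r \<and> (\<forall>r'. iso g r' \<longrightarrow> z1 g r \<le> z1 g r')"
definition topc :: "(int \<Rightarrow> int) \<Rightarrow> int \<Rightarrow> bool" where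
  "topc g r \<longleftrightarrow> cand g r \<and> (\<forall>r'. cand g r' \<longrightarrow> view g r' \<le> view g r)"
definition isou :: "(int \<Rightarrow> int) \<Rightarrow> int \<Rightarrow> bool" where
  "isou g r \<longleftrightarrow> iso g r \<and> uniq g r \<and> (\<forall>r'. iso g r' \<and> uniq g r' \<longrightarrow> view g r' \<le> view g r)"
text \<open>If the top candidates have mirror images, moving both of them could not be controlled.
  But then there is an axis, and an isolated robot on it is used instead, so that never more than
  one robot is told to move.\<close>

definition pS :: "(int \<Rightarrow> int) \<Rightarrow> int \<Rightarrow> bool" where
  "pS g r \<longleftrightarrow> (if \<exists>r'. topc g r' \<and> uniq g r' then topc g r else isou g r)"
definition cmid :: "(int \<Rightarrow> int) \<Rightarrow> int \<Rightarrow> int \<Rightarrow> int \<Rightarrow> bool" where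
  "cmid g b h r \<longleftrightarrow> uniq g r \<and> 1 \<le> h \<and> b = 2 * h + 1 \<and> run g b (r - h) \<and> in_run g b (r + h + 1) \<and> in_run g b (r - h - 1)"
definition topm :: "(int \<Rightarrow> int) \<Rightarrow> int \<Rightarrow> int \<Rightarrow> int \<Rightarrow> bool" where
  "topm g b h r \<longleftrightarrow> cmid g b h r \<and> (\<forall>r'. cmid g b h r' \<longrightarrow> view g r' \<le> view g r)"
definition r3 :: "(int \<Rightarrow> int) \<Rightarrow> int \<Rightarrow> int \<Rightarrow> bool" where
  "r3 g b r \<longleftrightarrow> (if exG g b then sel g b r
     else if \<exists>r'. pS g r' then pS g r \<and> g (r - 1) \<le> g r else \<exists>h. topm g b h (r + h))"
definition RT :: "(int \<Rightarrow> int) \<Rightarrow> int \<Rightarrow> bool" where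
  "RT g r \<longleftrightarrow> (\<exists>b. max_run g b \<and> b < K \<and> (if one_head g b then r1 g b r else r3 g b r))"
text \<open>A set of directions rather than one: a robot on an axis of symmetry is offered both, and
  the scheduler chooses.\<close>

definition F :: "(int \<Rightarrow> int) \<Rightarrow> int \<Rightarrow> int set" where
  "F g r = {d. d = -1 \<and> RT g r \<or> d = 1 \<and> RT (rf g) (- r)}"

lemma F_rf: "d \<in> F (rf g) (- r) \<longleftrightarrow> - d \<in> F g r" by (auto simp: F_def)

lemma view_rf: "view (rf g) r = view g (- r)"
proof -
  have "(\<lambda>j. rf g (r + int j)) = (\<lambda>j. g (- r - 1 - int j))" "(\<lambda>j. rf g (r - 1 - int j)) = (\<lambda>j. g (- r + int j))"
    by (auto simp: rf_def intro!: arg_cong[of _ _ g])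
  thus ?thesis by (simp add: view_def max.commute)
qed

section \<open>Equivariance\<close>

text \<open>A robot reads the gaps starting from itself: robot \<open>i\<close> sees
  \<open>sh i g\<close> and applies the rule at index 0. The lemmas below lead to
  \<open>F_sh\<close>, which turns this into the rule at index \<open>i\<close> of the global
  sequence \<open>g\<close>.\<close>

definition sh :: "int \<Rightarrow> (int \<Rightarrow> int) \<Rightarrow> int \<Rightarrow> int" where "sh s g = (\<lambda>j. g (j + s))"

lemma all_sh: "(\<forall>r::int. P (r + s)) = (\<forall>r. P r)" by (metis diff_add_cancel)
lemma ex_sh: "(\<exists>r::int. P (r + s)) = (\<exists>r. P r)" by (metis diff_add_cancel)

lemma sh_at: "sh s g j = g (j + s)" by (simp add: sh_def)
lemma sh_at1: "sh s g (j - 1) = g (j + s - 1)" by (simp add: sh_def algebra_simps)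
lemma rf_sh: "rf (sh s g) = sh (- s) (rf g)" by (auto simp: rf_def sh_def algebra_simps)
lemma run_sh: "run (sh s g) b j = run g b (j + s)"
proof -
  have "run (sh s g) b j = (\<forall>t. j \<le> t + - s \<longrightarrow> t + - s < j + b - 1 \<longrightarrow> g (t + -s + s) = 1)"
    using all_sh[of "\<lambda>t. j \<le> t \<longrightarrow> t < j + b - 1 \<longrightarrow> g (t + s) = 1" "-s"] by (simp add: run_def sh_def)
  also have "\<dots> = run g b (j + s)" by (auto simp: run_def algebra_simps)
  finally show ?thesis .
qed
lemma in_run_sh: "in_run (sh s g) b j = in_run g b (j + s)"
proof -
  have "in_run (sh s g) b j = (\<exists>i. i + s \<le> j + s \<and> j + s < i + s + b \<and> run g b (i + s))" by (simp add: in_run_def run_sh)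
  also have "\<dots> = in_run g b (j + s)" unfolding in_run_def by (rule ex_sh)
  finally show ?thesis .
qed
lemma max_run_sh: "max_run (sh s g) b = max_run g b"
  unfolding max_run_def run_sh using ex_sh[of "run g b" s] all_sh[of "\<lambda>j. \<not> run g (b+1) j" s] by simp
lemma one_head_sh: "one_head (sh s g) b = one_head g b"
proof -
  have "one_head (sh s g) b = (\<forall>i j. run g b (i + s) \<longrightarrow> run g b (j + s) \<longrightarrow> cg (i + s) (j + s))" by (simp add: one_head_def run_sh)
  also have "\<dots> = (\<forall>i j. run g b i \<longrightarrow> run g b j \<longrightarrow> cg i j)"
    by (metis diff_add_cancel)
  finally show ?thesis by (simp add: one_head_def)
qed
lemma view_sh: "view (sh s g) r = view g (r + s)" by (simp add: view_def sh_def algebra_simps)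
lemma r1_sh: "r1 (sh s g) b r = r1 g b (r + s)"
proof -
  have e: "r - 1 + s = r + s - 1" "r - b + s = r + s - b" "r - b - 1 + s = r + s - b - 1" by simp_all
  show ?thesis unfolding r1_def run_sh in_run_sh sh_at sh_at1 e by simp
qed
lemma sideA_sh: "sideA (sh s g) b r = sideA g b (r + s)"
  by (simp add: sideA_def in_run_sh algebra_simps)
lemma sideB_sh: "sideB (sh s g) b r = sideB g b (r + s)"
  by (simp add: sideB_def in_run_sh algebra_simps)
lemma exA_sh: "exA (sh s g) b = exA g b"
  unfolding exA_def rf_sh sideA_sh using ex_sh[of "sideA g b" s] ex_sh[of "sideA (rf g) b" "-s"] by simp
lemma good_sh: "good (sh s g) b r = good g b (r + s)"
  by (simp add: good_def exA_sh sideA_sh sideB_sh)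
lemma exG_sh: "exG (sh s g) b = exG g b"
  unfolding exG_def rf_sh good_sh using ex_sh[of "good g b" s] ex_sh[of "good (rf g) b" "-s"] by simp
lemma best_sh: "best (sh s g) b r = best g b (r + s)"
  unfolding best_def rf_sh good_sh sh_at1
  using all_sh[of "\<lambda>r'. good g b r' \<longrightarrow> g (r + s - 1) \<le> g (r' - 1)" s]
        all_sh[of "\<lambda>r'. good (rf g) b r' \<longrightarrow> g (r + s - 1) \<le> rf g (r' - 1)" "-s"] by simp
lemma sel_sh: "sel (sh s g) b r = sel g b (r + s)"
  unfolding sel_def rf_sh best_sh view_sh
  using all_sh[of "\<lambda>r'. best g b r' \<longrightarrow> view g r' \<le> view g (r + s)" s]
        all_sh[of "\<lambda>r'. best (rf g) b r' \<longrightarrow> view (rf g) r' \<le> view g (r + s)" "-s"] by simp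
lemma uniq_sh: "uniq (sh s g) r = uniq g (r + s)"
proof -
  have "uniq (sh s g) r = (\<forall>r'. view g (r' + s) = view g (r + s) \<longrightarrow> cg (r' + s) (r + s))" by (simp add: uniq_def view_sh)
  also have "\<dots> = uniq g (r + s)" unfolding uniq_def
    using all_sh[of "\<lambda>r'. view g r' = view g (r + s) \<longrightarrow> cg r' (r + s)" s] by simp
  finally show ?thesis .
qed
lemma iso_sh: "iso (sh s g) r = iso g (r + s)" by (simp add: iso_def sh_def algebra_simps)
lemma z1_sh: "z1 (sh s g) r = z1 g (r + s)" by (simp add: z1_def sh_def algebra_simps)
lemma cand_sh: "cand (sh s g) r = cand g (r + s)"
  unfolding cand_def iso_sh z1_sh using all_sh[of "\<lambda>r'. iso g r' \<longrightarrow> z1 g (r + s) \<le> z1 g r'" s] by simp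
lemma topc_sh: "topc (sh s g) r = topc g (r + s)"
  unfolding topc_def cand_sh view_sh using all_sh[of "\<lambda>r'. cand g r' \<longrightarrow> view g r' \<le> view g (r + s)" s] by simp
lemma isou_sh: "isou (sh s g) r = isou g (r + s)"
  unfolding isou_def iso_sh uniq_sh view_sh
  using all_sh[of "\<lambda>r'. iso g r' \<and> uniq g r' \<longrightarrow> view g r' \<le> view g (r + s)" s] by simp
lemma pS_sh: "pS (sh s g) r = pS g (r + s)"
  unfolding pS_def topc_sh isou_sh uniq_sh using ex_sh[of "\<lambda>r'. topc g r' \<and> uniq g r'" s] by simp
lemma cmid_sh: "cmid (sh s g) b h r = cmid g b h (r + s)"
  by (simp add: cmid_def uniq_sh run_sh in_run_sh algebra_simps)
lemma topm_sh: "topm (sh s g) b h r = topm g b h (r + s)"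
  unfolding topm_def cmid_sh view_sh using all_sh[of "\<lambda>r'. cmid g b h r' \<longrightarrow> view g r' \<le> view g (r + s)" s] by simp
lemma r3_sh: "r3 (sh s g) b r = r3 g b (r + s)"
proof -
  have e: "r + h + s = r + s + h" "r - 1 + s = r + s - 1" for h by simp_all
  have p: "(\<exists>r'. pS (sh s g) r') = (\<exists>r'. pS g r')" unfolding pS_sh by (rule ex_sh)
  show ?thesis unfolding r3_def p unfolding exG_sh sel_sh pS_sh topm_sh sh_at sh_at1 e by (rule refl)
qed
lemma RT_sh: "RT (sh s g) r = RT g (r + s)"
  by (simp add: RT_def max_run_sh one_head_sh r1_sh r3_sh)
lemma F_sh: "F (sh s g) r = F g (r + s)"
  by (simp add: F_def RT_sh rf_sh)

section \<open>Reflection\<close>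

lemma one_head_rf: "one_head (rf g) b = one_head g b"
proof -
  have "one_head g b \<Longrightarrow> one_head (rf g) b" for g
    unfolding one_head_def run_rf
  proof (intro allI impI)
    fix i j assume "\<forall>i j. run g b i \<longrightarrow> run g b j \<longrightarrow> cg i j" "run g b (- (i + b - 1))" "run g b (- (j + b - 1))"
    hence "cg (- (i + b - 1)) (- (j + b - 1))" by blast
    thus "cg i j" unfolding cg_neg by (simp add: cg_def)
  qed
  from this[of g] this[of "rf g"] show ?thesis by auto
qed
lemma exA_rf: "exA (rf g) b = exA g b" by (auto simp: exA_def)
lemma exG_rf: "exG (rf g) b = exG g b" by (auto simp: exG_def)
lemma uniq_rf: "uniq (rf g) r = uniq g (- r)"
  unfolding uniq_def view_rf by (metis cg_neg minus_minus)
lemma iso_rf: "iso (rf g) r = iso g (- r)" by (auto simp: iso_def rf_def minus_diff_commute)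
lemma z1_rf: "z1 (rf g) r = z1 g (- r)" by (simp add: z1_def rf_def min.commute minus_diff_commute)
lemma all_neg: "(\<forall>r::int. P (- r)) = (\<forall>r. P r)" by (metis minus_minus)
lemma ex_neg: "(\<exists>r::int. P (- r)) = (\<exists>r. P r)" by (metis minus_minus)
lemma cand_rf: "cand (rf g) r = cand g (- r)"
  unfolding cand_def iso_rf z1_rf using all_neg[of "\<lambda>r'. iso g r' \<longrightarrow> z1 g (-r) \<le> z1 g r'"] by simp
lemma topc_rf: "topc (rf g) r = topc g (- r)"
  unfolding topc_def cand_rf view_rf using all_neg[of "\<lambda>r'. cand g r' \<longrightarrow> view g r' \<le> view g (-r)"] by simp
lemma isou_rf: "isou (rf g) r = isou g (- r)"
  unfolding isou_def iso_rf uniq_rf view_rf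
  using all_neg[of "\<lambda>r'. iso g r' \<and> uniq g r' \<longrightarrow> view g r' \<le> view g (-r)"] by simp
lemma pS_rf: "pS (rf g) r = pS g (- r)"
  unfolding pS_def topc_rf isou_rf uniq_rf using ex_neg[of "\<lambda>r'. topc g r' \<and> uniq g r'"] by simp
lemma cmid_rf: "cmid (rf g) b h r = cmid g b h (- r)"
proof (cases "b = 2 * h + 1")
  case True
  have e: "- (r - h + b - 1) = - r - h" "- (r + h + 1) = - r - h - 1" "- (r - h - 1) = - r + h + 1" using True by auto
  show ?thesis unfolding cmid_def uniq_rf run_rf in_run_rf e by blast
qed (simp add: cmid_def)
lemma topm_rf: "topm (rf g) b h r = topm g b h (- r)"
  unfolding topm_def cmid_rf view_rf using all_neg[of "\<lambda>r'. cmid g b h r' \<longrightarrow> view g r' \<le> view g (-r)"] by simp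

lemma mxF: assumes "max_run g b" "b < K"
  shows "F g r = {d. d = -1 \<and> (if one_head g b then r1 g b r else r3 g b r) \<or>
                     d = 1 \<and> (if one_head g b then r1 (rf g) b (- r) else r3 (rf g) b (- r))}"
proof -
  have "RT g r = (if one_head g b then r1 g b r else r3 g b r)" using assms max_run_unique by (auto simp: RT_def)
  moreover have "RT (rf g) (-r) = (if one_head g b then r1 (rf g) b (-r) else r3 (rf g) b (-r))"
    using assms max_run_unique by (auto simp: RT_def max_run_rf one_head_rf)
  ultimately show ?thesis by (simp add: F_def)
qed

section \<open>Basic bounds, and the effect of a left move on runs\<close>

abbreviation "N \<equiv> int n"

lemma rf_minus: "rf g (- i) = g (i - 1)" by (simp add: rf_def)

lemma N7: "7 \<le> N" using k3 nk by simp
lemma KN: "K + 4 \<le> N" using nk by simp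
lemma K3: "3 \<le> K" using k3 by simp
lemma NN7: "7 * N \<le> N * N" using N7 by (simp add: mult_right_mono)
lemma Kodd: "odd K" using kodd by simp

lemma upd_one: assumes "valid g" "2 \<le> g (i - 1)" "upd g i (-1) t = 1"
  shows "\<not> cg t i" "g t = 1 \<or> cg t (i - 1) \<and> g (i - 1) = 2"
proof -
  have p: "per g" "1 \<le> g t" using assms validD by auto
  show "\<not> cg t i" using upd_at2[OF p(1), of t i "-1"] assms p(2) by auto
  show "g t = 1 \<or> cg t (i - 1) \<and> g (i - 1) = 2"
  proof (cases "cg t (i-1)")
    case True
    have "g t = g (i-1)" using per_cg[OF p(1) True] .
    thus ?thesis using True upd_at[OF p(1) True, of "-1"] assms(3) by auto
  next
    case False
    thus ?thesis using \<open>\<not> cg t i\<close> assms(3) upd_other by metis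
  qed
qed

text \<open>Only the gap \<open>i - 1\<close> shrinks, and it remains at least 2. So every gap of
  length 1 after the move was one before it: approaching without joining creates no run.\<close>

lemma approach_run: assumes "valid g" "3 \<le> g (i - 1)" "run (upd g i (-1)) s j" shows "run g s j"
  unfolding run_def
proof (intro allI impI)
  fix t assume "j \<le> t" "t < j + s - 1"
  hence "upd g i (-1) t = 1" using assms(3) by (simp add: run_def)
  thus "g t = 1" using upd_one[of g i t] assms by auto
qed
lemma approach_inr: assumes "valid g" "3 \<le> g (i - 1)" "in_run (upd g i (-1)) s r" shows "in_run g s r"
  using assms(3) approach_run[OF assms(1,2)] unfolding in_run_def by blast

text \<open>The only new gap of length 1 is \<open>i - 1\<close>, while the gap behind
  \<open>i\<close> opens. A run created by the move therefore has \<open>i\<close> as its last robot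
  and was a run before without \<open>i\<close>.\<close>

lemma join_run: assumes "valid g" "2 \<le> g (i - 1)" "run (upd g i (-1)) s j" "\<not> run g s j"
  shows "cg (j + s - 1) i" "run g (s - 1) j"
proof -
  have A: "t = j + s - 2 \<and> cg t (i - 1)" if t: "j \<le> t" "t < j + s - 1" "g t \<noteq> 1" for t
  proof -
    have "upd g i (-1) t = 1" using assms(3) t by (simp add: run_def)
    hence c: "cg t (i - 1)" using upd_one(2)[OF assms(1,2)] t by blast
    have "t = j + s - 2"
    proof (rule ccontr)
      assume "t \<noteq> j + s - 2"
      hence "upd g i (-1) (t + 1) = 1" using assms(3) t by (simp add: run_def)
      hence "\<not> cg (t + 1) i" using upd_one(1)[OF assms(1,2)] by blast
      thus False using c cg_move[of t 1 i] by simp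
    qed
    thus ?thesis using c by simp
  qed
  obtain t where t: "j \<le> t" "t < j + s - 1" "g t \<noteq> 1" using assms(4) unfolding run_def by blast
  hence "cg (j + s - 2) (i - 1)" using A by blast
  thus "cg (j + s - 1) i" using cg_add[of "j+s-2" 1 "i-1"] by simp
  show "run g (s - 1) j" unfolding run_def
  proof (intro allI impI, rule ccontr)
    fix t assume "j \<le> t" "t < j + (s - 1) - 1" "g t \<noteq> 1"
    thus False using A[of t] by simp
  qed
qed

lemma run_keep: assumes "valid g" "2 \<le> g (i - 1)" "run g s j" "\<And>t. j \<le> t \<Longrightarrow> t < j + s - 1 \<Longrightarrow> \<not> cg t i"
  shows "run (upd g i (-1)) s j"
  unfolding run_def
proof (intro allI impI)
  fix t assume t: "j \<le> t" "t < j + s - 1"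
  have g: "g t = 1" using assms(3) t by (simp add: run_def)
  have "\<not> cg t (i - 1)"
  proof
    assume "cg t (i - 1)"
    hence "g t = g (i - 1)" using per_cg[OF validD(1)[OF assms(1)]] by simp
    thus False using g assms by simp
  qed
  thus "upd g i (-1) t = 1" using upd_other assms(4)[OF t] g by metis
qed

lemma run_glue: assumes "run g s j" "run g s' (j + s)" "g (j + s - 1) = 1" shows "run g (s + s') j"
  unfolding run_def
proof (intro allI impI)
  fix t assume t: "j \<le> t" "t < j + (s + s') - 1"
  consider "t < j + s - 1" | "t = j + s - 1" | "j + s \<le> t" by linarith
  thus "g t = 1" using assms t unfolding run_def by cases auto
qed
lemma run_snoc: "run g s j \<Longrightarrow> g (j + s - 1) = 1 \<Longrightarrow> run g (s + 1) j"
  using run_glue[of g s j 1] by simp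

text \<open>A champion: the run of length \<open>b\<close> starting at \<open>l\<close> contains every run longer than \<open>c\<close>.\<close>

definition champ :: "(int \<Rightarrow> int) \<Rightarrow> int \<Rightarrow> int \<Rightarrow> int \<Rightarrow> bool" where
  "champ g l b c \<longleftrightarrow> valid g \<and> run g b l \<and> 1 \<le> c \<and> c < b \<and> b \<le> K \<and>
     (\<forall>j. run g (c + 1) j \<longrightarrow> (\<exists>t. 0 \<le> t \<and> t \<le> b - c - 1 \<and> cg j (l + t)))"
definition outc :: "int \<Rightarrow> int \<Rightarrow> int \<Rightarrow> bool" where
  "outc l b i \<longleftrightarrow> (\<exists>t. b \<le> t \<and> t < K \<and> cg i (l + t))"

lemma cg_offset: "cg (l + s) (l + t) \<longleftrightarrow> cg s t" by (simp add: cg_def)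
lemma cg_off: assumes "cg i (l + s)" "cg i (l + t)" shows "cg s t"
  using assms cg_trans cg_sym cg_offset by blast
lemma outc_not: assumes "outc l b i" "0 \<le> t" "t < b" shows "\<not> cg i (l + t)"
proof
  assume "cg i (l + t)"
  obtain u where u: "b \<le> u" "u < K" "cg i (l + u)" using assms(1) by (auto simp: outc_def)
  have "cg u t" using cg_off u(3) \<open>cg i (l + t)\<close> by blast
  thus False using cg_win[of u t] u assms by auto
qed
lemma not_outc: assumes "\<not> outc l b i" shows "\<exists>t. 0 \<le> t \<and> t < b \<and> cg i (l + t)"
proof -
  obtain j where j: "l \<le> j" "j < l + K" "cg j i" using cg_rep by blast
  hence c: "cg i (l + (j - l))" using cg_sym by simp
  show ?thesis
  proof (cases "j - l < b")
    case False
    hence "outc l b i" unfolding outc_def using c j by (intro exI[of _ "j - l"]) auto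
    thus ?thesis using assms by simp
  qed (use c j in \<open>auto intro!: exI[of _ "j - l"]\<close>)
qed
lemma outc_cg: "cg i j \<Longrightarrow> outc l b i \<longleftrightarrow> outc l b j"
  unfolding outc_def using cg_trans cg_sym by meson
lemma outc_rf: assumes "outc l b i" shows "outc (- (l + b - 1)) b (- i)"
proof -
  obtain u where u: "b \<le> u" "u < K" "cg i (l + u)" using assms by (auto simp: outc_def)
  have "cg (- i) (- (l + u))" using u(3) by (simp only: cg_neg)
  hence "cg (- i) (- (l + u) + K)" by (simp only: cg_K)
  moreover have "- (l + u) + K = - (l + b - 1) + (K - u + b - 1)" by simp
  ultimately have "cg (- i) (- (l + b - 1) + (K - u + b - 1))" by metis
  thus ?thesis unfolding outc_def using u by (intro exI[of _ "K - u + b - 1"]) auto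
qed

text \<open>The definition of \<open>champ\<close> only speaks of windows of \<open>c + 1\<close>
  robots. All windows of a longer run must start inside the champion early enough, so the whole run
  lies in it.\<close>

lemma champ_run: assumes "champ g l b c" "run g s j" "c + 1 \<le> s"
  shows "\<exists>t. 0 \<le> t \<and> t \<le> b - s \<and> cg j (l + t)"
proof -
  note C = assms(1)[unfolded champ_def]
  have "run g (c + 1) j" using run_mono[OF assms(2), of j] assms(3) by simp
  then obtain t where t: "0 \<le> t" "t \<le> b - c - 1" "cg j (l + t)" using C by blast
  have "t \<le> b - s"
  proof (rule ccontr)
    assume "\<not> t \<le> b - s"
    \<comment> \<open>The window of \<open>c + 1\<close> robots shifted by \<open>u\<close> starts
      at offset \<open>b - c\<close>, one beyond the last admissible start.\<close>
    define u where "u = b - c - t"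
    have "run g (c + 1) (j + u)" using run_mono[OF assms(2), of "j + u" "c + 1"] t \<open>\<not> t \<le> b - s\<close> by (simp add: u_def)
    then obtain t' where t': "0 \<le> t'" "t' \<le> b - c - 1" "cg (j + u) (l + t')" using C by blast
    have "cg (j + u) (l + (b - c))" using t(3) cg_add[of j u "l + t"] by (simp add: u_def algebra_simps)
    hence "cg (b - c) t'" using cg_off t'(3) by blast
    thus False using cg_win[of "b-c" t'] t' C by auto
  qed
  thus ?thesis using t by blast
qed

lemma champ_mx: assumes "champ g l b c" shows "max_run g b"
proof -
  have "\<not> run g (b + 1) j" for j
    using champ_run[OF assms, of "b+1" j] assms by (auto simp: champ_def)
  thus ?thesis using assms by (auto simp: champ_def max_run_def)
qed
lemma champ_head: assumes "champ g l b c" "run g b j" shows "cg j l"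
  using champ_run[OF assms] assms(1) by (auto simp: champ_def)
lemma champ_onehd: assumes "champ g l b c" shows "one_head g b"
  unfolding one_head_def using champ_head[OF assms] cg_trans cg_sym by blast
lemma champ_gapR: assumes "champ g l b c" shows "2 \<le> g (l + b - 1)"
proof (rule ccontr)
  assume "\<not> 2 \<le> g (l + b - 1)"
  moreover have "1 \<le> g (l + b - 1)" using assms validD by (auto simp: champ_def)
  ultimately have "run g (b + 1) l" using run_snoc assms by (auto simp: champ_def)
  thus False using champ_mx[OF assms] by (auto simp: max_run_def)
qed
lemma champ_rf: assumes "champ g l b c" shows "champ (rf g) (- (l + b - 1)) b c"
proof -
  note C = assms[unfolded champ_def]
  have 1: "run (rf g) b (- (l + b - 1))" using C by (simp add: run_rf)
  have 2: "\<exists>t. 0 \<le> t \<and> t \<le> b - c - 1 \<and> cg j (- (l + b - 1) + t)" if "run (rf g) (c + 1) j" for j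
  proof -
    have "run g (c + 1) (- (j + c))" using that by (simp add: run_rf)
    then obtain t where t: "0 \<le> t" "t \<le> b - c - 1" "cg (- (j + c)) (l + t)" using C by blast
    have "cg (- (j + c)) (- (- (l + t)))" using t by (simp only: minus_minus)
    hence "cg (j + c) (- (l + t))" by (simp only: cg_neg)
    hence "cg j (- (l + t) - c)" using cg_move by blast
    moreover have "- (l + t) - c = - (l + b - 1) + (b - c - 1 - t)" by simp
    ultimately have "cg j (- (l + b - 1) + (b - c - 1 - t))" by metis
    thus ?thesis using t by (intro exI[of _ "b - c - 1 - t"]) auto
  qed
  show ?thesis unfolding champ_def using C 1 2 valid_rf by auto
qed
text \<open>Uniqueness of the longest run forces \<open>b\<close> to be at least 2, because every
  robot is a run of length 1. Then \<open>b - 1\<close> is an admissible bound for the other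
  runs.\<close>

lemma one_head_champ: assumes "valid g" "max_run g b" "one_head g b" "b \<le> K" shows "\<exists>l. champ g l b (b - 1)"
proof -
  obtain l where l: "run g b l" using assms by (auto simp: max_run_def)
  have "b \<noteq> 1"
  proof
    assume "b = 1"
    hence "cg 0 1" using assms(3) by (auto simp: one_head_def)
    thus False using cg_win[of 0 1] K3 by simp
  qed
  hence "2 \<le> b" using assms by (auto simp: max_run_def)
  hence "champ g l b (b - 1)" unfolding champ_def using l assms
    by (auto simp: one_head_def intro!: exI[of _ 0])
  thus ?thesis ..
qed

section \<open>The champion zone\<close>

text \<open>Besides the two neighbours of the champion, at most one robot \<open>x\<close> (present iff \<open>\<rho>\<close>) may have a pending
  outdated move, in direction \<open>dx\<close>. It may create a run of length \<open>c + 1\<close>; when this is as long as the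
  champion, \<open>soft\<close> guarantees that the new run and the pending neighbours of the champion stay disjoint.\<close>

definition champ_pend :: "int \<Rightarrow> int \<Rightarrow> bool \<Rightarrow> int \<Rightarrow> int \<Rightarrow> (int \<Rightarrow> int) \<Rightarrow> bool" where
  "champ_pend l b \<rho> x dx q \<longleftrightarrow> (\<forall>i. q i \<noteq> 0 \<longrightarrow> outc l b i \<and>
     (cg i (l + b) \<and> q i = -1 \<or> cg i (l - 1) \<and> q i = 1 \<or> \<rho> \<and> cg i x \<and> q i = dx))"
definition rog :: "(int \<Rightarrow> int) \<Rightarrow> int \<Rightarrow> int \<Rightarrow> int \<Rightarrow> int \<Rightarrow> bool" where
  "rog g l b x dx \<longleftrightarrow> outc l b x \<and> outc l b (x + dx) \<and> (dx = -1 \<and> 2 \<le> g (x - 1) \<or> dx = 1 \<and> 2 \<le> g x)"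
definition soft :: "(int \<Rightarrow> int) \<Rightarrow> int \<Rightarrow> int \<Rightarrow> int \<Rightarrow> (int \<Rightarrow> int) \<Rightarrow> bool" where
  "soft g l b c q \<longleftrightarrow> (\<not> in_run g c (l + b) \<or> \<not> in_run g c (l - 1)) \<and>
     (\<forall>i. q i = -1 \<and> cg i (l + b) \<longrightarrow> \<not> in_run g c i) \<and> (\<forall>i. q i = 1 \<and> cg i (l - 1) \<longrightarrow> \<not> in_run g c i)"
definition champ_zone :: "int \<Rightarrow> int \<Rightarrow> int \<Rightarrow> bool \<Rightarrow> int \<Rightarrow> int \<Rightarrow> (int \<Rightarrow> int) \<Rightarrow> (int \<Rightarrow> int) \<Rightarrow> bool" where
  "champ_zone l b c \<rho> x dx g q \<longleftrightarrow> champ g l b c \<and> per q \<and> champ_pend l b \<rho> x dx q \<and>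
     (\<rho> \<longrightarrow> rog g l b x dx \<and> (c + 1 = b \<longrightarrow> soft g l b c q))"
text \<open>Potential of a lone robot with gaps \<open>u\<close> and \<open>v\<close> and pending
  move \<open>d\<close>. A pending move towards the farther side raises the minimum by at most 1,
  that is the potential by at most 3, and releases the surcharge 5. Any other move lowers the
  minimum.\<close>

definition sA :: "int \<Rightarrow> int \<Rightarrow> int \<Rightarrow> int" where
  "sA u v d = 3 * min u v + (if d = -1 \<and> v < u \<or> d = 1 \<and> u < v then 5 else 0)"
definition WA :: "int \<Rightarrow> int \<Rightarrow> (int \<Rightarrow> int) \<Rightarrow> (int \<Rightarrow> int) \<Rightarrow> int" where
  "WA l b g q = (if b + 2 \<le> K then 3 * (g (l + b - 1) + g (l - 1))
     else if b + 1 = K then sA (g (l + b - 1)) (g (l - 1)) (q (l - 1)) else 0)"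
text \<open>A join releases \<open>6 * N\<close>, enough for any later value of \<open>WA\<close>.
  The 4 covers the increase by 3 that the rogue robot may cause in a gap next to the champion. The
  quadratic term is spent if the rogue creates a second run as long as the champion; it exceeds the
  value of \<open>Zm\<close> there.\<close>

definition Wm :: "int \<Rightarrow> int \<Rightarrow> int \<Rightarrow> bool \<Rightarrow> (int \<Rightarrow> int) \<Rightarrow> (int \<Rightarrow> int) \<Rightarrow> int" where
  "Wm l b c \<rho> g q = (if \<rho> \<and> c + 1 = b then 40 * (N * N) else 0) + 6 * (N * (K - b)) + (if \<rho> then 4 else 0) + WA l b g q"

lemma champ_zone_rf: assumes "champ_zone l b c \<rho> x dx g q" shows "champ_zone (- (l + b - 1)) b c \<rho> (- x) (- dx) (rf g) (rq q)"
proof -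
  note A = assms[unfolded champ_zone_def]
  have cn: "cg i (- j) \<longleftrightarrow> cg (- i) j" for i j using cg_neg[of i "-j"] by simp
  have p: "champ_pend (- (l + b - 1)) b \<rho> (- x) (- dx) (rq q)"
    unfolding champ_pend_def
  proof (intro allI impI)
    fix i assume "rq q i \<noteq> 0"
    hence "q (- i) \<noteq> 0" by (simp add: rq_def)
    hence a: "outc l b (- i)" "cg (- i) (l + b) \<and> q (- i) = -1 \<or> cg (- i) (l - 1) \<and> q (- i) = 1 \<or> \<rho> \<and> cg (- i) x \<and> q (- i) = dx"
      using A unfolding champ_pend_def by auto
    have "- (l + b - 1) - 1 = - (l + b)" "- (l + b - 1) + b = - (l - 1)" by simp_all
    note e = this
    show "outc (- (l + b - 1)) b i \<and>
       (cg i (- (l + b - 1) + b) \<and> rq q i = - 1 \<or> cg i (- (l + b - 1) - 1) \<and> rq q i = 1 \<or> \<rho> \<and> cg i (- x) \<and> rq q i = - dx)"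
      using a outc_rf[OF a(1)] unfolding e rq_def minus_minus cn by (elim disjE conjE) simp_all
  qed
  have r: "rog (rf g) (- (l + b - 1)) b (- x) (- dx)" if \<rho>
  proof -
    have R: "rog g l b x dx" using A that by simp
    have "- x + - dx = - (x + dx)" by simp
    thus ?thesis using R outc_rf[of l b x] outc_rf[of l b "x + dx"] unfolding rog_def
      by (auto simp: rf_def)
  qed
  have s: "soft (rf g) (- (l + b - 1)) b c (rq q)" if "soft g l b c q"
  proof -
    have 1: "- (l + b - 1) - 1 = - (l + b)" "- (l + b - 1) + b = - (l - 1)" by simp_all
    show ?thesis using that unfolding soft_def 1 in_run_rf rq_def cn minus_minus neg_equal_iff_equal
      by (metis minus_minus)
  qed
  show ?thesis using A champ_rf per_rq p r s unfolding champ_zone_def by auto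
qed

lemma sA_sym: "sA v u (- d) = sA u v d" by (auto simp: sA_def min.commute)
lemma Wm_rf: assumes "per q" shows "Wm (- (l + b - 1)) b c \<rho> (rf g) (rq q) = Wm l b c \<rho> g q"
proof -
  have e: "rf g (- (l + b - 1) + b - 1) = g (l - 1)" "rf g (- (l + b - 1) - 1) = g (l + b - 1)"
    unfolding rf_def by (rule arg_cong[of _ _ g], simp)+
  have "rq q (- (l + b - 1) - 1) = - q (l - 1)" if "b + 1 = K"
  proof -
    have "cg (l + b) (l - 1)"
    proof -
      have "l + b = (l - 1) + K" using that by simp
      thus ?thesis by (simp only: cg_K cg_refl)
    qed
    moreover have "rq q (- (l + b - 1) - 1) = - q (l + b)" by (simp add: rq_def add.commute)
    ultimately show ?thesis using per_cg[OF assms] by metis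
  qed
  thus ?thesis unfolding Wm_def WA_def e by (auto simp: sA_sym)
qed

lemma WA_bd: assumes "valid g" shows "0 \<le> WA l b g q" "WA l b g q \<le> 6 * N"
proof -
  have a: "1 \<le> g j" "g j \<le> N" for j using validD[OF assms] g_le[OF assms] by auto
  from a[of "l+b-1"] a[of "l-1"] show "0 \<le> WA l b g q" "WA l b g q \<le> 6 * N"
    using N7 by (auto simp: WA_def sA_def)
qed

text \<open>The comparison with the opposite neighbour is exported because it is what preserves
  \<open>soft\<close> and keeps the surcharge in \<open>sA\<close> from appearing at a Look.\<close>

lemma champ_zone_Fside: assumes "champ g l b c" "b < K" "d \<in> F g r"
  shows "d = -1 \<and> cg r (l + b) \<and> (\<forall>s. in_run g s (l + b) \<longrightarrow> in_run g s (l - 1)) \<and> (b = K - 1 \<longrightarrow> g (l + b - 1) \<le> g (l - 1))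
       \<or> d = 1 \<and> cg r (l - 1) \<and> (\<forall>s. in_run g s (l - 1) \<longrightarrow> in_run g s (l + b)) \<and> (b = K - 1 \<longrightarrow> g (l - 1) \<le> g (l + b - 1))"
proof -
  have L: "cg r (l + b) \<and> (\<forall>s. in_run g s (l + b) \<longrightarrow> in_run g s (l - 1)) \<and> (b = K - 1 \<longrightarrow> g (l + b - 1) \<le> g (l - 1))"
    if C: "champ g l b c" and R: "r1 g b r" for g l r
  proof -
    have p: "per g" using C by (auto simp: champ_def valid_def)
    have "cg (r - b) l" using champ_head[OF C] R by (auto simp: r1_def)
    hence c: "cg r (l + b)" using cg_add[of "r-b" b l] by simp
    have c1: "cg (r - b - 1) (l - 1)" using \<open>cg (r - b) l\<close> by simp
    have c2: "cg (r - 1) (l + b - 1)" using c by simp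
    have "g r = g (l - 1)" if "b = K - 1"
    proof -
      have "l + b = l - 1 + K" using that by simp
      hence "cg r (l - 1)" using c by (simp only: cg_K)
      thus ?thesis using per_cg[OF p] by blast
    qed
    thus ?thesis using R c in_run_cg[OF p c] in_run_cg[OF p c1] per_cg[OF p c2] by (auto simp: r1_def)
  qed
  have "d = -1 \<and> r1 g b r \<or> d = 1 \<and> r1 (rf g) b (- r)"
    using assms(3) mxF[OF champ_mx[OF assms(1)] assms(2)] champ_onehd[OF assms(1)] by auto
  thus ?thesis
  proof
    assume a: "d = -1 \<and> r1 g b r"
    thus ?thesis using L[OF assms(1)] by blast
  next
    assume a: "d = 1 \<and> r1 (rf g) b (- r)"
    have e: "- (l + b - 1) + b = - (l - 1)" "- (l + b - 1) - 1 = - (l + b)" "- (l - 1) - 1 = -l" by simp_all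
    from a L[OF champ_rf[OF assms(1)], of "- r"] show ?thesis
      unfolding e in_run_rf minus_minus cg_neg rf_minus by blast
  qed
qed

lemma r1_intro: assumes "champ g l b c" "\<forall>s. in_run g s (l + b) \<longrightarrow> in_run g s (l - 1)" "b = K - 1 \<longrightarrow> g (l + b - 1) \<le> g (l - 1)"
  shows "r1 g b (l + b)"
proof -
  have p: "per g" using assms by (auto simp: champ_def valid_def)
  have "g (l + b) = g (l - 1)" if "b = K - 1"
  proof -
    have "l + b = l - 1 + K" using that by simp
    thus ?thesis using p[unfolded per_def] by metis
  qed
  moreover have "l + b - b - 1 = l - 1" by simp
  ultimately show ?thesis using assms unfolding r1_def champ_def by auto
qed

text \<open>Membership in runs of length \<open>s\<close> is monotone in \<open>s\<close>, so the
  two neighbours of the champion are comparable and at least one is allowed to move. If only one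
  other robot is left, both neighbours are that robot, and the nearer side decides.\<close>

lemma champ_zone_prog: assumes "champ g l b c" "b < K" shows "\<exists>i. F g i \<noteq> {}"
proof -
  have p: "per g" using assms by (auto simp: champ_def valid_def)
  have mf: "-1 \<in> F g r" if "r1 g b r" for r
    using mxF[OF champ_mx[OF assms(1)] assms(2)] champ_onehd[OF assms(1)] that by auto
  have mf2: "1 \<in> F g (- r)" if "r1 (rf g) b r" for r
    using mxF[OF champ_mx[OF assms(1)] assms(2)] champ_onehd[OF assms(1)] that by auto
  have R: "r1 g b (l + b)" if "\<forall>s. in_run g s (l + b) \<longrightarrow> in_run g s (l - 1)" "b = K - 1 \<longrightarrow> g (l + b - 1) \<le> g (l - 1)"
    using r1_intro[OF assms(1)] that by blast
  have e: "- (l + b - 1) + b = - (l - 1)" "- (l + b - 1) - 1 = - (l + b)" "- (l - 1) - 1 = - l" by simp_all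
  have R2: "r1 (rf g) b (- (l - 1))" if "\<forall>s. in_run g s (l - 1) \<longrightarrow> in_run g s (l + b)" "b = K - 1 \<longrightarrow> g (l - 1) \<le> g (l + b - 1)"
    using r1_intro[OF champ_rf[OF assms(1)], unfolded e in_run_rf minus_minus rf_minus] that by blast
  show ?thesis
  proof (cases "b = K - 1")
    case True
    have "l + b = l - 1 + K" using True by simp
    hence "cg (l + b) (l - 1)" by (simp only: cg_K cg_refl)
    hence "in_run g s (l + b) \<longleftrightarrow> in_run g s (l - 1)" for s using in_run_cg[OF p] by blast
    hence "r1 g b (l + b) \<or> r1 (rf g) b (- (l - 1))" using R R2 True by (metis linear)
    thus ?thesis using mf mf2 by blast
  next
    case False
    have "(\<forall>s. in_run g s (l + b) \<longrightarrow> in_run g s (l - 1)) \<or> (\<forall>s. in_run g s (l - 1) \<longrightarrow> in_run g s (l + b))"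
    proof (rule ccontr)
      assume "\<not> ?thesis"
      then obtain s s' where s: "in_run g s (l + b)" "\<not> in_run g s (l - 1)" "in_run g s' (l - 1)" "\<not> in_run g s' (l + b)" by blast
      have "1 \<le> s" "1 \<le> s'" using s by (auto simp: in_run_def)
      thus False using s in_run_mono[of g s "l+b" s'] in_run_mono[of g s' "l-1" s] by linarith
    qed
    thus ?thesis using R R2 False mf mf2 by blast
  qed
qed

lemma champ_zone_look: assumes "champ_zone l b c \<rho> x dx g q" "b < K" "d \<in> F g i" "q i = 0"
  shows "champ_zone l b c \<rho> x dx g (setq q i d)" "Wm l b c \<rho> g (setq q i d) \<le> Wm l b c \<rho> g q"
proof -
  note A = assms(1)[unfolded champ_zone_def]
  have C: "champ g l b c" using A by simp
  have p: "per g" using C by (auto simp: champ_def valid_def)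
  note S = champ_zone_Fside[OF C assms(2,3)]
  have o1: "outc l b (l + b)" unfolding outc_def using assms(2) C by (intro exI[of _ b]) (auto simp: champ_def)
  have o2: "outc l b (l - 1)"
  proof -
    have "l + (K - 1) = l - 1 + K" by simp
    hence "cg (l - 1) (l + (K - 1))" by (simp only: cg_K cg_refl)
    thus ?thesis unfolding outc_def using assms(2) by (intro exI[of _ "K - 1"]) auto
  qed
  have oi: "outc l b i" using S o1 o2 outc_cg by blast
  have pq: "per (setq q i d)" using A per_setq by blast
  have w: "champ_pend l b \<rho> x dx (setq q i d)" unfolding champ_pend_def
  proof (intro allI impI)
    fix j assume j: "setq q i d j \<noteq> 0"
    show "outc l b j \<and> (cg j (l + b) \<and> setq q i d j = - 1 \<or> cg j (l - 1) \<and> setq q i d j = 1 \<or> \<rho> \<and> cg j x \<and> setq q i d j = dx)"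
    proof (cases "cg j i")
      case True
      hence "setq q i d j = d" by (simp add: setq_def)
      moreover have "cg j (l + b) \<longleftrightarrow> cg i (l + b)" "cg j (l - 1) \<longleftrightarrow> cg i (l - 1)"
        using True cg_trans cg_sym by blast+
      ultimately show ?thesis using S outc_cg[OF True] oi by auto
    next
      case False
      hence "setq q i d j = q j" by (simp add: setq_def)
      thus ?thesis using A j unfolding champ_pend_def by auto
    qed
  qed
  \<comment> \<open>By \<open>soft\<close> one of the two neighbours is in no run of length
    \<open>c\<close>. The robot told to move lies in no longer run than the other neighbour, so it
    is in no run of length \<open>c\<close> either.\<close>
  have s: "soft g l b c (setq q i d)" if s: "soft g l b c q"
  proof -
    have "\<not> in_run g c j" if "cg j i" for j
    proof -
      have ji: "in_run g c j = in_run g c i" using in_run_cg[OF p that] .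
      from S show ?thesis
      proof (elim disjE conjE)
        assume h: "cg i (l + b)" "\<forall>s. in_run g s (l + b) \<longrightarrow> in_run g s (l - 1)"
        have "in_run g c i = in_run g c (l + b)" using in_run_cg[OF p h(1)] .
        thus ?thesis using h s ji unfolding soft_def by blast
      next
        assume h: "cg i (l - 1)" "\<forall>s. in_run g s (l - 1) \<longrightarrow> in_run g s (l + b)"
        have "in_run g c i = in_run g c (l - 1)" using in_run_cg[OF p h(1)] .
        thus ?thesis using h s ji unfolding soft_def by blast
      qed
    qed
    thus ?thesis using s unfolding soft_def setq_def by auto
  qed
  show "champ_zone l b c \<rho> x dx g (setq q i d)" using A pq w s unfolding champ_zone_def by auto
  show "Wm l b c \<rho> g (setq q i d) \<le> Wm l b c \<rho> g q"
  proof (cases "b + 1 = K")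
    case True
    have "setq q i d (l - 1) = d \<or> setq q i d (l - 1) = q (l - 1)" by (simp add: setq_def)
    moreover have "\<not> (d = -1 \<and> g (l - 1) < g (l + b - 1) \<or> d = 1 \<and> g (l + b - 1) < g (l - 1))"
      using S True by auto
    ultimately show ?thesis unfolding Wm_def WA_def sA_def by auto
  qed (simp add: Wm_def WA_def)
qed

text \<open>Two runs, of lengths \<open>b1\<close> and \<open>b2\<close>, separated by \<open>p\<close> and \<open>p'\<close> robots; all other runs are shorter than both.\<close>

definition two_champ :: "(int \<Rightarrow> int) \<Rightarrow> int \<Rightarrow> int \<Rightarrow> int \<Rightarrow> int \<Rightarrow> int \<Rightarrow> bool" where
  "two_champ g l1 b1 p b2 p' \<longleftrightarrow> valid g \<and> 2 \<le> b1 \<and> 2 \<le> b2 \<and> 0 \<le> p \<and> 0 \<le> p' \<and> b1 + p + b2 + p' = K \<and>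
     run g b1 l1 \<and> run g b2 (l1 + b1 + p) \<and>
     (\<forall>j. run g (min b1 b2) j \<longrightarrow> (\<exists>t. 0 \<le> t \<and> t \<le> b1 - min b1 b2 \<and> cg j (l1 + t)) \<or>
        (\<exists>t. 0 \<le> t \<and> t \<le> b2 - min b1 b2 \<and> cg j (l1 + b1 + p + t)))"
definition pair_pend :: "int \<Rightarrow> int \<Rightarrow> int \<Rightarrow> int \<Rightarrow> int \<Rightarrow> (int \<Rightarrow> int) \<Rightarrow> bool" where
  "pair_pend l1 b1 p b2 p' q \<longleftrightarrow> (\<forall>i. q i \<noteq> 0 \<longrightarrow>
     1 \<le> p \<and> (cg i (l1 + b1) \<and> q i = -1 \<or> cg i (l1 + b1 + p - 1) \<and> q i = 1) \<or>
     1 \<le> p' \<and> (cg i (l1 + b1 + p + b2) \<and> q i = -1 \<or> cg i (l1 - 1) \<and> q i = 1))"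
definition pair_zone :: "int \<Rightarrow> int \<Rightarrow> int \<Rightarrow> int \<Rightarrow> int \<Rightarrow> (int \<Rightarrow> int) \<Rightarrow> (int \<Rightarrow> int) \<Rightarrow> bool" where
  "pair_zone l1 b1 p b2 p' g q \<longleftrightarrow> two_champ g l1 b1 p b2 p' \<and> per q \<and> 1 \<le> p + p' \<and> pair_pend l1 b1 p b2 p' q"
text \<open>In an arc of several robots the two ends act on different gaps. A lone robot should go
  to the longer run, or to the nearer of two equal ones; the surcharge 5 pays for an outdated move
  in the wrong direction.\<close>

definition ZA :: "int \<Rightarrow> int \<Rightarrow> int \<Rightarrow> int \<Rightarrow> int \<Rightarrow> int \<Rightarrow> int" where
  "ZA p u v b1 b2 d = (if 2 \<le> p then 3 * (u + v) else if p = 1 then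
     (if b1 = b2 then sA u v d else if b2 < b1 then 3 * u + (if d = 1 then 5 else 0) else 3 * v + (if d = -1 then 5 else 0)) else 0)"
text \<open>Each join releases \<open>20 * N\<close>, more than the bound \<open>12 * N\<close> of
  the two \<open>ZA\<close> terms together. The summand \<open>10 * (N * N)\<close> pays for the
  champion zone that is entered when the last robot has joined.\<close>

definition Zm :: "int \<Rightarrow> int \<Rightarrow> int \<Rightarrow> int \<Rightarrow> int \<Rightarrow> (int \<Rightarrow> int) \<Rightarrow> (int \<Rightarrow> int) \<Rightarrow> int" where
  "Zm l1 b1 p b2 p' g q = 10 * (N * N) + 20 * (N * (p + p')) +
     ZA p (g (l1 + b1 - 1)) (g (l1 + b1 + p - 1)) b1 b2 (q (l1 + b1)) +
     ZA p' (g (l1 + b1 + p + b2 - 1)) (g (l1 - 1)) b2 b1 (q (l1 - 1))"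

lemma ZA_bd: assumes "valid g" shows "0 \<le> ZA p (g i) (g j) b1 b2 d" "ZA p (g i) (g j) b1 b2 d \<le> 6 * N"
proof -
  have a: "1 \<le> g j" "g j \<le> N" for j using validD[OF assms] g_le[OF assms] by auto
  from a[of i] a[of j] show "0 \<le> ZA p (g i) (g j) b1 b2 d" "ZA p (g i) (g j) b1 b2 d \<le> 6 * N"
    using N7 by (auto simp: ZA_def sA_def)
qed

definition late_zone :: "int \<Rightarrow> (int \<Rightarrow> int) \<Rightarrow> (int \<Rightarrow> int) \<Rightarrow> bool" where
  "late_zone m g q \<longleftrightarrow> (\<exists>l b c \<rho> x dx. champ_zone l b c \<rho> x dx g q \<and> Wm l b c \<rho> g q \<le> m) \<or>
     (\<exists>l1 b1 p b2 p'. pair_zone l1 b1 p b2 p' g q \<and> Zm l1 b1 p b2 p' g q \<le> m)"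

lemma late_zone_W: "champ_zone l b c \<rho> x dx g q \<Longrightarrow> Wm l b c \<rho> g q \<le> m \<Longrightarrow> late_zone m g q" unfolding late_zone_def by blast
lemma late_zone_Z: "pair_zone l1 b1 p b2 p' g q \<Longrightarrow> Zm l1 b1 p b2 p' g q \<le> m \<Longrightarrow> late_zone m g q" unfolding late_zone_def by blast

lemma ncg: assumes "i < j" "j < i + K" shows "\<not> cg i j" "\<not> cg j i"
  using cg_win[of i j] cg_win[of j i] assms by auto

lemma champ_zone_side_move: assumes "champ_zone l b c \<rho> x dx g q" "q (l + b) = -1"
  shows "2 \<le> g (l + b - 1)" "late_zone (Wm l b c \<rho> g q - 1) (upd g (l + b) (-1)) (setq q (l + b) 0)"
proof -
  note A = assms(1)[unfolded champ_zone_def]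
  let ?i = "l + b"
  let ?g = "upd g ?i (-1)" let ?q = "setq q ?i 0"
  have C: "champ g l b c" using A by simp
  hence v: "valid g" and p: "per g" and c: "1 \<le> c" "c < b" "b \<le> K" and rl: "run g b l" by (auto simp: champ_def valid_def)
  have oi: "outc l b ?i" using A assms(2) unfolding champ_pend_def by auto
  hence bK: "b < K" by (auto simp: outc_def)
  show gap: "2 \<le> g (l + b - 1)" using champ_gapR[OF C] .
  have v': "valid ?g" using valid_upd[OF v] gap by simp
  have g'1: "?g (l + b - 1) = g (l + b - 1) - 1" using upd_at[OF p, of "l+b-1" ?i "-1"] by simp
  have g'2: "?g (l + b) = g (l + b) + 1" using upd_at2[OF p, of "l+b" ?i "-1"] by simp
  have g'3: "?g (l - 1) = g (l - 1)" if "b + 2 \<le> K"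
    using ncg(1)[of "l - 1" "l + b"] ncg(1)[of "l - 1" "l + b - 1"] that c upd_other[of "l-1" ?i] by auto
  have g'4: "?g (l - 1) = g (l - 1) + 1" if "b + 1 = K"
  proof -
    have "l + b = l - 1 + K" using that by simp
    hence "cg (l - 1) (l + b)" by (simp only: cg_K cg_refl)
    thus ?thesis using upd_at2[OF p, of "l-1" ?i "-1"] by simp
  qed
  have q'1: "?q j = 0" if "cg j ?i" for j using that by (simp add: setq_def)
  have q'2: "?q j = q j \<and> \<not> cg j ?i" if "?q j \<noteq> 0" for j using that by (auto simp: setq_def split: if_splits)
  have pq: "per ?q" using A per_setq by auto
  have keep: "run ?g b l"
  proof (rule run_keep[OF v _ rl])
    show "2 \<le> g (?i - 1)" using gap by simp
    fix t assume "l \<le> t" "t < l + b - 1" thus "\<not> cg t ?i" using ncg(1)[of t "l+b"] bK by simp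
  qed
  have rg: "2 \<le> ?g (x - 1)" if "dx = -1" "outc l b x" "outc l b (x + dx)" "2 \<le> g (x - 1)"
  proof -
    have "\<not> cg (x - 1) (l + (b - 1))" using outc_not[of l b "x - 1" "b - 1"] that c by auto
    hence "\<not> cg (x - 1) (?i - 1)" by (simp add: add_diff_eq)
    thus ?thesis using that by (auto simp: upd_def)
  qed
  have rg2: "2 \<le> ?g x" if "outc l b x" "2 \<le> g x"
  proof -
    have "\<not> cg x (l + (b - 1))" using outc_not[of l b x "b - 1"] that c by auto
    hence "\<not> cg x (?i - 1)" by (simp add: add_diff_eq)
    thus ?thesis using that by (auto simp: upd_def)
  qed
  show "late_zone (Wm l b c \<rho> g q - 1) ?g ?q"
  proof (cases "3 \<le> g (l + b - 1)")
    case True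
    have ar: "run ?g s j \<Longrightarrow> run g s j" for s j using approach_run[OF v, of ?i] True by simp
    have ai: "in_run ?g s j \<Longrightarrow> in_run g s j" for s j using approach_inr[OF v, of ?i] True by simp
    have C': "champ ?g l b c" unfolding champ_def using v' keep c ar C unfolding champ_def by blast
    have w: "champ_pend l b \<rho> x dx ?q" using A q'2 unfolding champ_pend_def by metis
    have r: "rog ?g l b x dx" if \<rho> using A that rg rg2 unfolding rog_def by auto
    have s: "soft ?g l b c ?q" if "soft g l b c q" using that ai q'2 unfolding soft_def
      by (metis zero_neq_neg_one zero_neq_one)
    have champ_zone': "champ_zone l b c \<rho> x dx ?g ?q" unfolding champ_zone_def using C' pq w r s A by auto
    have "WA l b ?g ?q \<le> WA l b g q - 1"
    proof -
      consider "b + 2 \<le> K" | "b + 1 = K" using bK by linarith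
      thus ?thesis
      proof cases
        case 1
        thus ?thesis using g'1 g'3 by (simp add: WA_def)
      next
        case 2
        \<comment> \<open>With one robot outside the champion, its left and right neighbours
          coincide, so the executed move is also the one recorded at \<open>l - 1\<close>.\<close>
        have "l + b = l - 1 + K" using 2 by simp
        hence "cg (l - 1) (l + b)" by (simp only: cg_K cg_refl)
        hence "q (l - 1) = -1" "?q (l - 1) = 0" using per_cg[of q] A assms(2) q'1 by auto
        thus ?thesis using 2 g'1 g'4 by (auto simp: WA_def sA_def min_def)
      qed
    qed
    thus ?thesis using late_zone_W[OF champ_zone', of "Wm l b c \<rho> g q - 1"] by (simp add: Wm_def)
  next
    case False
    hence g2: "g (l + b - 1) = 2" using gap by simp
    have k1: "run ?g (b + 1) l" using run_snoc[OF keep] g'1 g2 by simp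
    have C': "champ ?g l (b + 1) c" unfolding champ_def
    proof (intro conjI allI impI)
      fix j assume r: "run ?g (c + 1) j"
      show "\<exists>t. 0 \<le> t \<and> t \<le> b + 1 - c - 1 \<and> cg j (l + t)"
      proof (cases "run g (c + 1) j")
        case True
        then obtain t where "0 \<le> t" "t \<le> b - c - 1" "cg j (l + t)" using C unfolding champ_def by blast
        thus ?thesis by (intro exI[of _ t]) auto
      next
        case False
        have "cg (j + c) (l + b)" using join_run(1)[OF v _ r False] gap by simp
        hence "cg j (l + (b - c))" using cg_move[of j c] by (simp add: add_diff_eq)
        thus ?thesis using c by (intro exI[of _ "b - c"]) auto
      qed
    qed (use v' k1 c bK in auto)
    \<comment> \<open>The rogue survives only while it has a pending move whose target index stays
      outside the extended champion. The bound \<open>c\<close> is kept, so \<open>c + 1\<close> is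
      now smaller than the length and \<open>soft\<close> is no longer required.\<close>
    define r' where "r' \<longleftrightarrow> \<rho> \<and> ?q x \<noteq> 0 \<and> outc l (b + 1) (x + dx)"
    have nx: "outc l (b + 1) j" if "outc l b j" "\<not> cg j ?i" for j
    proof -
      obtain u where u: "b \<le> u" "u < K" "cg j (l + u)" using \<open>outc l b j\<close> by (auto simp: outc_def)
      hence "u \<noteq> b" using that by auto
      thus ?thesis using u unfolding outc_def by (intro exI[of _ u]) auto
    qed
    have w: "champ_pend l (b + 1) r' x dx ?q" unfolding champ_pend_def
    proof (intro allI impI)
      fix j assume j: "?q j \<noteq> 0"
      have qj: "?q j = q j" "\<not> cg j ?i" using q'2[OF j] by auto
      have o: "outc l b j" "cg j (l - 1) \<and> q j = 1 \<or> \<rho> \<and> cg j x \<and> q j = dx"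
        using A qj j unfolding champ_pend_def by auto
      \<comment> \<open>A rogue heading for the index that has just been absorbed stands right
        behind the extended run and moves left: it has become an ordinary neighbour.\<close>
      have "cg j (l + (b + 1)) \<and> q j = -1" if h: "\<rho>" "cg j x" "q j = dx" "\<not> outc l (b + 1) (x + dx)"
      proof -
        have R: "rog g l b x dx" using A h by simp
        have "cg (x + dx) ?i" using nx[of "x+dx"] R h unfolding rog_def by blast
        hence e: "cg x (l + b - dx)" using cg_move by blast
        have "dx \<noteq> 1"
        proof
          assume "dx = 1"
          hence "cg x (l + (b - 1))" using e by (simp add: add_diff_eq)
          thus False using outc_not[of l b x "b - 1"] R c unfolding rog_def by auto
        qed
        hence "dx = -1" using R by (auto simp: rog_def)
        thus ?thesis using e h cg_trans by (auto simp: add.assoc)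
      qed
      moreover have "\<rho> \<and> cg j x \<and> q j = dx \<and> outc l (b + 1) (x + dx) \<Longrightarrow> r' \<and> cg j x \<and> q j = dx"
        unfolding r'_def using j per_cg[OF pq, of j x] by auto
      ultimately show "outc l (b + 1) j \<and> (cg j (l + (b + 1)) \<and> ?q j = -1 \<or> cg j (l - 1) \<and> ?q j = 1 \<or> r' \<and> cg j x \<and> ?q j = dx)"
        using o nx[OF o(1) qj(2)] qj(1) by auto
    qed
    have r: "rog ?g l (b + 1) x dx" if r'
    proof -
      have R: "rog g l b x dx" using A that by (simp add: r'_def)
      have "outc l (b + 1) x" using nx R that q'2[of x] unfolding rog_def r'_def by blast
      thus ?thesis using R rg rg2 that unfolding rog_def r'_def by auto
    qed
    have champ_zone': "champ_zone l (b + 1) c r' x dx ?g ?q" unfolding champ_zone_def using C' pq w r c by auto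
    have bd: "1 \<le> g j" "g j \<le> N" for j using validD[OF v] g_le[OF v] by auto
    have a0: "0 \<le> WA l b g q" using WA_bd[OF v] by simp
    have "WA l (b + 1) ?g ?q + 1 \<le> 6 * N + WA l b g q"
    proof -
      consider "b + 3 \<le> K" | "b + 2 = K" | "b + 1 = K" using bK by linarith
      thus ?thesis
      proof cases
        case 1
        have "l + (b + 1) - 1 = l + b" by simp
        hence "WA l (b+1) ?g ?q = 3 * (g (l + b) + 1 + g (l - 1))" using 1 g'2 g'3 by (simp add: WA_def)
        moreover have "WA l b g q = 3 * (2 + g (l - 1))" using 1 g2 by (simp add: WA_def)
        ultimately show ?thesis using bd(2)[of "l+b"] N7 by simp
      next
        case 2
        have "l + (b + 1) - 1 = l + b" by simp
        hence "WA l (b+1) ?g ?q \<le> 3 * (g (l + b) + 1) + 5" using 2 g'2 by (auto simp: WA_def sA_def min_def)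
        moreover have "WA l b g q \<ge> 9" using 2 g2 bd(1)[of "l-1"] by (simp add: WA_def)
        ultimately show ?thesis using bd(2)[of "l+b"] N7 by simp
      next
        case 3
        thus ?thesis using a0 N7 by (simp add: WA_def)
      qed
    qed
    moreover have "6 * (N * (K - (b + 1))) = 6 * (N * (K - b)) - 6 * N" by (simp add: algebra_simps)
    moreover define NN where "NN = N * N"
    moreover have "0 \<le> NN" by (simp add: NN_def)
    ultimately have "Wm l (b + 1) c r' ?g ?q \<le> Wm l b c \<rho> g q - 1"
      using c unfolding Wm_def r'_def NN_def[symmetric] by auto
    thus ?thesis using late_zone_W[OF champ_zone'] by blast
  qed
qed

lemma champ_zone_rogue_move: assumes "champ_zone l b c \<rho> x (-1) g q" "\<rho>" "q x = -1"
  shows "2 \<le> g (x - 1)" "late_zone (Wm l b c \<rho> g q - 1) (upd g x (-1)) (setq q x 0)"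
proof -
  note A = assms(1)[unfolded champ_zone_def]
  let ?g = "upd g x (-1)" let ?q = "setq q x 0"
  have C: "champ g l b c" using A by simp
  hence v: "valid g" and p: "per g" and c: "1 \<le> c" "c < b" "b \<le> K" and rl: "run g b l" by (auto simp: champ_def valid_def)
  have R: "outc l b x" "outc l b (x - 1)" "2 \<le> g (x - 1)" using A assms(2) by (auto simp: rog_def)
  show gap: "2 \<le> g (x - 1)" using R by simp
  obtain tx where tx: "b \<le> tx" "tx < K" "cg x (l + tx)" using R(1) by (auto simp: outc_def)
  have tx1: "b + 1 \<le> tx"
  proof (rule ccontr)
    assume "\<not> b + 1 \<le> tx"
    hence "tx = b" using tx by simp
    hence "cg (x - 1) (l + (b - 1))" using tx cg_diff[of x 1 "l+b"] by (simp add: add_diff_eq)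
    thus False using outc_not[OF R(2)] c by auto
  qed
  hence bK: "b + 2 \<le> K" using tx by simp
  have v': "valid ?g" using valid_upd[OF v] gap by simp
  have nin: "\<not> cg (l + t) x \<and> \<not> cg (l + t) (x - 1)" if "0 \<le> t" "t < b" for t
    using outc_not[OF R(1) that] outc_not[OF R(2) that] cg_sym by blast
  have gin: "?g (l + t) = g (l + t)" if "0 \<le> t" "t < b" for t using nin[OF that] upd_other by blast
  have ge: "?g (l + b - 1) = g (l + b - 1)" using gin[of "b-1"] c by (simp add: add_diff_eq)
  have gl: "?g (l - 1) \<le> g (l - 1) + 1" by (simp add: upd_def)
  have keep: "run ?g b l"
  proof (rule run_keep[OF v gap rl])
    fix t assume "l \<le> t" "t < l + b - 1" thus "\<not> cg t x" using nin[of "t - l"] by simp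
  qed
  have q'2: "?q j = q j \<and> \<not> cg j x" if "?q j \<noteq> 0" for j using that by (auto simp: setq_def split: if_splits)
  have pq: "per ?q" using A per_setq by auto
  have w: "champ_pend l b False x (-1) ?q" using A q'2 unfolding champ_pend_def by metis
  have WAle: "WA l b ?g ?q \<le> WA l b g q + 3" using ge gl bK by (simp add: WA_def)
  have last: "late_zone (Wm l b c \<rho> g q - 1) ?g ?q" if "champ ?g l b c'" "c \<le> c'" for c'
  proof -
    have champ_zone': "champ_zone l b c' False x (-1) ?g ?q" unfolding champ_zone_def using that w pq by auto
    define NN where "NN = N * N"
    have "0 \<le> NN" by (simp add: NN_def)
    hence "Wm l b c' False ?g ?q \<le> Wm l b c \<rho> g q - 1"
      using WAle assms(2) unfolding Wm_def NN_def[symmetric] by auto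
    thus ?thesis using late_zone_W[OF champ_zone'] gap by blast
  qed
  show "late_zone (Wm l b c \<rho> g q - 1) ?g ?q"
  proof (cases "c + 1 < b")
    case True
    \<comment> \<open>One move lengthens a foreign run by at most one robot, so the bound on foreign
      runs rises from \<open>c\<close> to \<open>c + 1\<close>, which is still below
      \<open>b\<close>.\<close>
    have "champ ?g l b (c + 1)" unfolding champ_def
    proof (intro conjI allI impI)
      fix j assume r: "run ?g (c + 1 + 1) j"
      show "\<exists>t. 0 \<le> t \<and> t \<le> b - (c + 1) - 1 \<and> cg j (l + t)"
      proof (cases "run g (c + 1 + 1) j")
        case True
        from champ_run[OF C True] show ?thesis by auto
      next
        case False
        have e: "j + (c + 1 + 1) - 1 = j + (c + 1)" "c + 1 + 1 - 1 = c + 1" by simp_all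
        have "cg (j + (c + 1)) x" "run g (c + 1) j" using join_run[OF v gap r False] unfolding e by blast+
        moreover then obtain t where t: "0 \<le> t" "t \<le> b - c - 1" "cg j (l + t)" using C unfolding champ_def by blast
        ultimately have "cg (l + t + (c + 1)) x" using cg_add cg_trans cg_sym by meson
        hence "cg (l + (t + c)) (x - 1)" using cg_diff[of "l + t + (c + 1)" 1 x] by (simp add: algebra_simps)
        thus ?thesis using nin[of "t + c"] t c by auto
      qed
    qed (use v' keep c True in auto)
    thus ?thesis using last by simp
  next
    case False
    hence cb: "c + 1 = b" using c by simp
    hence S: "soft g l b c q" using A assms(2) by blast
    show ?thesis
    proof (cases "\<exists>j. run ?g b j \<and> \<not> run g b j")
      case False
      hence "champ ?g l b c" unfolding champ_def using v' keep c C cb unfolding champ_def by blast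
      thus ?thesis using last by simp
    next
      case True
      then obtain j where j: "run ?g b j" "\<not> run g b j" by blast
      \<comment> \<open>Every new run of length \<open>b\<close> ends with the rogue, that is with
        robot \<open>l + tx\<close>; this determines its first robot.\<close>
      define l2 where "l2 = l + tx - b + 1"
      have state_inv: "cg j' l2 \<and> run g (b - 1) j'" if "run ?g b j'" "\<not> run g b j'" for j'
      proof -
        have "cg (j' + b - 1) (l + tx)" using join_run(1)[OF v gap that] tx(3) cg_trans by blast
        hence "cg (j' + b - 1 - (b - 1)) (l + tx - (b - 1))" by (simp only: cg_diff)
        moreover have "j' + b - 1 - (b - 1) = j'" "l + tx - (b - 1) = l2" by (simp_all add: l2_def)
        ultimately show ?thesis using join_run(2)[OF v gap that] by simp
      qed
      have pg': "per ?g" using validD(1)[OF v'] .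
      have r2: "run ?g b l2" using state_inv[OF j] j run_cg[OF pg'] by blast
      have r2': "run g (b - 1) l2" using state_inv[OF j] run_cg[OF p] by blast
      have l2: "l + b \<le> l2"
      proof (rule ccontr)
        assume "\<not> l + b \<le> l2"
        hence "?g (l + b - 1) = 1" using r2 tx1 unfolding run_def l2_def by auto
        thus False using ge champ_gapR[OF C] by simp
      qed
      define pp where "pp = l2 - l - b"
      define pp' where "pp' = K - tx - 1"
      have l2e: "l + b + pp = l2" by (simp add: pp_def)
      have arith: "0 \<le> pp" "0 \<le> pp'" "b + pp + b + pp' = K" using l2 tx by (auto simp: pp_def pp'_def l2_def)
      \<comment> \<open>Two runs of equal length cannot exhaust an odd number of robots, so at least
        one robot lies between them.\<close>
      have "odd (b + pp + b + pp')" using arith Kodd by simp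
      hence pos: "1 \<le> pp + pp'" using arith by presburger
      have T: "two_champ ?g l b pp b pp'" unfolding two_champ_def l2e
      proof (intro conjI allI impI)
        fix j assume r: "run ?g (min b b) j"
        show "(\<exists>t. 0 \<le> t \<and> t \<le> b - min b b \<and> cg j (l + t)) \<or> (\<exists>t. 0 \<le> t \<and> t \<le> b - min b b \<and> cg j (l2 + t))"
        proof (cases "run g b j")
          case True
          hence "cg j l" using champ_head[OF C] by blast
          thus ?thesis by auto
        next
          case False
          hence "cg j l2" using state_inv r by simp
          thus ?thesis by auto
        qed
      qed (use v' keep r2 arith cb c in auto)
      have "pair_pend l b pp b pp' ?q" unfolding pair_pend_def
      proof (intro allI impI)
        fix i assume i: "?q i \<noteq> 0"
        hence h: "cg i (l + b) \<and> q i = -1 \<or> cg i (l - 1) \<and> q i = 1" "?q i = q i" "\<not> cg i x"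
          using w q'2 unfolding champ_pend_def by auto
        from h(1) show "1 \<le> pp \<and> (cg i (l + b) \<and> ?q i = -1 \<or> cg i (l + b + pp - 1) \<and> ?q i = 1) \<or>
            1 \<le> pp' \<and> (cg i (l + b + pp + b) \<and> ?q i = -1 \<or> cg i (l - 1) \<and> ?q i = 1)"
        proof
          assume a: "cg i (l + b) \<and> q i = -1"
          have "pp \<noteq> 0"
          proof
            assume "pp = 0"
            hence "l2 = l + b" by (simp add: pp_def)
            \<comment> \<open>Without robots between the two runs, the right neighbour of the
              champion would have been in a run of length \<open>c\<close> while its move was
              pending, against \<open>soft\<close>.\<close>
            hence "in_run g c (l + b)" unfolding in_run_def using r2' cb c by (intro exI[of _ l2]) auto
            thus False using S a in_run_cg[OF p] unfolding soft_def by blast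
          qed
          thus ?thesis using a h(2) arith by auto
        next
          assume a: "cg i (l - 1) \<and> q i = 1"
          \<comment> \<open>Otherwise the rogue itself is the left neighbour of the champion, but
            its pending move has just been executed.\<close>
          have "pp' \<noteq> 0"
          proof
            assume "pp' = 0"
            hence "l + tx = l - 1 + K" by (simp add: pp'_def)
            hence "cg x (l - 1)" using tx(3) by (simp only: cg_K)
            thus False using a h(3) cg_trans cg_sym by blast
          qed
          thus ?thesis using a h(2) arith by auto
        qed
      qed
      hence Z: "pair_zone l b pp b pp' ?g ?q" unfolding pair_zone_def using T pq pos by auto
      have z: "ZA a (?g i) (?g j) b1 b2 d \<le> 6 * N" for a i j b1 b2 d using ZA_bd(2)[OF v'] .
      have "N * (pp + pp') \<le> N * N" using arith KN c by (intro mult_left_mono) auto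
      hence "Zm l b pp b pp' ?g ?q \<le> 30 * (N * N) + 12 * N"
        using z[of pp "l+b-1" "l + b + pp - 1" b b "?q (l + b)"] z[of pp' "l + b + pp + b - 1" "l - 1" b b "?q (l-1)"]
        unfolding Zm_def by linarith
      moreover have "40 * (N * N) \<le> Wm l b c \<rho> g q - 1"
      proof -
        have "0 \<le> N * (K - b)" using c by simp
        thus ?thesis using cb assms(2) WA_bd(1)[OF v, of l b q] by (simp add: Wm_def)
      qed
      ultimately have "Zm l b pp b pp' ?g ?q \<le> Wm l b c \<rho> g q - 1" using NN7 N7 by linarith
      thus ?thesis using late_zone_Z[OF Z] by blast
    qed
  qed
qed

section \<open>Views\<close>

lemma per_ext: assumes "per f" "per f'" "\<And>j. j < k \<Longrightarrow> f (int j) = f' (int j)" shows "f j = f' j"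
proof -
  have "0 \<le> j mod K" "j mod K < K" using k3 by simp_all
  hence "f (j mod K) = f' (j mod K)" using assms(3)[of "nat (j mod K)"] by simp
  thus ?thesis using per_cg[OF assms(1) cg_mod, of j] per_cg[OF assms(2) cg_mod, of j] by simp
qed

text \<open>Each maximum is attained by one of two readings. The four combinations give a rotation
  or a reflection carrying one robot to the other.\<close>

lemma view_cases: assumes p: "per g" and e: "view g r = view g r'"
  shows "(\<forall>j. g (r + j) = g (r' + j)) \<or> (\<forall>j. g (r + j) = g (r' - 1 - j))"
proof -
  let ?L = "\<lambda>r. map (\<lambda>j. g (r + int j)) [0..<k]" let ?M = "\<lambda>r. map (\<lambda>j. g (r - 1 - int j)) [0..<k]"
  have p1: "per (\<lambda>j. g (a + j))" for a unfolding per_def by (metis add.assoc p per_def)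
  have p2: "per (\<lambda>j. g (a - 1 - j))" for a unfolding per_def
    using per_shift[OF p] by (simp add: diff_diff_add[symmetric])
  have LL: "g (a + j) = g (a' + j)" if "?L a = ?L a'" for a a' j
    by (rule per_ext[OF p1 p1]) (use that in auto)
  have LM: "g (a + j) = g (a' - 1 - j)" if "?L a = ?M a'" for a a' j
    by (rule per_ext[OF p1 p2]) (use that in auto)
  have MM: "g (a - 1 - j) = g (a' - 1 - j)" if "?M a = ?M a'" for a a' j
    by (rule per_ext[OF p2 p2]) (use that in auto)
  have "?L r = ?L r' \<or> ?L r = ?M r' \<or> ?M r = ?L r' \<or> ?M r = ?M r'"
    using e unfolding view_def max_def by metis
  thus ?thesis
  proof (elim disjE)
    assume h: "?L r = ?L r'" show ?thesis using LL[OF h] by blast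
  next
    assume h: "?L r = ?M r'" show ?thesis using LM[OF h] by blast
  next
    assume h: "?M r = ?L r'"
    have "g (r + j) = g (r' - 1 - j)" for j
      using LM[OF h[symmetric], of "-1-j"] by (simp add: algebra_simps)
    thus ?thesis by blast
  next
    assume h: "?M r = ?M r'"
    have "g (r + j) = g (r' + j)" for j
      using MM[OF h, of "-1-j"] by (simp add: algebra_simps)
    thus ?thesis by blast
  qed
qed

lemma view_rot: assumes "\<And>j. g (r + j) = g (r' + j)" shows "view g r = view g r'"
proof -
  have "g (r - 1 - int j) = g (r' - 1 - int j)" for j using assms[of "-1 - int j"] by (simp add: algebra_simps)
  thus ?thesis using assms by (simp add: view_def)
qed
lemma view_refl: assumes "\<And>j. g (r + j) = g (r' - 1 - j)" shows "view g r = view g r'"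
proof -
  have "g (r - 1 - int j) = g (r' + int j)" for j using assms[of "-1 - int j"] by (simp add: algebra_simps)
  thus ?thesis using assms by (simp add: view_def max.commute)
qed
lemma view_cg: assumes "per g" "cg r r'" shows "view g r = view g r'"
  by (rule view_rot) (use per_cg[OF assms(1)] assms(2) in simp)

lemma iso_vw: assumes "per g" "view g r = view g r'" "iso g r" shows "iso g r'"
proof -
  have m: "r + (-1) = r - 1" "r' + (-1) = r' - 1" "r' - 1 - 0 = r' - 1" "r' - 1 - (-1) = r'" by simp_all
  from view_cases[OF assms(1,2)] show ?thesis
  proof
    assume h: "\<forall>j. g (r + j) = g (r' + j)"
    show ?thesis using h[rule_format, of 0] h[rule_format, of "-1"] assms(3) by (simp add: iso_def)
  next
    assume h: "\<forall>j. g (r + j) = g (r' - 1 - j)"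
    show ?thesis using h[rule_format, of 0] h[rule_format, of "-1"] assms(3) by (simp add: iso_def)
  qed
qed

section \<open>Two champions\<close>

text \<open>Exchanging the names of the runs, together with reflection, reduces the four possible
  moves at the ends of the two arcs to one: a left move into the first run.\<close>

lemma two_champ_swap: assumes "two_champ g l1 b1 p b2 p'" shows "two_champ g (l1 + b1 + p) b2 p' b1 p"
proof -
  note T = assms[unfolded two_champ_def]
  have e: "l1 + b1 + p + b2 + p' = l1 + K" using T by linarith
  have p: "per g" using T validD by auto
  have c: "cg (l1 + K) l1" by (simp only: cg_K cg_refl)
  have c': "cg j (l1 + K + t) \<longleftrightarrow> cg j (l1 + t)" for j t
  proof -
    have "l1 + K + t = l1 + t + K" by simp
    thus ?thesis by (simp only: cg_K)
  qed
  show ?thesis unfolding two_champ_def e c' min.commute[of b2 b1] using T run_cg[OF p c] by auto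
qed

lemma two_champ_mod: "cg i (l1 + K + t) \<longleftrightarrow> cg i (l1 + t)"
proof -
  have "l1 + K + t = l1 + t + K" by simp
  thus ?thesis by (simp only: cg_K)
qed

lemma pair_pend_swap: assumes "b1 + p + b2 + p' = K" "pair_pend l1 b1 p b2 p' q" shows "pair_pend (l1 + b1 + p) b2 p' b1 p q"
proof -
  have e: "l1 + b1 + p + b2 + p' = l1 + K" "l1 + K - 1 = l1 + K + (-1)" using assms(1) by linarith+
  show ?thesis using assms(2) unfolding pair_pend_def e(1) unfolding e(2) two_champ_mod by auto
qed

lemma two_champ_cross: assumes "b1 + p + b2 + p' = K"
  shows "cg (- (l1 + b1 - 1) + b1 + p' + t) (- (l1 + b1 + p + b2 - 1) + t)"
proof -
  have "- (l1 + b1 - 1) + b1 + p' + t = - (l1 + b1 + p + b2 - 1) + t + K" using assms by linarith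
  thus ?thesis by (simp only: cg_K cg_refl)
qed

lemma two_champ_rf: assumes "two_champ g l1 b1 p b2 p'" shows "two_champ (rf g) (- (l1 + b1 - 1)) b1 p' b2 p"
proof -
  note T = assms[unfolded two_champ_def]
  have p: "per g" using T validD by auto
  let ?m = "min b1 b2"
  have s: "b1 + p + b2 + p' = K" using T by simp
  have c0: "cg (- (l1 + b1 - 1) + b1 + p') (- (l1 + b1 + p + b2 - 1))" using two_champ_cross[OF s, of l1 0] by simp
  have r2: "run (rf g) b2 (- (l1 + b1 - 1) + b1 + p')"
  proof -
    have e: "- (- (l1 + b1 + p + b2 - 1) + b2 - 1) = l1 + b1 + p" by simp
    show ?thesis unfolding run_cg[OF per_rf[OF p] c0] unfolding run_rf e using T by blast
  qed
  have r1: "run (rf g) b1 (- (l1 + b1 - 1))" unfolding run_rf using T by simp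
  have rr: "(\<exists>t. 0 \<le> t \<and> t \<le> b1 - ?m \<and> cg j (- (l1 + b1 - 1) + t)) \<or>
        (\<exists>t. 0 \<le> t \<and> t \<le> b2 - ?m \<and> cg j (- (l1 + b1 - 1) + b1 + p' + t))" if r: "run (rf g) ?m j" for j
  proof -
    have A: "\<exists>t. 0 \<le> t \<and> t \<le> b - ?m \<and> cg j (- (l + b - 1) + t)"
      if t: "0 \<le> t" "t \<le> b - ?m" "cg (- (j + ?m - 1)) (l + t)" for l b t
    proof -
      have "cg (- (j + ?m - 1)) (- (- (l + t)))" using t by (simp only: minus_minus)
      hence "cg (j + (?m - 1)) (- (l + t))" by (simp only: cg_neg add_diff_eq)
      hence "cg j (- (l + t) - (?m - 1))" using cg_move by blast
      moreover have "- (l + t) - (?m - 1) = - (l + b - 1) + (b - ?m - t)" by simp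
      ultimately have "cg j (- (l + b - 1) + (b - ?m - t))" by metis
      thus ?thesis using t by (intro exI[of _ "b - ?m - t"]) auto
    qed
    have "run g ?m (- (j + ?m - 1))" using r run_rf by simp
    hence "(\<exists>t. 0 \<le> t \<and> t \<le> b1 - ?m \<and> cg (- (j + ?m - 1)) (l1 + t)) \<or>
        (\<exists>t. 0 \<le> t \<and> t \<le> b2 - ?m \<and> cg (- (j + ?m - 1)) (l1 + b1 + p + t))" using T by blast
    thus ?thesis
    proof
      assume "\<exists>t. 0 \<le> t \<and> t \<le> b1 - ?m \<and> cg (- (j + ?m - 1)) (l1 + t)"
      thus ?thesis using A by blast
    next
      assume "\<exists>t. 0 \<le> t \<and> t \<le> b2 - ?m \<and> cg (- (j + ?m - 1)) (l1 + b1 + p + t)"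
      then obtain t where t: "0 \<le> t" "t \<le> b2 - ?m" "cg j (- (l1 + b1 + p + b2 - 1) + t)" using A by blast
      hence "cg j (- (l1 + b1 - 1) + b1 + p' + t)" using two_champ_cross[OF s, of l1 t] cg_trans cg_sym by blast
      thus ?thesis using t by blast
    qed
  qed
  show ?thesis unfolding two_champ_def using T r1 r2 rr valid_rf by auto
qed

lemma pair_pend_rf: assumes s: "b1 + p + b2 + p' = K" and "pair_pend l1 b1 p b2 p' q"
  shows "pair_pend (- (l1 + b1 - 1)) b1 p' b2 p (rq q)"
  unfolding pair_pend_def
proof (intro allI impI)
  fix i assume "rq q i \<noteq> 0"
  hence h: "1 \<le> p \<and> (cg (- i) (l1 + b1) \<and> q (- i) = -1 \<or> cg (- i) (l1 + b1 + p - 1) \<and> q (- i) = 1) \<or>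
     1 \<le> p' \<and> (cg (- i) (l1 + b1 + p + b2) \<and> q (- i) = -1 \<or> cg (- i) (l1 - 1) \<and> q (- i) = 1)"
    using assms(2) unfolding pair_pend_def rq_def by auto
  have cn: "cg i (- j) \<longleftrightarrow> cg (- i) j" for j using cg_neg[of i "-j"] by simp
  have "cg i (- (l1 + b1 - 1) + b1 + p' - 1) = cg i (- (l1 + b1 + p + b2))"
  proof -
    have "- (l1 + b1 - 1) + b1 + p' - 1 = - (l1 + b1 + p + b2) + K" using s by linarith
    thus ?thesis by (simp only: cg_K)
  qed
  moreover have "cg i (- (l1 + b1 - 1) + b1 + p' + b2) = cg i (- (l1 + b1 + p - 1))"
  proof -
    have "- (l1 + b1 - 1) + b1 + p' + b2 = - (l1 + b1 + p - 1) + K" using s by linarith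
    thus ?thesis by (simp only: cg_K)
  qed
  moreover have "- (l1 + b1 - 1) + b1 = - (l1 - 1)" "- (l1 + b1 - 1) - 1 = - (l1 + b1)" by simp_all
  moreover note E = calculation
  have r: "rq q i = -1 \<longleftrightarrow> q (- i) = 1" "rq q i = 1 \<longleftrightarrow> q (- i) = -1" by (auto simp: rq_def)
  show "1 \<le> p' \<and> (cg i (- (l1 + b1 - 1) + b1) \<and> rq q i = - 1 \<or> cg i (- (l1 + b1 - 1) + b1 + p' - 1) \<and> rq q i = 1) \<or>
       1 \<le> p \<and> (cg i (- (l1 + b1 - 1) + b1 + p' + b2) \<and> rq q i = - 1 \<or> cg i (- (l1 + b1 - 1) - 1) \<and> rq q i = 1)"
    unfolding E(1,2) unfolding E cn r using h by blast
qed

lemma ZA_sym: "ZA p v u b2 b1 (- d) = ZA p u v b1 b2 d" by (auto simp: ZA_def sA_sym)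

lemma pair_zone_swap: assumes "pair_zone l1 b1 p b2 p' g q" shows "pair_zone (l1 + b1 + p) b2 p' b1 p g q"
    "Zm (l1 + b1 + p) b2 p' b1 p g q = Zm l1 b1 p b2 p' g q"
proof -
  note Z = assms[unfolded pair_zone_def]
  have s: "b1 + p + b2 + p' = K" using Z by (simp add: two_champ_def)
  show "pair_zone (l1 + b1 + p) b2 p' b1 p g q" unfolding pair_zone_def using Z two_champ_swap pair_pend_swap[OF s] by auto
  have pg: "per g" and pq: "per q" using Z by (auto simp: two_champ_def validD)
  have e1: "l1 + b1 + p + b2 + p' = l1 + K" using s by linarith
  have e2: "g (l1 + b1 + p + b2 + p' - 1) = g (l1 - 1)" "g (l1 + b1 + p + b2 + p' + b1 - 1) = g (l1 + b1 - 1)"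
    unfolding e1 using pg[unfolded per_def, rule_format, of "l1 - 1"] pg[unfolded per_def, rule_format, of "l1 + b1 - 1"]
    by (simp_all add: algebra_simps)
  \<comment> \<open>A pending move enters \<open>ZA\<close> only for an arc of one robot, and then
    both ends of the arc are that robot modulo \<open>k\<close>.\<close>
  have e3: "ZA p' u v b2 b1 (q (l1 + b1 + p + b2)) = ZA p' u v b2 b1 (q (l1 - 1))" for u v
  proof (cases "p' = 1")
    case True
    have "l1 + b1 + p + b2 = l1 - 1 + K" using e1 True by simp
    hence "q (l1 + b1 + p + b2) = q (l1 - 1)" using pq[unfolded per_def, rule_format, of "l1 - 1"] by metis
    thus ?thesis by simp
  qed (simp add: ZA_def)
  have e4: "ZA p u v b1 b2 (q (l1 + b1 + p - 1)) = ZA p u v b1 b2 (q (l1 + b1))" for u v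
    by (cases "p = 1") (simp_all add: ZA_def)
  show "Zm (l1 + b1 + p) b2 p' b1 p g q = Zm l1 b1 p b2 p' g q"
    unfolding Zm_def e2 e3 e4 by (simp add: add.commute)
qed

lemma pair_zone_rf: assumes "pair_zone l1 b1 p b2 p' g q" shows "pair_zone (- (l1 + b1 - 1)) b1 p' b2 p (rf g) (rq q)"
    "Zm (- (l1 + b1 - 1)) b1 p' b2 p (rf g) (rq q) = Zm l1 b1 p b2 p' g q"
proof -
  note Z = assms[unfolded pair_zone_def]
  have s: "b1 + p + b2 + p' = K" using Z by (simp add: two_champ_def)
  show "pair_zone (- (l1 + b1 - 1)) b1 p' b2 p (rf g) (rq q)" unfolding pair_zone_def
    using Z two_champ_rf pair_pend_rf[OF s] per_rq by auto
  have pg: "per g" and pq: "per q" using Z by (auto simp: two_champ_def validD)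
  have e1: "- (l1 - 1) - 1 = - l1" "- (l1 + b1 - 1) + b1 = - (l1 - 1)" "- (l1 + b1 - 1) - 1 = - (l1 + b1)" by simp_all
  have e2: "rf g (- (l1 + b1 - 1) + b1 + p' - 1) = g (l1 + b1 + p + b2 - 1)"
  proof -
    have "-1 - (- (l1 + b1 - 1) + b1 + p' - 1) = l1 + b1 + p + b2 - 1 - K" using s by linarith
    thus ?thesis unfolding rf_def using per_shift[OF pg] by metis
  qed
  have e3: "rf g (- (l1 + b1 - 1) + b1 + p' + b2 - 1) = g (l1 + b1 + p - 1)"
  proof -
    have "-1 - (- (l1 + b1 - 1) + b1 + p' + b2 - 1) = l1 + b1 + p - 1 - K" using s by linarith
    thus ?thesis unfolding rf_def using per_shift[OF pg] by metis
  qed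
  have e4: "rq q (- i) = - q i" for i by (simp add: rq_def)
  show "Zm (- (l1 + b1 - 1)) b1 p' b2 p (rf g) (rq q) = Zm l1 b1 p b2 p' g q"
    unfolding Zm_def e2 e3 unfolding e1 unfolding rf_minus e4 unfolding ZA_sym
    by (simp only: add.commute add.left_commute)
qed

text \<open>Otherwise the first run could be extended by one robot, and its last window of length
  \<open>min b1 b2\<close> would start at an index that belongs to neither run's list of admissible
  starts.\<close>

lemma two_champ_gap: assumes "two_champ g l1 b1 p b2 p'" shows "2 \<le> g (l1 + b1 - 1)"
proof (rule ccontr)
  note T = assms[unfolded two_champ_def]
  let ?m = "min b1 b2"
  assume "\<not> 2 \<le> g (l1 + b1 - 1)"
  moreover have "1 \<le> g (l1 + b1 - 1)" using T validD by auto
  ultimately have "run g (b1 + 1) l1" using run_snoc T by simp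
  hence "run g ?m (l1 + b1 - ?m + 1)" by (rule run_mono) auto
  hence "(\<exists>t. 0 \<le> t \<and> t \<le> b1 - ?m \<and> cg (l1 + b1 - ?m + 1) (l1 + t)) \<or>
        (\<exists>t. 0 \<le> t \<and> t \<le> b2 - ?m \<and> cg (l1 + b1 - ?m + 1) (l1 + b1 + p + t))" using T by blast
  moreover have m: "1 \<le> ?m" "?m \<le> b1" "?m \<le> b2" "0 \<le> p" "b1 + p + b2 \<le> K" "2 \<le> b1" "2 \<le> b2" using T by auto
  ultimately show False
  proof (elim disjE exE conjE)
    fix t assume t: "0 \<le> t" "t \<le> b1 - ?m" "cg (l1 + b1 - ?m + 1) (l1 + t)"
    show False using ncg(2)[of "l1 + t" "l1 + b1 - ?m + 1"] t m by linarith
  next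
    fix t assume t: "0 \<le> t" "t \<le> b2 - ?m" "cg (l1 + b1 - ?m + 1) (l1 + b1 + p + t)"
    show False using ncg(1)[of "l1 + b1 - ?m + 1" "l1 + b1 + p + t"] t m by linarith
  qed
qed
lemma two_champ_gaps: assumes "two_champ g l1 b1 p b2 p'"
  shows "2 \<le> g (l1 + b1 - 1)" "2 \<le> g (l1 - 1)" "2 \<le> g (l1 + b1 + p + b2 - 1)" "2 \<le> g (l1 + b1 + p - 1)"
proof -
  have r: "2 \<le> g (l1 - 1)" if "two_champ g l1 b1 p b2 p'" for l1 b1 p b2 p'
    using two_champ_gap[OF two_champ_rf[OF that]] by (simp add: rf_def)
  show "2 \<le> g (l1 + b1 - 1)" "2 \<le> g (l1 - 1)" "2 \<le> g (l1 + b1 + p + b2 - 1)" "2 \<le> g (l1 + b1 + p - 1)"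
    using two_champ_gap[OF assms] r[OF assms] two_champ_gap[OF two_champ_swap[OF assms]] r[OF two_champ_swap[OF assms]] by auto
qed

text \<open>A run of \<open>b1 + 1\<close> robots contains two consecutive windows of length
  \<open>b1\<close>. Neither can start at the first run, so both start inside the longer one, and
  the first of them is not the last admissible window.\<close>

lemma two_champ_run: assumes "two_champ g l1 b1 p b2 p'" "b1 < b2" "run g (b1 + 1) j"
  shows "\<exists>t. 0 \<le> t \<and> t \<le> b2 - b1 - 1 \<and> cg j (l1 + b1 + p + t)"
proof -
  note T = assms(1)[unfolded two_champ_def]
  have pg: "per g" using T validD by auto
  have m: "min b1 b2 = b1" using assms by simp
  have r1: "run g b1 j" using run_mono[OF assms(3), of j] by simp
  have r2: "run g b1 (j + 1)" using run_mono[OF assms(3), of "j+1"] by simp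
  have A: "(\<exists>t. 0 \<le> t \<and> t \<le> b1 - b1 \<and> cg j (l1 + t)) \<or> (\<exists>t. 0 \<le> t \<and> t \<le> b2 - b1 \<and> cg j (l1 + b1 + p + t))"
    if "run g b1 j" for j using T that unfolding m by blast
  have "\<not> cg j l1"
  proof
    assume "cg j l1"
    hence "run g (b1 + 1) l1" using run_cg[OF pg] assms(3) by blast
    hence "g (l1 + b1 - 1) = 1" using T unfolding run_def by auto
    thus False using two_champ_gap[OF assms(1)] by simp
  qed
  then obtain t where t: "0 \<le> t" "t \<le> b2 - b1" "cg j (l1 + b1 + p + t)" using A[OF r1] by auto
  have "t \<noteq> b2 - b1"
  proof
    assume tt: "t = b2 - b1"
    have j1: "cg (j + 1) (l1 + p + b2 + 1)" using t(3) cg_add[of j 1 "l1 + b1 + p + t"] tt by (simp add: algebra_simps)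
    from A[OF r2] show False
    proof (elim disjE exE conjE)
      fix u assume u: "0 \<le> u" "u \<le> b1 - b1" "cg (j + 1) (l1 + u)"
      hence "cg (l1 + p + b2 + 1) l1" using j1 cg_trans cg_sym by (metis add.right_neutral antisym diff_self)
      thus False using ncg(2)[of l1 "l1 + p + b2 + 1"] T by auto
    next
      fix u assume u: "0 \<le> u" "u \<le> b2 - b1" "cg (j + 1) (l1 + b1 + p + u)"
      hence "cg (l1 + p + b2 + 1) (l1 + b1 + p + u)" using j1 cg_trans cg_sym by blast
      thus False using ncg(2)[of "l1 + b1 + p + u" "l1 + p + b2 + 1"] u T by auto
    qed
  qed
  thus ?thesis using t by (intro exI[of _ t]) auto
qed

lemma two_champ_champ: assumes "two_champ g l1 b1 p b2 p'" "b1 < b2" shows "champ g (l1 + b1 + p) b2 b1"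
  using assms two_champ_run[OF assms] unfolding champ_def two_champ_def by auto

lemma two_champ_inr: assumes "two_champ g l1 b1 p b2 p'" "in_run g (min b1 b2) r"
  shows "(\<exists>t. 0 \<le> t \<and> t < b1 \<and> cg r (l1 + t)) \<or> (\<exists>t. 0 \<le> t \<and> t < b2 \<and> cg r (l1 + b1 + p + t))"
proof -
  let ?m = "min b1 b2"
  obtain j where j: "j \<le> r" "r < j + ?m" "run g ?m j" using assms(2) by (auto simp: in_run_def)
  have sft: "cg r (l + (t + (r - j)))" if "cg j (l + t)" for l t
  proof -
    have "cg (j + (r - j)) (l + t + (r - j))" using that by (simp only: cg_add)
    thus ?thesis by (simp add: algebra_simps)
  qed
  have "(\<exists>t. 0 \<le> t \<and> t \<le> b1 - ?m \<and> cg j (l1 + t)) \<or> (\<exists>t. 0 \<le> t \<and> t \<le> b2 - ?m \<and> cg j (l1 + b1 + p + t))"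
    using assms(1) j(3) unfolding two_champ_def by blast
  thus ?thesis
  proof (elim disjE exE conjE)
    fix t assume t: "0 \<le> t" "t \<le> b1 - ?m" "cg j (l1 + t)"
    show ?thesis using sft[OF t(3)] t j by (intro disjI1 exI[of _ "t + (r - j)"]) auto
  next
    fix t assume t: "0 \<le> t" "t \<le> b2 - ?m" "cg j (l1 + b1 + p + t)"
    show ?thesis using sft[OF t(3)] t j by (intro disjI2 exI[of _ "t + (r - j)"]) auto
  qed
qed
lemma two_champ_out: assumes "two_champ g l1 b1 p b2 p'" "l1 + b1 \<le> r" "r < l1 + b1 + p" shows "\<not> in_run g (min b1 b2) r"
proof
  assume "in_run g (min b1 b2) r"
  from two_champ_inr[OF assms(1) this] show False
  proof (elim disjE exE conjE)
    fix t assume t: "0 \<le> t" "t < b1" "cg r (l1 + t)"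
    show False using ncg(2)[of "l1 + t" r] t assms unfolding two_champ_def by auto
  next
    fix t assume t: "0 \<le> t" "t < b2" "cg r (l1 + b1 + p + t)"
    show False using ncg(1)[of r "l1 + b1 + p + t"] t assms unfolding two_champ_def by auto
  qed
qed

lemma pair_zone_move_L: assumes "pair_zone l1 b1 p b2 p' g q" "1 \<le> p" "q (l1 + b1) = -1"
  shows "2 \<le> g (l1 + b1 - 1)" "late_zone (Zm l1 b1 p b2 p' g q - 1) (upd g (l1 + b1) (-1)) (setq q (l1 + b1) 0)"
proof -
  note Z = assms(1)[unfolded pair_zone_def]
  have T: "two_champ g l1 b1 p b2 p'" using Z by simp
  note T' = T[unfolded two_champ_def]
  let ?i = "l1 + b1" let ?l2 = "l1 + b1 + p"
  let ?g = "upd g ?i (-1)" let ?q = "setq q ?i 0"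
  have v: "valid g" using T' by simp
  have pg: "per g" and pq: "per q" using Z v validD by auto
  show gap: "2 \<le> g (l1 + b1 - 1)" using two_champ_gap[OF T] .
  have bs: "2 \<le> b1" "2 \<le> b2" "0 \<le> p" "0 \<le> p'" "b1 + p + b2 + p' = K" using T' by auto
  have v': "valid ?g" using valid_upd[OF v] gap by simp
  have keep1: "run ?g b1 l1"
  proof (rule run_keep[OF v])
    fix t assume "l1 \<le> t" "t < l1 + b1 - 1" thus "\<not> cg t ?i" using ncg(1)[of t ?i] bs by simp
  qed (use gap T' in auto)
  have keep2: "run ?g b2 ?l2"
  proof (rule run_keep[OF v])
    fix t assume "?l2 \<le> t" "t < ?l2 + b2 - 1" thus "\<not> cg t ?i" using ncg(2)[of ?i t] bs assms(2) by simp
  qed (use gap T' in auto)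
  have g1: "?g (?i - 1) = g (?i - 1) - 1" using upd_at[OF pg, of "?i-1" ?i "-1"] by simp
  have g2: "?g ?i = g ?i + 1" using upd_at2[OF pg, of "?i" ?i "-1"] by simp
  have g3: "?g (l1 + b1 + p - 1) = (if p = 1 then g (l1 + b1 + p - 1) + 1 else g (l1 + b1 + p - 1))"
  proof (cases "p = 1")
    case True thus ?thesis using g2 by simp
  next
    case False
    hence "\<not> cg (l1 + b1 + p - 1) ?i" "\<not> cg (l1 + b1 + p - 1) (?i - 1)"
      using ncg(2)[of ?i "l1 + b1 + p - 1"] ncg(2)[of "?i - 1" "l1 + b1 + p - 1"] assms(2) bs by auto
    thus ?thesis using upd_other False by simp
  qed
  have g4: "?g (l1 + b1 + p + b2 - 1) = g (l1 + b1 + p + b2 - 1)"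
    using ncg(2)[of ?i "l1 + b1 + p + b2 - 1"] ncg(2)[of "?i - 1" "l1 + b1 + p + b2 - 1"] bs by (intro upd_other) auto
  have g5: "?g (l1 - 1) = g (l1 - 1)"
    using ncg(1)[of "l1 - 1" ?i] ncg(1)[of "l1 - 1" "?i - 1"] bs assms(2) by (intro upd_other) auto
  have q'2: "?q j = q j \<and> \<not> cg j ?i" if "?q j \<noteq> 0" for j using that by (auto simp: setq_def split: if_splits)
  have qi: "?q ?i = 0" by (simp add: setq_def)
  have q5: "?q (l1 - 1) = q (l1 - 1)" using ncg(1)[of "l1 - 1" ?i] bs assms(2) by (simp add: setq_def)
  have pq': "per ?q" using pq per_setq by auto
  show "late_zone (Zm l1 b1 p b2 p' g q - 1) ?g ?q"
  proof (cases "3 \<le> g (l1 + b1 - 1)")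
    case True
    have ar: "run ?g s j \<Longrightarrow> run g s j" for s j using approach_run[OF v, of ?i] True by simp
    have "two_champ ?g l1 b1 p b2 p'" unfolding two_champ_def using v' bs keep1 keep2 T' ar by blast
    moreover have "pair_pend l1 b1 p b2 p' ?q" using Z q'2 unfolding pair_pend_def by metis
    ultimately have Z': "pair_zone l1 b1 p b2 p' ?g ?q" using Z pq' unfolding pair_zone_def by auto
    have "ZA p (?g (?i - 1)) (?g (l1 + b1 + p - 1)) b1 b2 (?q ?i) \<le> ZA p (g (?i - 1)) (g (l1 + b1 + p - 1)) b1 b2 (q ?i) - 1"
      unfolding g1 g3 qi using assms(2,3) by (auto simp: ZA_def sA_def min_def)
    hence "Zm l1 b1 p b2 p' ?g ?q \<le> Zm l1 b1 p b2 p' g q - 1" unfolding Zm_def g4 g5 q5 by simp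
    thus ?thesis using late_zone_Z[OF Z'] by blast
  next
    case False
    hence gg: "g (?i - 1) = 2" using gap by simp
    have k1: "run ?g (b1 + 1) l1" using run_snoc[OF keep1] g1 gg by simp
    have e: "l1 + (b1 + 1) + (p - 1) = ?l2" by simp
    have T1: "two_champ ?g l1 (b1 + 1) (p - 1) b2 p'" unfolding two_champ_def e
    proof (intro conjI allI impI)
      let ?m = "min (b1 + 1) b2"
      fix j assume r: "run ?g ?m j"
      show "(\<exists>t. 0 \<le> t \<and> t \<le> b1 + 1 - ?m \<and> cg j (l1 + t)) \<or> (\<exists>t. 0 \<le> t \<and> t \<le> b2 - ?m \<and> cg j (?l2 + t))"
      proof (cases "run g ?m j")
        case r: True
        show ?thesis
        proof (cases "b1 < b2")
          case True
          hence m: "?m = b1 + 1" by simp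
          have "b2 - (b1 + 1) = b2 - b1 - 1" by simp
          thus ?thesis using two_champ_run[OF T True] r unfolding m by metis
        next
          case False
          hence m: "?m = b2" "min b1 b2 = b2" by auto
          have "(\<exists>t. 0 \<le> t \<and> t \<le> b1 - b2 \<and> cg j (l1 + t)) \<or> (\<exists>t. 0 \<le> t \<and> t \<le> b2 - b2 \<and> cg j (?l2 + t))"
            using T' r unfolding m by blast
          thus ?thesis unfolding m by (auto intro: exI)
        qed
      next
        case False
        have "cg (j + (?m - 1)) ?i" using join_run(1)[OF v _ r False] gap by (simp add: add_diff_eq)
        hence "cg j (l1 + (b1 + 1 - ?m))" using cg_move[of j "?m - 1" ?i] by (simp add: algebra_simps)
        thus ?thesis by (intro disjI1 exI[of _ "b1 + 1 - ?m"]) auto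
      qed
    qed (use v' bs k1 keep2 assms(2) in auto)
    have z: "0 \<le> ZA a (g i) (g j) c1 c2 d" for a i j c1 c2 d using ZA_bd(1)[OF v] .
    have z': "ZA a (?g i) (?g j) c1 c2 d \<le> 6 * N" for a i j c1 c2 d using ZA_bd(2)[OF v'] .
    have zold: "10 * (N * N) + 20 * (N * (p + p')) \<le> Zm l1 b1 p b2 p' g q" unfolding Zm_def
      using z[of p "l1 + b1 - 1" "l1 + b1 + p - 1" b1 b2 "q (l1 + b1)"] z[of p' "l1 + b1 + p + b2 - 1" "l1 - 1" b2 b1 "q (l1 - 1)"] by linarith
    show ?thesis
    proof (cases "p + p' = 1")
      case False
      have "pair_pend l1 (b1 + 1) (p - 1) b2 p' ?q" unfolding pair_pend_def e
      proof (intro allI impI)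
        fix j assume j: "?q j \<noteq> 0"
        have qj: "?q j = q j" "\<not> cg j ?i" using q'2[OF j] by auto
        have h: "1 \<le> p \<and> (cg j (l1 + b1) \<and> q j = -1 \<or> cg j (l1 + b1 + p - 1) \<and> q j = 1) \<or>
     1 \<le> p' \<and> (cg j (l1 + b1 + p + b2) \<and> q j = -1 \<or> cg j (l1 - 1) \<and> q j = 1)"
          using Z qj j unfolding pair_pend_def by metis
        have "2 \<le> p" if "cg j (l1 + b1 + p - 1)" using that qj(2) assms(2) by (cases "p = 1") auto
        thus "1 \<le> p - 1 \<and> (cg j (l1 + (b1 + 1)) \<and> ?q j = - 1 \<or> cg j (?l2 - 1) \<and> ?q j = 1) \<or>
          1 \<le> p' \<and> (cg j (?l2 + b2) \<and> ?q j = - 1 \<or> cg j (l1 - 1) \<and> ?q j = 1)"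
          using h qj by auto
      qed
      hence Z': "pair_zone l1 (b1 + 1) (p - 1) b2 p' ?g ?q" unfolding pair_zone_def using T1 pq' False assms(2) bs by auto
      \<comment> \<open>One robot fewer between the runs releases \<open>20 * N\<close>, while the
        two new \<open>ZA\<close> terms are at most \<open>12 * N\<close>.\<close>
      have "20 * (N * (p - 1 + p')) = 20 * (N * (p + p')) - 20 * N" by (simp add: algebra_simps)
      hence "Zm l1 (b1 + 1) (p - 1) b2 p' ?g ?q \<le> Zm l1 b1 p b2 p' g q - 1"
        unfolding Zm_def[of l1 "b1 + 1"] e
        using zold z'[of "p - 1" "l1 + (b1 + 1) - 1" "?l2 - 1" "b1 + 1" b2 "?q (l1 + (b1 + 1))"]
          z'[of p' "?l2 + b2 - 1" "l1 - 1" b2 "b1 + 1" "?q (l1 - 1)"] N7 by linarith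
      thus ?thesis using late_zone_Z[OF Z'] by blast
    next
      case True
      hence pp: "p = 1" "p' = 0" using assms(2) bs by auto
      have q0: "?q j = 0" for j
      proof (rule ccontr)
        assume j: "?q j \<noteq> 0"
        have "q j \<noteq> 0" "\<not> cg j ?i" using q'2[OF j] j by auto
        thus False using Z unfolding pair_pend_def pp by auto
      qed
      have fin: ?thesis if "champ ?g l b c" for l b c
      proof -
        have champ_zone': "champ_zone l b c False 0 0 ?g ?q" unfolding champ_zone_def champ_pend_def using that q0 pq' by auto
        have "N * (K - b) \<le> N * N" using KN that by (intro mult_left_mono) (auto simp: champ_def)
        hence "Wm l b c False ?g ?q \<le> 6 * (N * N) + 6 * N" unfolding Wm_def using WA_bd(2)[OF v', of l b ?q] by simp
        moreover have "N * 1 = N * (p + p')" using True by simp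
        ultimately have "Wm l b c False ?g ?q \<le> Zm l1 b1 p b2 p' g q - 1" using zold NN7 N7 by linarith
        thus ?thesis using late_zone_W[OF champ_zone'] by blast
      qed
      \<comment> \<open>The two runs now contain all robots, and \<open>k\<close> is odd. Their
        lengths differ, so the longer one is a champion without pending moves.\<close>
      have "b1 + 1 \<noteq> b2"
      proof
        assume "b1 + 1 = b2"
        hence "K = 2 * b2" using bs pp by simp
        thus False using Kodd by simp
      qed
      thus ?thesis using fin two_champ_champ[OF T1] two_champ_champ[OF two_champ_swap[OF T1]] by (metis linorder_neqE)
    qed
  qed
qed

lemma in_run_in: "run g b l \<Longrightarrow> 0 \<le> t \<Longrightarrow> t < b \<Longrightarrow> in_run g b (l + t)" unfolding in_run_def by (intro exI[of _ l]) auto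

text \<open>The rule never sends the only robot of an arc to the farther of two equal runs, nor to the shorter run.\<close>

definition arcok :: "int \<Rightarrow> int \<Rightarrow> int \<Rightarrow> int \<Rightarrow> int \<Rightarrow> int \<Rightarrow> bool" where
  "arcok b1 b2 p u v d \<longleftrightarrow> (p = 1 \<longrightarrow> (d = -1 \<longrightarrow> b2 \<le> b1 \<and> (b1 = b2 \<longrightarrow> u \<le> v)) \<and> (d = 1 \<longrightarrow> b1 \<le> b2 \<and> (b1 = b2 \<longrightarrow> v \<le> u)))"
definition zF :: "(int \<Rightarrow> int) \<Rightarrow> int \<Rightarrow> int \<Rightarrow> int \<Rightarrow> int \<Rightarrow> int \<Rightarrow> int \<Rightarrow> int \<Rightarrow> bool" where
  "zF g l1 b1 p b2 p' i d \<longleftrightarrow>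
     1 \<le> p \<and> (cg i (l1 + b1) \<and> d = -1 \<or> cg i (l1 + b1 + p - 1) \<and> d = 1) \<and>
        arcok b1 b2 p (g (l1 + b1 - 1)) (g (l1 + b1 + p - 1)) d \<or>
     1 \<le> p' \<and> (cg i (l1 + b1 + p + b2) \<and> d = -1 \<or> cg i (l1 - 1) \<and> d = 1) \<and>
        arcok b2 b1 p' (g (l1 + b1 + p + b2 - 1)) (g (l1 - 1)) d"

lemma arcok_sym: "arcok b2 b1 p v u (- d) = arcok b1 b2 p u v d" by (auto simp: arcok_def)
lemma arcok_ZA: "arcok b1 b2 p u v d \<Longrightarrow> ZA p u v b1 b2 d \<le> ZA p u v b1 b2 d'"
  by (auto simp: arcok_def ZA_def sA_def)

lemma zF_swap: assumes T: "two_champ g l1 b1 p b2 p'" and "zF g (l1 + b1 + p) b2 p' b1 p i d" shows "zF g l1 b1 p b2 p' i d"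
proof -
  have s: "b1 + p + b2 + p' = K" and pg: "per g" using T by (auto simp: two_champ_def validD)
  have e1: "l1 + b1 + p + b2 + p' - 1 = l1 - 1 + K" "l1 + b1 + p + b2 + p' + b1 = l1 + b1 + K"
    "l1 + b1 + K - 1 = l1 + b1 - 1 + K" using s by linarith+
  have pg': "g (j + K) = g j" for j using pg by (simp add: per_def)
  show ?thesis using assms(2) unfolding zF_def unfolding e1(1,2) unfolding e1(3) cg_K pg' by blast
qed

lemma zF_rf: assumes T: "two_champ g l1 b1 p b2 p'" and "zF (rf g) (- (l1 + b1 - 1)) b1 p' b2 p (- i) (- d)"
  shows "zF g l1 b1 p b2 p' i d"
proof -
  have s: "b1 + p + b2 + p' = K" and pg: "per g" using T by (auto simp: two_champ_def validD)
  have pg': "rf g (j + K) = rf g j" for j using per_rf[OF pg] by (simp add: per_def)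
  have e1: "- (l1 + b1 - 1) + b1 + p' - 1 = - (l1 + b1 + p + b2) + K"
    "- (l1 + b1 - 1) + b1 + p' + b2 = - (l1 + b1 + p - 1) + K"
    "- (l1 + b1 + p - 1) + K - 1 = - (l1 + b1 + p) + K"
    "- (l1 + b1 - 1) + b1 - 1 = - l1" using s by linarith+
  have e2: "- (l1 + b1 - 1) + b1 = - (l1 - 1)" "- (l1 + b1 - 1) - 1 = - (l1 + b1)" by simp_all
  have d: "- d = - 1 \<longleftrightarrow> d = 1" "- d = 1 \<longleftrightarrow> d = - 1" by auto
  show ?thesis using assms(2) unfolding zF_def unfolding e1(1,2,4) unfolding e1(3) e2 unfolding cg_K pg' cg_neg rf_minus arcok_sym d by blast
qed

text \<open>The longer run is a champion, so the rule for a unique longest run applies. If one arc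
  is empty, the neighbour on that side belongs to a run of length \<open>b1\<close> and the other
  neighbour does not; the comparison in \<open>r1\<close> therefore never tears a robot out of the
  shorter run.\<close>

lemma two_champ_lt: assumes T: "two_champ g l1 b1 p b2 p'" and "b1 < b2" "1 \<le> p + p'" "d \<in> F g i"
  shows "zF g l1 b1 p b2 p' i d"
proof -
  have s: "b1 + p + b2 + p' = K" and pg: "per g" and b: "2 \<le> b1" "0 \<le> p" "0 \<le> p'" "run g b1 l1"
    using T by (auto simp: two_champ_def validD)
  have m: "min b1 b2 = b1" using assms by simp
  have e1: "l1 + b1 + p + b2 + p' = l1 + K" using s by linarith
  have pg': "in_run g c (j + K) = in_run g c j" for c j by (rule in_run_cg[OF pg]) simp
  let ?l2 = "l1 + b1 + p"
  have oL: "\<not> in_run g b1 (?l2 - 1)" if "1 \<le> p"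
    using two_champ_out[OF T, of "?l2 - 1"] that m by simp
  have oR: "\<not> in_run g b1 (?l2 + b2)" if "1 \<le> p'"
    using two_champ_out[OF two_champ_swap[OF T], of "?l2 + b2"] that m by (simp add: min.commute)
  have iL: "in_run g b1 (?l2 - 1)" if "p = 0" using in_run_in[OF b(4), of "b1 - 1"] b that by (simp add: add_diff_eq)
  have iR: "in_run g b1 (?l2 + b2)" if "p' = 0"
  proof -
    have "l1 + b1 + p + b2 = l1 + K" using e1 that by simp
    moreover have "in_run g b1 (l1 + K)" using in_run_in[OF b(4), of 0] pg'[of b1 l1] b by simp
    ultimately show ?thesis by metis
  qed
  have "b2 < K" using s b assms by linarith
  from champ_zone_Fside[OF two_champ_champ[OF T assms(2)] this assms(4)] show ?thesis
  proof
    assume h: "d = - 1 \<and> cg i (?l2 + b2) \<and> (\<forall>s. in_run g s (?l2 + b2) \<longrightarrow> in_run g s (?l2 - 1)) \<and> (b2 = K - 1 \<longrightarrow> g (?l2 + b2 - 1) \<le> g (?l2 - 1))"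
    have "1 \<le> p'" using h oL iR assms(3) b by (cases "p' = 0") auto
    thus ?thesis using h assms(2) unfolding zF_def arcok_def by auto
  next
    assume h: "d = 1 \<and> cg i (?l2 - 1) \<and> (\<forall>s. in_run g s (?l2 - 1) \<longrightarrow> in_run g s (?l2 + b2)) \<and> (b2 = K - 1 \<longrightarrow> g (?l2 - 1) \<le> g (?l2 + b2 - 1))"
    have "1 \<le> p" using h oR iL assms(3) b by (cases "p = 0") auto
    thus ?thesis using h assms(2) unfolding zF_def arcok_def by auto
  qed
qed

lemma two_champ_inE: assumes T: "two_champ g l1 b p b p'"
  shows "in_run g b r \<longleftrightarrow> (\<exists>t. 0 \<le> t \<and> t < b \<and> cg r (l1 + t)) \<or> (\<exists>t. 0 \<le> t \<and> t < b \<and> cg r (l1 + b + p + t))"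
proof
  assume "in_run g b r" thus "(\<exists>t. 0 \<le> t \<and> t < b \<and> cg r (l1 + t)) \<or> (\<exists>t. 0 \<le> t \<and> t < b \<and> cg r (l1 + b + p + t))"
    using two_champ_inr[OF T] by simp
next
  have pg: "per g" and r: "run g b l1" "run g b (l1 + b + p)" using T by (auto simp: two_champ_def validD)
  assume "(\<exists>t. 0 \<le> t \<and> t < b \<and> cg r (l1 + t)) \<or> (\<exists>t. 0 \<le> t \<and> t < b \<and> cg r (l1 + b + p + t))"
  thus "in_run g b r" using in_run_in[OF r(1)] in_run_in[OF r(2)] in_run_cg[OF pg] by blast
qed

lemma two_champ_exA: assumes T: "two_champ g l1 b p b p'" "2 \<le> p" shows "exA g b"
proof -
  have r: "run g b l1" "2 \<le> b" using T by (auto simp: two_champ_def)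
  have "sideA g b (l1 + b)" unfolding sideA_def
    using in_run_in[OF r(1), of "b - 1"] r(2) two_champ_out[OF T(1), of "l1 + b"] two_champ_out[OF T(1), of "l1 + b + 1"] T(2)
    by (auto simp: add_diff_eq)
  thus ?thesis by (auto simp: exA_def)
qed

lemma two_champ_step: assumes "0 \<le> t" "t < b" "cg (r - 1) (l + t)" "\<And>t. 0 \<le> t \<Longrightarrow> t < b \<Longrightarrow> \<not> cg r (l + t)"
  shows "cg r (l + b)"
proof -
  have c: "cg r (l + (t + 1))" using assms(3) cg_add[of "r-1" 1 "l+t"] by (simp add: algebra_simps)
  hence "\<not> t + 1 < b" using assms(1) assms(4)[of "t+1"] by auto
  hence "t + 1 = b" using assms by simp
  thus ?thesis using c by simp
qed

lemma two_champ_good: assumes T: "two_champ g l1 b p b p'" and "good g b r"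
  shows "1 \<le> p \<and> cg r (l1 + b) \<or> 1 \<le> p' \<and> cg r (l1 + b + p + b)"
proof -
  have pg: "per g" and s: "b + p + b + p' = K" "0 \<le> p" "0 \<le> p'" "2 \<le> b" using T by (auto simp: two_champ_def validD)
  have h: "in_run g b (r - 1)" "\<not> in_run g b r" using assms(2) by (auto simp: good_def sideA_def sideB_def split: if_splits)
  have n: "\<not> cg r (l1 + t)" "\<not> cg r (l1 + b + p + t)" if "0 \<le> t" "t < b" for t
    using h(2) two_champ_inE[OF T] that by auto
  from h(1) two_champ_inE[OF T] have "cg r (l1 + b) \<or> cg r (l1 + b + p + b)" using two_champ_step n by metis
  thus ?thesis
  proof
    assume a: "cg r (l1 + b)"
    hence "p \<noteq> 0" using n(2)[of 0] s by auto
    thus ?thesis using a s by auto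
  next
    assume a: "cg r (l1 + b + p + b)"
    have "p' \<noteq> 0"
    proof
      assume "p' = 0"
      hence "l1 + b + p + b = l1 + K" using s by simp
      hence "cg r (l1 + 0)" using a by (simp only: cg_K add_0_right)
      thus False using n(1)[of 0] s by auto
    qed
    thus ?thesis using a s by auto
  qed
qed

text \<open>A lone robot has a heavy robot behind it, so \<open>sideA\<close> fails. Without any
  \<open>sideA\<close> the other arc has at most one robot, and by parity none; then the robot
  beyond the target run is heavy and \<open>sideB\<close> fails too.\<close>

lemma two_champ_good1: assumes T: "two_champ g l1 b p b p'" and g: "good g b r" and c: "1 \<le> p" "cg r (l1 + b)"
  shows "2 \<le> p"
proof (rule ccontr)
  have pg: "per g" and s: "b + p + b + p' = K" "0 \<le> p" "0 \<le> p'" "2 \<le> b" using T by (auto simp: two_champ_def validD)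
  assume "\<not> 2 \<le> p"
  hence p1: "p = 1" using c by simp
  have "in_run g b (l1 + b + p)" using T in_run_in[of g b "l1 + b + p" 0] s by (auto simp: two_champ_def)
  moreover have "cg (r + 1) (l1 + b + p)" using c(2) p1 by simp
  ultimately have "in_run g b (r + 1)" using in_run_cg[OF pg] by blast
  hence nA: "\<not> sideA g b r" by (simp add: sideA_def)
  hence nex: "\<not> exA g b" "sideB g b r" using g by (auto simp: good_def split: if_splits)
  have "\<not> 2 \<le> p'" using two_champ_exA[OF two_champ_swap[OF T]] nex by blast
  moreover have "odd (b + p + b + p')" using s Kodd by simp
  ultimately have "p' = 0" using p1 s by presburger
  hence e: "l1 + b + p + (b - 1) = l1 - 1 + K" using s by simp
  have "in_run g b (l1 + b + p + (b - 1))" using T in_run_in[of g b "l1 + b + p" "b - 1"] s by (auto simp: two_champ_def)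
  moreover have "cg (r - b - 1) (l1 + b + p + (b - 1))" unfolding e cg_K using c(2) cg_diff[of r "b+1" "l1+b"] by (simp add: algebra_simps)
  ultimately have "in_run g b (r - b - 1)" using in_run_cg[OF pg] by blast
  thus False using nex by (simp add: sideB_def)
qed

lemma pS_iso: "pS g r \<Longrightarrow> iso g r" by (auto simp: pS_def topc_def cand_def isou_def split: if_splits)

lemma iso_not_inr: assumes "iso g r" "2 \<le> b" shows "\<not> in_run g b r"
proof
  assume "in_run g b r"
  then obtain j where j: "j \<le> r" "r < j + b" "run g b j" by (auto simp: in_run_def)
  hence "g r = 1 \<or> g (r - 1) = 1" using assms(2) unfolding run_def by (cases "r = j") auto
  thus False using assms(1) by (auto simp: iso_def)
qed

text \<open>The lone robot is the only isolated one, hence the only candidate, and its view is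
  unique. The rule sends it to the nearer run.\<close>

lemma two_champ_one: assumes T: "two_champ g l1 b 1 b 0" and r: "\<not> exG g b" "r3 g b r"
  shows "cg r (l1 + b)" "g (r - 1) \<le> g r"
proof -
  have pg: "per g" and s: "b + 1 + b + 0 = K" "2 \<le> b" using T by (auto simp: two_champ_def validD)
  have ii: "iso g (l1 + b)" unfolding iso_def using two_champ_gaps[OF T] by simp
  have io: "cg r (l1 + b)" if "iso g r" for r
  proof -
    have "\<not> in_run g b r" using iso_not_inr[OF that s(2)] .
    hence n: "\<not> cg r (l1 + t)" "\<not> cg r (l1 + b + 1 + t)" if "0 \<le> t" "t < b" for t
      using two_champ_inE[OF T] that by auto
    obtain j where j: "l1 \<le> j" "j < l1 + K" "cg j r" using cg_rep by blast
    have cj: "cg r (l1 + (j - l1))" "cg r (l1 + b + 1 + (j - l1 - b - 1))" using j(3) cg_sym by auto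
    have "\<not> j - l1 < b" using n(1)[of "j - l1"] cj j by auto
    moreover have "j - l1 - b - 1 < 0" using n(2)[of "j - l1 - b - 1"] cj j s by force
    ultimately have "j = l1 + b" by simp
    thus ?thesis using j cg_sym by blast
  qed
  have vi: "view g r = view g (l1 + b)" if "iso g r" for r using view_cg[OF pg io[OF that]] .
  have cc: "cand g (l1 + b)" unfolding cand_def
  proof (intro conjI ii allI impI)
    fix r' assume "iso g r'"
    hence c: "cg r' (l1 + b)" by (rule io)
    hence "cg (r' - 1) (l1 + b - 1)" by simp
    hence "g (r' - 1) = g (l1 + b - 1)" using per_cg[OF pg] by blast
    thus "z1 g (l1 + b) \<le> z1 g r'" unfolding z1_def using per_cg[OF pg c] by simp
  qed
  have tc: "topc g (l1 + b)" unfolding topc_def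
  proof (intro conjI cc allI impI)
    fix r' assume "cand g r'" thus "view g r' \<le> view g (l1 + b)" using vi by (auto simp: cand_def)
  qed
  have un: "uniq g (l1 + b)" unfolding uniq_def
  proof (intro allI impI)
    fix r' assume "view g r' = view g (l1 + b)"
    hence "iso g r'" using iso_vw[OF pg _ ii] by metis
    thus "cg r' (l1 + b)" by (rule io)
  qed
  have "pS g (l1 + b)" unfolding pS_def using tc un by auto
  hence "pS g r \<and> g (r - 1) \<le> g r" using r unfolding r3_def by (auto split: if_splits)
  thus "cg r (l1 + b)" "g (r - 1) \<le> g r" using io pS_iso by blast+
qed

lemma two_champ_mx: assumes T: "two_champ g l1 b p b p'" shows "max_run g b" "\<not> one_head g b"
proof -
  have pg: "per g" and s: "b + p + b + p' = K" "0 \<le> p" "0 \<le> p'" "2 \<le> b" using T by (auto simp: two_champ_def validD)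
  have H: "cg j l1 \<or> cg j (l1 + b + p)" if r: "run g b j" for j
  proof -
    have "(\<exists>t. 0 \<le> t \<and> t \<le> 0 \<and> cg j (l1 + t)) \<or> (\<exists>t. 0 \<le> t \<and> t \<le> 0 \<and> cg j (l1 + b + p + t))"
      using T r unfolding two_champ_def by (metis diff_self min.idem)
    thus ?thesis by auto
  qed
  have "\<not> run g (b + 1) j" for j
  proof
    assume r: "run g (b + 1) j"
    hence g1: "g (j + b - 1) = 1" using s by (auto simp: run_def)
    have "run g b j" using run_mono[OF r, of j] by simp
    from H[OF this] show False
    proof
      assume "cg j l1"
      hence "cg (j + (b - 1)) (l1 + (b - 1))" by simp
      hence "g (j + (b - 1)) = g (l1 + (b - 1))" using per_cg[OF pg] by blast
      thus False using g1 two_champ_gaps(1)[OF T] by (simp add: add_diff_eq)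
    next
      assume "cg j (l1 + b + p)"
      hence "cg (j + (b - 1)) (l1 + b + p + (b - 1))" by (simp only: cg_add)
      hence "g (j + (b - 1)) = g (l1 + b + p + (b - 1))" using per_cg[OF pg] by blast
      thus False using g1 two_champ_gaps(3)[OF T] by (simp add: add_diff_eq)
    qed
  qed
  thus "max_run g b" using T s by (auto simp: max_run_def two_champ_def)
  show "\<not> one_head g b"
  proof
    assume "one_head g b"
    hence "cg l1 (l1 + b + p)" using T by (auto simp: one_head_def two_champ_def)
    thus False using ncg(1)[of l1 "l1 + b + p"] s by auto
  qed
qed

text \<open>A good side exists only in an arc of at least two robots, where \<open>arcok\<close>
  demands nothing. Without good sides both arcs have at most one robot, and parity leaves a single
  lone robot.\<close>

lemma two_champ_eq: assumes T: "two_champ g l1 b p b p'" "1 \<le> p + p'" "r3 g b r"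
  shows "zF g l1 b p b p' r (-1)"
proof -
  have pg: "per g" and s: "b + p + b + p' = K" "0 \<le> p" "0 \<le> p'" "2 \<le> b" using T(1) by (auto simp: two_champ_def validD)
  show ?thesis
  proof (cases "exG g b")
    case True
    hence g: "good g b r" using T(3) by (simp add: r3_def sel_def best_def)
    from two_champ_good[OF T(1) g] show ?thesis
    proof
      assume h: "1 \<le> p \<and> cg r (l1 + b)"
      hence "2 \<le> p" using two_champ_good1[OF T(1) g] by simp
      thus ?thesis using h unfolding zF_def arcok_def by auto
    next
      assume h: "1 \<le> p' \<and> cg r (l1 + b + p + b)"
      hence "2 \<le> p'" using two_champ_good1[OF two_champ_swap[OF T(1)] g] by simp
      thus ?thesis using h unfolding zF_def arcok_def by auto
    qed
  next
    case False
    hence nA: "\<not> exA g b" unfolding exG_def good_def exA_rf by (meson exA_def)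
    have "\<not> 2 \<le> p" "\<not> 2 \<le> p'" using nA two_champ_exA[OF T(1)] two_champ_exA[OF two_champ_swap[OF T(1)]] by auto
    moreover have "\<not> (p = 1 \<and> p' = 1)"
    proof
      assume "p = 1 \<and> p' = 1"
      hence "K = 2 * (b + 1)" using s(1) by auto
      thus False using Kodd by simp
    qed
    ultimately consider "p = 1" "p' = 0" | "p = 0" "p' = 1" using s(2,3) T(2) by linarith
    thus ?thesis
    proof cases
      case 1
      have h: "cg r (l1 + b)" "g (r - 1) \<le> g r" using two_champ_one[OF _ False T(3)] T(1) 1 by auto
      have "cg (r - 1) (l1 + b - 1)" using h(1) by simp
      hence "g (r - 1) = g (l1 + b - 1)" "g r = g (l1 + b)" using per_cg[OF pg] h(1) by auto
      thus ?thesis using h 1 unfolding zF_def arcok_def by auto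
    next
      case 2
      have T2: "two_champ g (l1 + b + p) b 1 b 0" using two_champ_swap[OF T(1)] 2 by simp
      have h: "cg r (l1 + b + p + b)" "g (r - 1) \<le> g r" using two_champ_one[OF T2 False T(3)] by auto
      have e: "l1 - 1 + K = l1 + b + p + b" using s 2 by simp
      have "cg (r - 1) (l1 + b + p + b - 1)" using h(1) by simp
      hence "g (r - 1) = g (l1 + b + p + b - 1)" "g r = g (l1 + b + p + b)" using per_cg[OF pg] h(1) by auto
      moreover have "g (l1 + b + p + b) = g (l1 - 1)" using pg e unfolding per_def by metis
      ultimately show ?thesis using h 2 unfolding zF_def arcok_def by auto
    qed
  qed
qed

lemma two_champ_F: assumes T: "two_champ g l1 b1 p b2 p'" and "1 \<le> p + p'" "d \<in> F g i"
  shows "zF g l1 b1 p b2 p' i d"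
proof -
  have s: "b1 + p + b2 + p' = K" "2 \<le> b1" "2 \<le> b2" "0 \<le> p" "0 \<le> p'" using T by (auto simp: two_champ_def)
  consider "b1 < b2" | "b2 < b1" | "b1 = b2" by linarith
  thus ?thesis
  proof cases
    case 1 thus ?thesis using two_champ_lt assms by blast
  next
    case 2 thus ?thesis using two_champ_lt[OF two_champ_swap[OF T]] zF_swap[OF T] assms by (simp add: add.commute)
  next
    case 3
    hence T3: "two_champ g l1 b1 p b1 p'" using T by simp
    have "b1 < K" using s by linarith
    hence "d = -1 \<and> r3 g b1 i \<or> d = 1 \<and> r3 (rf g) b1 (- i)"
      using mxF[OF two_champ_mx(1)[OF T3]] two_champ_mx(2)[OF T3] assms(3) by auto
    thus ?thesis
    proof
      assume "d = -1 \<and> r3 g b1 i"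
      thus ?thesis using two_champ_eq[OF T3 assms(2)] 3 by auto
    next
      assume h: "d = 1 \<and> r3 (rf g) b1 (- i)"
      hence "zF (rf g) (- (l1 + b1 - 1)) b1 p' b1 p (- i) (- d)"
        using two_champ_eq[OF two_champ_rf[OF T3]] assms(2) by (simp add: add.commute)
      thus ?thesis using zF_rf[OF T3] 3 by auto
    qed
  qed
qed

text \<open>The new pending move is next to one of the runs by \<open>zF\<close>, and
  \<open>arcok\<close> ensures that it never incurs the surcharge in \<open>ZA\<close>.\<close>

lemma pair_zone_look: assumes "pair_zone l1 b1 p b2 p' g q" "d \<in> F g i"
  shows "pair_zone l1 b1 p b2 p' g (setq q i d)" "Zm l1 b1 p b2 p' g (setq q i d) \<le> Zm l1 b1 p b2 p' g q"
proof -
  note Z = assms(1)[unfolded pair_zone_def]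
  have T: "two_champ g l1 b1 p b2 p'" using Z by simp
  have s: "b1 + p + b2 + p' = K" "2 \<le> b1" "2 \<le> b2" "0 \<le> p" "0 \<le> p'" using T by (auto simp: two_champ_def)
  have f: "zF g l1 b1 p b2 p' i d" using two_champ_F[OF T] Z assms(2) by blast
  have "pair_pend l1 b1 p b2 p' (setq q i d)" unfolding pair_pend_def
  proof (intro allI impI)
    fix j assume j: "setq q i d j \<noteq> 0"
    show "1 \<le> p \<and> (cg j (l1 + b1) \<and> setq q i d j = - 1 \<or> cg j (l1 + b1 + p - 1) \<and> setq q i d j = 1) \<or>
         1 \<le> p' \<and> (cg j (l1 + b1 + p + b2) \<and> setq q i d j = - 1 \<or> cg j (l1 - 1) \<and> setq q i d j = 1)"
    proof (cases "cg j i")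
      case True
      hence e: "setq q i d j = d" by (simp add: setq_def)
      have cx: "cg j x \<longleftrightarrow> cg i x" for x using True cg_trans cg_sym by blast
      show ?thesis using f unfolding zF_def e cx by blast
    next
      case False
      hence "setq q i d j = q j" by (simp add: setq_def)
      thus ?thesis using Z j unfolding pair_pend_def by metis
    qed
  qed
  thus "pair_zone l1 b1 p b2 p' g (setq q i d)" using Z per_setq unfolding pair_zone_def by auto
  have A: "ZA p (g (l1 + b1 - 1)) (g (l1 + b1 + p - 1)) b1 b2 (setq q i d (l1 + b1)) \<le> ZA p (g (l1 + b1 - 1)) (g (l1 + b1 + p - 1)) b1 b2 (q (l1 + b1))"
  proof (cases "cg (l1 + b1) i")
    case True
    have "\<not> (cg i (l1 + b1 + p + b2))" if "1 \<le> p'"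
      using ncg(1)[of "l1 + b1" "l1 + b1 + p + b2"] cg_trans[OF True] that s by auto
    moreover have "\<not> cg i (l1 - 1)" if "1 \<le> p'"
      using ncg(2)[of "l1 - 1" "l1 + b1"] cg_trans[OF True] that s by auto
    ultimately have "arcok b1 b2 p (g (l1 + b1 - 1)) (g (l1 + b1 + p - 1)) d" using f unfolding zF_def by blast
    thus ?thesis using arcok_ZA True by (simp add: setq_def)
  qed (simp add: setq_def)
  have B: "ZA p' (g (l1 + b1 + p + b2 - 1)) (g (l1 - 1)) b2 b1 (setq q i d (l1 - 1)) \<le> ZA p' (g (l1 + b1 + p + b2 - 1)) (g (l1 - 1)) b2 b1 (q (l1 - 1))"
  proof (cases "cg (l1 - 1) i")
    case True
    have "\<not> (cg i (l1 + b1))" if "1 \<le> p"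
      using ncg(1)[of "l1 - 1" "l1 + b1"] cg_trans[OF True] that s by auto
    moreover have "\<not> cg i (l1 + b1 + p - 1)" if "1 \<le> p"
    proof
      assume "cg i (l1 + b1 + p - 1)"
      hence "cg (l1 - 1) (l1 + b1 + p - 1)" using cg_trans[OF True] by blast
      moreover have "\<not> cg (l1 - 1) (l1 + b1 + p - 1)" by (rule ncg(1)) (use s that in linarith)+
      ultimately show False by blast
    qed
    ultimately have "arcok b2 b1 p' (g (l1 + b1 + p + b2 - 1)) (g (l1 - 1)) d" using f unfolding zF_def by blast
    thus ?thesis using arcok_ZA True by (simp add: setq_def)
  qed (simp add: setq_def)
  show "Zm l1 b1 p b2 p' g (setq q i d) \<le> Zm l1 b1 p b2 p' g q" using A B unfolding Zm_def by simp
qed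

section \<open>The champion and two-run zones taken together\<close>

lemma F_mx: "d \<in> F g i \<Longrightarrow> \<exists>b. max_run g b \<and> b < K" by (auto simp: F_def RT_def max_run_rf)

lemma late_zone_look: assumes "late_zone m g q" "d \<in> F g i" "q i = 0" shows "late_zone m g (setq q i d)"
  using assms(1)[unfolded late_zone_def]
proof (elim disjE exE conjE)
  fix l b c \<rho> x dx assume w: "champ_zone l b c \<rho> x dx g q" "Wm l b c \<rho> g q \<le> m"
  have "b < K" using F_mx[OF assms(2)] max_run_unique champ_mx w(1) unfolding champ_zone_def by metis
  from champ_zone_look[OF w(1) this assms(2,3)] w(2) show ?thesis using late_zone_W by (metis order_trans)
next
  fix l1 b1 p b2 p' assume z: "pair_zone l1 b1 p b2 p' g q" "Zm l1 b1 p b2 p' g q \<le> m"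
  from pair_zone_look[OF z(1) assms(2)] z(2) show ?thesis using late_zone_Z by (metis order_trans)
qed

lemma late_zone_mono: "late_zone m g q \<Longrightarrow> m \<le> m' \<Longrightarrow> late_zone m' g q" unfolding late_zone_def by (meson order_trans)

lemma late_zone_rf: assumes "late_zone m g q" shows "late_zone m (rf g) (rq q)"
  using assms[unfolded late_zone_def]
proof (elim disjE exE conjE)
  fix l b c \<rho> x dx assume w: "champ_zone l b c \<rho> x dx g q" "Wm l b c \<rho> g q \<le> m"
  have "per q" using w by (simp add: champ_zone_def)
  from late_zone_W[OF champ_zone_rf[OF w(1)]] Wm_rf[OF this] w(2) show ?thesis by simp
next
  fix l1 b1 p b2 p' assume z: "pair_zone l1 b1 p b2 p' g q" "Zm l1 b1 p b2 p' g q \<le> m"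
  from late_zone_Z[OF pair_zone_rf(1)[OF z(1)]] pair_zone_rf(2)[OF z(1)] z(2) show ?thesis by simp
qed

lemma late_zone_vals: assumes "late_zone m g q" shows "valid g" "per q" "q i \<in> {-1, 0, 1}"
proof -
  show "valid g" "per q" using assms unfolding late_zone_def champ_zone_def pair_zone_def champ_def two_champ_def by blast+
  show "q i \<in> {-1, 0, 1}"
    using assms[unfolded late_zone_def]
  proof (elim disjE exE conjE)
    fix l b c \<rho> x dx assume w: "champ_zone l b c \<rho> x dx g q"
    thus ?thesis unfolding champ_zone_def champ_pend_def rog_def by (metis insertI1 insertI2)
  next
    fix l1 b1 p b2 p' assume z: "pair_zone l1 b1 p b2 p' g q"
    thus ?thesis unfolding pair_zone_def pair_pend_def by (metis insertI1 insertI2)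
  qed
qed

lemma late_zone_move_L: assumes "late_zone m g q" "q i = -1"
  shows "2 \<le> g (i - 1) \<and> late_zone (m - 1) (upd g i (-1)) (setq q i 0)"
  using assms(1)[unfolded late_zone_def]
proof (elim disjE exE conjE)
  have pg: "per g" and pq: "per q" using late_zone_vals[OF assms(1)] validD by auto
  have cong: ?thesis if c: "cg i j" and h: "2 \<le> g (j - 1)" "late_zone (m' - 1) (upd g j (-1)) (setq q j 0)" "m' \<le> m" for j m'
  proof -
    have "cg (i - 1) (j - 1)" using c by simp
    hence "g (i - 1) = g (j - 1)" using per_cg[OF pg] by blast
    thus ?thesis using h upd_cong[OF c] setq_cong[OF c] late_zone_mono[of "m'-1" _ _ "m-1"] by auto
  qed
  { fix l b c \<rho> x dx assume w: "champ_zone l b c \<rho> x dx g q" "Wm l b c \<rho> g q \<le> m"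
    have "cg i (l + b) \<or> \<rho> \<and> cg i x \<and> dx = -1" using w(1) assms(2) unfolding champ_zone_def champ_pend_def by force
    thus ?thesis
    proof
      assume c: "cg i (l + b)"
      hence "q (l + b) = -1" using per_cg[OF pq c] assms(2) by simp
      from cong[OF c champ_zone_side_move[OF w(1) this] w(2)] show ?thesis .
    next
      assume h: "\<rho> \<and> cg i x \<and> dx = -1"
      hence "q x = -1" "champ_zone l b c \<rho> x (-1) g q" using per_cg[OF pq, of i x] assms(2) w by auto
      from cong[OF _ champ_zone_rogue_move[OF this(2) _ this(1)] w(2)] h show ?thesis by simp
    qed }
  { fix l1 b1 p b2 p' assume z: "pair_zone l1 b1 p b2 p' g q" "Zm l1 b1 p b2 p' g q \<le> m"
    have "1 \<le> p \<and> cg i (l1 + b1) \<or> 1 \<le> p' \<and> cg i (l1 + b1 + p + b2)"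
      using z(1) assms(2) unfolding pair_zone_def pair_pend_def by force
    thus ?thesis
    proof
      assume h: "1 \<le> p \<and> cg i (l1 + b1)"
      hence "q (l1 + b1) = -1" using per_cg[OF pq, of i "l1 + b1"] assms(2) by simp
      from cong[OF _ pair_zone_move_L[OF z(1) _ this] z(2)] h show ?thesis by simp
    next
      assume h: "1 \<le> p' \<and> cg i (l1 + b1 + p + b2)"
      hence "q (l1 + b1 + p + b2) = -1" using per_cg[OF pq, of i "l1 + b1 + p + b2"] assms(2) by simp
      from cong[OF _ pair_zone_move_L[OF pair_zone_swap(1)[OF z(1)] _ this]] z(2) pair_zone_swap(2)[OF z(1)] h show ?thesis by simp
    qed }
qed

lemma rq_upd: "rf (upd (rf g) (- i) (-1)) = upd g i 1" "rq (setq (rq q) (- i) 0) = setq q i 0"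
  using rf_upd[of "rf g" "-i" "-1"] rq_setq[of "rq q" "-i" 0] by simp_all

text \<open>Needed for the change of phase: when the block is complete, no outdated decision may
  survive to break it.\<close>

lemma late_zone_final: assumes "late_zone m g q" "max_run g K" shows "q i = 0"
  using assms(1)[unfolded late_zone_def]
proof (elim disjE exE conjE)
  fix l b c \<rho> x dx assume w: "champ_zone l b c \<rho> x dx g q"
  have "b = K" using max_run_unique[OF assms(2)] champ_mx w unfolding champ_zone_def by blast
  thus ?thesis using w unfolding champ_zone_def champ_pend_def outc_def by fastforce
next
  fix l1 b1 p b2 p' assume z: "pair_zone l1 b1 p b2 p' g q"
  hence T: "two_champ g l1 b1 p b2 p'" and pp: "1 \<le> p + p'" by (auto simp: pair_zone_def)
  have v: "per g" and s: "2 \<le> b1" "2 \<le> b2" "b1 + p + b2 + p' = K" "0 \<le> p" "0 \<le> p'" using T by (auto simp: two_champ_def validD)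
  obtain j where j: "run g K j" using assms(2) by (auto simp: max_run_def)
  have "in_run g (min b1 b2) r" for r
  proof -
    obtain r' where "j \<le> r'" "r' < j + K" "cg r' r" using cg_rep by blast
    hence "in_run g K r" using j in_run_cg[OF v] unfolding in_run_def by blast
    thus ?thesis using in_run_mono s by auto
  qed
  hence "\<not> 1 \<le> p" "\<not> 1 \<le> p'" using two_champ_out[OF T, of "l1 + b1"] two_champ_out[OF two_champ_swap[OF T], of "l1 + b1 + p + b2"]
    by (auto simp: min.commute)
  thus ?thesis using pp by simp
qed

section \<open>Symmetries of a configuration\<close>

definition nonper :: "(int \<Rightarrow> int) \<Rightarrow> bool" where "nonper g \<longleftrightarrow> (\<forall>s. (\<forall>j. g (j + s) = g j) \<longrightarrow> cg s 0)"
text \<open>The axis is given by the index sum \<sigma>: robot \<open>i\<close> is exchanged with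
  robot \<open>\<sigma> - i\<close>, and robot \<open>c\<close> lies on the axis iff
  \<open>cg (2 * c) \<sigma>\<close>.\<close>

definition refl_at :: "(int \<Rightarrow> int) \<Rightarrow> int \<Rightarrow> bool" where "refl_at g \<sigma> \<longleftrightarrow> (\<forall>j. g j = g (\<sigma> - 1 - j))"

lemma same_view: assumes "per g" "nonper g" "view g r = view g r'" shows "cg r r' \<or> refl_at g (r + r')"
  using view_cases[OF assms(1,3)]
proof
  assume h: "\<forall>j. g (r + j) = g (r' + j)"
  have "g (j + (r - r')) = g j" for j using h[rule_format, of "j - r'"] by (simp add: algebra_simps)
  hence "cg (r - r') 0" using assms(2) by (simp add: nonper_def)
  thus ?thesis by (simp add: cg_def)
next
  assume h: "\<forall>j. g (r + j) = g (r' - 1 - j)"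
  have "g j = g (r + r' - 1 - j)" for j using h[rule_format, of "j - r"] by (simp add: algebra_simps)
  thus ?thesis by (simp add: refl_at_def)
qed

text \<open>Two reflections compose to a rotation by the difference of their index sums, which
  nonperiodicity makes trivial.\<close>

lemma refl_refl: assumes "nonper g" "refl_at g \<sigma>" "refl_at g \<sigma>'" shows "cg \<sigma> \<sigma>'"
proof -
  have "g (j + (\<sigma> - \<sigma>')) = g j" for j
  proof -
    have "g j = g (\<sigma>' - 1 - j)" using assms(3) by (simp only: refl_at_def)
    also have "\<dots> = g (\<sigma> - 1 - (\<sigma>' - 1 - j))" using assms(2) by (simp only: refl_at_def)
    finally show ?thesis by (simp add: algebra_simps)
  qed
  hence "cg (\<sigma> - \<sigma>') 0" using assms(1) by (simp add: nonper_def)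
  thus ?thesis by (simp add: cg_def)
qed

lemma cg_addl: "cg (r + a) (r + b) \<longleftrightarrow> cg a b" by (simp add: cg_def)

text \<open>A robot sharing its view with two others would be reflected to both, but there is only
  one axis.\<close>

lemma no_three: assumes "per g" "nonper g" "view g r = view g r'" "view g r = view g r''" "\<not> cg r r'"
  shows "cg r'' r \<or> cg r'' r'"
proof -
  have "refl_at g (r + r')" using same_view assms by blast
  moreover have "cg r r'' \<or> refl_at g (r + r'')" using same_view assms by blast
  ultimately show ?thesis using refl_refl[OF assms(2)] cg_sym cg_addl by blast
qed

lemma uniq_refl: assumes "refl_at g \<sigma>" "uniq g c" shows "cg (2 * c) \<sigma>"
proof -
  have "g (\<sigma> - c + j) = g (c - 1 - j)" for j using assms(1)[unfolded refl_at_def, rule_format, of "\<sigma> - c + j"] by (simp add: algebra_simps)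
  hence "view g (\<sigma> - c) = view g c" by (rule view_refl)
  hence "cg (\<sigma> - c) c" using assms(2) by (simp add: uniq_def)
  hence "cg (\<sigma> - c + c) (c + c)" by (simp only: cg_add)
  thus ?thesis using cg_sym by simp
qed
lemma refl_uniq: assumes "per g" "nonper g" "refl_at g \<sigma>" "cg (2 * c) \<sigma>" shows "uniq g c"
  unfolding uniq_def
proof (intro allI impI)
  fix r' assume "view g r' = view g c"
  from same_view[OF assms(1,2) this] show "cg r' c"
  proof
    assume "refl_at g (r' + c)"
    hence "cg (r' + c) (2 * c)" using refl_refl assms cg_trans cg_sym by blast
    hence "cg (r' + c) (c + c)" by simp
    thus ?thesis by (simp only: cg_add)
  qed
qed
text \<open>Since \<open>k\<close> is odd, \<open>(K + 1) div 2\<close> is the inverse of 2 modulo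
  \<open>k\<close>, so every axis passes through a robot.\<close>

lemma refl_mid: "\<exists>c. cg (2 * c) \<sigma>"
proof -
  have "K + 1 = 2 * ((K + 1) div 2)" using Kodd by presburger
  hence "2 * (\<sigma> * ((K + 1) div 2)) = \<sigma> * (K + 1)" by (metis mult.left_commute)
  hence "cg (2 * (\<sigma> * ((K + 1) div 2))) \<sigma>" by (simp add: cg_def algebra_simps)
  thus ?thesis by blast
qed

text \<open>Compare the new gaps with their reflection in the old axis: the difference is
  \<open>2 * d\<close> at gap \<open>c - 1\<close>, \<open>- 2 * d\<close> at gap \<open>c\<close>
  and 0 elsewhere. A rotation symmetry of the new gaps must preserve gap \<open>c - 1\<close>, so it
  is trivial.\<close>

lemma nonper_upd_mid: assumes p: "per g" and r: "refl_at g \<sigma>" and c: "cg (2 * c) \<sigma>" and d: "d \<noteq> 0"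
  shows "nonper (upd g c d)"
  unfolding nonper_def
proof (intro allI impI)
  fix s assume s: "\<forall>j. upd g c d (j + s) = upd g c d j"
  let ?g = "upd g c d"
  have R: "g j = g (2 * c - 1 - j)" for j
  proof -
    have "cg (2 * c - (1 + j)) (\<sigma> - (1 + j))" using c by (simp only: cg_diff)
    hence "g (2 * c - (1 + j)) = g (\<sigma> - (1 + j))" using per_cg[OF p] by blast
    thus ?thesis using r[unfolded refl_at_def, rule_format, of j] by (simp add: diff_diff_add)
  qed
  have C: "cg (2 * c - 1 - j) (c - 1) \<longleftrightarrow> cg j c" "cg (2 * c - 1 - j) c \<longleftrightarrow> cg j (c - 1)" for j
  proof -
    have "2 * c - 1 - j - (c - 1) = c - j" "2 * c - 1 - j - c = (c - 1) - j" by simp_all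
    thus "cg (2 * c - 1 - j) (c - 1) \<longleftrightarrow> cg j c" "cg (2 * c - 1 - j) c \<longleftrightarrow> cg j (c - 1)"
      by (simp_all only: cg_def dvd_diff_commute)
  qed
  have D: "?g j - ?g (2 * c - 1 - j) = (if cg j (c - 1) then 2 * d else 0) - (if cg j c then 2 * d else 0)" for j
    unfolding upd_def C using R[of j] by simp
  have "?g (c - 1 + s) = ?g (c - 1)" using s by blast
  moreover have "?g (c - s) = ?g c" using s[rule_format, of "c - s"] by simp
  ultimately have "?g (c - 1 + s) - ?g (2 * c - 1 - (c - 1 + s)) = ?g (c - 1) - ?g (2 * c - 1 - (c - 1))" by simp
  hence "(if cg (c - 1 + s) (c - 1) then 2 * d else 0) - (if cg (c - 1 + s) c then 2 * d else 0) = 2 * d"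
    unfolding D using not_cg_pred by simp
  hence "cg (c - 1 + s) (c - 1)" using d by (auto split: if_splits)
  thus "cg s 0" by (simp add: cg_def)
qed

text \<open>After the move the gap in front of \<open>i\<close> is below the old minimum over
  isolated robots. A rotation would carry \<open>i\<close> to a robot that was isolated before the
  move and now has the same small gap; only the gap that has just shrunk qualifies.\<close>

lemma nonper_upd_top: assumes v: "valid g" and c: "cand g i" and a: "g (i - 1) \<le> g i" "3 \<le> g (i - 1)"
  shows "nonper (upd g i (-1))"
  unfolding nonper_def
proof (intro allI impI)
  let ?g = "upd g i (-1)"
  fix s assume s: "\<forall>j. ?g (j + s) = ?g j"
  have p: "per g" using v validD by blast
  have g1: "?g (i - 1) = g (i - 1) - 1" "?g i = g i + 1" using upd_vals[OF p] by auto
  have ge: "2 \<le> ?g t \<Longrightarrow> 2 \<le> g t" for t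
    using validD(2)[OF v, of t] approach_run[OF v a(2), of 2 t] upd_at2[OF p, of t i "-1"] per_cg[OF p, of t i] a
    by (cases "cg t i") (auto simp: upd_def split: if_splits)
  have e: "i - 1 + s = i + s - 1" by simp
  have s1: "?g (i + s - 1) = g (i - 1) - 1" using s g1 e by metis
  have s2: "?g (i + s) = g i + 1" using s g1 by metis
  have "iso g (i + s)" unfolding iso_def using ge s1 s2 a by auto
  hence z: "g (i - 1) \<le> g (i + s - 1)" using c a unfolding cand_def z1_def by force
  have "cg (i + s - 1) (i - 1)"
  proof (rule ccontr)
    assume n: "\<not> cg (i + s - 1) (i - 1)"
    hence "?g (i + s - 1) = g (i + s - 1) + (if cg (i + s - 1) i then 1 else 0)" by (simp add: upd_def)
    thus False using z s1 by (auto split: if_splits)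
  qed
  thus "cg s 0" by (simp add: cg_def)
qed

lemma nonper_rf: assumes "nonper g" shows "nonper (rf g)"
  unfolding nonper_def
proof (intro allI impI)
  fix s assume s: "\<forall>j. rf g (j + s) = rf g j"
  have "g (j + s) = g j" for j using s[rule_format, of "-1 - j - s"] by (simp add: rf_def)
  thus "cg s 0" using assms by (simp add: nonper_def)
qed

lemma ex_maxvw: assumes "per g" "P r" shows "\<exists>r. P r \<and> (\<forall>r'. P r' \<longrightarrow> view g r' \<le> view g r)"
proof -
  let ?V = "view g ` {r. P r}"
  have "?V \<subseteq> view g ` {0..<K}"
  proof
    fix v assume "v \<in> ?V"
    then obtain r where r: "v = view g r" by auto
    have "view g r = view g (r mod K)" using view_cg[OF assms(1)] cg_mod cg_sym by blast
    moreover have "r mod K \<in> {0..<K}" using k3 by simp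
    ultimately show "v \<in> view g ` {0..<K}" using r by blast
  qed
  hence f: "finite ?V" using finite_subset by blast
  have "?V \<noteq> {}" using assms(2) by blast
  hence "Max ?V \<in> ?V" using f Max_in by blast
  then obtain r where "P r" "view g r = Max ?V" by auto
  thus ?thesis using f Max_ge[OF f] by (metis (mono_tags) imageI mem_Collect_eq)
qed
lemma ex_minval: fixes f :: "int \<Rightarrow> int" assumes "P r" "\<And>r. 0 \<le> f r" shows "\<exists>r. P r \<and> (\<forall>r'. P r' \<longrightarrow> f r \<le> f r')"
proof -
  have "\<exists>r. P r \<and> (\<forall>r'. P r' \<longrightarrow> nat (f r) \<le> nat (f r'))" using ex_has_least_nat[of P r "\<lambda>r. nat (f r)"] assms(1) by blast
  thus ?thesis using assms(2) nat_le_eq_zle by (metis nat_0_le nat_le_iff)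
qed

section \<open>Heavy blocks\<close>

lemma heads_apart: assumes "max_run g b" "run g b i" "run g b j" "i < j" shows "i + b \<le> j"
proof (rule ccontr)
  assume n: "\<not> i + b \<le> j"
  have "run g (b + 1) i" unfolding run_def
  proof (intro allI impI)
    fix t assume "i \<le> t" "t < i + (b + 1) - 1"
    thus "g t = 1" using assms(2-4) n unfolding run_def by (cases "t < i + b - 1") auto
  qed
  thus False using assms(1) by (auto simp: max_run_def)
qed

text \<open>Two longest runs with different starts are disjoint on the ring. As \<open>k\<close> is
  odd and at least 3, this leaves two robots outside a longest run as well.\<close>

lemma twohd: assumes "valid g" "max_run g b" "\<not> one_head g b" shows "2 * b \<le> K" "b + 2 \<le> K"
proof -
  have p: "per g" using assms validD by blast
  obtain i j where ij: "run g b i" "run g b j" "\<not> cg i j" using assms(3) by (auto simp: one_head_def)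
  obtain j' where j': "i \<le> j'" "j' < i + K" "cg j' j" using cg_rep by blast
  have r: "run g b j'" using run_cg[OF p j'(3)] ij by simp
  have "i \<noteq> j'" using j'(3) ij(3) by auto
  hence "i + b \<le> j'" using heads_apart[OF assms(2) ij(1) r] j' by simp
  moreover have "run g b (i + K)" using run_cg[OF p, of "i + K" i] ij by simp
  hence "j' + b \<le> i + K" using heads_apart[OF assms(2) r] j' by simp
  ultimately show k: "2 * b \<le> K" by simp
  thus "b + 2 \<le> K" using K3 Kodd assms(2) unfolding max_run_def by presburger
qed

lemma side_run: assumes "in_run g b (x - 1)" "\<not> in_run g b x" shows "run g b (x - b)"
proof -
  obtain j where j: "j \<le> x - 1" "x - 1 < j + b" "run g b j" using assms by (auto simp: in_run_def)
  have "\<not> x < j + b" using assms(2) j unfolding in_run_def by auto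
  hence "j = x - b" using j by simp
  thus ?thesis using j by simp
qed

text \<open>A robot at distance two from the run \<open>[x-b, x-1]\<close> joins it, and a champion appears.\<close>

lemma join_W: assumes v: "valid g" and q: "per q" and m: "max_run g b" and b: "b + 2 \<le> K"
    and r: "run g b (x - b)" and g2: "g (x - 1) = 2"
    and pend: "\<And>i. setq q x 0 i \<noteq> 0 \<Longrightarrow> cg i x2 \<and> setq q x 0 i = d2"
    and rg: "setq q x 0 x2 \<noteq> 0 \<Longrightarrow> outc (x - b) (b + 1) x2 \<and> (cg x2 (x - b - 1) \<and> d2 = 1 \<or>
        outc (x - b) (b + 1) (x2 + d2) \<and> (d2 = -1 \<and> 2 \<le> upd g x (-1) (x2 - 1) \<or> d2 = 1 \<and> 2 \<le> upd g x (-1) x2) \<and>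
        (\<not> in_run (upd g x (-1)) b (x + 1) \<or> \<not> in_run (upd g x (-1)) b (x - b - 1)))"
  shows "late_zone (60 * (N * N)) (upd g x (-1)) (setq q x 0)"
proof -
  let ?g = "upd g x (-1)" let ?q = "setq q x 0"
  have p: "per g" using v validD by blast
  have v': "valid ?g" using valid_upd[OF v] g2 by simp
  have b1: "1 \<le> b" using m by (simp add: max_run_def)
  have pq: "per ?q" using q per_setq by blast
  have "run ?g b (x - b)"
  proof (rule run_keep[OF v _ r])
    fix t assume "x - b \<le> t" "t < x - b + b - 1" thus "\<not> cg t x" using ncg(1)[of t x] b by simp
  qed (use g2 in simp)
  moreover have "?g (x - 1) = 1" using upd_vals(1)[OF p] g2 by simp
  ultimately have run': "run ?g (b + 1) (x - b)" using run_snoc[of ?g b "x - b"] by simp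
  have C: "champ ?g (x - b) (b + 1) b" unfolding champ_def
  proof (intro conjI allI impI)
    fix j assume j: "run ?g (b + 1) j"
    have "\<not> run g (b + 1) j" using m by (simp add: max_run_def)
    hence "cg (j + b) x" using join_run(1)[OF v _ j] g2 by simp
    hence "cg j (x - b)" using cg_move by blast
    thus "\<exists>t. 0 \<le> t \<and> t \<le> b + 1 - b - 1 \<and> cg j (x - b + t)" by auto
  qed (use v' run' b b1 in auto)
  \<comment> \<open>The other pending robot counts as a rogue unless it is the left neighbour of the
    new champion moving towards it, which \<open>champ_pend\<close> admits anyway.\<close>
  define \<rho> where "\<rho> \<longleftrightarrow> ?q x2 \<noteq> 0 \<and> \<not> (cg x2 (x - b - 1) \<and> d2 = 1)"
  have q2: "?q x2 \<noteq> 0" if "?q i \<noteq> 0" for i using pend[OF that] per_cg[OF pq, of i x2] that by simp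
  have w: "champ_pend (x - b) (b + 1) \<rho> x2 d2 ?q" unfolding champ_pend_def
  proof (intro allI impI)
    fix i assume i: "?q i \<noteq> 0"
    have P: "cg i x2" "?q i = d2" using pend[OF i] by auto
    have "outc (x - b) (b + 1) i" using rg[OF q2[OF i]] outc_cg[OF P(1)] by blast
    moreover have "cg i (x - b - 1)" if "cg x2 (x - b - 1)" using that P cg_trans by blast
    ultimately show "outc (x - b) (b + 1) i \<and> (cg i (x - b + (b + 1)) \<and> ?q i = - 1 \<or>
      cg i (x - b - 1) \<and> ?q i = 1 \<or> \<rho> \<and> cg i x2 \<and> ?q i = d2)"
      using P q2[OF i] unfolding \<rho>_def by auto
  qed
  have R: "rog ?g (x - b) (b + 1) x2 d2 \<and> soft ?g (x - b) (b + 1) b ?q" if \<rho>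
  proof -
    have z: "outc (x - b) (b + 1) x2" "outc (x - b) (b + 1) (x2 + d2)" "d2 = -1 \<and> 2 \<le> ?g (x2 - 1) \<or> d2 = 1 \<and> 2 \<le> ?g x2"
      "\<not> in_run ?g b (x + 1) \<or> \<not> in_run ?g b (x - b - 1)" "\<not> (cg x2 (x - b - 1) \<and> d2 = 1)"
      using rg that unfolding \<rho>_def by auto
    have e: "x - b + (b + 1) = x + 1" by simp
    have "\<not> cg i (x + 1)" if "?q i = -1" for i
    proof
      assume c: "cg i (x + 1)"
      have P: "cg i x2" "d2 = -1" using pend[of i] that by auto
      hence "cg x2 (x + 1)" using c cg_trans cg_sym by blast
      hence "cg (x2 + d2) (x - b + b)" using P cg_diff[of x2 1 "x+1"] by simp
      thus False using outc_not[OF z(2), of b] b1 by simp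
    qed
    moreover have "\<not> cg i (x - b - 1)" if "?q i = 1" for i
      using pend[of i] that z(5) cg_trans cg_sym by (metis zero_neq_one)
    ultimately show ?thesis using z unfolding rog_def soft_def e by auto
  qed
  have champ_zone': "champ_zone (x - b) (b + 1) b \<rho> x2 d2 ?g ?q" unfolding champ_zone_def using C pq w R by auto
  have "N * (K - (b + 1)) \<le> N * N" using KN b1 by (intro mult_left_mono) auto
  moreover have "Wm (x - b) (b + 1) b \<rho> ?g ?q \<le> 40 * (N * N) + 6 * (N * (K - (b + 1))) + 4 + 6 * N"
  proof -
    define NN where "NN = N * N"
    have "0 \<le> NN" by (simp add: NN_def)
    thus ?thesis using WA_bd(2)[OF v', of "x - b" "b + 1" ?q] unfolding Wm_def NN_def[symmetric] by auto
  qed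
  ultimately have "Wm (x - b) (b + 1) b \<rho> ?g ?q \<le> 60 * (N * N)" using NN7 N7 by linarith
  thus ?thesis using late_zone_W[OF champ_zone'] by blast
qed

section \<open>A race between two sides\<close>

definition gside :: "(int \<Rightarrow> int) \<Rightarrow> int \<Rightarrow> int \<Rightarrow> int \<Rightarrow> bool" where
  "gside g b x d \<longleftrightarrow> d = -1 \<and> good g b x \<or> d = 1 \<and> good (rf g) b (- x)"
definition sgap :: "(int \<Rightarrow> int) \<Rightarrow> int \<Rightarrow> int \<Rightarrow> int" where "sgap g x d = (if d = -1 then g (x - 1) else g x)"
text \<open>Reflections allow at most two sides to be selected at the same time; both keep the smallest gaps until one robot joins a run.\<close>

definition PA0 :: "int \<Rightarrow> int \<Rightarrow> int \<Rightarrow> int \<Rightarrow> int \<Rightarrow> (int \<Rightarrow> int) \<Rightarrow> (int \<Rightarrow> int) \<Rightarrow> bool" where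
  "PA0 b x1 d1 x2 d2 g q \<longleftrightarrow> valid g \<and> per q \<and> max_run g b \<and> \<not> one_head g b \<and> gside g b x1 d1 \<and> gside g b x2 d2 \<and>
     (cg x1 x2 \<longrightarrow> d1 = d2) \<and> (\<forall>i. q i \<noteq> 0 \<longrightarrow> cg i x1 \<and> q i = d1 \<or> cg i x2 \<and> q i = d2)"
definition PA1 :: "int \<Rightarrow> int \<Rightarrow> int \<Rightarrow> int \<Rightarrow> int \<Rightarrow> (int \<Rightarrow> int) \<Rightarrow> bool" where
  "PA1 b x1 d1 x2 d2 g \<longleftrightarrow> (\<forall>x d. gside g b x d \<and> sgap g x d \<le> min (sgap g x1 d1) (sgap g x2 d2) \<longrightarrow>
     cg x x1 \<and> d = d1 \<or> cg x x2 \<and> d = d2)"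

lemma gside_rf: "gside (rf g) b (- x) (- d) \<longleftrightarrow> gside g b x d" by (auto simp: gside_def)
lemma sgap_rf: "d = -1 \<or> d = 1 \<Longrightarrow> sgap (rf g) (- x) (- d) = sgap g x d" by (auto simp: sgap_def rf_def)
lemma gside_dir: "gside g b x d \<Longrightarrow> d = -1 \<or> d = 1" by (auto simp: gside_def)
lemma gside_h: "gside g b x d \<Longrightarrow> in_run g b (x + d) \<and> \<not> in_run g b x"
  by (auto simp: gside_def good_def sideA_def sideB_def in_run_rf add.commute split: if_splits)

lemma PA0_rf: assumes "PA0 b x1 d1 x2 d2 g q" shows "PA0 b (- x1) (- d1) (- x2) (- d2) (rf g) (rq q)"
proof -
  have "rq q i \<noteq> 0 \<longrightarrow> cg i (- x1) \<and> rq q i = - d1 \<or> cg i (- x2) \<and> rq q i = - d2" for i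
    using assms cg_neg[of i "-x1"] cg_neg[of i "-x2"] unfolding PA0_def rq_def by auto
  thus ?thesis using assms unfolding PA0_def gside_rf by (auto simp: valid_rf per_rq max_run_rf one_head_rf)
qed
lemma PA1_rf: assumes "PA0 b x1 d1 x2 d2 g q" "PA1 b x1 d1 x2 d2 g" shows "PA1 b (- x1) (- d1) (- x2) (- d2) (rf g)"
  unfolding PA1_def
proof (intro allI impI)
  fix x d assume h: "gside (rf g) b x d \<and> sgap (rf g) x d \<le> min (sgap (rf g) (- x1) (- d1)) (sgap (rf g) (- x2) (- d2))"
  have d: "d1 = -1 \<or> d1 = 1" "d2 = -1 \<or> d2 = 1" using assms(1) gside_dir unfolding PA0_def by auto
  have dd: "d = -1 \<or> d = 1" using h gside_dir by blast
  have "gside g b (- x) (- d)" using h gside_rf[of g b "-x" "-d"] by simp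
  moreover have "sgap g (- x) (- d) = sgap (rf g) x d" using sgap_rf[of "-d" g "-x"] dd by auto
  ultimately have "cg (- x) x1 \<and> - d = d1 \<or> cg (- x) x2 \<and> - d = d2"
    using assms(2) h sgap_rf[OF d(1)] sgap_rf[OF d(2)] unfolding PA1_def by metis
  thus "cg x (- x1) \<and> d = - d1 \<or> cg x (- x2) \<and> d = - d2" using cg_neg[of x "-x1"] cg_neg[of x "-x2"] by auto
qed

lemma gside_gap: assumes "valid g" "max_run g b" "gside g b x d" shows "2 \<le> sgap g x d"
proof -
  have A: "2 \<le> g (x - 1)" if "valid g" "max_run g b" "gside g b x (-1)" for g x
  proof (rule ccontr)
    assume n: "\<not> 2 \<le> g (x - 1)"
    have r: "run g b (x - b)" using side_run gside_h[OF that(3)] by simp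
    have "g (x - 1) = 1" using n validD(2)[OF that(1), of "x-1"] by simp
    hence "run g (b + 1) (x - b)" using run_snoc[OF r] by simp
    thus False using that(2) by (auto simp: max_run_def)
  qed
  show ?thesis
  proof (cases "d = -1")
    case True thus ?thesis using A assms by (simp add: sgap_def)
  next
    case False
    hence d: "d = 1" using gside_dir assms by blast
    have "gside (rf g) b (- x) (-1)" using assms(3) gside_rf[of g b x 1] d by simp
    from A[OF valid_rf[OF assms(1)] _ this] assms(2) d show ?thesis unfolding max_run_rf by (simp add: sgap_def rf_def)
  qed
qed

text \<open>Whether a side is good depends on the gaps only through the set of heavy robots. An
  approach that keeps this set keeps the competitors of the race.\<close>

lemma gside_same: assumes "\<And>r. in_run g' b r \<longleftrightarrow> in_run g b r" shows "gside g' b x d \<longleftrightarrow> gside g b x d"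
proof -
  have A: "sideA g' b r = sideA g b r" "sideB g' b r = sideB g b r" "sideA (rf g') b r = sideA (rf g) b r"
    "sideB (rf g') b r = sideB (rf g) b r" for r unfolding sideA_def sideB_def in_run_rf assms by auto
  show ?thesis unfolding gside_def good_def exA_def rf_rf A by (rule refl)
qed

text \<open>The two gaps changed by the move touch the non-heavy robot \<open>x\<close>. A side of
  another robot could share one of them only if \<open>x\<close> were heavy or if the robot of that
  side were.\<close>

lemma sgap_upd: assumes v: "valid g" and x: "gside g b x (-1)" and y: "gside g b y d"
  shows "cg y x \<Longrightarrow> d = 1 \<Longrightarrow> sgap (upd g x (-1)) y d = sgap g y d + 1"
    "\<not> cg y x \<Longrightarrow> sgap (upd g x (-1)) y d = sgap g y d"
    "cg y x \<Longrightarrow> d = -1 \<Longrightarrow> sgap (upd g x (-1)) y d = sgap g y d - 1"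
proof -
  have p: "per g" using v validD by blast
  show "cg y x \<Longrightarrow> d = 1 \<Longrightarrow> sgap (upd g x (-1)) y d = sgap g y d + 1" using upd_at2[OF p, of y x "-1"] by (simp add: sgap_def)
  show "cg y x \<Longrightarrow> d = -1 \<Longrightarrow> sgap (upd g x (-1)) y d = sgap g y d - 1" using upd_at[OF p, of "y-1" x "-1"] by (simp add: sgap_def)
  assume n: "\<not> cg y x"
  have hx: "in_run g b (x - 1)" "\<not> in_run g b x" using gside_h[OF x] by auto
  have hy: "in_run g b (y + d)" "\<not> in_run g b y" using gside_h[OF y] by auto
  show "sgap (upd g x (-1)) y d = sgap g y d"
  proof (cases "d = -1")
    case True
    have "\<not> cg (y - 1) x" using hx hy True in_run_cg[OF p, of "y-1" x] by auto
    moreover have "\<not> cg (y - 1) (x - 1)" using n by simp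
    ultimately show ?thesis using True by (simp add: sgap_def upd_def)
  next
    case False
    have "\<not> cg y (x - 1)" using hx hy in_run_cg[OF p, of y "x-1"] by auto
    thus ?thesis using n False by (simp add: sgap_def upd_def)
  qed
qed

text \<open>The gap that opens lies behind \<open>x\<close>, which is not heavy, so no longest run
  loses a robot; approaching creates no run either.\<close>

lemma approach_heavy: assumes "valid g" "3 \<le> g (x - 1)" "\<not> in_run g b x"
  shows "run (upd g x (-1)) b j \<longleftrightarrow> run g b j"
proof
  assume r: "run g b j"
  show "run (upd g x (-1)) b j"
  proof (rule run_keep[OF assms(1) _ r])
    fix t assume t: "j \<le> t" "t < j + b - 1"
    have "in_run g b t" unfolding in_run_def using t r by (intro exI[of _ j]) auto
    thus "\<not> cg t x" using assms(3) in_run_cg[OF validD(1)[OF assms(1)]] by blast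
  qed (use assms(2) in simp)
qed (use approach_run assms in blast)

lemma same_heavy: assumes "\<And>j. run g' b j \<longleftrightarrow> run g b j"
  shows "in_run g' b r \<longleftrightarrow> in_run g b r" "one_head g' b \<longleftrightarrow> one_head g b"
  using assms by (auto simp: in_run_def one_head_def)

text \<open>While the gap is at least 3 the heavy robots and hence all sides are unchanged. At gap 2
  the robot joins; the other pending robot becomes a neighbour or the rogue of the new
  champion.\<close>

lemma PA0_move_L: assumes P: "PA0 b x1 (-1) x2 d2 g q" "q x1 = -1"
  shows "2 \<le> g (x1 - 1)"
    "3 \<le> g (x1 - 1) \<Longrightarrow> PA0 b x1 (-1) x2 d2 (upd g x1 (-1)) (setq q x1 0) \<and> (\<forall>x d. gside (upd g x1 (-1)) b x d = gside g b x d)"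
    "g (x1 - 1) = 2 \<Longrightarrow> late_zone (60 * (N * N)) (upd g x1 (-1)) (setq q x1 0)"
proof -
  note A = P(1)[unfolded PA0_def]
  let ?g = "upd g x1 (-1)" let ?q = "setq q x1 0"
  have v: "valid g" and m: "max_run g b" and no: "\<not> one_head g b" and s1: "gside g b x1 (-1)" and s2: "gside g b x2 d2" using A by auto
  have p: "per g" using v validD by blast
  show gap: "2 \<le> g (x1 - 1)" using gside_gap[OF v m s1] by (simp add: sgap_def)
  have v': "valid ?g" using valid_upd[OF v] gap by simp
  have hx: "in_run g b (x1 - 1)" "\<not> in_run g b x1" using gside_h[OF s1] by auto
  have hy: "in_run g b (x2 + d2)" "\<not> in_run g b x2" using gside_h[OF s2] by auto
  have bK: "b + 2 \<le> K" and b1: "1 \<le> b" using twohd[OF v m no] m by (auto simp: max_run_def)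
  have pq: "per ?q" using A per_setq by blast
  have q2: "?q j = q j \<and> \<not> cg j x1" if "?q j \<noteq> 0" for j using that by (auto simp: setq_def split: if_splits)
  have pend: "cg i x2 \<and> ?q i = d2" if "?q i \<noteq> 0" for i using A q2[OF that] that by metis
  { assume g3: "3 \<le> g (x1 - 1)"
    have R: "run ?g b j \<longleftrightarrow> run g b j" for j by (rule approach_heavy[OF v g3 hx(2)])
    have G: "gside ?g b x d = gside g b x d" for x d using gside_same[OF same_heavy(1)[OF R]] .
    have "max_run ?g b" using m R approach_run[OF v g3] unfolding max_run_def by blast
    hence "PA0 b x1 (-1) x2 d2 ?g ?q" unfolding PA0_def using v' pq same_heavy(2)[OF R] no G s1 s2 pend A by auto
    thus "PA0 b x1 (-1) x2 d2 ?g ?q \<and> (\<forall>x d. gside ?g b x d = gside g b x d)" using G by blast }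
  assume g2: "g (x1 - 1) = 2"
  have rr: "run g b (x1 - b)" using side_run hx by blast
  show "late_zone (60 * (N * N)) ?g ?q"
  proof (rule join_W[OF v _ m bK rr g2 pend])
    show "per q" using A by simp
    assume "?q x2 \<noteq> 0"
    hence n: "\<not> cg x2 x1" using q2 by blast
    have o: "outc (x1 - b) (b + 1) x2"
    proof (rule ccontr)
      assume "\<not> outc (x1 - b) (b + 1) x2"
      then obtain t where t: "0 \<le> t" "t < b + 1" "cg x2 (x1 - b + t)" using not_outc by blast
      have "t \<noteq> b" using n t by auto
      hence "in_run g b (x1 - b + t)" using in_run_in[OF rr] t by simp
      thus False using hy in_run_cg[OF p t(3)] by simp
    qed
    have o2: "outc (x1 - b) (b + 1) (x2 + d2)" if nc: "\<not> (cg x2 (x1 - b - 1) \<and> d2 = 1)"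
    proof (rule ccontr)
      assume "\<not> outc (x1 - b) (b + 1) (x2 + d2)"
      then obtain t where t: "0 \<le> t" "t < b + 1" "cg (x2 + d2) (x1 - b + t)" using not_outc by blast
      have c: "cg x2 (x1 - b + (t - d2))" using t(3) cg_move[of x2 d2] by (simp add: algebra_simps)
      have "t \<noteq> b"
      proof
        assume "t = b"
        hence "cg (x2 + d2) x1" using t by simp
        thus False using hx hy in_run_cg[OF p] by blast
      qed
      have ni: "\<not> (0 \<le> t - d2 \<and> t - d2 < b)" using in_run_in[OF rr] hy in_run_cg[OF p c] by blast
      from gside_dir[OF s2] show False
      proof
        assume d: "d2 = -1"
        hence "t + 1 = b" using ni t \<open>t \<noteq> b\<close> by auto
        hence "cg x2 x1" using c d by simp
        thus False using n by simp
      next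
        assume d: "d2 = 1"
        hence "t = 0" using ni t \<open>t \<noteq> b\<close> by auto
        thus False using c d nc by simp
      qed
    qed
    have gp: "2 \<le> sgap ?g x2 d2" using sgap_upd(2)[OF v s1 s2 n] gside_gap[OF v m s2] by simp
    \<comment> \<open>This is the purpose of \<open>sideA\<close> and \<open>sideB\<close>: one of
      the two robots next to the enlarged run was not heavy and cannot have become so, because new
      runs of length \<open>b\<close> end with \<open>x1\<close>.\<close>
    have sft: "\<not> in_run ?g b (x1 + 1) \<or> \<not> in_run ?g b (x1 - b - 1)"
    proof -
      have state_inv: "run g b j \<or> cg (j + b - 1) x1" if "run ?g b j" for j using join_run(1)[OF v gap that] by blast
      have "sideA g b x1 \<or> sideB g b x1" using s1 by (auto simp: gside_def good_def split: if_splits)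
      thus ?thesis
      proof
        assume "sideA g b x1"
        hence na: "\<not> in_run g b (x1 + 1)" by (simp add: sideA_def)
        have "\<not> in_run ?g b (x1 + 1)"
        proof
          assume "in_run ?g b (x1 + 1)"
          then obtain j where j: "j \<le> x1 + 1" "x1 + 1 < j + b" "run ?g b j" by (auto simp: in_run_def)
          have "\<not> run g b j" using na j unfolding in_run_def by blast
          hence "cg (j + b - 1) x1" using state_inv[OF j(3)] by blast
          thus False using ncg(2)[of x1 "j + b - 1"] j bK by simp
        qed
        thus ?thesis by simp
      next
        assume "sideB g b x1"
        hence na: "\<not> in_run g b (x1 - b - 1)" by (simp add: sideB_def)
        have "\<not> in_run ?g b (x1 - b - 1)"
        proof
          assume "in_run ?g b (x1 - b - 1)"
          then obtain j where j: "j \<le> x1 - b - 1" "x1 - b - 1 < j + b" "run ?g b j" by (auto simp: in_run_def)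
          have "\<not> run g b j" using na j unfolding in_run_def by blast
          hence "cg (j + b - 1) x1" using state_inv[OF j(3)] by blast
          thus False using ncg(1)[of "j + b - 1" x1] j bK by simp
        qed
        thus ?thesis by simp
      qed
    qed
    show "outc (x1 - b) (b + 1) x2 \<and> (cg x2 (x1 - b - 1) \<and> d2 = 1 \<or>
        outc (x1 - b) (b + 1) (x2 + d2) \<and> (d2 = -1 \<and> 2 \<le> ?g (x2 - 1) \<or> d2 = 1 \<and> 2 \<le> ?g x2) \<and>
        (\<not> in_run ?g b (x1 + 1) \<or> \<not> in_run ?g b (x1 - b - 1)))"
      using o o2 gp sft gside_dir[OF s2] by (auto simp: sgap_def)
  qed
qed

definition PAm :: "int \<Rightarrow> int \<Rightarrow> int \<Rightarrow> int \<Rightarrow> (int \<Rightarrow> int) \<Rightarrow> int" where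
  "PAm x1 d1 x2 d2 g = 60 * (N * N) + 3 * (sgap g x1 d1 + sgap g x2 d2)"
definition race_zone :: "int \<Rightarrow> (int \<Rightarrow> int) \<Rightarrow> (int \<Rightarrow> int) \<Rightarrow> bool" where
  "race_zone m g q \<longleftrightarrow> late_zone m g q \<or> (\<exists>b x1 d1 x2 d2. PA0 b x1 d1 x2 d2 g q \<and> PA1 b x1 d1 x2 d2 g \<and> PAm x1 d1 x2 d2 g \<le> m)"

lemma sgap_pos: "valid g \<Longrightarrow> 1 \<le> sgap g x d" using validD by (simp add: sgap_def)
lemma sgap_le: "valid g \<Longrightarrow> sgap g x d \<le> N" using g_le by (simp add: sgap_def)

lemma PA0_swap: "PA0 b x1 d1 x2 d2 g q \<Longrightarrow> PA0 b x2 d2 x1 d1 g q"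
  unfolding PA0_def using cg_sym by blast
lemma PA1_swap: "PA1 b x1 d1 x2 d2 g \<Longrightarrow> PA1 b x2 d2 x1 d1 g"
  unfolding PA1_def by (auto simp: min.commute)

lemma race_zone_rf: assumes "race_zone m g q" shows "race_zone m (rf g) (rq q)"
  using assms[unfolded race_zone_def]
proof (elim disjE exE conjE)
  assume "late_zone m g q" thus ?thesis using late_zone_rf by (simp add: race_zone_def)
next
  fix b x1 d1 x2 d2 assume h: "PA0 b x1 d1 x2 d2 g q" "PA1 b x1 d1 x2 d2 g" "PAm x1 d1 x2 d2 g \<le> m"
  have "d1 = -1 \<or> d1 = 1" "d2 = -1 \<or> d2 = 1" using h(1) gside_dir unfolding PA0_def by blast+
  hence "PAm (- x1) (- d1) (- x2) (- d2) (rf g) = PAm x1 d1 x2 d2 g" using sgap_rf by (simp add: PAm_def)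
  thus ?thesis using PA0_rf[OF h(1)] PA1_rf[OF h(1,2)] h(3) unfolding race_zone_def by metis
qed

lemma race_zone_move_L: assumes "race_zone m g q" "q i = -1"
  shows "2 \<le> g (i - 1) \<and> race_zone (m - 1) (upd g i (-1)) (setq q i 0)"
  using assms(1)[unfolded race_zone_def]
proof (elim disjE exE conjE)
  assume "late_zone m g q" thus ?thesis using late_zone_move_L assms(2) by (simp add: race_zone_def)
next
  have main: ?thesis if h: "PA0 b x1 d1 x2 d2 g q" "PA1 b x1 d1 x2 d2 g" "PAm x1 d1 x2 d2 g \<le> m" "cg i x1" "d1 = -1" for b x1 d1 x2 d2
  proof -
    note A = h(1)[unfolded PA0_def]
    have v: "valid g" and pq: "per q" using A by auto
    have p: "per g" using v validD by blast
    have P: "PA0 b x1 (-1) x2 d2 g q" using h by simp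
    have q1: "q x1 = -1" using per_cg[OF pq h(4)] assms(2) by simp
    let ?g = "upd g x1 (-1)" let ?q = "setq q x1 0"
    have s1: "gside g b x1 (-1)" and s2: "gside g b x2 d2" using A h by auto
    have g2: "2 \<le> g (x1 - 1)" using PA0_move_L(1)[OF P q1] .
    have "race_zone (m - 1) ?g ?q"
    proof (cases "g (x1 - 1) = 2")
      case True
      have "60 * (N * N) \<le> m - 1" using h(3) sgap_pos[OF v, of x1 d1] sgap_pos[OF v, of x2 d2] by (simp add: PAm_def)
      thus ?thesis using PA0_move_L(3)[OF P q1 True] late_zone_mono by (simp add: race_zone_def)
    next
      case False
      hence g3: "3 \<le> g (x1 - 1)" using g2 by simp
      have P': "PA0 b x1 (-1) x2 d2 ?g ?q" and G: "\<And>x d. gside ?g b x d = gside g b x d" using PA0_move_L(2)[OF P q1 g3] by auto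
      have e1: "sgap ?g x1 (-1) = sgap g x1 (-1) - 1" using sgap_upd(3)[OF v s1 s1] by simp
      have e2: "sgap ?g x2 d2 \<le> sgap g x2 d2" 
      proof (cases "cg x2 x1")
        case True
        hence "d2 = -1" using A h(5) cg_sym by blast
        thus ?thesis using sgap_upd(3)[OF v s1 s2 True] by simp
      qed (use sgap_upd(2)[OF v s1 s2] in simp)
      \<comment> \<open>The tracked gap shrinks and no gap of a side outside the tracked pair does,
        so no further competitor can reach the minimum.\<close>
      have "PA1 b x1 (-1) x2 d2 ?g" unfolding PA1_def
      proof (intro allI impI)
        fix x d assume x: "gside ?g b x d \<and> sgap ?g x d \<le> min (sgap ?g x1 (-1)) (sgap ?g x2 d2)"
        show "cg x x1 \<and> d = -1 \<or> cg x x2 \<and> d = d2"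
        proof (cases "cg x x1 \<and> d = -1")
          case n: False
          have gs: "gside g b x d" using x G by simp
          have "sgap g x d \<le> sgap ?g x d" 
          proof (cases "cg x x1")
            case True
            hence "d = 1" using n gside_dir[OF gs] by blast
            thus ?thesis using sgap_upd(1)[OF v s1 gs True] by simp
          qed (use sgap_upd(2)[OF v s1 gs] in simp)
          hence "sgap g x d \<le> min (sgap g x1 (-1)) (sgap g x2 d2)" using x e1 e2 by auto
          thus ?thesis using h(2) gs h(5) unfolding PA1_def by blast
        qed simp
      qed
      moreover have "PAm x1 (-1) x2 d2 ?g \<le> m - 1" using h(3,5) e1 e2 by (simp add: PAm_def)
      ultimately show ?thesis using P' unfolding race_zone_def by blast
    qed
    moreover have "cg (i - 1) (x1 - 1)" using h(4) by simp
    hence "g (i - 1) = g (x1 - 1)" using per_cg[OF p] by blast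
    ultimately show ?thesis using g2 upd_cong[OF h(4)] setq_cong[OF h(4)] by simp
  qed
  fix b x1 d1 x2 d2 assume h: "PA0 b x1 d1 x2 d2 g q" "PA1 b x1 d1 x2 d2 g" "PAm x1 d1 x2 d2 g \<le> m"
  have "cg i x1 \<and> d1 = -1 \<or> cg i x2 \<and> d2 = -1" using h(1) assms(2) unfolding PA0_def by (metis zero_neq_neg_one)
  thus ?thesis
  proof
    assume "cg i x1 \<and> d1 = -1" thus ?thesis using main[OF h] by blast
  next
    assume "cg i x2 \<and> d2 = -1"
    moreover have "PAm x2 d2 x1 d1 g \<le> m" using h(3) by (simp add: PAm_def add.commute)
    ultimately show ?thesis using main[OF PA0_swap[OF h(1)] PA1_swap[OF h(2)]] by blast
  qed
qed

lemma F_sel: assumes m: "max_run g b" "b < K" "\<not> one_head g b" "exG g b" and d: "d \<in> F g i"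
  shows "gside g b i d" "gside g b x d' \<Longrightarrow> sgap g i d \<le> sgap g x d'"
    "gside g b x d' \<Longrightarrow> sgap g x d' \<le> sgap g i d \<Longrightarrow> view g x \<le> view g i"
proof -
  have A: "gside g b i (-1) \<and> (\<forall>x d'. gside g b x d' \<longrightarrow> sgap g i (-1) \<le> sgap g x d' \<and> (sgap g x d' \<le> sgap g i (-1) \<longrightarrow> view g x \<le> view g i))"
    if "sel g b i" for g i
  proof -
    have b: "best g b i" using that by (simp add: sel_def)
    have le1: "g (i - 1) \<le> g (x - 1)" if "good g b x" for x using b that by (simp add: best_def)
    have le2: "g (i - 1) \<le> g x" if "good (rf g) b (- x)" for x
    proof -
      have "g (i - 1) \<le> rf g (- x - 1)" using b that unfolding best_def by blast
      thus ?thesis by (simp add: rf_def)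
    qed
    have v1: "view g x \<le> view g i" if "good g b x" "g (x - 1) \<le> g (i - 1)" for x
    proof -
      have "best g b x" using b that order_trans[OF that(2)] unfolding best_def by blast
      thus ?thesis using \<open>sel g b i\<close> by (simp add: sel_def)
    qed
    have v2: "view g x \<le> view g i" if "good (rf g) b (- x)" "g x \<le> g (i - 1)" for x
    proof -
      have e: "rf g (- x - 1) = g x" by (simp add: rf_def)
      have "best (rf g) b (- x)" using b that order_trans[OF that(2)] unfolding best_def e by auto
      hence "view (rf g) (- x) \<le> view g i" using \<open>sel g b i\<close> unfolding sel_def by blast
      thus ?thesis by (simp add: view_rf)
    qed
    have gi: "gside g b i (-1)" using b by (auto simp: best_def gside_def)
    show ?thesis using gi le1 le2 v1 v2 by (auto simp: gside_def sgap_def)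
  qed
  have "d = -1 \<and> sel g b i \<or> d = 1 \<and> sel (rf g) b (- i)"
    using mxF[OF m(1,2)] m(3,4) d by (auto simp: r3_def exG_rf)
  hence "gside g b i d \<and> (\<forall>x d'. gside g b x d' \<longrightarrow> sgap g i d \<le> sgap g x d' \<and> (sgap g x d' \<le> sgap g i d \<longrightarrow> view g x \<le> view g i))"
  proof
    assume "d = -1 \<and> sel g b i" thus ?thesis using A by blast
  next
    assume h: "d = 1 \<and> sel (rf g) b (- i)"
    note B = A[of "rf g" "- i"]
    have g1: "gside g b i 1" using B h gside_rf[of g b i 1] by simp
    have "sgap g i 1 \<le> sgap g x d' \<and> (sgap g x d' \<le> sgap g i 1 \<longrightarrow> view g x \<le> view g i)" if "gside g b x d'" for x d'
    proof -
      have dd: "d' = -1 \<or> d' = 1" using gside_dir[OF that] .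
      have "gside (rf g) b (- x) (- d')" using that gside_rf by simp
      hence "sgap (rf g) (- i) (-1) \<le> sgap (rf g) (- x) (- d') \<and>
        (sgap (rf g) (- x) (- d') \<le> sgap (rf g) (- i) (-1) \<longrightarrow> view (rf g) (- x) \<le> view (rf g) (- i))" using B h by blast
      thus ?thesis using sgap_rf[OF dd, of g x] sgap_rf[of 1 g i] by (simp add: view_rf)
    qed
    thus ?thesis using g1 h by simp
  qed
  thus "gside g b i d" "gside g b x d' \<Longrightarrow> sgap g i d \<le> sgap g x d'"
    "gside g b x d' \<Longrightarrow> sgap g x d' \<le> sgap g i d \<Longrightarrow> view g x \<le> view g i" by auto
qed

lemma gside_exG: "gside g b x d \<Longrightarrow> exG g b" by (auto simp: gside_def exG_def)

text \<open>A selected side has the smallest gap of all sides. By \<open>PA1\<close> only the two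
  tracked sides attain a value that small, so the new pending move is one already accounted
  for.\<close>

lemma race_zone_look: assumes "race_zone m g q" "d \<in> F g i" "q i = 0" shows "race_zone m g (setq q i d)"
  using assms(1)[unfolded race_zone_def]
proof (elim disjE exE conjE)
  assume "late_zone m g q" thus ?thesis using late_zone_look assms by (simp add: race_zone_def)
next
  fix b x1 d1 x2 d2 assume h: "PA0 b x1 d1 x2 d2 g q" "PA1 b x1 d1 x2 d2 g" "PAm x1 d1 x2 d2 g \<le> m"
  note A = h(1)[unfolded PA0_def]
  have bK: "b < K" using F_mx[OF assms(2)] max_run_unique A by metis
  have ex: "exG g b" using A gside_exG by blast
  note S = F_sel[of g b, OF _ bK _ ex assms(2)]
  have "gside g b i d \<and> sgap g i d \<le> min (sgap g x1 d1) (sgap g x2 d2)" using S A by auto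
  hence c: "cg i x1 \<and> d = d1 \<or> cg i x2 \<and> d = d2" using h(2) unfolding PA1_def by blast
  have "PA0 b x1 d1 x2 d2 g (setq q i d)"
  proof -
    have "setq q i d j \<noteq> 0 \<longrightarrow> cg j x1 \<and> setq q i d j = d1 \<or> cg j x2 \<and> setq q i d j = d2" for j
    proof (cases "cg j i")
      case True
      have "setq q i d j = d" using True by (simp add: setq_def)
      thus ?thesis using c True cg_trans by blast
    next
      case False
      have "setq q i d j = q j" using False by (simp add: setq_def)
      thus ?thesis using A by metis
    qed
    thus ?thesis unfolding PA0_def using A per_setq by auto
  qed
  thus ?thesis using h unfolding race_zone_def by blast
qed

lemma race_zone_vals: assumes "race_zone m g q" shows "valid g" "per q" "q i \<in> {-1, 0, 1}"
proof -
  show "valid g" "per q" using assms late_zone_vals unfolding race_zone_def PA0_def by blast+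
  show "q i \<in> {-1, 0, 1}"
    using assms late_zone_vals(3) gside_dir unfolding race_zone_def PA0_def by (metis insertI1 insertI2)
qed

lemma race_zone_final: assumes "race_zone m g q" "max_run g K" shows "q i = 0"
  using assms(1)[unfolded race_zone_def]
proof (elim disjE exE conjE)
  assume "late_zone m g q" thus ?thesis using late_zone_final assms(2) by blast
next
  fix b x1 d1 x2 d2 assume "PA0 b x1 d1 x2 d2 g q"
  hence "valid g" "max_run g b" "\<not> one_head g b" by (auto simp: PA0_def)
  thus ?thesis using twohd(2) max_run_unique[OF assms(2)] by fastforce
qed

section \<open>The sum of squared gaps, and configurations without \<open>sideA\<close>\<close>

definition sum_sq :: "(int \<Rightarrow> int) \<Rightarrow> int" where "sum_sq g = (\<Sum>j\<in>{0..<K}. g j * g j)"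

lemma sum_sq_bd: assumes "valid g" shows "0 \<le> sum_sq g" "sum_sq g \<le> N * N"
proof -
  show "0 \<le> sum_sq g" unfolding sum_sq_def by (intro sum_nonneg) simp
  have "sum_sq g \<le> (\<Sum>j\<in>{0..<K}. g j * N)" unfolding sum_sq_def
    using validD(2)[OF assms] g_le[OF assms] by (intro sum_mono mult_left_mono) (auto intro: order_trans[OF zero_le_one])
  also have "\<dots> = N * N" using assms by (simp add: valid_def sum_distrib_right[symmetric])
  finally show "sum_sq g \<le> N * N" .
qed

text \<open>Replacing the gaps \<open>a\<close>, \<open>b\<close> on both sides of the robot by
  \<open>a - 1\<close>, \<open>b + 1\<close> changes the sum of their squares by
  \<open>2 * (b - a) + 2\<close>. This is at least 2 if the robot approaches its nearer
  neighbour.\<close>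

lemma sum_sq_upd: assumes "per g" shows "sum_sq (upd g i (-1)) = sum_sq g + 2 * (g i - g (i - 1)) + 2"
proof -
  have "upd g i (-1) j * upd g i (-1) j = g j * g j + (if cg j (i - 1) then 1 - 2 * g (i - 1) else 0) + (if cg j i then 2 * g i + 1 else 0)" for j
  proof -
    consider "cg j (i - 1)" "\<not> cg j i" | "cg j i" "\<not> cg j (i - 1)" | "\<not> cg j i" "\<not> cg j (i - 1)"
      using not_cg_pred cg_trans cg_sym by blast
    thus ?thesis
    proof cases
      case 1
      have "g j = g (i - 1)" using per_cg[OF assms 1(1)] .
      hence u: "upd g i (-1) j = g (i - 1) - 1" "g j = g (i - 1)" using upd_at[OF assms 1(1), of "-1"] by simp_all
      have "(a - 1) * (a - 1) = a * a + (1 - 2 * a)" for a :: int by (simp add: algebra_simps)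
      thus ?thesis unfolding u using 1 by simp
    next
      case 2
      have "g j = g i" using per_cg[OF assms 2(1)] .
      hence u: "upd g i (-1) j = g i + 1" "g j = g i" using upd_at2[OF assms 2(1), of "-1"] by simp_all
      have "(a + 1) * (a + 1) = a * a + (2 * a + 1)" for a :: int by (simp add: algebra_simps)
      thus ?thesis unfolding u using 2 by simp
    next
      case 3 thus ?thesis by (simp add: upd_def)
    qed
  qed
  hence "sum_sq (upd g i (-1)) = (\<Sum>j\<in>{0..<K}. g j * g j + (if cg j (i - 1) then 1 - 2 * g (i - 1) else 0) + (if cg j i then 2 * g i + 1 else 0))"
    unfolding sum_sq_def by simp
  also have "\<dots> = sum_sq g + (1 - 2 * g (i - 1)) + (2 * g i + 1)" unfolding sum_sq_def sum.distrib sum_ind ..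
  finally show ?thesis by simp
qed

lemma no_sideA: assumes "\<not> exA g b"
  shows "in_run g b (r - 1) \<Longrightarrow> \<not> in_run g b r \<Longrightarrow> in_run g b (r + 1)" "in_run g b (r + 1) \<Longrightarrow> \<not> in_run g b r \<Longrightarrow> in_run g b (r - 1)"
proof -
  have "\<not> sideA g b r" "\<not> sideA (rf g) b (- r)" using assms by (auto simp: exA_def)
  thus "in_run g b (r - 1) \<Longrightarrow> \<not> in_run g b r \<Longrightarrow> in_run g b (r + 1)" "in_run g b (r + 1) \<Longrightarrow> \<not> in_run g b r \<Longrightarrow> in_run g b (r - 1)"
    unfolding sideA_def in_run_rf by (auto simp: add.commute)
qed

text \<open>Without \<open>sideA\<close> in either direction, two adjacent non-heavy robots would
  force the next one to be non-heavy, and so on around the ring, although a heavy run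
  exists.\<close>

lemma flank: assumes "valid g" "max_run g b" "\<not> exA g b" "\<not> in_run g b r" shows "in_run g b (r - 1)" "in_run g b (r + 1)"
proof -
  show l: "in_run g b (r - 1)"
  proof (rule ccontr)
    assume n: "\<not> in_run g b (r - 1)"
    have "\<not> in_run g b (r + int m - 1) \<and> \<not> in_run g b (r + int m)" for m
    proof (induction m)
      case 0 thus ?case using n assms(4) by simp
    next
      case (Suc m)
      have "\<not> in_run g b (r + int m + 1)" using no_sideA(2)[OF assms(3), of "r + int m"] Suc by blast
      moreover have "r + int (Suc m) - 1 = r + int m" "r + int (Suc m) = r + int m + 1" by simp_all
      ultimately show ?case using Suc by metis
    qed
    moreover obtain l where l: "run g b l" using assms by (auto simp: max_run_def)
    moreover obtain j where j: "r \<le> j" "cg j l" using cg_rep by blast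
    have "in_run g b l" using in_run_in[OF l, of 0] assms by (simp add: max_run_def)
    hence "in_run g b j" using in_run_cg[OF validD(1)[OF assms(1)] j(2)] by simp
    hence "in_run g b (r + int (nat (j - r)))" using j by simp
    ultimately show False by blast
  qed
  thus "in_run g b (r + 1)" using no_sideA(1)[OF assms(3)] assms(4) by blast
qed

lemma in_run_ends: assumes "valid g" "max_run g b" "\<not> in_run g b r" shows "in_run g b (r - 1) \<Longrightarrow> 2 \<le> g (r - 1)" "in_run g b (r + 1) \<Longrightarrow> 2 \<le> g r"
proof -
  have A: "2 \<le> g (r - 1)" if "valid g" "max_run g b" "\<not> in_run g b r" "in_run g b (r - 1)" for g r
  proof (rule ccontr)
    assume n: "\<not> 2 \<le> g (r - 1)"
    have rn: "run g b (r - b)" using side_run that by blast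
    have "g (r - 1) = 1" using n validD(2)[OF that(1), of "r-1"] by simp
    hence "run g (b + 1) (r - b)" using run_snoc[OF rn] by simp
    thus False using that(2) by (auto simp: max_run_def)
  qed
  show "in_run g b (r - 1) \<Longrightarrow> 2 \<le> g (r - 1)" using A assms by blast
  assume "in_run g b (r + 1)"
  hence "2 \<le> rf g (- r - 1)" using A[of "rf g" "- r"] assms valid_rf by (simp add: max_run_rf in_run_rf add.commute)
  thus "2 \<le> g r" by (simp add: rf_def)
qed

lemma nonheavy_iso: assumes "valid g" "max_run g b" "\<not> exA g b" "\<not> in_run g b r" shows "iso g r"
  unfolding iso_def using flank[OF assms] in_run_ends[OF assms(1,2,4)] by simp

lemma exA_exG: "exA g b \<Longrightarrow> exG g b" unfolding exG_def good_def exA_rf by (auto simp: exA_def)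

text \<open>Before the first join the pending moves are those of the current configuration; the sum of the squared gaps
  grows as long as isolated robots approach their nearer neighbours.\<close>

definition Init :: "(int \<Rightarrow> int) \<Rightarrow> (int \<Rightarrow> int) \<Rightarrow> bool" where
  "Init g q \<longleftrightarrow> valid g \<and> nonper g \<and> per q \<and> (\<exists>b. max_run g b \<and> \<not> one_head g b) \<and> (\<forall>i. q i \<noteq> 0 \<longrightarrow> q i \<in> F g i)"
definition Im :: "(int \<Rightarrow> int) \<Rightarrow> int" where "Im g = 80 * (N * N) + (N * N - sum_sq g)"
definition INV :: "int \<Rightarrow> (int \<Rightarrow> int) \<Rightarrow> (int \<Rightarrow> int) \<Rightarrow> bool" where
  "INV m g q \<longleftrightarrow> race_zone m g q \<or> Init g q \<and> Im g \<le> m"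

text \<open>All pending robots were selected in the current configuration, so they have the same gap
  and the same view; nonperiodicity leaves at most two of them.\<close>

lemma Init_sel: assumes I: "Init g q" and m: "max_run g b" "\<not> one_head g b" and ex: "exG g b" and q: "q i = -1"
  shows "2 \<le> g (i - 1) \<and> race_zone (80 * (N * N) - 1) (upd g i (-1)) (setq q i 0)"
proof -
  note A = I[unfolded Init_def]
  have v: "valid g" and np: "nonper g" and pq: "per q" using A by auto
  have p: "per g" using v validD by blast
  have bK: "b < K" using twohd[OF v m] by simp
  note S = F_sel[OF m(1) bK m(2) ex]
  have Fi: "-1 \<in> F g i" using A q by (metis zero_neq_neg_one)
  have Fj: "q j \<in> F g j" if "q j \<noteq> 0" for j using A that by blast
  have view_eq: "view g j = view g i" if "q j \<noteq> 0" for j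
  proof -
    have "sgap g j (q j) \<le> sgap g i (-1)" using S(2)[OF Fj[OF that] S(1)[OF Fi]] .
    moreover have "sgap g i (-1) \<le> sgap g j (q j)" using S(2)[OF Fi S(1)[OF Fj[OF that]]] .
    ultimately show ?thesis using S(3)[OF Fj[OF that] S(1)[OF Fi]] S(3)[OF Fi S(1)[OF Fj[OF that]]] by auto
  qed
  have "\<exists>x2 d2. PA0 b i (-1) x2 d2 g q \<and> sgap g x2 d2 \<ge> sgap g i (-1)"
  proof (cases "\<exists>j. q j \<noteq> 0 \<and> \<not> cg j i")
    case False
    hence "cg j i \<and> q j = -1" if "q j \<noteq> 0" for j using that per_cg[OF pq, of j i] q by auto
    hence "PA0 b i (-1) i (-1) g q" unfolding PA0_def using v pq m S(1)[OF Fi] by auto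
    thus ?thesis by blast
  next
    case True
    then obtain j where j: "q j \<noteq> 0" "\<not> cg j i" by blast
    have P: "cg r i \<and> q r = -1 \<or> cg r j \<and> q r = q j" if r: "q r \<noteq> 0" for r
    proof -
      have "cg r j \<or> cg r i" using no_three[OF p np, of j i r] view_eq[OF j(1)] view_eq[OF r] j(2) by metis
      thus ?thesis using per_cg[OF pq] q by metis
    qed
    have "PA0 b i (-1) j (q j) g q" unfolding PA0_def using v pq m S(1)[OF Fi] S(1)[OF Fj[OF j(1)]] j(2) cg_sym P by blast
    moreover have "sgap g j (q j) \<ge> sgap g i (-1)" using S(2)[OF Fi S(1)[OF Fj[OF j(1)]]] .
    ultimately show ?thesis by blast
  qed
  then obtain x2 d2 where P: "PA0 b i (-1) x2 d2 g q" "sgap g i (-1) \<le> sgap g x2 d2" by blast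
  let ?g = "upd g i (-1)" let ?q = "setq q i 0"
  have gap: "2 \<le> g (i - 1)" using PA0_move_L(1)[OF P(1) q] .
  have "race_zone (80 * (N * N) - 1) ?g ?q"
  proof (cases "g (i - 1) = 2")
    case True
    have "60 * (N * N) \<le> 80 * (N * N) - 1" using NN7 N7 by linarith
    thus ?thesis using PA0_move_L(3)[OF P(1) q True] late_zone_mono unfolding race_zone_def by blast
  next
    case False
    hence g3: "3 \<le> g (i - 1)" using gap by simp
    have P': "PA0 b i (-1) x2 d2 ?g ?q" and G: "\<And>x d. gside ?g b x d = gside g b x d" using PA0_move_L(2)[OF P(1) q g3] by auto
    have s1: "gside g b i (-1)" using S(1)[OF Fi] .
    have e1: "sgap ?g i (-1) = sgap g i (-1) - 1" using sgap_upd(3)[OF v s1 s1] by simp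
    \<comment> \<open>Before the move, sides with the same gap but a smaller view may exist. The
      first move makes the gap of \<open>i\<close> strictly smaller than that of all sides outside
      the tracked pair, and the view no longer matters.\<close>
    have "PA1 b i (-1) x2 d2 ?g" unfolding PA1_def
    proof (intro allI impI)
      fix x d assume x: "gside ?g b x d \<and> sgap ?g x d \<le> min (sgap ?g i (-1)) (sgap ?g x2 d2)"
      show "cg x i \<and> d = -1 \<or> cg x x2 \<and> d = d2"
      proof (cases "cg x i \<and> d = -1")
        case n: False
        have gs: "gside g b x d" using x G by simp
        have "sgap g x d \<le> sgap ?g x d" 
        proof (cases "cg x i")
          case True
          hence "d = 1" using n gside_dir[OF gs] by blast
          thus ?thesis using sgap_upd(1)[OF v s1 gs True] by simp
        qed (use sgap_upd(2)[OF v s1 gs] in simp)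
        moreover have "sgap g i (-1) \<le> sgap g x d" using S(2)[OF Fi gs] .
        ultimately show ?thesis using x e1 by auto
      qed simp
    qed
    moreover have v': "valid ?g" using P' by (simp add: PA0_def)
    have "PAm i (-1) x2 d2 ?g \<le> 80 * (N * N) - 1"
      using sgap_le[OF v', of i "-1"] sgap_le[OF v', of x2 d2] NN7 N7 unfolding PAm_def distrib_left by linarith
    ultimately show ?thesis using P' unfolding race_zone_def by blast
  qed
  thus ?thesis using gap by blast
qed

lemma topc_ex: assumes "valid g" "iso g r" shows "\<exists>r. topc g r"
proof -
  have "0 \<le> z1 g r" for r using validD(2)[OF assms(1), of r] validD(2)[OF assms(1), of "r-1"] by (simp add: z1_def)
  then obtain r where "cand g r" unfolding cand_def using ex_minval[of "iso g" r "z1 g"] assms(2) by blast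
  thus ?thesis unfolding topc_def using ex_maxvw[OF validD(1)[OF assms(1)], of "cand g"] by blast
qed

text \<open>Top candidates share the maximal view, so if one of them is unique they all coincide; in
  the fallback case uniqueness of the view is required directly.\<close>

lemma pS_unique: assumes "pS g i" "pS g j" shows "cg j i"
proof (cases "\<exists>r'. topc g r' \<and> uniq g r'")
  case True
  then obtain r where r: "topc g r" "uniq g r" by blast
  have "topc g i" "topc g j" using assms True by (auto simp: pS_def)
  hence "view g i = view g r" "view g j = view g r" using r unfolding topc_def by (auto intro: antisym)
  thus ?thesis using r(2) cg_trans cg_sym unfolding uniq_def by blast
next
  case False
  hence "isou g i" "isou g j" using assms unfolding pS_def by auto
  thus ?thesis unfolding isou_def uniq_def by (metis antisym)
qed

text \<open>A moved top candidate obtains a singular small gap (\<open>nonper_upd_top\<close>). In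
  the fallback case the top candidates have mirror images, so the moved robot is on the axis
  (\<open>nonper_upd_mid\<close>).\<close>

lemma pS_nonper: assumes v: "valid g" and np: "nonper g" and pS: "pS g i" "g (i - 1) \<le> g i" "3 \<le> g (i - 1)"
  shows "nonper (upd g i (-1))"
proof (cases "\<exists>r'. topc g r' \<and> uniq g r'")
  case True
  hence "cand g i" using pS by (auto simp: pS_def topc_def)
  thus ?thesis using nonper_upd_top v pS by blast
next
  case False
  hence i: "isou g i" using pS unfolding pS_def by auto
  obtain r where r: "topc g r" using topc_ex v i unfolding isou_def by blast
  hence "\<not> uniq g r" using False by blast
  then obtain r' where r': "view g r' = view g r" "\<not> cg r' r" unfolding uniq_def by blast
  have p: "per g" using v validD by blast
  have "refl_at g (r' + r)" using same_view[OF p np r'(1)] r'(2) by blast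
  moreover have "cg (2 * i) (r' + r)" using uniq_refl[OF calculation] i by (simp add: isou_def)
  ultimately show ?thesis using nonper_upd_mid[OF p] by simp
qed

text \<open>Only one robot can be pending. Either it joins a neighbour and \<open>join_W\<close>
  applies without a second pending robot, or the configuration stays nonperiodic and the sum of
  squared gaps grows.\<close>

lemma Init_iso: assumes I: "Init g q" and m: "max_run g b" "\<not> one_head g b" and ex: "\<not> exG g b" "\<exists>r. pS g r" and q: "q i = -1"
  shows "2 \<le> g (i - 1) \<and> INV (Im g - 1) (upd g i (-1)) (setq q i 0)"
proof -
  note A = I[unfolded Init_def]
  have v: "valid g" and np: "nonper g" and pq: "per q" using A by auto
  have p: "per g" using v validD by blast
  have b2: "b + 2 \<le> K" "b < K" using twohd[OF v m] by auto
  have FS: "pS g j \<and> (d = -1 \<longrightarrow> g (j - 1) \<le> g j)" if "d \<in> F g j" for j d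
  proof -
    have ex': "\<not> exG (rf g) b" "\<exists>r. pS (rf g) r" using ex unfolding exG_rf pS_rf by (auto intro: exI[of _ "- r" for r] simp: ex_neg)
    have "d = -1 \<and> r3 g b j \<or> d = 1 \<and> r3 (rf g) b (- j)" using mxF[OF m(1) b2(2)] m(2) that by auto
    thus ?thesis using ex ex' unfolding r3_def pS_rf by (auto simp: pS_rf)
  qed
  have "-1 \<in> F g i" using A q by (metis zero_neq_neg_one)
  hence i: "pS g i" "g (i - 1) \<le> g i" using FS by blast+
  have ii: "iso g i" using pS_iso i by blast
  let ?g = "upd g i (-1)" let ?q = "setq q i 0"
  have q0: "?q j = 0" for j
  proof (rule ccontr)
    assume j: "?q j \<noteq> 0"
    hence "q j \<noteq> 0" "\<not> cg j i" by (auto simp: setq_def split: if_splits)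
    hence "pS g j" using A FS by blast
    hence "cg j i" using pS_unique i by blast
    thus False using \<open>\<not> cg j i\<close> by blast
  qed
  have gap: "2 \<le> g (i - 1)" using ii by (simp add: iso_def)
  have v': "valid ?g" using valid_upd[OF v] gap by simp
  have "INV (Im g - 1) ?g ?q"
  proof (cases "g (i - 1) = 2")
    case True
    have nA: "\<not> exA g b" using ex exA_exG by blast
    have "run g b (i - b)"
    proof (cases "2 \<le> b")
      case True
      have "\<not> in_run g b i" using iso_not_inr[OF ii True] .
      thus ?thesis using side_run flank[OF v m(1) nA] by blast
    qed simp
    hence "late_zone (60 * (N * N)) ?g ?q" using join_W[OF v pq m(1) b2(1) _ True] q0 by simp
    moreover have "60 * (N * N) \<le> Im g - 1" using sum_sq_bd[OF v] NN7 N7 unfolding Im_def by linarith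
    ultimately show ?thesis unfolding INV_def race_zone_def using late_zone_mono by blast
  next
    case False
    hence g3: "3 \<le> g (i - 1)" using gap by simp
    have R: "run ?g b j \<longleftrightarrow> run g b j" for j
    proof
      assume r: "run g b j"
      show "run ?g b j"
      proof (rule run_keep[OF v gap r])
        fix t assume "j \<le> t" "t < j + b - 1"
        hence "g t = 1" using r by (simp add: run_def)
        thus "\<not> cg t i" using per_cg[OF p, of t i] ii by (auto simp: iso_def)
      qed
    qed (use approach_run v g3 in blast)
    have "max_run ?g b" using m(1) R approach_run[OF v g3] unfolding max_run_def by blast
    moreover have "\<not> one_head ?g b" using m(2) same_heavy(2)[OF R] by simp
    ultimately have "Init ?g ?q" unfolding Init_def using v' pS_nonper[OF v np i g3] per_setq[OF pq] q0 by auto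
    moreover have "Im ?g \<le> Im g - 1" unfolding Im_def sum_sq_upd[OF p] using i by simp
    ultimately show ?thesis unfolding INV_def by blast
  qed
  thus ?thesis using gap by blast
qed

text \<open>Both ends of the centre run are sent towards the heavy runs that flank it. After the
  first step either a champion has appeared, or the centre run is no longer heavy and its two ends
  are the only robots satisfying \<open>sideA\<close>, so that they start a race.\<close>

lemma Init_mid: assumes v: "valid g" and pq: "per q" and m: "max_run g b" "\<not> one_head g b" and ex: "\<not> exG g b"
    and c: "cmid g b h c" and pend: "\<And>i. q i \<noteq> 0 \<Longrightarrow> cg i (c - h) \<and> q i = -1 \<or> cg i (c + h) \<and> q i = 1"
  shows "2 \<le> g (c - h - 1) \<and> race_zone (80 * (N * N) - 1) (upd g (c - h) (-1)) (setq q (c - h) 0)"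
proof -
  define e where "e = c - h" define f where "f = c + h"
  note C = c[unfolded cmid_def]
  have b: "b = 2 * h + 1" "1 \<le> h" "3 \<le> b" and fe: "f = e + b - 1" using C by (auto simp: e_def f_def)
  have r: "run g b e" and hl: "in_run g b (e - 1)" and hr: "in_run g b (e + b)" using C b unfolding e_def by (auto simp: algebra_simps)
  have p: "per g" using v validD by blast
  obtain j where j: "j \<le> e - 1" "e - 1 < j + b" "run g b j" using hl by (auto simp: in_run_def)
  hence "j = e - b" using heads_apart[OF m(1) j(3) r] by simp
  hence rD: "run g b (e - b)" using j by simp
  obtain j where j: "j \<le> e + b" "e + b < j + b" "run g b j" using hr by (auto simp: in_run_def)
  hence "j = e + b" using heads_apart[OF m(1) r j(3)] by simp
  hence rE: "run g b (e + b)" using j by simp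
  have "run g b (e - b + K)" using run_cg[OF p, of "e - b + K" "e - b"] rD by simp
  \<comment> \<open>By parity the flanking runs \<open>[e - b, e - 1]\<close> and
    \<open>[e + b, e + 2 * b - 1]\<close> are distinct modulo \<open>k\<close>, so there are three
    disjoint heavy runs.\<close>
  moreover have b2K: "2 * b < K" using twohd(1)[OF v m] Kodd by presburger
  ultimately have b3: "3 * b \<le> K" using heads_apart[OF m(1) rE, of "e - b + K"] by linarith
  have gf: "2 \<le> g f"
  proof (rule ccontr)
    assume "\<not> 2 \<le> g f"
    hence "g (e + b - 1) = 1" using validD(2)[OF v, of f] fe by simp
    thus False using run_snoc[OF r] m(1) by (auto simp: max_run_def)
  qed
  have ge: "2 \<le> g (e - 1)"
  proof (rule ccontr)
    assume "\<not> 2 \<le> g (e - 1)"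
    hence "g (e - 1) = 1" using validD(2)[OF v, of "e-1"] by simp
    hence "run g (1 + b) (e - 1)" using run_glue[of g 1 "e-1" b] r by simp
    thus False using m(1) by (auto simp: max_run_def add.commute)
  qed
  let ?g = "upd g e (-1)" let ?q = "setq q e 0"
  have v': "valid ?g" using valid_upd[OF v] ge by simp
  have p': "per ?g" using v' validD by blast
  have e2: "?g e = g e + 1" using upd_vals(2)[OF p] by simp
  have ng: "\<not> run ?g b e"
  proof
    assume "run ?g b e"
    hence "?g e = 1" using b unfolding run_def by auto
    thus False using e2 validD(2)[OF v, of e] by simp
  qed
  have pend': "cg i f \<and> ?q i = 1" if "?q i \<noteq> 0" for i
    using that pend[of i] unfolding e_def f_def by (auto simp: setq_def split: if_splits)
  have race_zone': "race_zone (80 * (N * N) - 1) ?g ?q"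
  proof (cases "g (e - 1) = 2")
    case True
    have "late_zone (60 * (N * N)) ?g ?q"
    proof (rule join_W[OF v pq m(1) _ rD True pend'])
      show "b + 2 \<le> K" using b3 b by simp
      have o1: "outc (e - b) (b + 1) f" unfolding outc_def using b b3 fe by (intro exI[of _ "2 * b - 1"]) (auto simp: algebra_simps)
      have o2: "outc (e - b) (b + 1) (f + 1)" unfolding outc_def using b b3 fe by (intro exI[of _ "2 * b"]) (auto simp: algebra_simps)
      have "\<not> cg f e" "\<not> cg f (e - 1)" using ncg(2)[of e f] ncg(2)[of "e - 1" f] fe b b3 by auto
      hence "2 \<le> ?g f" using upd_other gf by metis
      moreover have "\<not> in_run ?g b (e + 1)"
      proof
        assume "in_run ?g b (e + 1)"
        then obtain j where j: "j \<le> e + 1" "e + 1 < j + b" "run ?g b j" by (auto simp: in_run_def)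
        have "\<not> cg (j + b - 1) e" using ncg(2)[of e "j + b - 1"] j b b3 by simp
        hence rj: "run g b j" using join_run(1)[OF v ge j(3)] by blast
        have "j = e" using heads_apart[OF m(1) r rj] heads_apart[OF m(1) rj r] j b by linarith
        thus False using ng j by simp
      qed
      ultimately show "outc (e - b) (b + 1) f \<and> (cg f (e - b - 1) \<and> (1::int) = 1 \<or>
        outc (e - b) (b + 1) (f + 1) \<and> ((1::int) = -1 \<and> 2 \<le> ?g (f - 1) \<or> (1::int) = 1 \<and> 2 \<le> ?g f) \<and>
        (\<not> in_run ?g b (e + 1) \<or> \<not> in_run ?g b (e - b - 1)))" using o1 o2 by auto
    qed
    moreover have "60 * (N * N) \<le> 80 * (N * N) - 1" using NN7 N7 by linarith
    ultimately show ?thesis unfolding race_zone_def using late_zone_mono by blast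
  next
    case False
    hence g3: "3 \<le> g (e - 1)" using ge by simp
    have nE: "cg j e" if "run g b j" "cg t e" "j \<le> t" "t < j + b" for j t
    proof -
      have c: "cg (j + (e - t)) j" using that(2) by (simp add: cg_def dvd_diff_commute)
      have rj: "run g b (j + (e - t))" using run_cg[OF p c] that by simp
      have "j + (e - t) = e" using heads_apart[OF m(1) r rj] heads_apart[OF m(1) rj r] that b by linarith
      thus ?thesis using c cg_sym by simp
    qed
    have R: "run ?g b j \<longleftrightarrow> run g b j \<and> \<not> cg j e" for j
    proof
      assume rj: "run ?g b j"
      hence "\<not> cg j e" using ng run_cg[OF p'] by blast
      thus "run g b j \<and> \<not> cg j e" using approach_run[OF v g3 rj] by blast
    next
      assume rj: "run g b j \<and> \<not> cg j e"
      show "run ?g b j"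
      proof (rule run_keep[OF v ge])
        fix t assume "j \<le> t" "t < j + b - 1" thus "\<not> cg t e" using nE[of j t] rj by auto
      qed (use rj in blast)
    qed
    \<comment> \<open>Longest runs are disjoint, so opening the gap behind \<open>e\<close> removes
      precisely the robots of the centre run from the heavy ones.\<close>
    have I: "in_run ?g b x \<longleftrightarrow> in_run g b x \<and> outc e b x" for x
    proof
      assume "in_run ?g b x"
      then obtain j where j: "j \<le> x" "x < j + b" "run ?g b j" by (auto simp: in_run_def)
      hence rj: "run g b j" "\<not> cg j e" using R by auto
      have "outc e b x"
      proof (rule ccontr)
        assume "\<not> outc e b x"
        then obtain t where t: "0 \<le> t" "t < b" "cg x (e + t)" using not_outc by blast
        have c: "cg (j + (e + t - x)) j" using cg_sym[OF t(3)] by (simp add: cg_def)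
        have rj': "run g b (j + (e + t - x))" using run_cg[OF p c] rj by simp
        have "j + (e + t - x) = e" using heads_apart[OF m(1) r rj'] heads_apart[OF m(1) rj' r] j t by linarith
        thus False using c rj cg_sym by metis
      qed
      thus "in_run g b x \<and> outc e b x" using rj j unfolding in_run_def by blast
    next
      assume h: "in_run g b x \<and> outc e b x"
      then obtain j where j: "j \<le> x" "x < j + b" "run g b j" by (auto simp: in_run_def)
      have "\<not> cg j e"
      proof
        assume "cg j e"
        hence "cg (j + (x - j)) (e + (x - j))" by (simp only: cg_add)
        thus False using outc_not[of e b x "x - j"] h j by simp
      qed
      hence "run ?g b j" using R j by blast
      thus "in_run ?g b x" using j unfolding in_run_def by blast
    qed
    have m': "max_run ?g b"
    proof -
      have "\<not> cg (e - b) e" using ncg(1)[of "e - b" e] b b3 by simp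
      hence "run ?g b (e - b)" using R rD by blast
      thus ?thesis using m(1) approach_run[OF v g3] unfolding max_run_def by blast
    qed
    have no': "\<not> one_head ?g b"
    proof
      assume o: "one_head ?g b"
      have "\<not> cg (e - b) e" "\<not> cg (e + b) e" using ncg(1)[of "e - b" e] ncg(2)[of e "e + b"] b b3 by auto
      hence "cg (e - b) (e + b)" using o R rD rE unfolding one_head_def by blast
      thus False using ncg(1)[of "e - b" "e + b"] b b3 by simp
    qed
    have oe: "\<not> outc e b (e + t)" if "0 \<le> t" "t < b" for t using outc_not[of e b "e + t" t] that by auto
    have out1: "outc e b (e - 1)"
    proof -
      have "e + (K - 1) = e - 1 + K" by simp
      hence "cg (e - 1) (e + (K - 1))" by (simp only: cg_K cg_refl)
      thus ?thesis unfolding outc_def using b3 b by (intro exI[of _ "K - 1"]) auto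
    qed
    have fb: "f + 1 = e + b" using fe by simp
    have out2: "outc e b (f + 1)" unfolding outc_def fb using b3 b by (intro exI[of _ b]) simp
    have sA1: "sideA ?g b e" unfolding sideA_def I using oe[of 0] oe[of 1] out1 hl b by auto
    have sA2: "sideA (rf ?g) b (- f)"
    proof -
      have e: "- (- f - 1) = f + 1" "- (- f) = f" "- (- f + 1) = f - 1" by simp_all
      have ff: "f = e + (b - 1)" "f - 1 = e + (b - 2)" using fe by auto
      have "\<not> outc e b (e + (b - 1))" "\<not> outc e b (e + (b - 2))" by (rule oe; use b in linarith)+
      hence "\<not> outc e b f" "\<not> outc e b (f - 1)" using ff by metis+
      moreover have "in_run g b (f + 1)" unfolding fb by (rule hr)
      ultimately show ?thesis unfolding sideA_def in_run_rf e I using out2 by blast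
    qed
    have exA': "exA ?g b" "exA (rf ?g) b" using sA1 by (auto simp: exA_def)
    have sh1: "cg (x - 1) (e + (t - 1))" if "cg x (e + t)" for x t using cg_diff[of x 1 "e+t"] that by (simp add: algebra_simps)
    have sh2: "cg (x + 1) (e + (t + 1))" if "cg x (e + t)" for x t using cg_add[of x 1 "e+t"] that by (simp add: algebra_simps)
    have nA: "\<not> exA g b" using ex exA_exG by blast
    \<comment> \<open>No \<open>sideA\<close> existed before, so a new one must border the dissolved
      run. Inside that run only its first robot has a heavy left neighbour; the robot just before it
      is still heavy.\<close>
    have U1: "cg x e" if s: "sideA ?g b x" for x
    proof (cases "outc e b x")
      case False
      then obtain t where t: "0 \<le> t" "t < b" "cg x (e + t)" using not_outc by blast
      have "t = 0"
      proof (rule ccontr)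
        assume "t \<noteq> 0"
        hence "\<not> outc e b (x - 1)" using outc_not[of e b "x - 1" "t - 1"] sh1[OF t(3)] t by auto
        thus False using s unfolding sideA_def I by blast
      qed
      thus ?thesis using t by simp
    next
      case o: True
      have h: "in_run g b (x - 1)" "\<not> in_run g b x" using s o unfolding sideA_def I by auto
      hence "in_run g b (x + 1)" using no_sideA(1)[OF nA] by blast
      hence "\<not> outc e b (x + 1)" using s unfolding sideA_def I by blast
      then obtain t where t: "0 \<le> t" "t < b" "cg (x + 1) (e + t)" using not_outc by blast
      have cx: "cg x (e + (t - 1))" using sh1[OF t(3)] by simp
      have "t = 0" using outc_not[OF o, of "t - 1"] cx t by force
      hence "in_run g b x" using hl in_run_cg[OF p cx] by simp
      thus ?thesis using h by blast
    qed
    have U2: "cg x f" if s: "sideA (rf ?g) b (- x)" for x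
    proof -
      have ee: "- (- x - 1) = x + 1" "- (- x) = x" "- (- x + 1) = x - 1" by simp_all
      have s': "in_run ?g b (x + 1)" "\<not> in_run ?g b x" "\<not> in_run ?g b (x - 1)" using s unfolding sideA_def in_run_rf ee by auto
      show ?thesis
      proof (cases "outc e b x")
        case False
        then obtain t where t: "0 \<le> t" "t < b" "cg x (e + t)" using not_outc by blast
        have "t = b - 1"
        proof (rule ccontr)
          assume "t \<noteq> b - 1"
          hence "\<not> outc e b (x + 1)" using outc_not[of e b "x + 1" "t + 1"] sh2[OF t(3)] t by auto
          thus False using s' unfolding I by blast
        qed
        thus ?thesis using t fe by (simp add: add_diff_eq)
      next
        case o: True
        have h: "in_run g b (x + 1)" "\<not> in_run g b x" using s' o unfolding I by auto
        hence "in_run g b (x - 1)" using no_sideA(2)[OF nA] by blast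
        hence "\<not> outc e b (x - 1)" using s' unfolding I by blast
        then obtain t where t: "0 \<le> t" "t < b" "cg (x - 1) (e + t)" using not_outc by blast
        have cx: "cg x (e + (t + 1))" using sh2[OF t(3)] by simp
        have "t = b - 1" using outc_not[OF o, of "t + 1"] cx t by force
        hence "in_run g b x" using hr in_run_cg[OF p cx] by simp
        thus ?thesis using h by blast
      qed
    qed
    have gs: "gside ?g b x d \<Longrightarrow> cg x e \<and> d = -1 \<or> cg x f \<and> d = 1" for x d
      using U1 U2 exA' by (auto simp: gside_def good_def)
    have g1: "gside ?g b e (-1)" "gside ?g b f 1" using sA1 sA2 exA' by (auto simp: gside_def good_def)
    have "\<not> cg e f" using ncg(1)[of e f] fe b b3 by simp
    hence "PA0 b e (-1) f 1 ?g ?q" unfolding PA0_def using v' per_setq[OF pq] m' no' g1 pend' by auto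
    moreover have "PA1 b e (-1) f 1 ?g" unfolding PA1_def using gs by blast
    moreover have "PAm e (-1) f 1 ?g \<le> 80 * (N * N) - 1"
      using sgap_le[OF v', of e "-1"] sgap_le[OF v', of f 1] NN7 N7 unfolding PAm_def distrib_left by linarith
    ultimately show ?thesis unfolding race_zone_def by blast
  qed
  thus ?thesis using ge unfolding e_def by blast
qed

lemma Init_move_L: assumes I: "Init g q" and q: "q i = -1"
  shows "2 \<le> g (i - 1) \<and> INV (Im g - 1) (upd g i (-1)) (setq q i 0)"
proof -
  note A = I[unfolded Init_def]
  have v: "valid g" and np: "nonper g" and pq: "per q" using A by auto
  obtain b where m: "max_run g b" "\<not> one_head g b" using A by blast
  have bK: "b < K" using twohd[OF v m] by simp
  have Imle: "80 * (N * N) - 1 \<le> Im g - 1" using sum_sq_bd[OF v] by (simp add: Im_def)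
  have up: "INV (Im g - 1) g' q'" if "race_zone (80 * (N * N) - 1) g' q'" for g' q'
  proof -
    have "race_zone m g' q' \<Longrightarrow> m \<le> m' \<Longrightarrow> race_zone m' g' q'" for m m' unfolding race_zone_def using late_zone_mono by (meson order_trans)
    thus ?thesis using that Imle unfolding INV_def by blast
  qed
  consider "exG g b" | "\<not> exG g b" "\<exists>r. pS g r" | "\<not> exG g b" "\<not> (\<exists>r. pS g r)" by blast
  thus ?thesis
  proof cases
    case 1
    from Init_sel[OF I m 1 q] up show ?thesis by blast
  next
    case 2
    from Init_iso[OF I m 2 q] show ?thesis .
  next
    case 3
    have ex': "\<not> exG (rf g) b" "\<not> (\<exists>r. pS (rf g) r)" using 3 unfolding exG_rf pS_rf by auto
    have FF: "d = -1 \<and> (\<exists>h. topm g b h (j + h)) \<or> d = 1 \<and> (\<exists>h. topm g b h (j - h))" if "d \<in> F g j" for d j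
    proof -
      have "d = -1 \<and> r3 g b j \<or> d = 1 \<and> r3 (rf g) b (- j)" using mxF[OF m(1) bK] m(2) that by auto
      thus ?thesis using 3 ex' unfolding r3_def topm_rf by auto
    qed
    have "-1 \<in> F g i" using A q by (metis zero_neq_neg_one)
    then obtain h where h: "topm g b h (i + h)" using FF[of "-1" i] by auto
    define c where "c = i + h"
    have cm: "cmid g b h c" using h by (simp add: topm_def c_def)
    have tu: "h' = h \<and> cg x c" if "topm g b h' x" for h' x
    proof -
      have hh: "h' = h" using that cm by (auto simp: topm_def cmid_def)
      have "view g x = view g c" using that h unfolding hh topm_def c_def by (auto intro: antisym)
      thus ?thesis using cm hh unfolding cmid_def uniq_def by blast
    qed
    have pend: "cg j (c - h) \<and> q j = -1 \<or> cg j (c + h) \<and> q j = 1" if j: "q j \<noteq> 0" for j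
    proof -
      have "q j \<in> F g j" using A j by blast
      from FF[OF this] show ?thesis
      proof
        assume a: "q j = -1 \<and> (\<exists>h. topm g b h (j + h))"
        then obtain h' where "topm g b h' (j + h')" by blast
        hence "cg (j + h) c" using tu by blast
        thus ?thesis using a cg_move by blast
      next
        assume a: "q j = 1 \<and> (\<exists>h. topm g b h (j - h))"
        then obtain h' where "topm g b h' (j - h')" by blast
        hence "cg (j - h) c" using tu by blast
        hence "cg (j - h + h) (c + h)" by (simp only: cg_add)
        thus ?thesis using a by simp
      qed
    qed
    have "c - h = i" by (simp add: c_def)
    from Init_mid[OF v pq m 3(1) cm pend, unfolded this] up show ?thesis by blast
  qed
qed

section \<open>The invariant of the tower-free phase\<close>

lemma sum_sq_rf: "per g \<Longrightarrow> sum_sq (rf g) = sum_sq g" unfolding sum_sq_def using sum_rf[of g "\<lambda>x. x * x"] by simp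

lemma INV_rf: assumes "INV m g q" shows "INV m (rf g) (rq q)"
proof -
  have "Init (rf g) (rq q) \<and> Im (rf g) = Im g" if "Init g q"
  proof -
    note A = that[unfolded Init_def]
    have "rq q i \<in> F (rf g) i" if "rq q i \<noteq> 0" for i
    proof -
      have "q (- i) \<in> F g (- i)" using A that by (auto simp: rq_def)
      thus ?thesis using F_rf[of "- q (- i)" g "- i"] by (simp add: rq_def)
    qed
    thus ?thesis unfolding Init_def Im_def using A valid_rf nonper_rf per_rq sum_sq_rf validD(1)
      by (simp add: max_run_rf one_head_rf)
  qed
  thus ?thesis using assms race_zone_rf unfolding INV_def by auto
qed

lemma INV_mono: "INV m g q \<Longrightarrow> m \<le> m' \<Longrightarrow> INV m' g q"
  unfolding INV_def race_zone_def using late_zone_mono by (meson order_trans)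

lemma INV_move_L: assumes "INV m g q" "q i = -1" shows "2 \<le> g (i - 1) \<and> INV (m - 1) (upd g i (-1)) (setq q i 0)"
  using assms(1)[unfolded INV_def]
proof
  assume "race_zone m g q" thus ?thesis using race_zone_move_L assms(2) by (auto simp: INV_def)
next
  assume h: "Init g q \<and> Im g \<le> m"
  thus ?thesis using Init_move_L[of g q i] assms(2) INV_mono[of "Im g - 1" _ _ "m - 1"] by auto
qed
lemma INV_move_R: assumes "INV m g q" "q i = 1" shows "2 \<le> g i \<and> INV (m - 1) (upd g i 1) (setq q i 0)"
proof -
  have "rq q (- i) = -1" using assms(2) by (simp add: rq_def)
  from INV_move_L[OF INV_rf[OF assms(1)] this]
  have h: "2 \<le> rf g (- i - 1)" "INV (m - 1) (upd (rf g) (- i) (-1)) (setq (rq q) (- i) 0)" by auto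
  show ?thesis using h(1) INV_rf[OF h(2)] rq_upd[of g i] rq_upd(2)[of q i] by (simp add: rf_def)
qed

lemma INV_look: assumes "INV m g q" "d \<in> F g i" "q i = 0" shows "INV m g (setq q i d)"
  using assms(1)[unfolded INV_def]
proof
  assume "race_zone m g q" thus ?thesis using race_zone_look assms(2,3) by (auto simp: INV_def)
next
  assume h: "Init g q \<and> Im g \<le> m"
  have "setq q i d j \<in> F g j" if "setq q i d j \<noteq> 0" for j
  proof (cases "cg j i")
    case True
    \<comment> \<open>\<open>setq\<close> records the decision at all indices congruent to
      \<open>i\<close>; by \<open>F_sh\<close> and periodicity the rule agrees at all of
      them.\<close>
    obtain t where t: "j = i + t" by (metis diff_add_cancel add.commute)
    have "sh t g = g" if "cg t 0" for t unfolding sh_def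
    proof
      fix u have "cg (u + t) u" using \<open>cg t 0\<close> by (simp add: cg_def)
      thus "g (u + t) = g u" using per_cg h by (auto simp: Init_def validD)
    qed
    moreover have "cg t 0" using True t by (simp add: cg_def)
    ultimately have "F g j = F g i" using F_sh[of t g i] t by simp
    thus ?thesis using True assms(2) by (simp add: setq_def)
  next
    case False
    thus ?thesis using h that unfolding Init_def by (simp add: setq_def)
  qed
  hence "Init g (setq q i d)" using h per_setq unfolding Init_def by blast
  thus ?thesis using h unfolding INV_def by blast
qed

lemma INV_vals: assumes "INV m g q" shows "valid g" "per q" "q i \<in> {-1, 0, 1}" "0 \<le> m"
proof -
  show "valid g" "per q" using assms race_zone_vals unfolding INV_def Init_def by blast+
  show "q i \<in> {-1, 0, 1}"
    using assms race_zone_vals(3) unfolding INV_def Init_def F_def by fastforce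
  have champ_zone: "0 \<le> Wm l b c \<rho> g q" if "champ g l b c" for l b c \<rho> q
  proof -
    have "0 \<le> N * (K - b)" using that by (simp add: champ_def)
    moreover have "valid g" using that by (simp add: champ_def)
    moreover define NN where "NN = N * N"
    moreover have "0 \<le> NN" by (simp add: NN_def)
    ultimately show ?thesis using WA_bd(1)[of g l b q] unfolding Wm_def NN_def[symmetric] by auto
  qed
  have Z: "0 \<le> Zm l1 b1 p b2 p' g q" if "two_champ g l1 b1 p b2 p'" for l1 b1 p b2 p' q
  proof -
    have "0 \<le> N * (p + p')" "valid g" using that by (auto simp: two_champ_def)
    moreover define NN where "NN = N * N"
    moreover have "0 \<le> NN" by (simp add: NN_def)
    moreover have v: "valid g" using that by (simp add: two_champ_def)
    ultimately show ?thesis using ZA_bd(1)[OF v, of p "l1 + b1 - 1" "l1 + b1 + p - 1" b1 b2 "q (l1 + b1)"]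
      ZA_bd(1)[OF v, of p' "l1 + b1 + p + b2 - 1" "l1 - 1" b2 b1 "q (l1 - 1)"] unfolding Zm_def NN_def[symmetric] by linarith
  qed
  have NN0: "0 \<le> N * N" by simp
  from assms show "0 \<le> m" unfolding INV_def race_zone_def late_zone_def
  proof (elim disjE exE conjE)
    fix l b c \<rho> x dx assume "champ_zone l b c \<rho> x dx g q" "Wm l b c \<rho> g q \<le> m"
    thus ?thesis using champ_zone unfolding champ_zone_def by (meson order_trans)
  next
    fix l1 b1 p b2 p' assume "pair_zone l1 b1 p b2 p' g q" "Zm l1 b1 p b2 p' g q \<le> m"
    thus ?thesis using Z unfolding pair_zone_def by (meson order_trans)
  next
    fix b x1 d1 x2 d2 assume h: "PA0 b x1 d1 x2 d2 g q" "PAm x1 d1 x2 d2 g \<le> m"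
    have "valid g" using h by (simp add: PA0_def)
    thus ?thesis using h(2) sgap_pos[OF \<open>valid g\<close>, of x1 d1] sgap_pos[OF \<open>valid g\<close>, of x2 d2] NN0 unfolding PAm_def distrib_left by linarith
  next
    assume h: "Init g q" "Im g \<le> m"
    hence "valid g" by (simp add: Init_def)
    thus ?thesis using h sum_sq_bd[OF \<open>valid g\<close>] NN0 unfolding Im_def by linarith
  qed
qed

lemma INV_final: assumes "INV m g q" "max_run g K" shows "q i = 0"
  using assms(1)[unfolded INV_def]
proof
  assume "race_zone m g q" thus ?thesis using race_zone_final assms(2) by blast
next
  assume h: "Init g q \<and> Im g \<le> m"
  then obtain b where "valid g" "max_run g b" "\<not> one_head g b" by (auto simp: Init_def)
  thus ?thesis using twohd(2) max_run_unique[OF assms(2)] by fastforce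
qed

text \<open>The constant 81 is 80 for the race and everything after it, plus 1 for the sum of
  squared gaps, which is at most \<open>N * N\<close>.\<close>

lemma INV_init: assumes v: "valid g" and np: "nonper g" shows "INV (81 * (N * N)) g (\<lambda>_. 0)"
proof -
  obtain b where b: "max_run g b" "b \<le> K" using max_run_ex[OF v] by blast
  have p0: "per (\<lambda>_. 0)" by (simp add: per_def)
  show ?thesis
  proof (cases "one_head g b")
    case True
    then obtain l where C: "champ g l b (b - 1)" using one_head_champ v b by blast
    have w: "champ_zone l b (b - 1) False 0 0 g (\<lambda>_. 0)" unfolding champ_zone_def champ_pend_def using C p0 by auto
    have "N * (K - b) \<le> N * N" using KN b by (intro mult_left_mono) (auto simp: max_run_def)
    hence "Wm l b (b - 1) False g (\<lambda>_. 0) \<le> 6 * (N * N) + 6 * N" unfolding Wm_def using WA_bd(2)[OF v, of l b "\<lambda>_. 0"] by simp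
    also have "\<dots> \<le> 81 * (N * N)" using NN7 N7 by linarith
    finally show ?thesis using late_zone_W[OF w] unfolding INV_def race_zone_def by blast
  next
    case False
    hence "Init g (\<lambda>_. 0)" unfolding Init_def using v np p0 b by auto
    moreover have "Im g \<le> 81 * (N * N)" using sum_sq_bd[OF v] by (simp add: Im_def)
    ultimately show ?thesis unfolding INV_def by blast
  qed
qed

section \<open>Some robot is always told to move\<close>

lemma refl_rf: assumes "refl_at g \<sigma>" shows "rf g = sh \<sigma> g"
proof
  fix j show "rf g j = sh \<sigma> g j"
    using assms[unfolded refl_at_def, rule_format, of "-1 - j"] by (simp add: rf_def sh_def algebra_simps)
qed
lemma refl_inr: assumes "refl_at g \<sigma>" shows "in_run g b (- i) \<longleftrightarrow> in_run g b (i + \<sigma>)"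
  using in_run_rf[of g b i] unfolding refl_rf[OF assms] in_run_sh by simp
lemma refl_run: assumes "refl_at g \<sigma>" shows "run g b (- (j + b - 1)) \<longleftrightarrow> run g b (j + \<sigma>)"
  using run_rf[of g b j] unfolding refl_rf[OF assms] run_sh by simp

text \<open>The mirror image of a longest run through the axis robot \<open>c\<close> overlaps that
  run and hence equals it, so \<open>c\<close> is its centre.\<close>

lemma heavy_mid: assumes v: "valid g" and m: "max_run g b" "2 * b \<le> K" and s: "refl_at g \<sigma>" "cg (2 * c) \<sigma>"
    and r: "run g b l" "c = l + t" "0 \<le> t" "t < b"
  shows "b = 2 * t + 1"
proof -
  have p: "per g" using v validD by blast
  have "run g b (- (l + b - 1) + \<sigma>)" using refl_run[OF s(1), of b "- (l + b - 1)"] r(1) by simp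
  moreover have "cg (- (l + b - 1) + 2 * c) (- (l + b - 1) + \<sigma>)" using s(2) by (simp only: cg_addl)
  ultimately have r': "run g b (- (l + b - 1) + 2 * c)" using run_cg[OF p] by blast
  have e: "- (l + b - 1) + 2 * c = l + (2 * t - b + 1)" using r(2) by simp
  show ?thesis using heads_apart[OF m(1) r(1) r'] heads_apart[OF m(1) r' r(1)] r(3,4) unfolding e by linarith
qed

text \<open>The heavy run through the axis robot is centred there. If the robot beyond one end were
  not heavy, neither would its mirror image be, and the end would have a good \<open>sideB\<close>
  neighbour.\<close>

lemma cmid_heavy: assumes v: "valid g" and np: "nonper g" and m: "max_run g b" "\<not> one_head g b" "2 \<le> b" and nG: "\<not> exG g b"
    and s: "refl_at g \<sigma>" "cg (2 * c) \<sigma>" and h: "in_run g b c"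
  shows "\<exists>h. cmid g b h c"
proof -
  have p: "per g" using v validD by blast
  obtain l where l: "l \<le> c" "c < l + b" "run g b l" using h by (auto simp: in_run_def)
  have t: "b = 2 * (c - l) + 1" using heavy_mid[OF v m(1) twohd(1)[OF v m(1,2)] s l(3), of "c - l"] l by simp
  let ?h = "c - l"
  have sym: "in_run g b (c + x) \<longleftrightarrow> in_run g b (c - x)" for x
  proof -
    have "cg (- (c + x) + 2 * c) (- (c + x) + \<sigma>)" using s(2) by (simp only: cg_addl)
    hence "cg (c - x) (- (c + x) + \<sigma>)" by (simp add: algebra_simps)
    moreover have "in_run g b (c + x) = in_run g b (- (c + x) + \<sigma>)" using refl_inr[OF s(1), of b "- (c + x)"] unfolding minus_minus .
    ultimately show ?thesis using in_run_cg[OF p] by blast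
  qed
  have "in_run g b (c + (?h + 1))"
  proof (rule ccontr)
    assume n: "\<not> in_run g b (c + (?h + 1))"
    have "in_run g b (c + (?h + 1) - 1)" unfolding in_run_def using l t by (intro exI[of _ l]) auto
    moreover have "c + (?h + 1) - b - 1 = c - (?h + 1)" using t by simp
    moreover have "\<not> in_run g b (c - (?h + 1))" using n sym by blast
    ultimately have "sideB g b (c + (?h + 1))" unfolding sideB_def using n by metis
    hence "good g b (c + (?h + 1))" using nG exA_exG by (auto simp: good_def)
    thus False using nG by (auto simp: exG_def)
  qed
  hence "in_run g b (c + ?h + 1)" "in_run g b (c - ?h - 1)" using sym[of "?h + 1"] by (simp_all add: algebra_simps)
  moreover have "run g b (c - ?h)" using l by simp
  moreover have "1 \<le> ?h" using t m(3) by presburger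
  moreover have "uniq g c" using refl_uniq[OF p np s] .
  ultimately have "cmid g b ?h c" unfolding cmid_def using t by blast
  thus ?thesis by blast
qed

text \<open>Longest runs that cover every robot follow each other without interruption, so
  \<open>b\<close> divides the odd number \<open>k\<close>.\<close>

lemma all_heavy_odd: assumes v: "valid g" and m: "max_run g b" "b < K" and a: "\<And>r. in_run g b r"
  shows "odd b"
proof -
  have p: "per g" using v validD by blast
  have b1: "1 \<le> b" using m by (simp add: max_run_def)
  obtain l where l: "run g b l" using m by (auto simp: max_run_def)
  have nx: "run g b (y + b)" if y: "run g b y" for y
  proof -
    obtain j where j: "j \<le> y + b" "y + b < j + b" "run g b j" using a[of "y + b"] by (auto simp: in_run_def)
    have "j = y + b" using heads_apart[OF m(1) y j(3)] j by simp
    thus ?thesis using j by simp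
  qed
  have "run g b (l + b * int i)" for i
  proof (induction i)
    case (Suc i)
    have "l + b * int (Suc i) = l + b * int i + b" by (simp add: algebra_simps)
    thus ?case using nx[OF Suc] by metis
  qed (use l in simp)
  hence ry: "run g b (l + b * int (nat (K div b)))" .
  have nd: "int (nat (K div b)) = K div b" using b1 by (simp add: pos_imp_zdiv_nonneg_iff)
  define y where "y = l + b * (K div b)"
  have ry': "run g b y" using ry nd by (simp add: y_def)
  have rl: "run g b (l + K)" using run_cg[OF p, of "l + K" l] l by simp
  have d: "K = b * (K div b) + K mod b" "0 \<le> K mod b" "K mod b < b" using b1 by simp_all
  have d2: "b * (K div b) \<le> K" using d by linarith
  have ny: "\<not> y < l + K"
  proof
    assume "y < l + K"
    from heads_apart[OF m(1) ry' rl this] d(1,3) show False unfolding y_def by linarith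
  qed
  have "K = b * (K div b)" using ny d2 unfolding y_def by linarith
  thus ?thesis using Kodd by (metis even_mult_iff)
qed

lemma max_run_1: assumes "valid g" "max_run g b" "\<not> 2 \<le> b" shows "2 \<le> g j"
proof (rule ccontr)
  assume "\<not> 2 \<le> g j"
  hence "g j = 1" using validD(2)[OF assms(1), of j] by simp
  hence "run g 2 j" using run_snoc[of g 1 j] by simp
  moreover have "b = 1" using assms by (simp add: max_run_def)
  ultimately show False using assms(2) by (auto simp: max_run_def)
qed

text \<open>If isolated robots exist but \<open>pS\<close> selects none, the top candidates are
  mirror images and the axis robot is not isolated, hence heavy. If none is isolated, all robots are
  heavy: with an axis the same argument applies, and without one all views are unique and the centre
  of any run will do.\<close>

lemma cmid_ex: assumes v: "valid g" and np: "nonper g" and m: "max_run g b" "\<not> one_head g b" and nG: "\<not> exG g b" and nS: "\<not> (\<exists>r. pS g r)"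
  shows "\<exists>h c. cmid g b h c"
proof -
  have p: "per g" using v validD by blast
  have nA: "\<not> exA g b" using nG exA_exG by blast
  have ntu: "\<not> (\<exists>r. topc g r \<and> uniq g r)" using nS unfolding pS_def by metis
  have niu: "\<not> (iso g r \<and> uniq g r)" for r
  proof
    assume "iso g r \<and> uniq g r"
    hence "\<exists>r. isou g r" unfolding isou_def using ex_maxvw[OF p, of "\<lambda>r. iso g r \<and> uniq g r" r] by blast
    thus False using nS ntu unfolding pS_def by metis
  qed
  show ?thesis
  proof (cases "\<exists>r. iso g r")
    case True
    then obtain r where r: "topc g r" using topc_ex[OF v] by blast
    hence "\<not> uniq g r" using ntu by blast
    then obtain r' where r': "view g r' = view g r" "\<not> cg r' r" unfolding uniq_def by blast
    have s: "refl_at g (r' + r)" using same_view[OF p np r'(1)] r'(2) by blast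
    obtain c where c: "cg (2 * c) (r' + r)" using refl_mid by blast
    have ni: "\<not> iso g c" using niu refl_uniq[OF p np s c] by blast
    have h: "in_run g b c" using nonheavy_iso[OF v m(1) nA] ni by blast
    have "2 \<le> b"
    proof (rule ccontr)
      assume "\<not> 2 \<le> b"
      hence "2 \<le> g j" for j using max_run_1[OF v m(1)] by blast
      thus False using ni by (auto simp: iso_def)
    qed
    from cmid_heavy[OF v np m this nG s c h] show ?thesis by blast
  next
    case False
    hence H: "in_run g b r" for r using nonheavy_iso[OF v m(1) nA] by blast
    have b2: "2 \<le> b"
    proof (rule ccontr)
      assume "\<not> 2 \<le> b"
      hence "2 \<le> g j" for j using max_run_1[OF v m(1)] by blast
      thus False using False by (auto simp: iso_def)
    qed
    show ?thesis
    proof (cases "\<exists>r. \<not> uniq g r")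
      case True
      then obtain r r' where r': "view g r' = view g r" "\<not> cg r' r" unfolding uniq_def by blast
      have s: "refl_at g (r' + r)" using same_view[OF p np r'(1)] r'(2) by blast
      obtain c where c: "cg (2 * c) (r' + r)" using refl_mid by blast
      from cmid_heavy[OF v np m b2 nG s c H] show ?thesis by blast
    next
      case False
      have "b < K" using twohd[OF v m] by simp
      hence "odd b" using all_heavy_odd[OF v m(1)] H by blast
      then obtain h where h: "b = 2 * h + 1" by (auto elim: oddE)
      obtain l where "run g b l" using m by (auto simp: max_run_def)
      hence "cmid g b h (l + h)" unfolding cmid_def using False H h b2 by auto
      thus ?thesis by blast
    qed
  qed
qed

lemma sel_intro: assumes "gside g b x (-1)" "\<And>x' d'. gside g b x' d' \<Longrightarrow> sgap g x (-1) \<le> sgap g x' d'"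
   "\<And>x' d'. gside g b x' d' \<Longrightarrow> sgap g x' d' \<le> sgap g x (-1) \<Longrightarrow> view g x' \<le> view g x"
  shows "sel g b x"
proof -
  have s1: "sgap g y (-1) = g (y - 1)" "sgap g y 1 = g y" "rf g (y - 1) = g (- y)" for y by (simp_all add: sgap_def rf_def)
  have g1: "gside g b y (-1) = good g b y" "gside g b (- y) 1 = good (rf g) b y" for y by (auto simp: gside_def)
  have b: "best g b x" unfolding best_def
    using assms(1) assms(2)[of _ "-1"] assms(2)[of "- r" 1 for r] unfolding s1 g1 by simp
  show ?thesis unfolding sel_def
  proof (intro conjI b allI impI)
    fix r' assume "best g b r'"
    hence "gside g b r' (-1)" "sgap g r' (-1) \<le> sgap g x (-1)" using b unfolding best_def s1 g1 by auto
    thus "view g r' \<le> view g x" using assms(3) by blast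
  next
    fix r' assume h: "best (rf g) b r'"
    hence "gside g b (- r') 1" by (simp add: best_def g1)
    moreover have "rf g (r' - 1) \<le> rf (rf g) (x - 1)" using h b unfolding best_def by (simp add: rf_def)
    hence "sgap g (- r') 1 \<le> sgap g x (-1)" unfolding s1 by (simp add: rf_def)
    ultimately have "view g (- r') \<le> view g x" using assms(3) by blast
    thus "view (rf g) r' \<le> view g x" by (simp add: view_rf)
  qed
qed

text \<open>Minimising the gap over all sides in both directions and then maximising the view yields
  a side that satisfies \<open>sel\<close> either directly or after reflection.\<close>

lemma sel_ex: assumes v: "valid g" and ex: "exG g b" shows "(\<exists>r. sel g b r) \<or> (\<exists>r. sel (rf g) b r)"
proof -
  have p: "per g" using v validD by blast
  obtain r where "good g b r \<or> good (rf g) b r" using ex by (auto simp: exG_def)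
  hence "gside g b r (-1) \<or> gside g b (- r) 1" by (auto simp: gside_def)
  hence "\<exists>z. gside g b (fst z) (snd z)" by (metis fst_conv snd_conv)
  then obtain z0 where "gside g b (fst z0) (snd z0)" by blast
  then obtain z where z: "gside g b (fst z) (snd z)" "\<And>y. gside g b (fst y) (snd y) \<Longrightarrow> nat (sgap g (fst z) (snd z)) \<le> nat (sgap g (fst y) (snd y))"
    using ex_has_least_nat[of "\<lambda>z. gside g b (fst z) (snd z)" z0 "\<lambda>z. nat (sgap g (fst z) (snd z))"] by blast
  define a where "a = sgap g (fst z) (snd z)"
  have a: "a \<le> sgap g x d" if "gside g b x d" for x d
    using z(2)[of "(x, d)"] that sgap_pos[OF v, of x d] sgap_pos[OF v, of "fst z" "snd z"] by (simp add: a_def)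
  have "\<exists>d. gside g b (fst z) d \<and> sgap g (fst z) d = a" using z a_def by blast
  from ex_maxvw[OF p, of "\<lambda>x. \<exists>d. gside g b x d \<and> sgap g x d = a", OF this]
  obtain x d where x: "gside g b x d" "sgap g x d = a" "\<And>x' d'. gside g b x' d' \<Longrightarrow> sgap g x' d' = a \<Longrightarrow> view g x' \<le> view g x" by blast
  have m: "gside g b x' d' \<Longrightarrow> sgap g x d \<le> sgap g x' d'" for x' d' using a x(2) by simp
  have w: "gside g b x' d' \<Longrightarrow> sgap g x' d' \<le> sgap g x d \<Longrightarrow> view g x' \<le> view g x" for x' d' using x(2,3) a by (metis antisym)
  from gside_dir[OF x(1)] show ?thesis
  proof
    assume "d = -1"
    thus ?thesis using sel_intro[of g b x] x(1) m w by blast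
  next
    assume d: "d = 1"
    have tr: "gside g b (- y) (- e) \<and> sgap (rf g) y e = sgap g (- y) (- e)" if "gside (rf g) b y e" for y e
    proof -
      have "e = -1 \<or> e = 1" using gside_dir[OF that] .
      moreover have "gside (rf g) b (- (- y)) (- (- e))" using that by simp
      ultimately show ?thesis using gside_rf sgap_rf[of "- e" g "- y"] by (metis minus_minus)
    qed
    have "gside (rf g) b (- x) (-1)" "sgap (rf g) (- x) (-1) = sgap g x d" using x(1) d gside_rf[of g b x 1] sgap_rf[of 1 g x] by auto
    hence "sel (rf g) b (- x)" using sel_intro[of "rf g" b "- x"] tr m w by (metis view_rf minus_minus)
    thus ?thesis by blast
  qed
qed

lemma progress: assumes v: "valid g" and np: "nonper g" and m: "max_run g b" "\<not> one_head g b" shows "\<exists>i. F g i \<noteq> {}"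
proof -
  have p: "per g" using v validD by blast
  have bK: "b < K" using twohd[OF v m] by simp
  have F1: "F g i \<noteq> {}" if "r3 g b i" for i using mxF[OF m(1) bK] m(2) that by auto
  have F2: "F g (- i) \<noteq> {}" if "r3 (rf g) b i" for i using mxF[OF m(1) bK] m(2) that by auto
  have "(\<exists>i. r3 g b i) \<or> (\<exists>i. r3 (rf g) b i)"
  proof (cases "exG g b")
    case True
    thus ?thesis using sel_ex[OF v True] by (auto simp: r3_def exG_rf)
  next
    case nG: False
    show ?thesis
    proof (cases "\<exists>r. pS g r")
      case True
      then obtain r where r: "pS g r" by blast
      have e: "rf g (- r - 1) = g r" "rf g (- r) = g (r - 1)" by (simp_all add: rf_def)
      have r': "pS (rf g) (- r)" using r by (simp add: pS_rf)
      have "r3 g b r \<or> r3 (rf g) b (- r)"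
        using nG True r r' unfolding r3_def exG_rf e by (metis linear)
      thus ?thesis by blast
    next
      case nS: False
      obtain h c where "cmid g b h c" using cmid_ex[OF v np m nG nS] by blast
      from ex_maxvw[OF p, of "cmid g b h", OF this] obtain c where "topm g b h c" unfolding topm_def by blast
      hence "topm g b h (c - h + h)" by simp
      hence "\<exists>h'. topm g b h' (c - h + h')" by blast
      hence "r3 g b (c - h)" using nG nS unfolding r3_def by simp
      thus ?thesis by blast
    qed
  qed
  thus ?thesis using F1 F2 by blast
qed

text \<open>A rotation permutes the two longest runs. If it exchanges them, its square fixes them,
  so \<open>2 * s\<close> and hence \<open>s\<close> is divisible by the odd
  \<open>k\<close>.\<close>

lemma two_champ_nonper: assumes T: "two_champ g l1 b p b p'" shows "nonper g"
  unfolding nonper_def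
proof (intro allI impI)
  fix s assume s: "\<forall>j. g (j + s) = g j"
  let ?l2 = "l1 + b + p"
  have H: "cg j l1 \<or> cg j ?l2" if r: "run g b j" for j
  proof -
    have "(\<exists>t. 0 \<le> t \<and> t \<le> 0 \<and> cg j (l1 + t)) \<or> (\<exists>t. 0 \<le> t \<and> t \<le> 0 \<and> cg j (?l2 + t))"
      using T r unfolding two_champ_def by (metis diff_self min.idem)
    thus ?thesis by auto
  qed
  have "sh s g = g" using s by (auto simp: sh_def)
  hence R: "run g b (j + s) = run g b j" for j using run_sh[of s g b j] by simp
  have r: "run g b l1" "run g b ?l2" using T by (auto simp: two_champ_def)
  have c0: "cg (l1 + s) (l1 + 0) \<longleftrightarrow> cg s 0" "cg (?l2 + s) (?l2 + 0) \<longleftrightarrow> cg s 0" by (simp_all only: cg_addl)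
  have "cg (l1 + s) l1 \<or> cg (l1 + s) ?l2" "cg (?l2 + s) l1 \<or> cg (?l2 + s) ?l2" using H R r by blast+
  moreover have "cg s 0" if "cg (l1 + s) ?l2" "cg (?l2 + s) l1"
  proof -
    have "cg (l1 + s + s) (?l2 + s)" using that(1) by (simp only: cg_add)
    hence "cg (l1 + s + s) l1" using that(2) cg_trans by blast
    hence "cg (2 * s) (2 * 0)" by (simp add: cg_def)
    thus ?thesis using cg_double by blast
  qed
  ultimately show "cg s 0" using c0 by auto
qed

lemma INV_prog: assumes I: "INV m g q" and nK: "\<not> max_run g K" shows "\<exists>i. F g i \<noteq> {}"
proof -
  have v: "valid g" using INV_vals[OF I] by simp
  have lt: "b < K" if C: "champ g l b c" for l b c
    using champ_mx[OF C] nK C by (cases "b = K") (auto simp: champ_def)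
  from I show ?thesis unfolding INV_def race_zone_def late_zone_def
  proof (elim disjE exE conjE)
    fix l b c \<rho> x dx assume "champ_zone l b c \<rho> x dx g q"
    hence C: "champ g l b c" by (simp add: champ_zone_def)
    from champ_zone_prog[OF C lt[OF C]] show ?thesis .
  next
    fix l1 b1 p b2 p' assume z: "pair_zone l1 b1 p b2 p' g q"
    hence T: "two_champ g l1 b1 p b2 p'" by (simp add: pair_zone_def)
    consider "b1 < b2" | "b2 < b1" | "b1 = b2" by linarith
    thus ?thesis
    proof cases
      case 1
      from champ_zone_prog[OF two_champ_champ[OF T 1] lt[OF two_champ_champ[OF T 1]]] show ?thesis .
    next
      case 2
      from champ_zone_prog[OF two_champ_champ[OF two_champ_swap[OF T] 2] lt[OF two_champ_champ[OF two_champ_swap[OF T] 2]]] show ?thesis .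
    next
      case 3
      hence T3: "two_champ g l1 b1 p b1 p'" using T by simp
      from progress[OF v two_champ_nonper[OF T3] two_champ_mx[OF T3]] show ?thesis .
    qed
  next
    fix b x1 d1 x2 d2 assume h: "PA0 b x1 d1 x2 d2 g q"
    hence m: "max_run g b" "\<not> one_head g b" and ex: "exG g b" using gside_exG by (auto simp: PA0_def)
    have bK: "b < K" using twohd[OF v m] by simp
    have F1: "F g i \<noteq> {}" if "sel g b i" for i using mxF[OF m(1) bK] m(2) that ex by (auto simp: r3_def)
    have F2: "F g (- i) \<noteq> {}" if "sel (rf g) b i" for i using mxF[OF m(1) bK] m(2) that ex by (auto simp: r3_def exG_rf)
    show ?thesis using sel_ex[OF v ex] F1 F2 by blast
  next
    assume h: "Init g q"
    then obtain b where "nonper g" "max_run g b" "\<not> one_head g b" unfolding Init_def by blast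
    thus ?thesis using progress[OF v] by blast
  qed
qed

section \<open>Nodes, snapshots and integer coordinates\<close>

definition nd :: "int \<Rightarrow> nat" where "nd x = nat (x mod N)"
lemma Npos: "0 < N" using N7 by simp
lemma nd_eq: "nd x = nd y \<longleftrightarrow> N dvd x - y"
proof -
  have "nd x = nd y \<longleftrightarrow> x mod N = y mod N" unfolding nd_def using Npos by (subst eq_nat_nat_iff) simp_all
  thus ?thesis by (simp add: mod_eq_dvd_iff)
qed
lemma nd_lt: "nd x < n" unfolding nd_def using Npos by (simp add: nat_less_iff)
lemma nd_int: "x < n \<Longrightarrow> nd (int x) = x" unfolding nd_def by simp
lemma int_nd: "int (nd x) = x mod N" unfolding nd_def using Npos by simp
lemma nd_nd: "nd (int (nd x) + y) = nd (x + y)" unfolding nd_def using Npos by (simp add: mod_add_left_eq)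
lemma nd_step: assumes "u < n" shows "(u + 1) mod n = nd (int u + 1)" "(u + n - 1) mod n = nd (int u - 1)"
proof -
  have "int ((u + 1) mod n) = (int u + 1) mod N" by (simp add: zmod_int add.commute)
  thus "(u + 1) mod n = nd (int u + 1)" unfolding nd_def by linarith
  have "int ((u + n - 1) mod n) = (int u + N - 1) mod N" using k3 nk by (simp add: zmod_int of_nat_diff)
  also have "\<dots> = (int u - 1) mod N" by (metis add_diff_eq add.commute diff_add_eq mod_add_self2)
  finally show "(u + n - 1) mod n = nd (int u - 1)" unfolding nd_def by linarith
qed

definition sorted_dists :: "nat set \<Rightarrow> nat \<Rightarrow> nat list" where "sorted_dists S u = cw_dists n S u"

lemma sorted_dists_facts: assumes "S \<subseteq> {..<n}" "u \<in> S"
  shows "set (sorted_dists S u) = (\<lambda>x. nd (int x - int u)) ` S" "sorted (sorted_dists S u)" "distinct (sorted_dists S u)" "sorted_dists S u \<noteq> []" "sorted_dists S u ! 0 = 0"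
    "\<And>i. i < length (sorted_dists S u) \<Longrightarrow> sorted_dists S u ! i < n"
proof -
  have un: "u < n" using assms by auto
  have f: "finite S" using assms finite_subset by blast
  have e: "(x + n - u) mod n = nd (int x - int u)" for x
  proof -
    have "int ((x + n - u) mod n) = (int x - int u + N) mod N" using un by (simp add: zmod_int of_nat_diff algebra_simps)
    thus ?thesis unfolding nd_def by simp
  qed
  show st: "set (sorted_dists S u) = (\<lambda>x. nd (int x - int u)) ` S" unfolding sorted_dists_def cw_dists_def using f e by simp
  show so: "sorted (sorted_dists S u)" "distinct (sorted_dists S u)" unfolding sorted_dists_def cw_dists_def by simp_all
  have "nd 0 = 0" by (simp add: nd_def)
  hence z: "0 \<in> set (sorted_dists S u)" unfolding st using assms(2) by (intro image_eqI[of _ _ u]) auto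
  thus ne: "sorted_dists S u \<noteq> []" by auto
  obtain i where "i < length (sorted_dists S u)" "sorted_dists S u ! i = 0" using z by (auto simp: in_set_conv_nth)
  thus "sorted_dists S u ! 0 = 0" using so(1) sorted_nth_mono[of "sorted_dists S u" 0 i] by simp
  fix i assume "i < length (sorted_dists S u)"
  hence "sorted_dists S u ! i \<in> set (sorted_dists S u)" by simp
  thus "sorted_dists S u ! i < n" unfolding st using nd_lt by auto
qed

lemma segs_cs: "segs n S u = map2 (\<lambda>x y. x - y) (tl (sorted_dists S u) @ [n]) (sorted_dists S u)"
  by (simp add: segs_def sorted_dists_def Let_def)

lemma segs_len: assumes "S \<subseteq> {..<n}" "u \<in> S" shows "length (segs n S u) = length (sorted_dists S u)"
  unfolding segs_cs using sorted_dists_facts(4)[OF assms] by (cases "sorted_dists S u") auto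

lemma segs_nth: assumes "S \<subseteq> {..<n}" "u \<in> S" "i < length (sorted_dists S u)"
  shows "segs n S u ! i = (if Suc i < length (sorted_dists S u) then sorted_dists S u ! Suc i else n) - sorted_dists S u ! i"
proof -
  have "(tl (sorted_dists S u) @ [n]) ! i = (if Suc i < length (sorted_dists S u) then sorted_dists S u ! Suc i else n)"
    using assms(3) by (auto simp: nth_append nth_tl)
  moreover have "i < length (tl (sorted_dists S u) @ [n])" using assms(3) by simp
  ultimately show ?thesis unfolding segs_cs using assms(3) by simp
qed

text \<open>The segment lengths are differences of the sorted distances and telescope; the last one
  closes the ring with \<open>n\<close>.\<close>

lemma segs_take: assumes "S \<subseteq> {..<n}" "u \<in> S"
  shows "i < length (sorted_dists S u) \<Longrightarrow> sum_list (take i (segs n S u)) = sorted_dists S u ! i" "sum_list (segs n S u) = n"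
proof -
  let ?w = "length (sorted_dists S u)"
  have A: "sum_list (take i (segs n S u)) = sorted_dists S u ! i" if "i < ?w" for i
    using that
  proof (induction i)
    case 0 thus ?case using sorted_dists_facts[OF assms] by simp
  next
    case (Suc i)
    have l: "i < length (segs n S u)" using Suc segs_len[OF assms] by simp
    have "sorted_dists S u ! i \<le> sorted_dists S u ! Suc i" using sorted_dists_facts(2)[OF assms] Suc by (simp add: sorted_nth_mono)
    thus ?case using Suc segs_nth[OF assms, of i] l by (simp add: take_Suc_conv_app_nth)
  qed
  show "i < length (sorted_dists S u) \<Longrightarrow> sum_list (take i (segs n S u)) = sorted_dists S u ! i" using A .
  obtain i where i: "Suc i = ?w" using sorted_dists_facts(4)[OF assms] by (cases "sorted_dists S u") auto
  have l: "i < length (segs n S u)" using i segs_len[OF assms] by simp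
  have "sum_list (take (Suc i) (segs n S u)) = sorted_dists S u ! i + (n - sorted_dists S u ! i)"
    unfolding take_Suc_conv_app_nth[OF l] using A[of i] i segs_nth[OF assms, of i] by simp
  moreover have "sorted_dists S u ! i < n" using sorted_dists_facts(6)[OF assms, of i] i by simp
  moreover have "take (Suc i) (segs n S u) = segs n S u" using i segs_len[OF assms] by simp
  ultimately show "sum_list (segs n S u) = n" by simp
qed

text \<open>The occupied nodes, lifted to the integers with the observing robot at \<open>0\<close>, recovered from a view.\<close>

definition Ov :: "nat list \<Rightarrow> int set" where
  "Ov v = {x. \<exists>i<length v. N dvd x - int (sum_list (take i v))}"

lemma Ov_segs: assumes "S \<subseteq> {..<n}" "u \<in> S" shows "x \<in> Ov (segs n S u) \<longleftrightarrow> nd (int u + x) \<in> S"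
proof -
  have "x \<in> Ov (segs n S u) \<longleftrightarrow> (\<exists>i<length (sorted_dists S u). nd x = nd (int (sorted_dists S u ! i)))"
    unfolding Ov_def segs_len[OF assms] using segs_take(1)[OF assms] nd_eq by auto
  also have "\<dots> \<longleftrightarrow> (\<exists>i<length (sorted_dists S u). nd x = sorted_dists S u ! i)" using nd_int sorted_dists_facts(6)[OF assms] by auto
  also have "\<dots> \<longleftrightarrow> nd x \<in> set (sorted_dists S u)" by (auto simp: in_set_conv_nth)
  also have "\<dots> \<longleftrightarrow> (\<exists>s\<in>S. nd x = nd (int s - int u))" unfolding sorted_dists_facts(1)[OF assms] by auto
  also have "\<dots> \<longleftrightarrow> (\<exists>s\<in>S. nd (int u + x) = nd (int s))" unfolding nd_eq by (simp add: algebra_simps)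
  also have "\<dots> \<longleftrightarrow> nd (int u + x) \<in> S" using nd_int assms(1) by (auto; metis lessThan_iff subsetD)
  finally show ?thesis .
qed

lemma sum_rev_take: "i \<le> length v \<Longrightarrow> sum_list (take i (rev v)) + sum_list (take (length v - i) v) = sum_list (v :: nat list)"
proof -
  assume "i \<le> length v"
  have "take i (rev v) = rev (drop (length v - i) v)" by (simp add: take_rev)
  hence "sum_list (take i (rev v)) = sum_list (drop (length v - i) v)" by (simp add: sum_list_rev)
  thus ?thesis by (metis add.commute append_take_drop_id sum_list.append)
qed

text \<open>The first \<open>i\<close> segments read backwards and the first
  \<open>length v - i\<close> read forwards make up the whole ring, so reversing the reading negates
  all coordinates.\<close>

lemma Ov_rev: assumes "sum_list v = n" shows "x \<in> Ov (rev v) \<longleftrightarrow> - x \<in> Ov v"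
proof -
  have A: "- x \<in> Ov v" if h: "x \<in> Ov (rev v)" "sum_list v = n" for x v
  proof -
    obtain i where i: "i < length v" "N dvd x - int (sum_list (take i (rev v)))" using h(1) by (auto simp: Ov_def)
    have e: "int (sum_list (take i (rev v))) = N - int (sum_list (take (length v - i) v))"
      using sum_rev_take[of i v] i h(2) by linarith
    have "N dvd - x - int (sum_list (take (length v - i) v))"
    proof -
      have "- x - int (sum_list (take (length v - i) v)) = - (x - int (sum_list (take i (rev v)))) - N" unfolding e by simp
      thus ?thesis using i(2) by (metis dvd_diff dvd_minus_iff dvd_refl)
    qed
    \<comment> \<open>The node of the observer is the empty prefix in both readings; for it the
      index \<open>length v - i\<close> would be out of range.\<close>
    show ?thesis
    proof (cases "i = 0")
      case True
      hence "N dvd - x - int (sum_list (take 0 v))" using i(2) by simp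
      moreover have "0 < length v" using i(1) by (cases v) simp_all
      ultimately show ?thesis unfolding Ov_def by blast
    next
      case False
      thus ?thesis unfolding Ov_def using i \<open>N dvd - x - _\<close> by (auto intro!: exI[of _ "length v - i"])
    qed
  qed
  show ?thesis using A[of x v] A[of "- x" "rev v"] assms by (auto simp: sum_list_rev)
qed

section \<open>The protocol\<close>

definition gl :: "nat list \<Rightarrow> int \<Rightarrow> int" where "gl v j = int (v ! nat (j mod K))"
text \<open>Relative to the centre, \<open>sideS a j\<close> are the offsets of \<open>a\<close> nodes on one side with a hole at offset \<open>j\<close>
  (no hole if \<open>j = a + 1\<close>). \<open>en L R i\<close>: the robot at offset \<open>i\<close> of side \<open>L\<close> moves inwards. The hole is pushed outwards, and
  once both sides are contiguous the innermost robots enter the centre.\<close>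

definition sideS :: "int \<Rightarrow> int \<Rightarrow> int set" where "sideS a j = {1..a + 1} - {j}"
definition cf :: "int set \<Rightarrow> int set \<Rightarrow> int set" where "cf L R = insert 0 (uminus ` L \<union> R)"
definition en :: "int set \<Rightarrow> int set \<Rightarrow> int \<Rightarrow> bool" where
  "en L R i \<longleftrightarrow> L \<subseteq> {..(K - 1) div 2} \<and> R \<subseteq> {..(K - 1) div 2} \<and> (\<exists>a\<ge>1.
     (\<exists>j j'. 1 \<le> j \<and> j \<le> a \<and> 1 \<le> j' \<and> j' \<le> a + 1 \<and> L = sideS a j \<and> R = sideS a j' \<and> i = j + 1) \<or>
     L = sideS a (a + 1) \<and> (R = sideS a (a + 1) \<or> R = sideS (a - 1) 1) \<and> i = 1)"
text \<open>In centre coordinates the observer sits at \<open>- i\<close>, on side \<open>L\<close>,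
  and \<open>d\<close> is the direction of the reading that leads to the centre. The robot searches
  for any stage of the collapse that fits its view and in which it is enabled.\<close>

definition Ph2 :: "nat list \<Rightarrow> int set" where
  "Ph2 v = {d. (d = 1 \<or> d = -1) \<and> (\<exists>L R i. en L R i \<and> (\<forall>x. x \<in> Ov v \<longleftrightarrow> (\<exists>y\<in>cf L R. N dvd d * x - (y + i))))}"
text \<open>A view of length \<open>k\<close> shows that there is no tower. The complete block is
  already handed to the collapse phase. There a robot on a tower has reached the centre and
  stays.\<close>

definition rule :: "nat list \<Rightarrow> bool \<Rightarrow> int set" where
  "rule v m = (if length v = k \<and> \<not> max_run (gl v) K then F (gl v) 0 else if m then {} else Ph2 v)"
definition Pr :: protocol where
  "Pr vm = (let A = rule (fst vm) (snd vm) in if 1 \<in> A then Move True else if -1 \<in> A then Move False else Stay)"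

lemma gl_rev: assumes "length v = k" shows "gl (rev v) = rf (gl v)"
proof
  fix j
  have b: "0 \<le> j mod K" "j mod K < K" using k3 by simp_all
  have "(-1 - j) mod K = K - 1 - j mod K"
  proof -
    have "(-1 - j) mod K = (K - 1 - j mod K) mod K"
    proof (rule mod_eq_dvd_iff[THEN iffD2])
      show "K dvd (-1 - j) - (K - 1 - j mod K)"
      proof -
        have "(-1 - j) - (K - 1 - j mod K) = - (j - j mod K) - K" by simp
        moreover have "K dvd j - j mod K" by (simp add: dvd_minus_mod)
        ultimately show ?thesis by (metis dvd_diff dvd_minus_iff dvd_refl)
      qed
    qed
    thus ?thesis using b by simp
  qed
  hence "nat ((-1 - j) mod K) = k - Suc (nat (j mod K))" using b by linarith
  thus "gl (rev v) j = rf (gl v) j" unfolding gl_def rf_def using assms b by (simp add: rev_nth nat_less_iff)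
qed

lemma rule_dir: "d \<in> rule v m \<Longrightarrow> d = 1 \<or> d = -1" by (auto simp: rule_def F_def Ph2_def split: if_splits)

text \<open>Reversing the reading reverses the answer, so the decision denotes the same physical
  direction whichever reading the snapshot contains.\<close>

lemma rule_rev: assumes "sum_list v = n" shows "d \<in> rule (rev v) m \<longleftrightarrow> - d \<in> rule v m"
proof (cases "length v = k \<and> \<not> max_run (gl v) K")
  case True
  thus ?thesis unfolding rule_def using gl_rev[of v] max_run_rf F_rf[of d "gl v" 0] by simp
next
  case False
  hence 1: "\<not> (length (rev v) = k \<and> \<not> max_run (gl (rev v)) K)" using gl_rev[of v] max_run_rf by auto
  have "(\<forall>x. x \<in> Ov (rev v) \<longleftrightarrow> (\<exists>y\<in>cf L R. N dvd d * x - (y + i))) \<longleftrightarrow> (\<forall>x. x \<in> Ov v \<longleftrightarrow> (\<exists>y\<in>cf L R. N dvd - d * x - (y + i)))" for L R i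
    unfolding Ov_rev[OF assms] by (metis minus_minus minus_mult_minus)
  hence "d \<in> Ph2 (rev v) \<longleftrightarrow> - d \<in> Ph2 v" unfolding Ph2_def by auto
  thus ?thesis using False 1 unfolding rule_def by auto
qed

text \<open>The snapshot retains only the larger of the two readings. By \<open>rule_rev\<close> the
  decision can nevertheless be evaluated on the clockwise reading, whose direction 1 is
  \<open>+1\<close> on the nodes; for equal readings the rule is symmetric.\<close>

lemma targets_rule: assumes p: "\<And>r. r < k \<Longrightarrow> p r < n" and r: "r < k" and x: "x \<in> targets Pr n k p r"
  defines "A \<equiv> rule (segs n (occupied k p) (p r)) (\<exists>r'<k. r' \<noteq> r \<and> p r' = p r)"
  shows "A = {} \<and> x = p r \<or> (\<exists>d\<in>A. x = nd (int (p r) + d))"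
proof -
  define c where "c = segs n (occupied k p) (p r)"
  define rc where "rc = rev c"
  define m where "m = (\<exists>r'<k. r' \<noteq> r \<and> p r' = p r)"
  have A: "A = rule c m" by (simp add: A_def c_def m_def)
  have S: "occupied k p \<subseteq> {..<n}" "p r \<in> occupied k p" using p r by (auto simp: occupied_def)
  have sn: "sum_list c = n" unfolding c_def using segs_take(2)[OF S] .
  have snap: "snapshot n k p r = (max c rc, m)" by (simp add: snapshot_def Let_def c_def rc_def m_def)
  have st: "(p r + 1) mod n = nd (int (p r) + 1)" "(p r + n - 1) mod n = nd (int (p r) - 1)" using nd_step p[OF r] by auto
  have rv: "d \<in> rule rc m \<longleftrightarrow> - d \<in> A" for d unfolding A rc_def by (rule rule_rev[OF sn])
  have Ae: "A = {} \<longleftrightarrow> 1 \<notin> A \<and> -1 \<notin> A" using rule_dir unfolding A by blast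
  let ?P = "Pr (max c rc, m)"
  have x': "x \<in> (case ?P of Stay \<Rightarrow> {p r} | Move b \<Rightarrow> (if c = rc then {nd (int (p r) + 1), nd (int (p r) - 1)}
      else if (rc < c) = b then {nd (int (p r) + 1)} else {nd (int (p r) - 1)}))"
    using x unfolding targets_def Let_def snap st rc_def c_def .
  have Pm: "?P = (if 1 \<in> rule (max c rc) m then Move True else if -1 \<in> rule (max c rc) m then Move False else Stay)"
    by (simp add: Pr_def Let_def)
  have dd: "1 \<in> A \<and> x = nd (int (p r) + 1) \<or> -1 \<in> A \<and> x = nd (int (p r) - 1) \<Longrightarrow> \<exists>d\<in>A. x = nd (int (p r) + d)"
    by (metis add_uminus_conv_diff)
  consider "rc = c" | "rc < c" | "c < rc" using linorder_cases by blast
  hence "A = {} \<and> x = p r \<or> 1 \<in> A \<and> x = nd (int (p r) + 1) \<or> -1 \<in> A \<and> x = nd (int (p r) - 1)"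
  proof cases
    case 1
    have B: "rule (max c rc) m = A" by (simp add: A 1)
    have "1 \<in> A \<longleftrightarrow> -1 \<in> A" using rv[of 1] by (simp add: 1 A)
    thus ?thesis using x' 1 unfolding Pm unfolding B Ae by (auto split: if_splits)
  next
    case 2
    hence "max c rc = c" by (intro max_absorb1 less_imp_le)
    hence B: "rule (max c rc) m = A" by (simp add: A)
    have "c \<noteq> rc" using 2 by auto
    thus ?thesis using x' 2 unfolding Pm unfolding B Ae by (auto split: if_splits)
  next
    case 3
    hence max_run: "max c rc = rc" by (intro max_absorb2 less_imp_le)
    have B: "1 \<in> rule rc m \<longleftrightarrow> -1 \<in> A" "-1 \<in> rule rc m \<longleftrightarrow> 1 \<in> A" using rv[of 1] rv[of "-1"] by auto
    have "c \<noteq> rc" "\<not> rc < c" using 3 by auto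
    thus ?thesis using x' unfolding Pm unfolding max_run B Ae by (auto split: if_splits)
  qed
  thus ?thesis using dd by blast
qed

section \<open>Transfer between integer gaps and robots on the ring\<close>

definition lift :: "(int \<Rightarrow> int) \<Rightarrow> (int \<Rightarrow> int) \<Rightarrow> bool" where
  "lift X g \<longleftrightarrow> (\<forall>j. X (j + 1) = X j + g j) \<and> (\<forall>j. X (j + K) = X j + N)"

lemma lift_mono: assumes "lift X g" "\<And>j. 1 \<le> g j" shows "X i + int t \<le> X (i + int t)"
proof (induction t)
  case (Suc t)
  have "X (i + int (Suc t)) = X (i + int t) + g (i + int t)"
    using assms(1)[unfolded lift_def] by (metis add.assoc of_nat_Suc add.commute)
  thus ?case using Suc assms(2)[of "i + int t"] by simp
qed simp

lemma lift_cg: assumes "lift X g" "cg i j" shows "N dvd X i - X j"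
proof -
  have "per (\<lambda>j. X j mod N)" using assms(1) by (simp add: per_def lift_def)
  from per_cg[OF this assms(2)] show ?thesis by (simp add: mod_eq_dvd_iff)
qed

lemma lift_win: assumes "lift X g" "\<And>j. 1 \<le> g j" "0 \<le> t" "t < K" shows "0 \<le> X (i + t) - X i" "X (i + t) - X i < N"
proof -
  show "0 \<le> X (i + t) - X i" using lift_mono[OF assms(1,2), of i "nat t"] assms(3) by simp
  have "X (i + t) + 1 \<le> X (i + K)" using lift_mono[OF assms(1,2), of "i + t" "nat (K - t)"] assms(4) by simp
  thus "X (i + t) - X i < N" using assms(1) by (simp add: lift_def)
qed

text \<open>Over one period the lifted positions increase strictly and stay within \<open>N\<close>
  of \<open>X i\<close>, so sorting the distances modulo \<open>n\<close> returns them in cyclic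
  order.\<close>

lemma segs_lift: assumes l: "lift X g" and g: "\<And>j. 1 \<le> g j" and S: "S = range (\<lambda>j. nd (X j))" and u: "u = nd (X i)"
  shows "segs n S u = map (\<lambda>t. nat (g (i + int t))) [0..<k]"
proof -
  let ?a = "map (\<lambda>t. nat (X (i + int t) - X i)) [0..<k]"
  have Sn: "S \<subseteq> {..<n}" "u \<in> S" using S u nd_lt by auto
  have w: "0 \<le> X (i + int t) - X i \<and> X (i + int t) - X i < N" if "t < k" for t using lift_win[OF l g, of "int t" i] that by simp
  have nt: "nd (X (i + int t) - X i) = nat (X (i + int t) - X i)" if "t < k" for t using w[OF that] by (simp add: nd_def)
  have st: "X (i + int (Suc t)) = X (i + int t) + g (i + int t)" for t
    using l[unfolded lift_def] by (metis add.assoc of_nat_Suc add.commute)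
  have "sorted ?a \<and> distinct ?a"
  proof -
    have "X (i + int s) < X (i + int t)" if "s < t" for s t
      using lift_mono[OF l g, of "i + int s" "t - s"] that by (simp add: of_nat_diff algebra_simps)
    hence "X (i + int s) - X i < X (i + int t) - X i" if "s < t" for s t using that by simp
    hence "nat (X (i + int s) - X i) < nat (X (i + int t) - X i)" if "s < t" "t < k" for s t
      using w[of s] that by (subst nat_less_eq_zless) auto
    hence "sorted_wrt (<) ?a" unfolding sorted_wrt_iff_nth_less by simp
    thus ?thesis by (simp add: strict_sorted_iff)
  qed
  moreover have "set (sorted_dists S u) = set ?a"
  proof -
    have e: "nd (int (nd (X j)) - int (nd (X i))) = nd (X j - X i)" for j unfolding nd_eq int_nd
      by (metis mod_diff_eq mod_eq_dvd_iff)
    have "set (sorted_dists S u) = (\<lambda>x. nd (int x - int u)) ` S" by (rule sorted_dists_facts(1)[OF Sn])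
    also have "\<dots> = range (\<lambda>j. nd (X j - X i))" unfolding S u image_image e ..
    also have "\<dots> = (\<lambda>t. nd (X (i + int t) - X i)) ` {0..<k}"
    proof
      show "range (\<lambda>j. nd (X j - X i)) \<subseteq> (\<lambda>t. nd (X (i + int t) - X i)) ` {0..<k}"
      proof
        fix z assume "z \<in> range (\<lambda>j. nd (X j - X i))"
        then obtain j where j: "z = nd (X j - X i)" by auto
        obtain j' where j': "i \<le> j'" "j' < i + K" "cg j' j" using cg_rep by blast
        have "N dvd X j - X i - (X j' - X i)" using lift_cg[OF l cg_sym[OF j'(3)]] by simp
        hence "z = nd (X (i + int (nat (j' - i))) - X i)" using j j' nd_eq by simp
        moreover have "nat (j' - i) \<in> {0..<k}" using j' by (simp add: nat_less_iff)
        ultimately show "z \<in> (\<lambda>t. nd (X (i + int t) - X i)) ` {0..<k}" by blast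
      qed
    qed auto
    also have "\<dots> = set ?a" using nt by simp
    finally show ?thesis .
  qed
  ultimately have sorted_dists: "sorted_dists S u = ?a" using sorted_distinct_set_unique sorted_dists_facts(2,3)[OF Sn] by blast
  show ?thesis
  proof (rule nth_equalityI)
    show "length (segs n S u) = length (map (\<lambda>t. nat (g (i + int t))) [0..<k])" using segs_len[OF Sn] sorted_dists by simp
    fix t assume "t < length (segs n S u)"
    hence t: "t < k" using segs_len[OF Sn] sorted_dists by simp
    have "(if Suc t < k then ?a ! Suc t else n) = nat (X (i + int (Suc t)) - X i)"
    proof (cases "Suc t < k")
      case False
      hence "int (Suc t) = K" using t by simp
      hence "X (i + int (Suc t)) = X i + N" using l by (simp only: lift_def)
      thus ?thesis using False by simp
    qed simp
    moreover have "segs n S u ! t = (if Suc t < k then ?a ! Suc t else n) - ?a ! t"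
      using segs_nth[OF Sn, of t] t unfolding sorted_dists by simp
    ultimately have "segs n S u ! t = nat (X (i + int (Suc t)) - X i) - nat (X (i + int t) - X i)" using t by simp
    also have "\<dots> = nat (g (i + int t))" unfolding st using w[OF t] g[of "i + int t"] by linarith
    finally show "segs n S u ! t = map (\<lambda>t. nat (g (i + int t))) [0..<k] ! t" using t by simp
  qed
qed

lemma gl_map: assumes "per g" "\<And>j. 1 \<le> g j" shows "gl (map (\<lambda>t. nat (g (i + int t))) [0..<k]) = sh i g"
proof
  fix j
  have b: "0 \<le> j mod K" "j mod K < K" using k3 by simp_all
  have "gl (map (\<lambda>t. nat (g (i + int t))) [0..<k]) j = g (i + j mod K)"
    using b assms(2)[of "i + j mod K"] by (simp add: gl_def nat_less_iff)
  also have "cg (i + j mod K) (i + j)" unfolding cg_addl by (rule cg_mod)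
  hence "g (i + j mod K) = g (i + j)" by (rule per_cg[OF assms(1)])
  finally show "gl (map (\<lambda>t. nat (g (i + int t))) [0..<k]) j = sh i g j" by (simp add: sh_def add.commute)
qed

text \<open>\<open>ix r\<close> is the cyclic index of robot \<open>r\<close>; \<open>X\<close> lists the occupied nodes, unrolled to the integers.\<close>

definition tower_free :: "(int \<Rightarrow> int) \<Rightarrow> (int \<Rightarrow> int) \<Rightarrow> (int \<Rightarrow> int) \<Rightarrow> (nat \<Rightarrow> int) \<Rightarrow> int \<Rightarrow> state \<Rightarrow> bool" where
  "tower_free X g q ix m s \<longleftrightarrow> INV m g q \<and> lift X g \<and> (\<forall>i. \<exists>r<k. cg (ix r) i) \<and> (\<forall>r<k. \<forall>r'<k. cg (ix r) (ix r') \<longrightarrow> r = r') \<and>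
     (\<forall>r<k. fst s r = nd (X (ix r))) \<and>
     (\<forall>r<k. (snd s r = None \<longrightarrow> q (ix r) = 0) \<and> (\<forall>x. snd s r = Some x \<longrightarrow> x = nd (X (ix r) + q (ix r))))"

lemma tower_free_I: assumes "INV m g q" "lift X g" "\<And>i. \<exists>r<k. cg (ix r) i" "\<And>r r'. r < k \<Longrightarrow> r' < k \<Longrightarrow> cg (ix r) (ix r') \<Longrightarrow> r = r'"
    "\<And>r. r < k \<Longrightarrow> fst s r = nd (X (ix r))" "\<And>r. r < k \<Longrightarrow> snd s r = None \<Longrightarrow> q (ix r) = 0"
    "\<And>r x. r < k \<Longrightarrow> snd s r = Some x \<Longrightarrow> x = nd (X (ix r) + q (ix r))"
  shows "tower_free X g q ix m s" unfolding tower_free_def using assms by blast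
lemma tower_free_D: assumes "tower_free X g q ix m s"
  shows "INV m g q" "lift X g" "\<exists>r<k. cg (ix r) i" "r < k \<Longrightarrow> r' < k \<Longrightarrow> cg (ix r) (ix r') \<Longrightarrow> r = r'"
    "r < k \<Longrightarrow> fst s r = nd (X (ix r))" "r < k \<Longrightarrow> snd s r = None \<Longrightarrow> q (ix r) = 0"
    "r < k \<Longrightarrow> snd s r = Some x \<Longrightarrow> x = nd (X (ix r) + q (ix r))"
  using assms unfolding tower_free_def by blast+

lemma tower_free_vals: assumes "tower_free X g q ix m s" shows "per g" "\<And>j. 1 \<le> g j" "lift X g" "per q"
  using assms INV_vals unfolding tower_free_def by (auto simp: validD)

lemma tower_free_occ: assumes "tower_free X g q ix m s" shows "occupied k (fst s) = range (\<lambda>j. nd (X j))"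
proof
  show "occupied k (fst s) \<subseteq> range (\<lambda>j. nd (X j))" using assms by (auto simp: occupied_def tower_free_def)
  show "range (\<lambda>j. nd (X j)) \<subseteq> occupied k (fst s)"
  proof
    fix z assume "z \<in> range (\<lambda>j. nd (X j))"
    then obtain j where j: "z = nd (X j)" by auto
    have "\<exists>r<k. cg (ix r) j" using assms unfolding tower_free_def by blast
    then obtain r where r: "r < k" "cg (ix r) j" by blast
    have "z = fst s r" using lift_cg[OF tower_free_vals(3)[OF assms] r(2)] r(1) assms unfolding tower_free_def j nd_eq
      by (metis nd_eq)
    thus "z \<in> occupied k (fst s)" using r by (auto simp: occupied_def)
  qed
qed

lemma tower_free_lt: assumes "tower_free X g q ix m s" "r < k" shows "fst s r < n"
  using assms nd_lt by (auto simp: tower_free_def)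

lemma tower_free_rule: assumes T: "tower_free X g q ix m s" and nK: "\<not> max_run g K" and r: "r < k"
  shows "rule (segs n (occupied k (fst s)) (fst s r)) (\<exists>r'<k. r' \<noteq> r \<and> fst s r' = fst s r) = F g (ix r)"
proof -
  note V = tower_free_vals[OF T]
  have "fst s r = nd (X (ix r))" using T r by (auto simp: tower_free_def)
  from segs_lift[OF V(3,2) tower_free_occ[OF T] this] have e: "segs n (occupied k (fst s)) (fst s r) = map (\<lambda>t. nat (g (ix r + int t))) [0..<k]" .
  show ?thesis unfolding rule_def e gl_map[OF V(1,2)] max_run_sh F_sh using nK by simp
qed

lemma nd_move_ne: assumes "x < n" "d = 1 \<or> d = -1" shows "nd (int x + d) \<noteq> x"
proof
  assume "nd (int x + d) = x"
  hence "nd (int x + d) = nd (int x)" using nd_int[OF assms(1)] by simp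
  hence "N dvd d" unfolding nd_eq by simp
  thus False using assms(2) N7 zdvd_imp_le[of N 1] by auto
qed

lemma nd_add: "x = nd a \<Longrightarrow> nd (int x + d) = nd (a + d)" using nd_nd by simp

text \<open>A pending decision to stay is represented by \<open>q = 0\<close>, just like the absence
  of a decision, so executing it changes nothing in the integer model. Only a real change of
  position has to lower the potential.\<close>

lemma tower_free_step: assumes T: "tower_free X g q ix m s" and nK: "\<not> max_run g K" and st: "cstep Pr n k r s s'"
  shows "\<exists>X' g' q' m'. tower_free X' g' q' ix m' s' \<and> m' \<le> m \<and> (fst s' \<noteq> fst s \<longrightarrow> m' < m)"
proof -
  have r: "r < k" using st by (simp add: cstep_def)
  note V = tower_free_vals[OF T] note D = tower_free_D[OF T]
  have cgix: "r' = r" if "r' < k" "cg (ix r') (ix r)" for r' using D(4)[OF that(1) r that(2)] .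
  have pr: "fst s r = nd (X (ix r))" using D(5)[OF r] .
  have same: "tower_free X g q ix m s'" if h: "fst s' = fst s" "snd s' r = None \<Longrightarrow> q (ix r) = 0" "\<And>x. snd s' r = Some x \<Longrightarrow> x = nd (X (ix r) + q (ix r))"
      "\<And>r'. r' \<noteq> r \<Longrightarrow> snd s' r' = snd s r'"
  proof (rule tower_free_I[OF D(1,2,3,4)])
    fix r' assume r': "r' < k"
    show "fst s' r' = nd (X (ix r'))" using D(5)[OF r'] h(1) by simp
    show "snd s' r' = None \<Longrightarrow> q (ix r') = 0" using D(6)[OF r'] h(2,4) by (cases "r' = r") simp_all
    show "snd s' r' = Some x \<Longrightarrow> x = nd (X (ix r') + q (ix r'))" for x using D(7)[OF r'] h(3,4) by (cases "r' = r") simp_all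
  qed
  from st consider
    (look) x where "snd s r = None" "fst s' = fst s" "x \<in> targets Pr n k (fst s) r" "snd s' = (snd s)(r := Some x)"
    | (move) x where "snd s r = Some x" "fst s' = (fst s)(r := x)" "snd s' = (snd s)(r := None)"
    unfolding cstep_def by blast
  thus ?thesis
  proof cases
    case look
    have q0: "q (ix r) = 0" using D(6)[OF r look(1)] .
    from targets_rule[of "fst s", OF tower_free_lt[OF T] r look(3)]
    have "x = fst s r \<or> (\<exists>d\<in>F g (ix r). x = nd (int (fst s r) + d))" unfolding tower_free_rule[OF T nK r] by blast
    thus ?thesis
    proof
      assume "x = fst s r"
      hence "tower_free X g q ix m s'" using same look q0 pr by simp
      thus ?thesis using look by (intro exI[of _ X] exI[of _ g] exI[of _ q] exI[of _ m]) auto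
    next
      assume "\<exists>d\<in>F g (ix r). x = nd (int (fst s r) + d)"
      then obtain d where d: "d \<in> F g (ix r)" "x = nd (X (ix r) + d)" using nd_add[OF pr] by auto
      have "tower_free X g (setq q (ix r) d) ix m s'"
      proof (rule tower_free_I[OF INV_look[OF D(1) d(1) q0] D(2,3,4)])
        fix r' assume r': "r' < k"
        show "fst s' r' = nd (X (ix r'))" using D(5)[OF r'] look(2) by simp
        have o: "setq q (ix r) d (ix r') = q (ix r')" "snd s' r' = snd s r'" if "r' \<noteq> r" 
          using cgix[OF r'] that look(4) by (auto simp: setq_def)
        have i: "setq q (ix r) d (ix r) = d" by (simp add: setq_def)
        show "snd s' r' = None \<Longrightarrow> setq q (ix r) d (ix r') = 0" using D(6)[OF r'] o look(4) by (cases "r' = r") simp_all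
        show "snd s' r' = Some y \<Longrightarrow> y = nd (X (ix r') + setq q (ix r) d (ix r'))" for y
          using D(7)[OF r'] o look(4) i d(2) by (cases "r' = r") simp_all
      qed
      thus ?thesis using look by (intro exI[of _ X] exI[of _ g] exI[of _ "setq q (ix r) d"] exI[of _ m]) auto
    qed
  next
    case move
    define d where "d = q (ix r)"
    have x: "x = nd (X (ix r) + d)" using D(7)[OF r move(1)] by (simp add: d_def)
    show ?thesis
    proof (cases "d = 0")
      case True
      hence "x = fst s r" using x pr by simp
      hence f: "fst s' = fst s" using move by simp
      have "tower_free X g q ix m s'" using same f True move(3) by (simp add: d_def)
      thus ?thesis using f by (intro exI[of _ X] exI[of _ g] exI[of _ q] exI[of _ m]) auto
    next
      case False
      have dd: "d = -1 \<or> d = 1" using INV_vals(3)[OF D(1), of "ix r"] False by (auto simp: d_def)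
      define g' where "g' = upd g (ix r) d"
      define q' where "q' = setq q (ix r) 0"
      \<comment> \<open>All lifts of the robot are moved together, so that \<open>X'\<close> remains
        periodic up to \<open>N\<close>.\<close>
      define X' where "X' = (\<lambda>j. X j + (if cg j (ix r) then d else 0))"
      have I': "INV (m - 1) g' q'" using dd INV_move_L[OF D(1), of "ix r"] INV_move_R[OF D(1), of "ix r"] unfolding g'_def q'_def d_def by auto
      have l': "lift X' g'" unfolding lift_def
      proof (intro conjI allI)
        fix j
        have "X (j + 1) = X j + g j" using V(3) by (simp add: lift_def)
        thus "X' (j + 1) = X' j + g' j" unfolding X'_def g'_def upd_def cg_move by simp
        have "X (j + K) = X j + N" using V(3) by (simp add: lift_def)
        thus "X' (j + K) = X' j + N" unfolding X'_def cg_K by simp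
      qed
      have "tower_free X' g' q' ix (m - 1) s'"
      proof (rule tower_free_I[OF I' l' D(3,4)])
        fix r' assume r': "r' < k"
        have o: "X' (ix r') = X (ix r')" "q' (ix r') = q (ix r')" "snd s' r' = snd s r'" "fst s' r' = fst s r'" if "r' \<noteq> r" 
          using cgix[OF r'] that move by (auto simp: X'_def q'_def setq_def)
        have i: "X' (ix r) = X (ix r) + d" "q' (ix r) = 0" by (simp_all add: X'_def q'_def setq_def)
        show "fst s' r' = nd (X' (ix r'))" using D(5)[OF r'] o i x move(2) by (cases "r' = r") simp_all
        show "snd s' r' = None \<Longrightarrow> q' (ix r') = 0" using D(6)[OF r'] o i by (cases "r' = r") simp_all
        show "snd s' r' = Some y \<Longrightarrow> y = nd (X' (ix r') + q' (ix r'))" for y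
          using D(7)[OF r'] o i move(3) by (cases "r' = r") simp_all
      qed
      thus ?thesis by (intro exI[of _ X'] exI[of _ g'] exI[of _ q'] exI[of _ "m - 1"]) auto
    qed
  qed
qed

lemma F_dir: "d \<in> F g i \<Longrightarrow> d = 1 \<or> d = -1" by (auto simp: F_def)

lemma tower_free_prog: assumes T: "tower_free X g q ix m s" and nK: "\<not> max_run g K"
  shows "\<exists>r<k. \<forall>x\<in>targets Pr n k (fst s) r. x \<noteq> fst s r"
proof -
  have I: "INV m g q" using T by (simp add: tower_free_def)
  obtain i where i: "F g i \<noteq> {}" using INV_prog[OF I nK] by blast
  have "\<exists>r<k. cg (ix r) i" using tower_free_D(3)[OF T] .
  then obtain r where r: "r < k" "cg (ix r) i" by blast
  have "F g (ix r) = F g i"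
  proof -
    have "sh (ix r - i) g = g"
    proof
      fix u have "cg (u + (ix r - i)) u" using r(2) by (simp add: cg_def)
      thus "sh (ix r - i) g u = g u" unfolding sh_def by (rule per_cg[OF tower_free_vals(1)[OF T]])
    qed
    hence "F g i = F g (i + (ix r - i))" using F_sh[of "ix r - i" g i] by metis
    thus ?thesis by (metis add.commute diff_add_cancel)
  qed
  hence ne: "F g (ix r) \<noteq> {}" using i by simp
  show ?thesis
  proof (intro exI[of _ r] conjI r(1) ballI)
    fix x assume "x \<in> targets Pr n k (fst s) r"
    from targets_rule[of "fst s", OF tower_free_lt[OF T] r(1) this]
    obtain d where "d \<in> F g (ix r)" "x = nd (int (fst s r) + d)" unfolding tower_free_rule[OF T nK r(1)] using ne by blast
    thus "x \<noteq> fst s r" using nd_move_ne[OF tower_free_lt[OF T r(1)] F_dir] by metis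
  qed
qed

section \<open>Gathering a single block\<close>

abbreviation "H \<equiv> (K - 1) div 2"
lemma KH: "K = 2 * H + 1" "1 \<le> H" "2 * H + 5 \<le> N" using Kodd K3 KN by presburger+

definition hole_ok :: "int \<Rightarrow> int \<Rightarrow> bool" where "hole_ok a j \<longleftrightarrow> 0 \<le> a \<and> 1 \<le> j \<and> j \<le> a + 1"
lemma sideS_mem: "x \<in> sideS a j \<longleftrightarrow> 1 \<le> x \<and> x \<le> a + 1 \<and> x \<noteq> j" by (auto simp: sideS_def)
lemma sideS_fin: "finite (sideS a j)" by (simp add: sideS_def)
lemma sideS_card: "hole_ok a j \<Longrightarrow> card (sideS a j) = nat a" by (simp add: sideS_def hole_ok_def)
lemma sideS_inj: assumes "hole_ok a j" "hole_ok b i" "sideS a j = sideS b i" shows "a = b \<and> j = i"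
proof -
  have "nat a = nat b" using sideS_card[OF assms(1)] sideS_card[OF assms(2)] assms(3) by metis
  hence ab: "a = b" using assms(1,2) unfolding hole_ok_def by linarith
  have "j \<notin> sideS b i" using assms(3) sideS_mem[of j a j] by auto
  hence "j = i" using assms(1) ab by (auto simp: sideS_mem hole_ok_def)
  thus ?thesis using ab by simp
qed

text \<open>The stages of the collapse: both sides with the same number of robots and possibly a
  hole each, or one innermost robot already in the centre while the other side is still
  contiguous.\<close>

definition fam :: "int set \<Rightarrow> int set \<Rightarrow> bool" where
  "fam L R \<longleftrightarrow> L \<subseteq> {..H} \<and> R \<subseteq> {..H} \<and> (\<exists>a. 
     (\<exists>j j'. hole_ok a j \<and> hole_ok a j' \<and> L = sideS a j \<and> R = sideS a j') \<or>
     1 \<le> a \<and> (L = sideS (a - 1) 1 \<and> R = sideS a (a + 1) \<or> L = sideS a (a + 1) \<and> R = sideS (a - 1) 1))"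

lemma fam_sym: "fam L R \<Longrightarrow> fam R L" unfolding fam_def by blast
lemma fam_sp: assumes "fam L R" shows "\<exists>a j b i. hole_ok a j \<and> hole_ok b i \<and> L = sideS a j \<and> R = sideS b i"
proof -
  have "hole_ok (a - 1) 1 \<and> hole_ok a (a + 1)" if "1 \<le> a" for a using that by (simp add: hole_ok_def)
  thus ?thesis using assms unfolding fam_def by blast
qed
lemma fam_facts: assumes "fam L R" shows "L \<subseteq> {1..H}" "R \<subseteq> {1..H}" "finite L" "finite R"
proof -
  obtain a j b i where h: "L = sideS a j" "R = sideS b i" using fam_sp[OF assms] by blast
  show "L \<subseteq> {1..H}" "R \<subseteq> {1..H}" using assms unfolding fam_def h by (auto simp: sideS_mem)
  show "finite L" "finite R" unfolding h by (rule sideS_fin)+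
qed

lemma en_fam: assumes "en L R i" shows "fam L R"
proof -
  have "hole_ok a j" if "1 \<le> a" "1 \<le> j" "j \<le> a + 1" for a j :: int using that by (simp add: hole_ok_def)
  thus ?thesis using assms unfolding en_def fam_def
    by (smt (verit, ccfv_threshold))
qed
lemma en_mem: assumes "en L R i" shows "i \<in> L"
  using assms unfolding en_def by (auto simp: sideS_mem)
lemma en_pos: assumes "en L R i" shows "1 \<le> i" "i \<le> H"
  using en_mem[OF assms] fam_facts(1)[OF en_fam[OF assms]] by auto

lemma cf_neg: "cf R L = uminus ` cf L R" unfolding cf_def by (auto simp: image_Un image_image)
lemma cf_neg_mem: "x \<in> cf R L \<longleftrightarrow> - x \<in> cf L R" unfolding cf_neg[of R L] by force
lemma cf_bd: assumes "fam L R" "x \<in> cf L R" shows "- H \<le> x" "x \<le> H"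
  using fam_facts[OF assms(1)] assms(2) KH(2) by (auto simp: cf_def)
lemma cf_fin: "fam L R \<Longrightarrow> finite (cf L R)" using fam_facts by (auto simp: cf_def)
lemma cf_parts: assumes "fam L R" shows "x \<in> L \<longleftrightarrow> 0 < x \<and> - x \<in> cf L R" "x \<in> R \<longleftrightarrow> 0 < x \<and> x \<in> cf L R"
  using fam_facts(1,2)[OF assms] by (force simp: cf_def)+
lemma cf_card: assumes "fam L R" shows "card (cf L R) = card L + card R + 1"
proof -
  note f = fam_facts[OF assms]
  have "uminus ` L \<inter> R = {}" using f by fastforce
  hence "card (uminus ` L \<union> R) = card L + card R" using f by (simp add: card_Un_disjoint card_image)
  moreover have "0 \<notin> uminus ` L \<union> R" using f by fastforce
  ultimately show ?thesis unfolding cf_def using f by simp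
qed

text \<open>Each side has at most one hole, so neighbouring occupied offsets differ by at most 2,
  while the gap around the rest of the ring is at least 5. This identifies the leftmost
  node.\<close>

lemma cf_pred: assumes F: "fam L R" and x: "x \<in> cf L R" and z: "z \<in> cf L R" "z < x"
  shows "\<exists>x'\<in>cf L R. x - 2 \<le> x' \<and> x' < x"
proof -
  obtain a j b i where h: "hole_ok a j" "hole_ok b i" "L = sideS a j" "R = sideS b i" using fam_sp[OF F] by blast
  have Rm: "w \<in> cf L R" if "1 \<le> w" "w \<le> b + 1" "w \<noteq> i" for w using that by (auto simp: cf_def h sideS_mem)
  have Lm: "- w \<in> cf L R" if "1 \<le> w" "w \<le> a + 1" "w \<noteq> j" for w using that by (auto simp: cf_def h sideS_mem)
  have 0: "0 \<in> cf L R" by (simp add: cf_def)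
  show ?thesis
  proof (cases "0 < x")
    case True
    hence xr: "x \<le> b + 1" "x \<noteq> i" using x by (auto simp: cf_def h sideS_mem)
    consider "x \<le> 2" | "3 \<le> x" "x - 1 \<noteq> i" | "3 \<le> x" "x - 1 = i" by linarith
    thus ?thesis
    proof cases
      case 1 thus ?thesis using 0 True by (intro bexI[of _ 0]) auto
    next
      case 2 thus ?thesis using Rm[of "x - 1"] xr by (intro bexI[of _ "x - 1"]) auto
    next
      case 3 thus ?thesis using Rm[of "x - 2"] xr by (intro bexI[of _ "x - 2"]) auto
    qed
  next
    case False
    have zl: "1 \<le> - z" "- z \<le> a + 1" "- z \<noteq> j" using z False by (auto simp: cf_def h sideS_mem)
    show ?thesis
    proof (cases "1 - x = j")
      case False
      thus ?thesis using Lm[of "1 - x"] zl z(2) \<open>\<not> 0 < x\<close> by (intro bexI[of _ "x - 1"]) auto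
    next
      case True
      hence "2 - x \<le> - z" using zl z(2) by simp
      thus ?thesis using Lm[of "2 - x"] zl True \<open>\<not> 0 < x\<close> by (intro bexI[of _ "x - 2"]) auto
    qed
  qed
qed

lemma N_small: assumes "N dvd x" "\<bar>x\<bar> < N" shows "x = 0"
proof (rule ccontr)
  assume "x \<noteq> 0"
  hence "N \<le> \<bar>x\<bar>" using assms(1) zdvd_imp_le[of N "\<bar>x\<bar>"] by simp
  thus False using assms(2) by simp
qed

text \<open>The big gap pins the configuration down up to a translation, and the centre is recognised by the
  number of nodes on its left; only two adjacent nodes are ambiguous.\<close>

lemma cf_unique: assumes F: "fam L R" and E: "en L' R' i"
    and eq: "\<And>x. (\<exists>y\<in>cf L R. N dvd x - y) \<longleftrightarrow> (\<exists>y\<in>cf L' R'. N dvd x - t0 - y)"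
    and side: "card (cf L R) = 2 \<Longrightarrow> \<not> N dvd t0 - i"
  shows "N dvd t0 \<and> L = L' \<and> R = R'"
proof -
  have F': "fam L' R'" using en_fam[OF E] .
  let ?M = "cf L R" let ?M' = "cf L' R'"
  have fin: "finite ?M" "finite ?M'" using cf_fin F F' by auto
  have z0: "0 \<in> ?M" "0 \<in> ?M'" by (auto simp: cf_def)
  define m0 where "m0 = Min ?M" define m1 where "m1 = Min ?M'"
  have m0: "m0 \<in> ?M" "\<And>x. x \<in> ?M \<Longrightarrow> m0 \<le> x" unfolding m0_def using fin z0 Min_in[of ?M] Min_le[of ?M] by blast+
  have m1: "m1 \<in> ?M'" "\<And>x. x \<in> ?M' \<Longrightarrow> m1 \<le> x" unfolding m1_def using fin z0 Min_in[of ?M'] Min_le[of ?M'] by blast+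
  note b = cf_bd[OF F] cf_bd[OF F']
  have "\<exists>y\<in>?M'. N dvd (m1 + t0) - t0 - y" using m1(1) by (intro bexI[of _ m1]) auto
  then obtain x where x: "x \<in> ?M" "N dvd m1 + t0 - x" using eq by blast
  \<comment> \<open>Otherwise \<open>x\<close> has an occupied node at distance at most 2 on its
    left, whereas the leftmost node \<open>m1\<close> of the other description has only the big gap
    there.\<close>
  have xm: "x = m0"
  proof (rule ccontr)
    assume "x \<noteq> m0"
    hence "m0 < x" using m0(2)[OF x(1)] by simp
    from cf_pred[OF F x(1) m0(1) this] obtain x' where x': "x' \<in> ?M" "x - 2 \<le> x'" "x' < x" by blast
    have "\<exists>y\<in>?M. N dvd x' - y" using x'(1) by (intro bexI[of _ x']) auto
    then obtain y where y: "y \<in> ?M'" "N dvd x' - t0 - y" using eq by blast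
    have "N dvd (m1 + t0 - x) + (x' - t0 - y)" using x(2) y(2) by (rule dvd_add)
    hence "N dvd (x' - x) - (y - m1)" by (simp add: algebra_simps)
    moreover have "\<bar>(x' - x) - (y - m1)\<bar> < N" using x' m1(2)[OF y(1)] b(3)[OF m1(1)] b(4)[OF y(1)] KH by linarith
    ultimately have "(x' - x) - (y - m1) = 0" using N_small by blast
    thus False using x' m1(2)[OF y(1)] by simp
  qed
  \<comment> \<open>The shift \<open>t0\<close> is known only modulo \<open>N\<close>; with the
    representative \<open>t\<close> the two offset sets are literal translates of each
    other.\<close>
  define t where "t = m0 - m1"
  have tt: "N dvd t0 - t" using x(2) unfolding xm t_def by (simp add: algebra_simps)
  have close: "z = y + t" if "z \<in> ?M" "y \<in> ?M'" "N dvd z - t0 - y" for z y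
  proof -
    have "N dvd (z - t0 - y) + (t0 - t)" using that(3) tt by (rule dvd_add)
    hence "N dvd z - (y + t)" by (simp add: algebra_simps)
    moreover have "\<bar>z - (y + t)\<bar> < N"
      using m0(2)[OF that(1)] m1(2)[OF that(2)] b(2)[OF that(1)] b(1)[OF m0(1)] b(4)[OF that(2)] b(3)[OF m1(1)] KH(3)
      unfolding t_def by linarith
    ultimately show ?thesis using N_small by fastforce
  qed
  have M: "?M = (+) t ` ?M'"
  proof
    show "?M \<subseteq> (+) t ` ?M'"
    proof
      fix z assume z: "z \<in> ?M"
      hence "\<exists>y\<in>?M. N dvd z - y" by (intro bexI[of _ z]) auto
      then obtain y where "y \<in> ?M'" "N dvd z - t0 - y" using eq by blast
      hence "z = t + y" "y \<in> ?M'" using close[OF z, of y] by simp_all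
      thus "z \<in> (+) t ` ?M'" by blast
    qed
    show "(+) t ` ?M' \<subseteq> ?M"
    proof
      fix w assume "w \<in> (+) t ` ?M'"
      then obtain y where y: "y \<in> ?M'" "w = t + y" by blast
      hence "\<exists>y'\<in>?M'. N dvd (y + t0) - t0 - y'" by (intro bexI[of _ y]) auto
      then obtain z where z: "z \<in> ?M" "N dvd (y + t0) - z" using eq by blast
      have "N dvd z - t0 - y"
      proof -
        have "z - t0 - y = - ((y + t0) - z)" by simp
        thus ?thesis using z(2) by (simp only: dvd_minus_iff)
      qed
      thus "w \<in> ?M" using close[OF z(1) y(1)] z(1) y(2) by (simp add: add.commute)
    qed
  qed
  have cM: "card L + card R = card L' + card R'"
  proof -
    have "card ?M = card ?M'" unfolding M by (intro card_image) auto
    thus ?thesis using cf_card[OF F] cf_card[OF F'] by simp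
  qed
  \<comment> \<open>The cardinality of the left side is the rank of the centre among the occupied
    offsets; equal ranks mean equal centres.\<close>
  have rank: "t = 0" if cl: "card L = card L'"
  proof -
    have "{x \<in> ?M. x < 0} = uminus ` L" using fam_facts(1,2)[OF F] by (force simp: cf_def)
    hence c1: "card {x \<in> ?M. x < 0} = card L" by (simp add: card_image)
    have "{x \<in> ?M'. x < 0} = uminus ` L'" using fam_facts(1,2)[OF F'] by (force simp: cf_def)
    hence c2: "card {x \<in> ?M'. x < 0} = card L'" by (simp add: card_image)
    have "{x \<in> ?M. x < t} = (+) t ` {x \<in> ?M'. x < 0}" unfolding M by auto
    hence c3: "card {x \<in> ?M. x < t} = card L'" using c2 by (simp add: card_image)
    have tM: "t \<in> ?M" unfolding M using z0 by force
    show ?thesis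
    proof (rule ccontr)
      assume "t \<noteq> 0"
      then consider "0 < t" | "t < 0" by linarith
      thus False
      proof cases
        case 1
        have "{x \<in> ?M. x < 0} \<subset> {x \<in> ?M. x < t}" using 1 z0 by auto
        from psubset_card_mono[OF _ this] show False using fin c1 c3 cl by simp
      next
        case 2
        have "{x \<in> ?M. x < t} \<subset> {x \<in> ?M. x < 0}" using 2 tM by auto
        from psubset_card_mono[OF _ this] show False using fin c1 c3 cl by simp
      qed
    qed
  qed
  have zero: "N dvd t0 \<and> L = L' \<and> R = R'" if "t = 0"
  proof -
    have "?M = ?M'" using M that by simp
    hence "L = L'" "R = R'" using cf_parts[OF F] cf_parts[OF F'] by blast+
    thus ?thesis using tt that by simp
  qed
  from E obtain a' where a': "1 \<le> a'" "card L' = nat a' \<and> card R' = nat a' \<or> L' = sideS a' (a' + 1) \<and> R' = sideS (a' - 1) 1 \<and> i = 1"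
  proof -
    have "hole_ok a j" if "1 \<le> a" "1 \<le> j" "j \<le> a + 1" for a j :: int using that by (simp add: hole_ok_def)
    hence cc: "card (sideS a j) = nat a" if "1 \<le> a" "1 \<le> j" "j \<le> a + 1" for a j :: int using sideS_card that by blast
    from E obtain a where "a \<ge> 1" "(\<exists>j j'. 1 \<le> j \<and> j \<le> a \<and> 1 \<le> j' \<and> j' \<le> a + 1 \<and> L' = sideS a j \<and> R' = sideS a j' \<and> i = j + 1) \<or>
     L' = sideS a (a + 1) \<and> (R' = sideS a (a + 1) \<or> R' = sideS (a - 1) 1) \<and> i = 1" unfolding en_def by blast
    thus ?thesis
    proof (elim disjE exE conjE)
      fix j j' assume h: "1 \<le> j" "j \<le> a" "1 \<le> j'" "j' \<le> a + 1" "L' = sideS a j" "R' = sideS a j'"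
      have "card L' = nat a" "card R' = nat a" unfolding h(5,6) by (rule cc; use h \<open>1 \<le> a\<close> in linarith)+
      thus ?thesis using that[of a] \<open>1 \<le> a\<close> by blast
    next
      assume h: "L' = sideS a (a + 1)" "R' = sideS a (a + 1)"
      have "card L' = nat a" "card R' = nat a" unfolding h by (rule cc; use \<open>1 \<le> a\<close> in linarith)+
      thus ?thesis using that[of a] \<open>1 \<le> a\<close> by blast
    next
      assume h: "L' = sideS a (a + 1)" "R' = sideS (a - 1) 1" "i = 1"
      thus ?thesis using that[of a] \<open>1 \<le> a\<close> by blast
    qed
  qed
  have lagc: "card (sideS a (a + 1)) = nat a" "card (sideS (a - 1) 1) = nat (a - 1)" if "1 \<le> a" for a
    using sideS_card[of a "a + 1"] sideS_card[of "a - 1" 1] that by (simp_all add: hole_ok_def)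
  from F obtain a where "(\<exists>j j'. hole_ok a j \<and> hole_ok a j' \<and> L = sideS a j \<and> R = sideS a j') \<or>
     1 \<le> a \<and> (L = sideS (a - 1) 1 \<and> R = sideS a (a + 1) \<or> L = sideS a (a + 1) \<and> R = sideS (a - 1) 1)" unfolding fam_def by blast
  then consider (sym) "0 \<le> a" "card L = nat a" "card R = nat a" | (A) "1 \<le> a" "L = sideS (a - 1) 1" "R = sideS a (a + 1)"
    | (B) "1 \<le> a" "L = sideS a (a + 1)" "R = sideS (a - 1) 1"
  proof (elim disjE exE conjE)
    fix j j' assume h: "hole_ok a j" "hole_ok a j'" "L = sideS a j" "R = sideS a j'"
    show ?thesis using sym sideS_card[OF h(1)] sideS_card[OF h(2)] h by (simp add: hole_ok_def)
  qed blast+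
  \<comment> \<open>The total numbers agree, so by parity a balanced stage cannot be confused with
    an unbalanced one. The ranks differ only between an unbalanced stage and its mirror image of the
    same size.\<close>
  hence "card L = card L' \<or> (1 \<le> a \<and> L = sideS (a - 1) 1 \<and> R = sideS a (a + 1) \<and> L' = sideS a (a + 1) \<and> R' = sideS (a - 1) 1 \<and> i = 1)"
  proof cases
    case sym
    from a'(2) show ?thesis
    proof
      assume "card L' = nat a' \<and> card R' = nat a'" thus ?thesis using sym cM by simp
    next
      assume "L' = sideS a' (a' + 1) \<and> R' = sideS (a' - 1) 1 \<and> i = 1"
      hence "nat a + nat a = nat a' + nat (a' - 1)" using sym cM lagc[OF a'(1)] by simp
      hence "a + a = a' + (a' - 1)" using sym(1) a'(1) by linarith
      hence False by presburger
      thus ?thesis ..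
    qed
  next
    case A
    from a'(2) show ?thesis
    proof
      assume "card L' = nat a' \<and> card R' = nat a'"
      hence "nat (a - 1) + nat a = nat a' + nat a'" using A cM lagc[OF A(1)] by simp
      hence "(a - 1) + a = a' + a'" using A(1) a'(1) by linarith
      hence False by presburger
      thus ?thesis ..
    next
      assume l: "L' = sideS a' (a' + 1) \<and> R' = sideS (a' - 1) 1 \<and> i = 1"
      hence "nat (a - 1) + nat a = nat a' + nat (a' - 1)" using A cM lagc[OF A(1)] lagc[OF a'(1)] by simp
      hence "a = a'" using A(1) a'(1) by linarith
      thus ?thesis using A l by simp
    qed
  next
    case B
    from a'(2) show ?thesis
    proof
      assume "card L' = nat a' \<and> card R' = nat a'"
      hence "nat (a - 1) + nat a = nat a' + nat a'" using B cM lagc[OF B(1)] by simp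
      hence "(a - 1) + a = a' + a'" using B(1) a'(1) by linarith
      hence False by presburger
      thus ?thesis ..
    next
      assume l: "L' = sideS a' (a' + 1) \<and> R' = sideS (a' - 1) 1 \<and> i = 1"
      hence "nat (a - 1) + nat a = nat a' + nat (a' - 1)" using B cM lagc[OF B(1)] lagc[OF a'(1)] by simp
      hence "a = a'" using B(1) a'(1) by linarith
      thus ?thesis using B l by simp
    qed
  qed
  thus ?thesis
  proof
    assume "card L = card L'" thus ?thesis using rank zero by blast
  next
    assume l: "1 \<le> a \<and> L = sideS (a - 1) 1 \<and> R = sideS a (a + 1) \<and> L' = sideS a (a + 1) \<and> R' = sideS (a - 1) 1 \<and> i = 1"
    have m1': "m1 = - a" unfolding m1_def
      by (rule Min_eqI[OF fin(2)]) (use l in \<open>auto simp: cf_def sideS_mem\<close>)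
    show ?thesis
    proof (cases "a = 1")
      case False
      have "m0 = - a" unfolding m0_def
        by (rule Min_eqI[OF fin(1)]) (use l False in \<open>auto simp: cf_def sideS_mem\<close>)
      hence "t = 0" using m1' by (simp add: t_def)
      thus ?thesis by (rule zero)
    next
      \<comment> \<open>The ambiguous case compares offsets \<open>{0, 1}\<close> with
        \<open>{-1, 0}\<close>: two adjacent nodes, either of which could be the centre. The
        hypothesis \<open>side\<close> excludes it.\<close>
      case True
      have "m0 = 0" unfolding m0_def
        by (rule Min_eqI[OF fin(1)]) (use l True in \<open>auto simp: cf_def sideS_mem\<close>)
      hence "t = 1" using m1' True by (simp add: t_def)
      hence "N dvd t0 - i" using tt l by simp
      moreover have "card (cf L R) = 2" using cf_card[OF F] lagc[of a] l True by simp
      ultimately show ?thesis using side by blast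
    qed
  qed
qed

text \<open>\<open>y r\<close> is the coordinate of robot \<open>r\<close> relative to the centre \<open>c\<close>, in the orientation \<open>s\<close>.\<close>

definition one_block :: "int \<Rightarrow> int \<Rightarrow> int set \<Rightarrow> int set \<Rightarrow> (nat \<Rightarrow> int) \<Rightarrow> state \<Rightarrow> bool" where
  "one_block c s L R y st \<longleftrightarrow> (s = 1 \<or> s = -1) \<and> fam L R \<and> (\<forall>r<k. y r \<in> cf L R) \<and> (\<forall>z\<in>cf L R. \<exists>r<k. y r = z) \<and>
     (\<forall>r<k. \<forall>r'<k. y r = y r' \<longrightarrow> y r \<noteq> 0 \<longrightarrow> r = r') \<and> (\<forall>r<k. fst st r = nd (c + s * y r)) \<and>
     (\<forall>r<k. \<forall>x. snd st r = Some x \<longrightarrow> x = fst st r \<or> en L R (- y r) \<and> x = nd (c + s * (y r + 1)) \<or>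
        en R L (y r) \<and> x = nd (c + s * (y r - 1)))"

lemma one_block_I: assumes "s = 1 \<or> s = -1" "fam L R" "\<And>r. r < k \<Longrightarrow> y r \<in> cf L R" "\<And>z. z \<in> cf L R \<Longrightarrow> \<exists>r<k. y r = z"
    "\<And>r r'. r < k \<Longrightarrow> r' < k \<Longrightarrow> y r = y r' \<Longrightarrow> y r \<noteq> 0 \<Longrightarrow> r = r'" "\<And>r. r < k \<Longrightarrow> fst st r = nd (c + s * y r)"
    "\<And>r x. r < k \<Longrightarrow> snd st r = Some x \<Longrightarrow> x = fst st r \<or> en L R (- y r) \<and> x = nd (c + s * (y r + 1)) \<or>
        en R L (y r) \<and> x = nd (c + s * (y r - 1))"
  shows "one_block c s L R y st" unfolding one_block_def using assms by blast
lemma one_block_D: assumes "one_block c s L R y st"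
  shows "s = 1 \<or> s = -1" "fam L R" "r < k \<Longrightarrow> y r \<in> cf L R" "z \<in> cf L R \<Longrightarrow> \<exists>r<k. y r = z"
    "r < k \<Longrightarrow> r' < k \<Longrightarrow> y r = y r' \<Longrightarrow> y r \<noteq> 0 \<Longrightarrow> r = r'" "r < k \<Longrightarrow> fst st r = nd (c + s * y r)"
    "r < k \<Longrightarrow> snd st r = Some x \<Longrightarrow> x = fst st r \<or> en L R (- y r) \<and> x = nd (c + s * (y r + 1)) \<or>
        en R L (y r) \<and> x = nd (c + s * (y r - 1))"
  using assms unfolding one_block_def by blast+

lemma one_block_mirror: assumes "one_block c s L R y st" shows "one_block c (- s) R L (\<lambda>r. - y r) st"
proof -
  note D = one_block_D[OF assms]
  show ?thesis
  proof (rule one_block_I[OF _ fam_sym[OF D(2)]])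
    show "- s = 1 \<or> - s = -1" using D(1) by auto
    show "\<And>r. r < k \<Longrightarrow> - y r \<in> cf R L" by (rule cf_neg_mem[THEN iffD2]) (use D(3) in simp)
    fix z assume "z \<in> cf R L"
    hence "- z \<in> cf L R" by (rule cf_neg_mem[THEN iffD1])
    thus "\<exists>r<k. - y r = z" using D(4) by force
  next
    show "\<And>r r'. r < k \<Longrightarrow> r' < k \<Longrightarrow> - y r = - y r' \<Longrightarrow> - y r \<noteq> 0 \<Longrightarrow> r = r'" using D(5) by simp
    show "\<And>r. r < k \<Longrightarrow> fst st r = nd (c + - s * - y r)" using D(6) by simp
    fix r x assume h: "r < k" "snd st r = Some x"
    have e: "c + - s * (- y r + 1) = c + s * (y r - 1)" "c + - s * (- y r - 1) = c + s * (y r + 1)" by (simp_all add: algebra_simps)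
    show "x = fst st r \<or> en R L (- (- y r)) \<and> x = nd (c + - s * (- y r + 1)) \<or> en L R (- y r) \<and> x = nd (c + - s * (- y r - 1))"
      using D(7)[OF h] unfolding e by auto
  qed
qed

lemma one_block_node: assumes "one_block c s L R y st" "z \<in> cf L R" "z' \<in> cf L R" "nd (c + s * z) = nd (c + s * z')" shows "z = z'"
proof -
  note D = one_block_D[OF assms(1)]
  have "N dvd s * (z - z')" using assms(4) unfolding nd_eq by (simp add: algebra_simps)
  hence "N dvd z - z'" using D(1) by (auto simp: dvd_diff_commute)
  moreover have "\<bar>z - z'\<bar> < N" using cf_bd[OF D(2) assms(2)] cf_bd[OF D(2) assms(3)] KH by linarith
  ultimately show ?thesis using N_small by force
qed

lemma one_block_occ: assumes "one_block c s L R y st" shows "occupied k (fst st) = (\<lambda>z. nd (c + s * z)) ` cf L R"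
proof -
  note D = one_block_D[OF assms]
  show ?thesis
  proof
    show "occupied k (fst st) \<subseteq> (\<lambda>z. nd (c + s * z)) ` cf L R" unfolding occupied_def using D(3,6) by auto
    show "(\<lambda>z. nd (c + s * z)) ` cf L R \<subseteq> occupied k (fst st)"
    proof
      fix w assume "w \<in> (\<lambda>z. nd (c + s * z)) ` cf L R"
      then obtain z where z: "z \<in> cf L R" "w = nd (c + s * z)" by blast
      obtain r where "r < k" "y r = z" using D(4)[OF z(1)] by blast
      thus "w \<in> occupied k (fst st)" unfolding occupied_def using D(6)[of r] z by force
    qed
  qed
qed

text \<open>Explicit gaps and positions for a block numbered from its left end, with one long gap
  closing the ring. It shows that a robot of a complete block applies the collapse rule.\<close>

lemma block_mx: assumes S: "S = (\<lambda>z. nd (c + z)) ` {- H..H}" and u: "u \<in> S" shows "max_run (gl (segs n S u)) K"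
proof -
  define g where "g = (\<lambda>j. if j mod K = K - 1 then N - K + 1 else 1)"
  define X where "X = (\<lambda>j. c - H + j mod K + N * (j div K))"
  have g1: "1 \<le> g j" for j using KN by (simp add: g_def)
  have pg: "per g" by (simp add: per_def g_def)
  have l: "lift X g" unfolding lift_def
  proof (intro conjI allI)
    fix j
    have b: "0 \<le> j mod K" "j mod K < K" using K3 by simp_all
    show "X (j + 1) = X j + g j"
    proof (cases "j mod K = K - 1")
      case True
      have "j + 1 = K * (j div K) + K" using True mult_div_mod_eq[of K j] by linarith
      hence "j + 1 = K * (j div K + 1)" unfolding distrib_left mult_1_right .
      hence "(j + 1) div K = j div K + 1" "(j + 1) mod K = 0" using K3 by simp_all
      thus ?thesis unfolding X_def g_def using True by (simp add: algebra_simps)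
    next
      case False
      have "j + 1 = K * (j div K) + (j mod K + 1)" using mult_div_mod_eq[of K j] by simp
      hence "(j + 1) div K = j div K" "(j + 1) mod K = j mod K + 1"
        by (rule int_div_pos_eq int_mod_pos_eq; use False b in linarith)+
      thus ?thesis unfolding X_def g_def using False by simp
    qed
    have "(j + K) div K = j div K + 1" using K3 by (intro div_add_self2) simp
    thus "X (j + K) = X j + N" unfolding X_def by (simp add: algebra_simps)
  qed
  have SX: "S = range (\<lambda>j. nd (X j))"
  proof
    show "S \<subseteq> range (\<lambda>j. nd (X j))"
    proof
      fix w assume "w \<in> S"
      then obtain z where z: "z \<in> {- H..H}" "w = nd (c + z)" using S by blast
      have "0 \<le> z + H" "z + H < K" using z KH by auto
      hence "X (z + H) = c + z" unfolding X_def by simp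
      thus "w \<in> range (\<lambda>j. nd (X j))" using z by (metis rangeI)
    qed
    show "range (\<lambda>j. nd (X j)) \<subseteq> S"
    proof
      fix w assume "w \<in> range (\<lambda>j. nd (X j))"
      then obtain j where j: "w = nd (X j)" by blast
      have b: "0 \<le> j mod K" "j mod K < K" using K3 by simp_all
      have "w = nd (c + (j mod K - H))" unfolding j nd_eq X_def by simp
      moreover have "j mod K - H \<in> {- H..H}" using b KH(1) by simp
      ultimately show "w \<in> S" unfolding S by blast
    qed
  qed
  then obtain i where i: "u = nd (X i)" using u by blast
  have "max_run g K" unfolding max_run_def
  proof (intro conjI allI)
    show "1 \<le> K" using K3 by simp
    have "run g K 0" unfolding run_def g_def by auto
    thus "\<exists>j. run g K j" by blast
    fix j show "\<not> run g (K + 1) j"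
    proof
      assume r: "run g (K + 1) j"
      obtain t where t: "j \<le> t" "t < j + K" "cg t (K - 1)" using cg_rep by blast
      have "g t = g (K - 1)" using per_cg[OF pg t(3)] .
      moreover have "(K - 1) mod K = K - 1" using K3 by (intro mod_pos_pos_trivial) simp_all
      hence "g (K - 1) = N - K + 1" unfolding g_def by simp
      moreover have "g t = 1" using r t unfolding run_def by simp
      ultimately show False using KN by simp
    qed
  qed
  thus ?thesis unfolding segs_lift[OF l g1 SX i] gl_map[OF pg g1] max_run_sh .
qed

lemma one_block_len: assumes P: "one_block c s L R y st" and r: "r < k" and l: "length (segs n (occupied k (fst st)) (fst st r)) = k"
  shows "max_run (gl (segs n (occupied k (fst st)) (fst st r))) K"
proof -
  note D = one_block_D[OF P]
  let ?S = "occupied k (fst st)"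
  have Sn: "?S \<subseteq> {..<n}" unfolding one_block_occ[OF P] using nd_lt by auto
  have u: "fst st r \<in> ?S" using r by (auto simp: occupied_def)
  have "k = card (set (sorted_dists ?S (fst st r)))" using l segs_len[OF Sn u] sorted_dists_facts(3)[OF Sn u] distinct_card by metis
  also have "\<dots> \<le> card ?S" unfolding sorted_dists_facts(1)[OF Sn u] using Sn finite_subset by (intro card_image_le) blast
  also have "\<dots> \<le> card (cf L R)" unfolding one_block_occ[OF P] using cf_fin[OF D(2)] by (rule card_image_le)
  finally have c: "k \<le> card (cf L R)" .
  have sub: "cf L R \<subseteq> {- H..H}" using cf_bd[OF D(2)] by auto
  have "card {- H..H} = k" using KH(1) by simp
  hence cf: "cf L R = {- H..H}" using c sub by (intro card_seteq) auto
  have "(\<lambda>z. nd (c + s * z)) ` {- H..H} = (\<lambda>z. nd (c + z)) ` {- H..H}"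
  proof -
    have "(\<lambda>z. s * z) ` {- H..H} = {- H..H}" using D(1) by auto
    hence "(\<lambda>z. nd (c + z)) ` (\<lambda>z. s * z) ` {- H..H} = (\<lambda>z. nd (c + z)) ` {- H..H}" by simp
    thus ?thesis by (simp add: image_image)
  qed
  hence "?S = (\<lambda>z. nd (c + z)) ` {- H..H}" using one_block_occ[OF P] cf by simp
  from block_mx[OF this u] show ?thesis .
qed

text \<open>The second part supplies the hypothesis \<open>side\<close> of \<open>cf_unique\<close>:
  with at least three robots on two nodes, of which only the centre can be a tower, a robot without
  company is not at the centre.\<close>

lemma one_block_flag: assumes P: "one_block c s L R y st" and r: "r < k"
  shows "y r \<noteq> 0 \<Longrightarrow> \<not> (\<exists>r'<k. r' \<noteq> r \<and> fst st r' = fst st r)"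
    "\<not> (\<exists>r'<k. r' \<noteq> r \<and> fst st r' = fst st r) \<Longrightarrow> card (cf L R) = 2 \<Longrightarrow> y r \<noteq> 0"
proof -
  note D = one_block_D[OF P]
  have same: "fst st r' = fst st r \<longleftrightarrow> y r' = y r" if "r' < k" for r'
    using D(6)[OF r] D(6)[OF that] one_block_node[OF P D(3)[OF that] D(3)[OF r]] by auto
  show "y r \<noteq> 0 \<Longrightarrow> \<not> (\<exists>r'<k. r' \<noteq> r \<and> fst st r' = fst st r)" using same D(5)[OF r] by metis
  assume n: "\<not> (\<exists>r'<k. r' \<noteq> r \<and> fst st r' = fst st r)" and c: "card (cf L R) = 2"
  show "y r \<noteq> 0"
  proof
    assume z: "y r = 0"
    have "inj_on y {..<k}"
    proof (rule inj_onI)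
      fix a b assume ab: "a \<in> {..<k}" "b \<in> {..<k}" "y a = y b"
      show "a = b"
      proof (cases "y a = 0")
        case True
        hence "a = r" "b = r" using ab same n z by auto
        thus ?thesis by simp
      qed (use D(5) ab in auto)
    qed
    hence "card (y ` {..<k}) = k" by (simp add: card_image)
    moreover have "card (y ` {..<k}) \<le> card (cf L R)" using D(3) cf_fin[OF D(2)] by (intro card_mono) auto
    ultimately show False using c k3 by simp
  qed
qed

text \<open>Any stage that a robot fits to its view is the true one by \<open>cf_unique\<close>, so
  the rule tells exactly the enabled robots to move, and towards the true centre.\<close>

lemma one_block_rule1: assumes P: "one_block c 1 L R y st" and r: "r < k"
  defines "A \<equiv> rule (segs n (occupied k (fst st)) (fst st r)) (\<exists>r'<k. r' \<noteq> r \<and> fst st r' = fst st r)"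
  shows "1 \<in> A \<longleftrightarrow> en L R (- y r)" "-1 \<in> A \<longleftrightarrow> en R L (y r)"
proof -
  note D = one_block_D[OF P]
  define v where "v = segs n (occupied k (fst st)) (fst st r)"
  define m where "m = (\<exists>r'<k. r' \<noteq> r \<and> fst st r' = fst st r)"
  have A: "A = (if m then {} else Ph2 v)" using one_block_len[OF P r] unfolding A_def rule_def v_def m_def by auto
  have Sn1: "occupied k (fst st) \<subseteq> {..<n}" unfolding one_block_occ[OF P] using nd_lt by auto
  have Sn2: "fst st r \<in> occupied k (fst st)" using r by (auto simp: occupied_def)
  note Sn = Sn1 Sn2
  have O: "x \<in> Ov v \<longleftrightarrow> (\<exists>z\<in>cf L R. N dvd x + y r - z)" for x
  proof -
    have "nd (int (fst st r) + x) = nd (c + y r + x)" using nd_add[OF D(6)[OF r], of x] by simp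
    hence "x \<in> Ov v \<longleftrightarrow> (\<exists>z\<in>cf L R. nd (c + y r + x) = nd (c + z))" unfolding v_def Ov_segs[OF Sn] unfolding one_block_occ[OF P] by auto
    thus ?thesis unfolding nd_eq by (simp add: algebra_simps)
  qed
  have yb: "- H \<le> y r" "y r \<le> H" using cf_bd[OF D(2) D(3)[OF r]] by auto
  have nz: "\<not> N dvd y r" if "\<not> m" "card (cf L R) = 2"
  proof
    assume "N dvd y r"
    hence "y r = 0" using N_small[of "y r"] yb KH by linarith
    thus False using one_block_flag(2)[OF P r] that unfolding m_def by blast
  qed
  have cfs: "cf R L = uminus ` cf L R" by (rule cf_neg)
  show "1 \<in> A \<longleftrightarrow> en L R (- y r)"
  proof
    assume "1 \<in> A"
    hence m: "\<not> m" and "1 \<in> Ph2 v" unfolding A by (auto split: if_splits)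
    then obtain L' R' i where E: "en L' R' i" and e: "\<And>x. x \<in> Ov v \<longleftrightarrow> (\<exists>y\<in>cf L' R'. N dvd 1 * x - (y + i))" unfolding Ph2_def by blast
    have "N dvd y r + i \<and> L = L' \<and> R = R'"
    proof (rule cf_unique[OF D(2) E])
      fix x
      show "(\<exists>y\<in>cf L R. N dvd x - y) \<longleftrightarrow> (\<exists>z\<in>cf L' R'. N dvd x - (y r + i) - z)"
        using O[of "x - y r"] e[of "x - y r"] by (simp add: algebra_simps)
      show "card (cf L R) = 2 \<Longrightarrow> \<not> N dvd y r + i - i" using nz[OF m] by simp
    qed
    moreover from this have "y r + i = 0" using N_small[of "y r + i"] yb en_pos[OF E] KH by linarith
    hence "i = - y r" by simp
    ultimately show "en L R (- y r)" using E by simp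
  next
    assume E: "en L R (- y r)"
    hence "\<not> m" using en_pos(1)[OF E] one_block_flag(1)[OF P r] unfolding m_def by auto
    moreover have "x \<in> Ov v \<longleftrightarrow> (\<exists>z\<in>cf L R. N dvd 1 * x - (z + - y r))" for x unfolding O by (simp add: algebra_simps)
    hence "1 \<in> Ph2 v" unfolding Ph2_def using E by blast
    ultimately show "1 \<in> A" unfolding A by simp
  qed
  have O': "x \<in> Ov v \<longleftrightarrow> (\<exists>z\<in>cf R L. N dvd - x - y r - z)" for x
  proof -
    have d: "N dvd x + y r - z \<longleftrightarrow> N dvd - x - y r - (- z)" for z
    proof -
      have "- x - y r - (- z) = - (x + y r - z)" by simp
      thus ?thesis by (simp only: dvd_minus_iff)
    qed
    show ?thesis unfolding O d unfolding cfs by blast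
  qed
  show "-1 \<in> A \<longleftrightarrow> en R L (y r)"
  proof
    assume "-1 \<in> A"
    hence m: "\<not> m" and "-1 \<in> Ph2 v" unfolding A by (auto split: if_splits)
    then obtain L' R' i where E: "en L' R' i" and e: "\<And>x. x \<in> Ov v \<longleftrightarrow> (\<exists>y\<in>cf L' R'. N dvd -1 * x - (y + i))" unfolding Ph2_def by blast
    have "N dvd i - y r \<and> R = L' \<and> L = R'"
    proof (rule cf_unique[OF fam_sym[OF D(2)] E])
      fix x
      show "(\<exists>y\<in>cf R L. N dvd x - y) \<longleftrightarrow> (\<exists>z\<in>cf L' R'. N dvd x - (i - y r) - z)"
        using O'[of "- x - y r"] e[of "- x - y r"] by (simp add: algebra_simps)
      have "card (cf R L) = card (cf L R)" unfolding cfs by (simp add: card_image)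
      thus "card (cf R L) = 2 \<Longrightarrow> \<not> N dvd i - y r - i" using nz[OF m] by simp
    qed
    moreover from this have "i - y r = 0" using N_small[of "i - y r"] yb en_pos[OF E] KH by linarith
    hence "i = y r" by simp
    ultimately show "en R L (y r)" using E by simp
  next
    assume E: "en R L (y r)"
    hence "\<not> m" using en_pos(1)[OF E] one_block_flag(1)[OF P r] unfolding m_def by auto
    moreover have "x \<in> Ov v \<longleftrightarrow> (\<exists>z\<in>cf R L. N dvd -1 * x - (z + y r))" for x unfolding O' by (simp add: algebra_simps)
    hence "-1 \<in> Ph2 v" unfolding Ph2_def using E by blast
    ultimately show "-1 \<in> A" unfolding A by simp
  qed
qed

lemma one_block_rule: assumes P: "one_block c s L R y st" and r: "r < k"
  defines "A \<equiv> rule (segs n (occupied k (fst st)) (fst st r)) (\<exists>r'<k. r' \<noteq> r \<and> fst st r' = fst st r)"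
  shows "s \<in> A \<longleftrightarrow> en L R (- y r)" "- s \<in> A \<longleftrightarrow> en R L (y r)"
proof -
  from one_block_D(1)[OF P] have "(s \<in> A \<longleftrightarrow> en L R (- y r)) \<and> (- s \<in> A \<longleftrightarrow> en R L (y r))"
  proof
    assume s: "s = 1"
    thus ?thesis using one_block_rule1[OF _ r, of c L R y st] P unfolding A_def by simp
  next
    assume s: "s = -1"
    hence "one_block c 1 R L (\<lambda>r. - y r) st" using one_block_mirror[OF P] by simp
    from one_block_rule1[OF this r] show ?thesis unfolding A_def s by simp
  qed
  thus "s \<in> A \<longleftrightarrow> en L R (- y r)" "- s \<in> A \<longleftrightarrow> en R L (y r)" by auto
qed

section \<open>Inward moves during the collapse\<close>

definition inw :: "int set \<Rightarrow> int \<Rightarrow> int set" where "inw L i = (L - {i}) \<union> ({i - 1} - {0})"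

text \<open>The number of robots on a side and the position of its hole are determined by the side,
  and they determine the enabled robot.\<close>

lemma en_unique: assumes "en L R i" "en L R i'" shows "i = i'"
proof -
  have f: "\<exists>a j. hole_ok a j \<and> L = sideS a j \<and> i = (if j \<le> a then j + 1 else 1)" if E: "en L R i" for i
  proof -
    from E obtain a where "a \<ge> 1" "(\<exists>j j'. 1 \<le> j \<and> j \<le> a \<and> 1 \<le> j' \<and> j' \<le> a + 1 \<and> L = sideS a j \<and> R = sideS a j' \<and> i = j + 1) \<or>
     L = sideS a (a + 1) \<and> (R = sideS a (a + 1) \<or> R = sideS (a - 1) 1) \<and> i = 1" unfolding en_def by blast
    thus ?thesis
    proof (elim disjE exE conjE)
      fix j assume "1 \<le> j" "j \<le> a" "L = sideS a j" "i = j + 1"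
      thus ?thesis by (intro exI[of _ a] exI[of _ j]) (auto simp: hole_ok_def)
    next
      assume "L = sideS a (a + 1)" "i = 1" "1 \<le> a"
      thus ?thesis by (intro exI[of _ a] exI[of _ "a + 1"]) (auto simp: hole_ok_def)
    next
      assume "L = sideS a (a + 1)" "i = 1" "1 \<le> a"
      thus ?thesis by (intro exI[of _ a] exI[of _ "a + 1"]) (auto simp: hole_ok_def)
    qed
  qed
  from f[OF assms(1)] f[OF assms(2)] show ?thesis using sideS_inj by metis
qed

lemma inw_hole: "1 \<le> j \<Longrightarrow> j \<le> a \<Longrightarrow> inw (sideS a j) (j + 1) = sideS a (j + 1)" by (auto simp: inw_def sideS_mem)
lemma inw_full: "1 \<le> a \<Longrightarrow> inw (sideS a (a + 1)) 1 = sideS (a - 1) 1" by (auto simp: inw_def sideS_mem)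

text \<open>The last claim removes the problem of outdated moves: a move on one side does not
  disable the robot enabled on the other, and by \<open>en_unique\<close> there is no third robot.
  The target is free or the centre.\<close>

lemma en_step: assumes E: "en L R i"
  shows "fam (inw L i) R" "i - 1 \<notin> L" "en R L i' \<Longrightarrow> en R (inw L i) i'"
proof -
  note B = en_pos[OF E]
  have F: "fam L R" using en_fam[OF E] .
  have sub: "inw L i \<subseteq> {..H}" "R \<subseteq> {..H}" "L \<subseteq> {..H}" using fam_facts(1,2)[OF F] B by (auto simp: inw_def)
  from E obtain a where a: "a \<ge> 1" "(\<exists>j j'. 1 \<le> j \<and> j \<le> a \<and> 1 \<le> j' \<and> j' \<le> a + 1 \<and> L = sideS a j \<and> R = sideS a j' \<and> i = j + 1) \<or>
     L = sideS a (a + 1) \<and> (R = sideS a (a + 1) \<or> R = sideS (a - 1) 1) \<and> i = 1" unfolding en_def by blast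
  have E': "hole_ok a j \<Longrightarrow> R = sideS a j \<Longrightarrow> en R L i' \<Longrightarrow> (j \<le> a \<and> i' = j + 1 \<and> (\<exists>j'. hole_ok a j' \<and> L = sideS a j')) \<or>
      (j = a + 1 \<and> i' = 1 \<and> (L = sideS a (a + 1) \<or> L = sideS (a - 1) 1))" for a j
  proof -
    assume h: "hole_ok a j" "R = sideS a j" "en R L i'"
    from h(3) obtain b where b: "b \<ge> 1" "(\<exists>j j'. 1 \<le> j \<and> j \<le> b \<and> 1 \<le> j' \<and> j' \<le> b + 1 \<and> R = sideS b j \<and> L = sideS b j' \<and> i' = j + 1) \<or>
     R = sideS b (b + 1) \<and> (L = sideS b (b + 1) \<or> L = sideS (b - 1) 1) \<and> i' = 1" unfolding en_def by blast
    from b(2) show ?thesis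
    proof
      assume "\<exists>j j'. 1 \<le> j \<and> j \<le> b \<and> 1 \<le> j' \<and> j' \<le> b + 1 \<and> R = sideS b j \<and> L = sideS b j' \<and> i' = j + 1"
      then obtain l j' where l: "1 \<le> l" "l \<le> b" "1 \<le> j'" "j' \<le> b + 1" "R = sideS b l" "L = sideS b j'" "i' = l + 1" by blast
      have "hole_ok b l" "hole_ok b j'" using l b(1) by (auto simp: hole_ok_def)
      moreover from this have "a = b \<and> j = l" using sideS_inj[OF h(1)] h(2) l(5) by metis
      ultimately show ?thesis using l by auto
    next
      assume l: "R = sideS b (b + 1) \<and> (L = sideS b (b + 1) \<or> L = sideS (b - 1) 1) \<and> i' = 1"
      have "hole_ok b (b + 1)" using b(1) by (auto simp: hole_ok_def)
      hence "a = b \<and> j = b + 1" using sideS_inj[OF h(1)] h(2) l by metis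
      thus ?thesis using l by auto
    qed
  qed
  from a(2) have "fam (inw L i) R \<and> i - 1 \<notin> L \<and> (en R L i' \<longrightarrow> en R (inw L i) i')"
  proof
    assume "\<exists>j j'. 1 \<le> j \<and> j \<le> a \<and> 1 \<le> j' \<and> j' \<le> a + 1 \<and> L = sideS a j \<and> R = sideS a j' \<and> i = j + 1"
    then obtain j j' where j: "1 \<le> j" "j \<le> a" "1 \<le> j'" "j' \<le> a + 1" "L = sideS a j" "R = sideS a j'" "i = j + 1" by blast
    have w: "inw L i = sideS a (j + 1)" using inw_hole j by simp
    have hole_ok: "hole_ok a (j + 1)" "hole_ok a j'" "hole_ok a j" using j by (auto simp: hole_ok_def)
    have f: "fam (inw L i) R" unfolding fam_def using sub w hole_ok j(6) by blast
    have "en R (inw L i) i'" if e: "en R L i'"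
    proof -
      from E'[OF hole_ok(2) j(6) e] have "j' \<le> a \<and> i' = j' + 1"
      proof
        assume x: "j' = a + 1 \<and> i' = 1 \<and> (L = sideS a (a + 1) \<or> L = sideS (a - 1) 1)"
        have "hole_ok a (a + 1)" "hole_ok (a - 1) 1" using a(1) by (auto simp: hole_ok_def)
        hence "j = a + 1 \<or> a = a - 1" using x j(5) sideS_inj[OF hole_ok(3)] by metis
        thus ?thesis using j by simp
      qed simp
      thus ?thesis unfolding en_def using sub w j(1,3,6) a(1) j(2)
        by (intro conjI exI[of _ a] disjI1 exI[of _ j'] exI[of _ "j + 1"]) auto
    qed
    thus ?thesis using f j by (auto simp: sideS_mem)
  next
    assume l: "L = sideS a (a + 1) \<and> (R = sideS a (a + 1) \<or> R = sideS (a - 1) 1) \<and> i = 1"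
    have w: "inw L i = sideS (a - 1) 1" using inw_full a(1) l by simp
    have hole_ok: "hole_ok a (a + 1)" "hole_ok (a - 1) 1" using a(1) by (auto simp: hole_ok_def)
    have f: "fam (inw L i) R" unfolding fam_def using sub w hole_ok l a(1) by blast
    have "en R (inw L i) i'" if e: "en R L i'"
    proof (cases "R = sideS a (a + 1)")
      case True
      from E'[OF hole_ok(1) True e] have "i' = 1" by auto
      thus ?thesis unfolding en_def using sub w True a(1) by (intro conjI exI[of _ a] disjI2) auto
    next
      case False
      hence R: "R = sideS (a - 1) 1" using l by blast
      from E'[OF hole_ok(2) R e] have False
      proof
        assume "1 \<le> a - 1 \<and> i' = 1 + 1 \<and> (\<exists>j'. hole_ok (a - 1) j' \<and> L = sideS (a - 1) j')"
        then obtain j' where "hole_ok (a - 1) j'" "L = sideS (a - 1) j'" by blast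
        hence "a = a - 1" using sideS_inj[OF hole_ok(1)] l by metis
        thus False by simp
      next
        assume h: "1 = a - 1 + 1 \<and> i' = 1 \<and> (L = sideS (a - 1) (a - 1 + 1) \<or> L = sideS (a - 1 - 1) 1)"
        have "1 \<in> L" using l a(1) by (simp add: sideS_mem)
        thus False using h by (auto simp: sideS_mem)
      qed
      thus ?thesis ..
    qed
    thus ?thesis using f l by (auto simp: sideS_mem)
  qed
  thus "fam (inw L i) R" "i - 1 \<notin> L" "en R L i' \<Longrightarrow> en R (inw L i) i'" by auto
qed

definition spread :: "(nat \<Rightarrow> int) \<Rightarrow> int" where "spread y = (\<Sum>r<k. \<bar>y r\<bar>)"

lemma spread_upd: assumes "r < k" shows "spread (y(r := v)) = spread y - \<bar>y r\<bar> + \<bar>v\<bar>"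
proof -
  have "spread (y(r := v)) = \<bar>v\<bar> + (\<Sum>r\<in>{..<k} - {r}. \<bar>y r\<bar>)"
    unfolding spread_def using assms by (subst sum.remove[of _ r]) auto
  moreover have "spread y = \<bar>y r\<bar> + (\<Sum>r\<in>{..<k} - {r}. \<bar>y r\<bar>)"
    unfolding spread_def using assms by (subst sum.remove[of _ r]) auto
  ultimately show ?thesis by simp
qed
lemma spread_nonneg: "0 \<le> spread y" unfolding spread_def by (intro sum_nonneg) simp

lemma cf_inw: assumes "fam L R" "i \<in> L" shows "cf (inw L i) R = insert (1 - i) (cf L R - {- i})"
proof -
  note f = fam_facts(1,2)[OF assms(1)]
  have i: "1 \<le> i" using f assms(2) by auto
  have "- i \<notin> R" using f i by auto
  hence "cf L R - {- i} = insert 0 (uminus ` (L - {i}) \<union> R)" using i by (auto simp: cf_def)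
  moreover have "cf (inw L i) R = insert (1 - i) (insert 0 (uminus ` (L - {i}) \<union> R))"
    by (cases "i = 1") (auto simp: cf_def inw_def)
  ultimately show ?thesis by simp
qed

lemma one_block_left: assumes P: "one_block c s L R y st" and r: "r < k" and E: "en L R (- y r)" and x: "x = nd (c + s * (y r + 1))"
  shows "one_block c s (inw L (- y r)) R (y(r := y r + 1)) ((fst st)(r := x), (snd st)(r := None))"
    "spread (y(r := y r + 1)) < spread y"
proof -
  note D = one_block_D[OF P]
  let ?i = "- y r"
  note B = en_pos[OF E]
  have cf': "cf (inw L ?i) R = insert (y r + 1) (cf L R - {y r})" using cf_inw[OF D(2) en_mem[OF E]] by (simp add: add.commute)
  have other: "y r' \<noteq> y r" if "r' < k" "r' \<noteq> r" for r' using D(5)[OF that(1) r] that B by auto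
  \<comment> \<open>Here towers are confined to the centre, which keeps the coordinates of all other
    robots distinct.\<close>
  have fresh: "y r + 1 \<notin> cf L R \<or> y r + 1 = 0"
  proof -
    have "?i - 1 \<notin> L" using en_step(2)[OF E] .
    thus ?thesis using cf_parts(1)[OF D(2), of "?i - 1"] B by (auto simp: add.commute)
  qed
  show "one_block c s (inw L ?i) R (y(r := y r + 1)) ((fst st)(r := x), (snd st)(r := None))"
  proof (rule one_block_I[OF D(1) en_step(1)[OF E]])
    fix r' assume r': "r' < k"
    show "(y(r := y r + 1)) r' \<in> cf (inw L ?i) R" unfolding cf' using D(3)[OF r'] other[OF r'] by auto
    show "fst ((fst st)(r := x), (snd st)(r := None)) r' = nd (c + s * (y(r := y r + 1)) r')" using D(6)[OF r'] x by simp
    fix z assume z: "snd ((fst st)(r := x), (snd st)(r := None)) r' = Some z"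
    hence n: "r' \<noteq> r" "snd st r' = Some z" by (auto split: if_splits)
    have "\<not> en L R (- y r')"
    proof
      assume "en L R (- y r')"
      hence "- y r' = ?i" using en_unique E by blast
      thus False using other[OF r' n(1)] by simp
    qed
    hence "z = fst st r' \<or> en R L (y r') \<and> z = nd (c + s * (y r' - 1))" using D(7)[OF r' n(2)] by blast
    thus "z = fst ((fst st)(r := x), (snd st)(r := None)) r' \<or>
        en (inw L ?i) R (- (y(r := y r + 1)) r') \<and> z = nd (c + s * ((y(r := y r + 1)) r' + 1)) \<or>
        en R (inw L ?i) ((y(r := y r + 1)) r') \<and> z = nd (c + s * ((y(r := y r + 1)) r' - 1))"
      using n(1) en_step(3)[OF E] by auto
  next
    fix z assume "z \<in> cf (inw L ?i) R"
    hence "z = y r + 1 \<or> z \<in> cf L R \<and> z \<noteq> y r" unfolding cf' by blast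
    thus "\<exists>r'<k. (y(r := y r + 1)) r' = z"
    proof
      assume "z = y r + 1" thus ?thesis using r by (intro exI[of _ r]) simp
    next
      assume z: "z \<in> cf L R \<and> z \<noteq> y r"
      then obtain r' where "r' < k" "y r' = z" using D(4) by blast
      thus ?thesis using z by (intro exI[of _ r']) auto
    qed
  next
    fix a b assume ab: "a < k" "b < k" "(y(r := y r + 1)) a = (y(r := y r + 1)) b" "(y(r := y r + 1)) a \<noteq> 0"
    show "a = b"
    proof (cases "a = r \<or> b = r")
      case False
      thus ?thesis using D(5)[OF ab(1,2)] ab(3,4) by simp
    next
      case True
      show ?thesis
      proof (rule ccontr)
        assume "a \<noteq> b"
        then obtain r' where "r' < k" "y r' = y r + 1" using True ab by (metis fun_upd_other fun_upd_same)
        hence "y r + 1 \<in> cf L R" using D(3) by metis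
        hence "y r + 1 = 0" using fresh by blast
        thus False using True ab(3,4) by (metis fun_upd_same)
      qed
    qed
  qed
  show "spread (y(r := y r + 1)) < spread y" unfolding spread_upd[OF r] using B by simp
qed

lemma spread_neg: "spread (\<lambda>r. - y r) = spread y" by (simp add: spread_def)

lemma one_block_step: assumes P: "one_block c s L R y st" and sorted_dists: "cstep Pr n k r st st'"
  shows "\<exists>s' L' R' y'. one_block c s' L' R' y' st' \<and> spread y' \<le> spread y \<and> (fst st' \<noteq> fst st \<longrightarrow> spread y' < spread y)"
proof -
  note D = one_block_D[OF P]
  have r: "r < k" using sorted_dists by (simp add: cstep_def)
  have pn: "fst st r' < n" if "r' < k" for r' using D(6)[OF that] nd_lt by simp
  have same: ?thesis if h: "fst st' = fst st" "\<And>x. snd st' r = Some x \<Longrightarrow> x = fst st r \<or> en L R (- y r) \<and> x = nd (c + s * (y r + 1)) \<or>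
        en R L (y r) \<and> x = nd (c + s * (y r - 1))" "\<And>r'. r' \<noteq> r \<Longrightarrow> snd st' r' = snd st r'"
  proof -
    have "one_block c s L R y st'"
    proof (rule one_block_I[OF D(1,2,3,4,5)])
      fix r' assume r': "r' < k"
      show "fst st' r' = nd (c + s * y r')" using D(6)[OF r'] h(1) by simp
      fix x assume "snd st' r' = Some x"
      thus "x = fst st' r' \<or> en L R (- y r') \<and> x = nd (c + s * (y r' + 1)) \<or> en R L (y r') \<and> x = nd (c + s * (y r' - 1))"
        using D(7)[OF r'] h by (cases "r' = r") simp_all
    qed
    thus ?thesis using h(1) by blast
  qed
  from sorted_dists consider
    (look) x where "snd st r = None" "fst st' = fst st" "x \<in> targets Pr n k (fst st) r" "snd st' = (snd st)(r := Some x)"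
    | (move) x where "snd st r = Some x" "fst st' = (fst st)(r := x)" "snd st' = (snd st)(r := None)"
    unfolding cstep_def by blast
  thus ?thesis
  proof cases
    case look
    define A where "A = rule (segs n (occupied k (fst st)) (fst st r)) (\<exists>r'<k. r' \<noteq> r \<and> fst st r' = fst st r)"
    have AR: "s \<in> A \<longleftrightarrow> en L R (- y r)" "- s \<in> A \<longleftrightarrow> en R L (y r)" using one_block_rule[OF P r] unfolding A_def by auto
    from targets_rule[of "fst st", OF pn r look(3)]
    have "x = fst st r \<or> (\<exists>d\<in>A. x = nd (int (fst st r) + d))" unfolding A_def by blast
    hence "x = fst st r \<or> en L R (- y r) \<and> x = nd (c + s * (y r + 1)) \<or> en R L (y r) \<and> x = nd (c + s * (y r - 1))"
    proof
      assume "\<exists>d\<in>A. x = nd (int (fst st r) + d)"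
      then obtain d where d: "d \<in> A" "x = nd (c + s * y r + d)" using nd_add[OF D(6)[OF r]] by auto
      have "d = 1 \<or> d = -1" using rule_dir d(1) unfolding A_def by blast
      hence "d = s \<or> d = - s" using D(1) by auto
      thus ?thesis
      proof
        assume "d = s" thus ?thesis using d AR by (simp add: algebra_simps)
      next
        assume "d = - s" thus ?thesis using d AR by (simp add: algebra_simps)
      qed
    qed simp
    thus ?thesis using same look by simp
  next
    case move
    have st': "st' = ((fst st)(r := x), (snd st)(r := None))" using move by (simp add: prod_eq_iff)
    from D(7)[OF r move(1)] show ?thesis
    proof (elim disjE conjE)
      assume "x = fst st r" thus ?thesis using same move by simp
    next
      assume "en L R (- y r)" "x = nd (c + s * (y r + 1))"
      from one_block_left[OF P r this] show ?thesis unfolding st' by (intro exI conjI) auto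
    next
      assume h: "en R L (y r)" "x = nd (c + s * (y r - 1))"
      have e: "en R L (- (- y r))" "x = nd (c + - s * (- y r + 1))" using h by (simp_all add: algebra_simps)
      from one_block_left[OF one_block_mirror[OF P] r e] show ?thesis unfolding st' spread_neg by (intro exI conjI) auto
    qed
  qed
qed

lemma fam_en: assumes F: "fam L R" and ne: "L \<noteq> {} \<or> R \<noteq> {}" shows "\<exists>i. en L R i \<or> en R L i"
proof -
  have sub: "L \<subseteq> {..H}" "R \<subseteq> {..H}" using F by (auto simp: fam_def)
  obtain a where a: "(\<exists>j j'. hole_ok a j \<and> hole_ok a j' \<and> L = sideS a j \<and> R = sideS a j') \<or>
     1 \<le> a \<and> (L = sideS (a - 1) 1 \<and> R = sideS a (a + 1) \<or> L = sideS a (a + 1) \<and> R = sideS (a - 1) 1)"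
    using F unfolding fam_def by blast
  from a show ?thesis
  proof
    assume "\<exists>j j'. hole_ok a j \<and> hole_ok a j' \<and> L = sideS a j \<and> R = sideS a j'"
    then obtain j j' where j: "hole_ok a j" "hole_ok a j'" "L = sideS a j" "R = sideS a j'" by blast
    have a1: "1 \<le> a"
    proof (rule ccontr)
      assume "\<not> 1 \<le> a"
      hence "L = {}" "R = {}" using j by (auto simp: hole_ok_def sideS_def)
      thus False using ne by simp
    qed
    consider "j \<le> a" | "j' \<le> a" | "j = a + 1" "j' = a + 1" using j by (force simp: hole_ok_def)
    thus ?thesis
    proof cases
      case 1
      hence "en L R (j + 1)" unfolding en_def using sub j a1
        by (intro conjI exI[of _ a] disjI1 exI[of _ j] exI[of _ j']) (auto simp: hole_ok_def)
      thus ?thesis by blast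
    next
      case 2
      hence "en R L (j' + 1)" unfolding en_def using sub j a1
        by (intro conjI exI[of _ a] disjI1 exI[of _ j'] exI[of _ j]) (auto simp: hole_ok_def)
      thus ?thesis by blast
    next
      case 3
      hence "L = sideS a (a + 1) \<and> (R = sideS a (a + 1) \<or> R = sideS (a - 1) 1) \<and> (1::int) = 1" using j by simp
      hence "en L R 1" unfolding en_def using sub a1 by blast
      thus ?thesis by blast
    qed
  next
    assume h: "1 \<le> a \<and> (L = sideS (a - 1) 1 \<and> R = sideS a (a + 1) \<or> L = sideS a (a + 1) \<and> R = sideS (a - 1) 1)"
    hence "en R L 1 \<or> en L R 1" unfolding en_def using sub by blast
    thus ?thesis by blast
  qed
qed

lemma one_block_prog: assumes P: "one_block c s L R y st" and ne: "L \<noteq> {} \<or> R \<noteq> {}"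
  shows "\<exists>r<k. \<forall>x\<in>targets Pr n k (fst st) r. x \<noteq> fst st r"
proof -
  note D = one_block_D[OF P]
  have pn: "fst st r' < n" if "r' < k" for r' using D(6)[OF that] nd_lt by simp
  obtain i where i: "en L R i \<or> en R L i" using fam_en[OF D(2) ne] by blast
  have "\<exists>r<k. en L R (- y r) \<or> en R L (y r)"
    using i
  proof
    assume e: "en L R i"
    have "- i \<in> cf L R" using en_mem[OF e] by (auto simp: cf_def)
    then obtain r where "r < k" "y r = - i" using D(4) by blast
    thus ?thesis using e by (intro exI[of _ r]) simp
  next
    assume e: "en R L i"
    have "i \<in> cf L R" using en_mem[OF e] by (auto simp: cf_def)
    then obtain r where "r < k" "y r = i" using D(4) by blast
    thus ?thesis using e by (intro exI[of _ r]) simp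
  qed
  then obtain r where r: "r < k" "en L R (- y r) \<or> en R L (y r)" by blast
  show ?thesis
  proof (intro exI[of _ r] conjI r(1) ballI)
    fix x assume "x \<in> targets Pr n k (fst st) r"
    from targets_rule[of "fst st", OF pn r(1) this] one_block_rule[OF P r(1)] r(2)
    obtain d where "d \<in> rule (segs n (occupied k (fst st)) (fst st r)) (\<exists>r'<k. r' \<noteq> r \<and> fst st r' = fst st r)"
      "x = nd (int (fst st r) + d)" by blast
    thus "x \<noteq> fst st r" using nd_move_ne[OF pn[OF r(1)]] rule_dir by metis
  qed
qed

text \<open>By \<open>INV_final\<close> nothing but decisions to stay is pending when the block is
  complete, so the collapse starts from a clean state, with the middle robot of the block as
  centre.\<close>

lemma tower_free_block: assumes T: "tower_free X g q ix m st" and mK: "max_run g K" shows "\<exists>c y. one_block c 1 {1..H} {1..H} y st \<and> spread y \<le> N * N"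
proof -
  note D = tower_free_D[OF T] note V = tower_free_vals[OF T]
  obtain j where j: "run g K j" using mK by (auto simp: max_run_def)
  have Xt: "int t < K \<Longrightarrow> X (j + int t) = X j + int t" for t
  proof (induction t)
    case (Suc t)
    have "X (j + int (Suc t)) = X (j + int t) + g (j + int t)" using D(2) unfolding lift_def
      by (metis add.assoc of_nat_Suc add.commute)
    moreover have "g (j + int t) = 1" using j Suc.prems by (simp add: run_def)
    ultimately show ?case using Suc by simp
  qed simp
  have Xt': "X (j + t) = X j + t" if "0 \<le> t" "t < K" for t using Xt[of "nat t"] that by simp
  define t where "t r = (ix r - j) mod K" for r
  have tb: "0 \<le> t r" "t r < K" for r using K3 by (simp_all add: t_def)
  have tc: "cg (ix r) (j + t r)" for r
  proof -
    have "cg ((ix r - j) mod K) (ix r - j)" by (rule cg_mod)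
    hence "cg (t r + j) (ix r - j + j)" unfolding t_def by (simp only: cg_add)
    thus ?thesis using cg_sym by (simp add: add.commute)
  qed
  define c where "c = X j + H"
  define y where "y r = t r - H" for r
  have cfH: "cf {1..H} {1..H} = {- H..H}"
  proof
    show "cf {1..H} {1..H} \<subseteq> {- H..H}" using KH(2) by (auto simp: cf_def)
    show "{- H..H} \<subseteq> cf {1..H} {1..H}"
    proof
      fix x assume x: "x \<in> {- H..H}"
      consider "x = 0" | "0 < x" | "x < 0" by linarith
      thus "x \<in> cf {1..H} {1..H}"
      proof cases
        case 3
        hence "- x \<in> {1..H}" using x by auto
        hence "- (- x) \<in> uminus ` {1..H}" by blast
        thus ?thesis by (simp add: cf_def)
      qed (use x in \<open>auto simp: cf_def\<close>)
    qed
  qed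
  have HS: "hole_ok H (H + 1)" "{1..H} = sideS H (H + 1)" using KH(2) by (auto simp: hole_ok_def sideS_mem)
  have "{1..H} \<subseteq> {..H}" by auto
  hence F: "fam {1..H} {1..H}" unfolding fam_def using HS by blast
  have pr: "fst st r = nd (c + 1 * y r)" if "r < k" for r
  proof -
    have "nd (X (ix r)) = nd (X (j + t r))" unfolding nd_eq using lift_cg[OF D(2) tc] .
    moreover have "X (j + t r) = c + 1 * y r" using Xt'[OF tb] by (simp add: c_def y_def)
    ultimately show ?thesis using D(5)[OF that] by simp
  qed
  have "one_block c 1 {1..H} {1..H} y st"
  proof (rule one_block_I[OF _ F])
    fix r assume r: "r < k"
    show "y r \<in> cf {1..H} {1..H}" unfolding cfH y_def using tb[of r] KH(1) by simp
    show "fst st r = nd (c + 1 * y r)" using pr[OF r] .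
    fix x assume "snd st r = Some x"
    from D(7)[OF r this] INV_final[OF D(1) mK] D(5)[OF r] have "x = fst st r" by simp
    thus "x = fst st r \<or> en {1..H} {1..H} (- y r) \<and> x = nd (c + 1 * (y r + 1)) \<or> en {1..H} {1..H} (y r) \<and> x = nd (c + 1 * (y r - 1))" ..
  next
    fix z assume "z \<in> cf {1..H} {1..H}"
    hence z: "- H \<le> z" "z \<le> H" unfolding cfH by auto
    obtain r where r: "r < k" "cg (ix r) (j + (z + H))" using D(3) by blast
    have "cg (t r) (z + H)" using cg_off[OF tc r(2)] .
    hence "t r = z + H" using cg_win[of "t r" "z + H"] tb[of r] z KH(1) by linarith
    thus "\<exists>r<k. y r = z" using r(1) by (intro exI[of _ r]) (simp add: y_def)
  next
    fix r r' assume h: "r < k" "r' < k" "y r = y r'"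
    hence "cg (ix r) (j + t r')" using tc[of r] by (simp add: y_def)
    thus "r = r'" using D(4)[OF h(1,2)] tc[of r'] cg_trans cg_sym by blast
  qed simp
  moreover have "spread y \<le> N * N"
  proof -
    have "\<bar>y r\<bar> \<le> N" for r using tb[of r] KH unfolding y_def by linarith
    hence "spread y \<le> (\<Sum>r<k. N)" unfolding spread_def by (intro sum_mono) auto
    also have "\<dots> = K * N" by simp
    also have "\<dots> \<le> N * N" using KN by (intro mult_right_mono) auto
    finally show ?thesis .
  qed
  ultimately show ?thesis by blast
qed

section \<open>One potential for the whole execution\<close>

definition state_inv :: "int \<Rightarrow> state \<Rightarrow> bool" where
  "state_inv M st \<longleftrightarrow> (\<exists>X g q ix m. tower_free X g q ix m st \<and> \<not> max_run g K \<and> m + N * N \<le> M) \<or> (\<exists>c s L R y. one_block c s L R y st \<and> spread y \<le> M)"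

lemma state_inv_PT: assumes "one_block c s L R y st" shows "state_inv (spread y) st"
proof -
  have "spread y \<le> spread y" by simp
  thus ?thesis using assms unfolding state_inv_def by blast
qed

text \<open>The reserve \<open>N * N\<close> carried through the tower-free phase pays for the
  initial value of \<open>spread\<close>.\<close>

lemma state_inv_TF: assumes T: "tower_free X g q ix m st" shows "state_inv (m + N * N) st"
proof (cases "max_run g K")
  case True
  have "0 \<le> m" using INV_vals(4) tower_free_D(1)[OF T] by blast
  from tower_free_block[OF T True] obtain c y where "one_block c 1 {1..H} {1..H} y st" "spread y \<le> N * N" by blast
  moreover from this have "spread y \<le> m + N * N" using \<open>0 \<le> m\<close> by simp
  ultimately show ?thesis unfolding state_inv_def by blast
next
  case False thus ?thesis using T unfolding state_inv_def by blast
qed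

lemma state_inv_nonneg: assumes "state_inv M st" shows "0 \<le> M"
  using assms unfolding state_inv_def
proof (elim disjE exE conjE)
  fix X g q ix m assume h: "tower_free X g q ix m st" "m + N * N \<le> M"
  have "0 \<le> m" using INV_vals(4) tower_free_D(1)[OF h(1)] by blast
  moreover have "0 \<le> N * N" by simp
  ultimately show ?thesis using h(2) by linarith
next
  fix c s L R y assume "spread y \<le> M" thus ?thesis using spread_nonneg[of y] by simp
qed

lemma state_inv_mono: "state_inv M st \<Longrightarrow> M \<le> M' \<Longrightarrow> state_inv M' st" unfolding state_inv_def by (meson order_trans)

lemma state_inv_step: assumes "state_inv M st" "cstep Pr n k r st st'"
  shows "\<exists>M'\<le>M. state_inv M' st' \<and> (fst st' \<noteq> fst st \<longrightarrow> M' < M)"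
  using assms(1) unfolding state_inv_def[of M]
proof (elim disjE exE conjE)
  fix X g q ix m assume h: "tower_free X g q ix m st" "\<not> max_run g K" "m + N * N \<le> M"
  from tower_free_step[OF h(1,2) assms(2)] obtain X' g' q' m' where "tower_free X' g' q' ix m' st'" "m' \<le> m" "fst st' \<noteq> fst st \<longrightarrow> m' < m" by blast
  thus ?thesis using state_inv_TF h(3) by (intro exI[of _ "m' + N * N"]) auto
next
  fix c s L R y assume h: "one_block c s L R y st" "spread y \<le> M"
  from one_block_step[OF h(1) assms(2)] obtain s' L' R' y' where "one_block c s' L' R' y' st'" "spread y' \<le> spread y" "fst st' \<noteq> fst st \<longrightarrow> spread y' < spread y" by blast
  thus ?thesis using h(2) state_inv_PT by (intro exI[of _ "spread y'"]) auto
qed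

lemma state_inv_zero: assumes "state_inv 0 st" shows "\<exists>g. \<forall>r<k. fst st r = g"
  using assms unfolding state_inv_def
proof (elim disjE exE conjE)
  fix X g q ix m assume h: "tower_free X g q ix m st" "m + N * N \<le> 0"
  have "0 \<le> m" using INV_vals(4) tower_free_D(1)[OF h(1)] by blast
  moreover have "0 < N * N" using Npos by simp
  ultimately show ?thesis using h(2) by linarith
next
  fix c s L R y assume h: "one_block c s L R y st" "spread y \<le> 0"
  hence "spread y = 0" using spread_nonneg[of y] by simp
  hence "y r = 0" if "r < k" for r using that unfolding spread_def by (simp add: sum_nonneg_eq_0_iff)
  thus ?thesis using one_block_D(6)[OF h(1)] by (intro exI[of _ "nd c"]) simp
qed

lemma state_inv_prog: assumes "state_inv M st" shows "state_inv 0 st \<or> (\<exists>r<k. \<forall>x\<in>targets Pr n k (fst st) r. x \<noteq> fst st r)"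
  using assms unfolding state_inv_def[of M]
proof (elim disjE exE conjE)
  fix X g q ix m assume h: "tower_free X g q ix m st" "\<not> max_run g K"
  from tower_free_prog[OF this] show ?thesis by blast
next
  fix c s L R y assume h: "one_block c s L R y st"
  show ?thesis
  proof (cases "L \<noteq> {} \<or> R \<noteq> {}")
    case True from one_block_prog[OF h True] show ?thesis by blast
  next
    case False
    have "y r = 0" if "r < k" for r using one_block_D(3)[OF h that] False by (simp add: cf_def)
    hence "spread y = 0" by (simp add: spread_def)
    thus ?thesis using state_inv_PT[OF h] by simp
  qed
qed

section \<open>Rounds\<close>

context
  fixes p0 :: "nat \<Rightarrow> nat" and sched :: "nat \<Rightarrow> nat" and s :: "nat \<Rightarrow> state"
  assumes ex: "fair_exec Pr n k p0 sched s"
begin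

lemma st_step: "cstep Pr n k (sched t) (s t) (s (Suc t))" using ex by (simp add: fair_exec_def)

lemma round_moves: assumes "r < k"
  shows "\<exists>t. round_end k s sched j \<le> t \<and> t < round_end k s sched (Suc j) \<and> move_at s sched t r"
proof -
  let ?T = "round_end k s sched j"
  let ?P = "\<lambda>t. \<forall>r<k. \<exists>t'. ?T \<le> t' \<and> t' < t \<and> move_at s sched t' r"
  have "\<forall>r\<in>{..<k}. \<exists>t'. ?T \<le> t' \<and> move_at s sched t' r" using ex by (auto simp: fair_exec_def)
  then obtain f where f: "\<And>r. r < k \<Longrightarrow> ?T \<le> f r \<and> move_at s sched (f r) r" by (metis lessThan_iff)
  \<comment> \<open>The sum of the chosen times serves as a common bound, which shows that the
    minimum defining the end of the round exists.\<close>
  have "f r \<le> (\<Sum>r<k. f r)" if "r < k" for r using that by (intro member_le_sum) auto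
  hence "?P (Suc (\<Sum>r<k. f r))" using f by (meson le_imp_less_Suc)
  hence "?P (LEAST t. ?P t)" by (rule LeastI)
  thus ?thesis using assms by simp
qed

lemma round_mono: "i \<le> j \<Longrightarrow> round_end k s sched i \<le> round_end k s sched j"
proof (induction j)
  case (Suc j)
  have "round_end k s sched j \<le> round_end k s sched (Suc j)" using round_moves[of 0 j] k3 by fastforce
  thus ?case using Suc by (cases "i = Suc j") auto
qed simp

lemma state_inv_run: assumes "state_inv M (s t)" "t \<le> t'"
  shows "\<exists>M'\<le>M. state_inv M' (s t') \<and> ((\<exists>u. t \<le> u \<and> u < t' \<and> fst (s (Suc u)) \<noteq> fst (s u)) \<longrightarrow> M' < M)"
  using assms(2)
proof (induction t' rule: dec_induct)
  case base thus ?case using assms(1) by auto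
next
  case (step t')
  then obtain M' where M': "M' \<le> M" "state_inv M' (s t')" "(\<exists>u. t \<le> u \<and> u < t' \<and> fst (s (Suc u)) \<noteq> fst (s u)) \<longrightarrow> M' < M" by blast
  obtain M'' where M'': "M'' \<le> M'" "state_inv M'' (s (Suc t'))" "fst (s (Suc t')) \<noteq> fst (s t') \<longrightarrow> M'' < M'" using state_inv_step[OF M'(2) st_step] by blast
  have "M'' < M" if "t \<le> u" "u < Suc t'" "fst (s (Suc u)) \<noteq> fst (s u)" for u
    using that M' M'' by (cases "u = t'") auto
  thus ?case using M' M'' by (intro exI[of _ M'']) auto
qed

text \<open>One round is not enough, because a robot told to move may first execute an older
  decision. If no position has changed since, its next Look yields the same instruction, and its
  Move in the second round changes its position.\<close>

lemma two_rounds: assumes M: "state_inv M (s (round_end k s sched j))"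
  shows "\<exists>M'. state_inv M' (s (round_end k s sched (j + 2))) \<and> (M' = 0 \<or> M' < M)"
proof -
  let ?T = "round_end k s sched j" let ?T1 = "round_end k s sched (Suc j)" let ?T2 = "round_end k s sched (j + 2)"
  have T: "?T \<le> ?T1" "?T1 \<le> ?T2" "?T \<le> ?T2" using round_mono[of j "Suc j"] round_mono[of "Suc j" "j + 2"] round_mono[of j "j+2"] by simp_all
  from state_inv_prog[OF M] show ?thesis
  proof
    assume "state_inv 0 (s ?T)"
    from state_inv_run[OF this T(3)] obtain M' where M': "M' \<le> 0" "state_inv M' (s ?T2)" by blast
    have "M' = 0" using M'(1) state_inv_nonneg[OF M'(2)] by linarith
    thus ?thesis using M'(2) by blast
  next
    assume "\<exists>r<k. \<forall>x\<in>targets Pr n k (fst (s ?T)) r. x \<noteq> fst (s ?T) r"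
    then obtain r where r: "r < k" "\<And>x. x \<in> targets Pr n k (fst (s ?T)) r \<Longrightarrow> x \<noteq> fst (s ?T) r" by blast
    have "\<exists>u. ?T \<le> u \<and> u < ?T2 \<and> fst (s (Suc u)) \<noteq> fst (s u)"
    proof (rule ccontr)
      assume "\<not> ?thesis"
      hence c: "fst (s (Suc u)) = fst (s u)" if "?T \<le> u" "u < ?T2" for u using that by blast
      have const: "fst (s u) = fst (s ?T)" if "?T \<le> u" "u \<le> ?T2" for u
        using that by (induction u rule: dec_induct) (use c in auto)
      obtain t1 where t1: "?T \<le> t1" "t1 < ?T1" "move_at s sched t1 r" using round_moves[OF r(1), of j] by blast
      obtain t2 where t2: "?T1 \<le> t2" "t2 < ?T2" "move_at s sched t2 r" using round_moves[OF r(1), of "Suc j"] by auto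
      \<comment> \<open>After the Move of the first round, any decision of \<open>r\<close> is taken
        on the unchanged configuration.\<close>
      have "snd (s u) r = None \<or> (\<exists>x\<in>targets Pr n k (fst (s ?T)) r. snd (s u) r = Some x)" if "Suc t1 \<le> u" "u \<le> t2" for u
        using that
      proof (induction u rule: dec_induct)
        case base
        show ?case using st_step[of t1] t1(3) unfolding cstep_def move_at_def by auto
      next
        case (step u)
        have "fst (s u) = fst (s ?T)" using const[of u] step t1 t2 by simp
        thus ?case using st_step[of u] step by (cases "sched u = r") (auto simp: cstep_def)
      qed
      from this[of t2] t1 t2 obtain x where x: "x \<in> targets Pr n k (fst (s ?T)) r" "snd (s t2) r = Some x"
        unfolding move_at_def by fastforce
      have "fst (s (Suc t2)) = (fst (s t2))(r := x)" using st_step[of t2] t2(3) x(2) unfolding cstep_def move_at_def by auto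
      hence "fst (s (Suc t2)) r = x" by simp
      moreover have "fst (s (Suc t2)) r = fst (s ?T) r" using const[of "Suc t2"] t1 t2 T by simp
      ultimately show False using r(2)[OF x(1)] by simp
    qed
    thus ?thesis using state_inv_run[OF M T(3)] by blast
  qed
qed

lemma many_rounds: assumes "state_inv M (s 0)" shows "\<exists>M'. state_inv M' (s (round_end k s sched (2 * i))) \<and> (M' = 0 \<or> M' \<le> M - int i)"
proof (induction i)
  case 0
  have "state_inv M (s (round_end k s sched (2 * 0)))" using assms by (simp only: mult_0_right round_end.simps)
  thus ?case by (intro exI[of _ M]) simp
next
  case (Suc i)
  then obtain M' where M': "state_inv M' (s (round_end k s sched (2 * i)))" "M' = 0 \<or> M' \<le> M - int i" by blast
  from two_rounds[OF M'(1)] obtain M'' where M'': "state_inv M'' (s (round_end k s sched (2 * i + 2)))" "M'' = 0 \<or> M'' < M'" by blast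
  have n: "M'' = 0 \<or> M'' \<le> M - int (Suc i)"
  proof (cases "M'' = 0")
    case False
    hence "M'' < M'" using M''(2) by blast
    hence "M' \<noteq> 0" using state_inv_nonneg[OF M''(1)] by linarith
    hence "M' \<le> M - int i" using M'(2) by blast
    thus ?thesis using \<open>M'' < M'\<close> by simp
  qed simp
  have "2 * Suc i = 2 * i + 2" by simp
  hence "state_inv M'' (s (round_end k s sched (2 * Suc i)))" using M''(1) by (simp only:)
  thus ?case using n by blast
qed

lemma state_inv_gathered: assumes "state_inv (int m) (s 0)" shows "gathered_within k s sched (2 * m)"
proof -
  let ?T = "round_end k s sched (2 * m)"
  obtain M' where M': "state_inv M' (s ?T)" "M' = 0 \<or> M' \<le> int m - int m" using many_rounds[OF assms] by blast
  have "M' = 0" using M'(2) state_inv_nonneg[OF M'(1)] by linarith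
  hence J0: "state_inv 0 (s ?T)" using M'(1) by blast
  then obtain g where g: "\<And>r. r < k \<Longrightarrow> fst (s ?T) r = g" using state_inv_zero by blast
  have const: "fst (s t) = fst (s ?T)" if "?T \<le> t" for t
    using that
  proof (induction t rule: dec_induct)
    case (step t)
    obtain M' where "M' \<le> 0" "state_inv M' (s t)" using state_inv_run[OF J0 step(1)] by blast
    hence "state_inv 0 (s t)" using state_inv_mono by blast
    from state_inv_step[OF this st_step] obtain M'' where M'': "state_inv M'' (s (Suc t))" "fst (s (Suc t)) \<noteq> fst (s t) \<longrightarrow> M'' < 0" by blast
    have "fst (s (Suc t)) = fst (s t)" using M''(2) state_inv_nonneg[OF M''(1)] by linarith
    thus ?case using step(3) by (rule trans)
  qed (rule refl)
  show ?thesis unfolding gathered_within_def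
  proof (intro exI[of _ g] allI impI)
    fix t r assume h: "?T \<le> t" "r < k"
    show "fst (s t) r = g" unfolding const[OF h(1)] by (rule g[OF h(2)])
  qed
qed

end

section \<open>Initial configurations\<close>

lemma period_mult: fixes g :: "int \<Rightarrow> int" assumes "\<And>j. g (j + s) = g j" shows "g (j + s * u) = g j"
proof -
  have A: "g (j + s * int m) = g j" for m j
  proof (induction m)
    case (Suc m)
    have "g (j + s * int (Suc m)) = g (j + s * int m + s)" by (simp add: algebra_simps)
    thus ?case using Suc assms by simp
  qed simp
  show ?thesis
  proof (cases "0 \<le> u")
    case True thus ?thesis using A[of j "nat u"] by simp
  next
    case False
    have "g (j + s * u + s * int (nat (- u))) = g (j + s * u)" using A by blast
    thus ?thesis using False by simp
  qed
qed

lemma map_period: assumes "\<And>t. e (t + d) = e t" shows "map e [0..<m * d] = concat (replicate m (map e [0..<d]))"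
proof (induction m)
  case (Suc m)
  have "[0..<Suc m * d] = [0..<d] @ [d..<d + m * d]" using upt_add_eq_append[of 0 d "m * d"] by simp
  moreover have "[d..<d + m * d] = map (\<lambda>t. t + d) [0..<m * d]" by (simp add: map_add_upt add.commute)
  hence "map e [d..<d + m * d] = map e [0..<m * d]" using assms by (simp add: o_def)
  ultimately show ?case using Suc by simp
qed simp

text \<open>A rotation by \<open>s\<close> and the period \<open>K\<close> give the period
  \<open>gcd s K\<close> by Bezout. If it is smaller than \<open>K\<close>, the list of segments is
  a repetition of its first \<open>gcd s K\<close> entries.\<close>

lemma nonper_segs: assumes p: "per g" and np: "\<not> periodic_seq (map (\<lambda>t. nat (g (i + int t))) [0..<k])" shows "nonper g"
  unfolding nonper_def
proof (intro allI impI, rule ccontr)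
  fix s assume s: "\<forall>j. g (j + s) = g j" and n: "\<not> cg s 0"
  define d where "d = gcd s K"
  have dK: "d dvd K" "d dvd s" "0 \<le> d" by (simp_all add: d_def)
  have dpos: "0 < d" using K3 by (simp add: d_def)
  obtain u v where uv: "d = s * u + K * v" using bezout_int[of s K] unfolding d_def by (metis mult.commute)
  have gd: "g (j + d) = g j" for j
  proof -
    have "g (j + d) = g (j + s * u + K * v)" unfolding uv by (simp add: add.assoc)
    also have "\<dots> = g (j + s * u)" using period_mult[of g K] p by (simp add: per_def)
    also have "\<dots> = g j" using period_mult[of g s] s by simp
    finally show ?thesis .
  qed
  have "d \<noteq> K"
  proof
    assume "d = K"
    hence "K dvd s" using dK by simp
    thus False using n by (simp add: cg_def)
  qed
  obtain m where m: "K = d * m" using dK(1) by blast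
  have mp: "0 < m" using m dpos K3 by (metis zero_less_mult_pos of_nat_0_less_iff k3 less_le_trans zero_less_numeral)
  have m2: "2 \<le> m" using m mp \<open>d \<noteq> K\<close> by (cases "m = 1") auto
  have k': "k = nat m * nat d" using m mp dpos by (metis mult.commute nat_int nat_mult_distrib dK(3))
  define e where "e t = nat (g (i + int t))" for t
  have "e (t + nat d) = e t" for t using gd[of "i + int t"] dK(3) by (simp add: e_def add.assoc)
  hence "map e [0..<nat m * nat d] = concat (replicate (nat m) (map e [0..<nat d]))" by (rule map_period)
  hence "map e [0..<k] = concat (replicate (nat m) (map e [0..<nat d]))" using k' by simp
  hence "periodic_seq (map e [0..<k])" unfolding periodic_seq_def using m2 by (intro exI[of _ "map e [0..<nat d]"] exI[of _ "nat m"]) auto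
  thus False using np unfolding e_def by simp
qed

lemma sum_tele: "(\<Sum>j\<in>{0..<int m}. X (j + 1) - X j) = (X (int m) - X 0 :: int)"
proof (induction m)
  case (Suc m)
  have "{0..<int (Suc m)} = insert (int m) {0..<int m}" by auto
  thus ?case using Suc by (simp add: add.commute)
qed simp

text \<open>Sorting the occupied nodes provides the cyclic indices \<open>ix\<close>; winding around
  the ring adds \<open>N\<close> per period of \<open>k\<close> robots.\<close>

lemma tower_free_init: assumes pn: "\<And>r. r < k \<Longrightarrow> p0 r < n" and inj: "inj_on p0 {..<k}"
    and np: "\<not> periodic_seq (segs n (occupied k p0) (p0 0))"
  shows "\<exists>X g ix. tower_free X g (\<lambda>_. 0) ix (81 * (N * N)) (p0, \<lambda>_. None)"
proof -
  define A where "A = sorted_list_of_set (p0 ` {..<k})"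
  have lA: "length A = k" unfolding A_def using card_image[OF inj] by simp
  have sA: "set A = p0 ` {..<k}" unfolding A_def by simp
  have ssA: "sorted_wrt (<) A" unfolding A_def by simp
  have dA: "distinct A" unfolding A_def by simp
  have An: "A ! i < n" if "i < k" for i using nth_mem[of i A] lA that sA pn by auto
  define X where "X j = int (A ! nat (j mod K)) + N * (j div K)" for j
  define g where "g j = X (j + 1) - X j" for j
  have XK: "X (j + K) = X j + N" for j
  proof -
    have "(j + K) div K = j div K + 1" using K3 by (intro div_add_self2) simp
    thus ?thesis unfolding X_def by (simp add: algebra_simps)
  qed
  have l: "lift X g" unfolding lift_def using XK by (simp add: g_def)
  have pg: "per g" unfolding per_def
  proof
    fix j
    have e: "j + K + 1 = (j + 1) + K" by simp
    show "g (j + K) = g j" unfolding g_def e XK by simp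
  qed
  have g1: "1 \<le> g j" for j
  proof -
    have b: "0 \<le> j mod K" "j mod K < K" using K3 by simp_all
    show ?thesis
    proof (cases "j mod K = K - 1")
      case True
      have "j + 1 = K * (j div K) + K" using True mult_div_mod_eq[of K j] by linarith
      hence "j + 1 = K * (j div K + 1)" unfolding distrib_left mult_1_right .
      hence "(j + 1) div K = j div K + 1" "(j + 1) mod K = 0" using K3 by simp_all
      hence "g j = int (A ! 0) + N - int (A ! nat (j mod K))" unfolding g_def X_def by (simp add: algebra_simps)
      moreover have "A ! nat (j mod K) < n" using An b by (simp add: nat_less_iff)
      ultimately show ?thesis by linarith
    next
      case False
      have "j + 1 = K * (j div K) + (j mod K + 1)" using mult_div_mod_eq[of K j] by simp
      hence "(j + 1) div K = j div K" "(j + 1) mod K = j mod K + 1"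
        by (rule int_div_pos_eq int_mod_pos_eq; use False b in linarith)+
      hence "g j = int (A ! nat (j mod K + 1)) - int (A ! nat (j mod K))" unfolding g_def X_def by simp
      moreover have "A ! nat (j mod K) < A ! nat (j mod K + 1)"
        using ssA[unfolded sorted_wrt_iff_nth_less] lA b False by (auto simp: nat_less_iff nat_less_eq_zless)
      ultimately show ?thesis by linarith
    qed
  qed
  have v: "valid g" unfolding valid_def
  proof (intro conjI allI pg g1)
    show "(\<Sum>j\<in>{0..<K}. g j) = N" unfolding g_def sum_tele using XK[of 0] by simp
  qed
  have "\<exists>i. i < k \<and> A ! i = p0 r" if "r < k" for r
  proof -
    have "p0 r \<in> set A" using sA that by simp
    thus ?thesis using lA by (metis in_set_conv_nth)
  qed
  then obtain f where f: "\<And>r. r < k \<Longrightarrow> f r < k \<and> A ! f r = p0 r" by metis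
  define ix where "ix r = int (f r)" for r
  have Xix: "X (ix r) = int (p0 r)" if "r < k" for r
  proof -
    have "ix r mod K = ix r" "ix r div K = 0" using f[OF that] by (simp_all add: ix_def)
    thus ?thesis unfolding X_def using f[OF that] by (simp add: ix_def)
  qed
  have pr: "p0 r = nd (X (ix r))" if "r < k" for r using Xix[OF that] nd_int[OF pn[OF that]] by simp
  have surj: "\<exists>r<k. cg (ix r) i" for i
  proof -
    have b: "0 \<le> i mod K" "i mod K < K" using K3 by simp_all
    have "A ! nat (i mod K) \<in> p0 ` {..<k}" using nth_mem[of "nat (i mod K)" A] lA b sA by (simp add: nat_less_iff)
    then obtain r where r: "r < k" "A ! nat (i mod K) = p0 r" by auto
    have "f r = nat (i mod K)" using f[OF r(1)] r(2) dA lA b by (metis nth_eq_iff_index_eq nat_less_iff)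
    hence "ix r = i mod K" using b by (simp add: ix_def)
    thus ?thesis using r(1) cg_mod by metis
  qed
  have injx: "r = r'" if h: "r < k" "r' < k" "cg (ix r) (ix r')" for r r'
  proof -
    have "\<bar>ix r - ix r'\<bar> < K" using f[OF h(1)] f[OF h(2)] unfolding ix_def by linarith
    hence "ix r = ix r'" by (rule cg_win[OF h(3)])
    hence "p0 r = p0 r'" using f[OF h(1)] f[OF h(2)] by (simp add: ix_def)
    thus ?thesis using inj h(1,2) by (auto dest: inj_onD)
  qed
  have k0: "0 < k" using k3 by simp
  have occ: "occupied k p0 = range (\<lambda>j. nd (X j))"
  proof
    show "occupied k p0 \<subseteq> range (\<lambda>j. nd (X j))" using pr by (auto simp: occupied_def)
    show "range (\<lambda>j. nd (X j)) \<subseteq> occupied k p0"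
    proof
      fix z assume "z \<in> range (\<lambda>j. nd (X j))"
      then obtain j where j: "z = nd (X j)" by auto
      obtain r where r: "r < k" "cg (ix r) j" using surj by blast
      have "z = p0 r" unfolding j pr[OF r(1)] nd_eq using lift_cg[OF l cg_sym[OF r(2)]] .
      thus "z \<in> occupied k p0" using r by (auto simp: occupied_def)
    qed
  qed
  have "nonper g" using nonper_segs[OF pg] np segs_lift[OF l g1 occ pr[OF k0]] by simp
  from INV_init[OF v this] have "tower_free X g (\<lambda>_. 0) ix (81 * (N * N)) (p0, \<lambda>_. None)"
    by (rule tower_free_I[OF _ l surj injx]) (use pr in auto)
  thus ?thesis by blast
qed

end

theorem mainTheorem1:
  shows "\<exists>c::nat. \<forall>n k::nat. odd k \<and> 2 < k \<and> k + 3 < n \<longrightarrow>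
    (\<exists>P::protocol. \<forall>p0 sched s.
        (\<forall>r<k. p0 r < n) \<and> inj_on p0 {..<k} \<and>
        \<not> periodic_seq (segs n (occupied k p0) (p0 0)) \<and>
        fair_exec P n k p0 sched s
        \<longrightarrow> gathered_within k s sched (c * n\<^sup>2))"
proof (rule exI[of _ 164], intro allI impI)
  fix n k :: nat
  assume "odd k \<and> 2 < k \<and> k + 3 < n"
  then interpret robot_ring k n by unfold_locales auto
  show "\<exists>P::protocol. \<forall>p0 sched s. (\<forall>r<k. p0 r < n) \<and> inj_on p0 {..<k} \<and>
        \<not> periodic_seq (segs n (occupied k p0) (p0 0)) \<and> fair_exec P n k p0 sched s
        \<longrightarrow> gathered_within k s sched (164 * n\<^sup>2)"
  proof (intro exI[of _ Pr] allI impI, elim conjE)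
    fix p0 sched s
    assume h: "\<forall>r<k. p0 r < n" "inj_on p0 {..<k}" "\<not> periodic_seq (segs n (occupied k p0) (p0 0))" "fair_exec Pr n k p0 sched s"
    obtain X g ix where T: "tower_free X g (\<lambda>_. 0) ix (81 * (int n * int n)) (p0, \<lambda>_. None)" using tower_free_init h by blast
    have "s 0 = (p0, \<lambda>_. None)" using h(4) by (simp add: fair_exec_def)
    \<comment> \<open>The tower-free phase costs 81 and the collapse 1 in units of \<open>n\<close>
      squared. Two rounds per unit of potential give the constant 164.\<close>
    moreover have "81 * (int n * int n) + int n * int n = int (82 * n\<^sup>2)" by (simp add: power2_eq_square)
    ultimately have "state_inv (int (82 * n\<^sup>2)) (s 0)" using state_inv_TF[OF T] by metis
    from state_inv_gathered[OF h(4) this] show "gathered_within k s sched (164 * n\<^sup>2)" by simp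
  qed
qed

end
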